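(* Let $m\ge 2$ and let $\mathcal C$ be a generalized Cantor ladder with $m$ steps, with parameters $I_i=[a_i,b_i]$, $\rho_i$, $e_i$ ($i=1,\dots,m$), and let $\mu=\mathcal C'$ be the corresponding self-similar measure on $[0,1]$. Suppose that the self-similarity is arithmetic, and that $a_i-b_{i-1}>0$ for all $i=2,\dots,m$. Let $D$, $T$ and the continuous $T$-periodic function $s$ be those of the eigenvalue asymptotics $N(\lambda)=\lambda^D\bigl(s(\ln\lambda)+o(1)\bigr)$, $\lambda\to+\infty$, of the Neumann problem $-y''=\lambda\mu y$, $y'(0)=y'(1)=0$. Then $$\forall t\in[0,T]\qquad s(t)=e^{-Dt}\,\sigma(t),$$ where $\sigma$ is some purely singular non-decreasing function, i.e. a non-decreasing function that is the primitive of a measure singular with respect to the Lebesgue measure.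
   Context: Generalized Cantor ladder: let $m\ge2$, let $I_k=[a_k,b_k]$, $k=1,\dots,m$ (with $a_k<b_k$), be sub-segments of $[0,1]$ with $b_j\le a_{j+1}$ for $j=1,\dots,m-1$; let $\rho_1,\dots,\rho_m>0$ with $\sum_k\rho_k=1$, and let $e_1,\dots,e_m\in\{0,1\}$. Put $S_i(t)=a_i+(b_i-a_i)t$ if $e_i=0$ and $S_i(t)=b_i-(b_i-a_i)t$ if $e_i=1$. The operator $$\mathcal S(f)=\sum_{i=1}^m\Bigl(\bigl(e_i+(-1)^{e_i}f\circ S_i^{-1}\bigr)\chi_{I_i}+\chi_{\{x>b_i\}}\Bigr)\rho_i$$ is a contraction on $L_\infty(0,1)$; its unique fixed point $\mathcal C$ (which has a continuous non-decreasing representative with $\mathcal C(0)=0$, $\mathcal C(1)=1$) is the generalized Cantor ladder with $m$ steps. Its distributional derivative $\mu$ is a probability measure without atoms satisfying $\mu(E)=\sum_{k}\rho_k\,\mu(S_k^{-1}(E\cap I_k))$. Arithmetic self-similarity: $\rho_i(b_i-a_i)=\tau^{k_i}$, $i=1,\dots,m$, for a certain constant $\tau\in(0,1)$ and $k_i\in\mathbb N$ with $\gcd(k_1,\dots,k_m)=1$. Neumann problem: $\lambda$ is an eigenvalue if there is a nonzero $y\in W_2^1[0,1]$ with $\int_0^1y'\eta'\,dx=\lambda\int_0^1y\eta\,\mu(dx)$ for all $\eta\in W_2^1[0,1]$. $N(\lambda)$ is the number of eigenvalues less than $\lambda$. Known facts fixing the notation: for such $\mu$ there is the asymptotics $N(\lambda)=\lambda^D(s(\ln\lambda)+o(1))$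 as $\lambda\to+\infty$, where $D\in(0,\tfrac12)$ is determined by $\sum_{i=1}^m\tau^{k_iD}=1$, $T=-\ln\tau$, and $s$ is a continuous $T$-periodic function (uniquely determined by these properties). *)

theory Defs
  imports "HOL-Analysis.Analysis"
begin

definition ladder_params ::
  "nat \<Rightarrow> (nat \<Rightarrow> real) \<Rightarrow> (nat \<Rightarrow> real) \<Rightarrow> (nat \<Rightarrow> real) \<Rightarrow> (nat \<Rightarrow> nat) \<Rightarrow> bool"
  where "ladder_params m a b \<rho> e \<longleftrightarrow>
    2 \<le> m \<and>
    (\<forall>i\<in>{1..m}. 0 \<le> a i \<and> a i < b i \<and> b i \<le> 1) \<and>
    (\<forall>j\<in>{1..m-1}. b j \<le> a (j + 1)) \<and>
    (\<forall>i\<in>{1..m}. 0 < \<rho> i) \<and> (\<Sum>i=1..m. \<rho> i) = 1 \<and>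
    (\<forall>i\<in>{1..m}. e i \<in> {0, 1})"

definition ladder_map :: "real \<Rightarrow> real \<Rightarrow> nat \<Rightarrow> real \<Rightarrow> real"
  where "ladder_map a b e t = (if e = 0 then a + (b - a) * t else b - (b - a) * t)"

definition ladder_operator ::
  "nat \<Rightarrow> (nat \<Rightarrow> real) \<Rightarrow> (nat \<Rightarrow> real) \<Rightarrow> (nat \<Rightarrow> real) \<Rightarrow> (nat \<Rightarrow> nat)
    \<Rightarrow> (real \<Rightarrow> real) \<Rightarrow> real \<Rightarrow> real"
  where "ladder_operator m a b \<rho> e f x =
    (\<Sum>i=1..m.
      ((real (e i) + (-1) ^ e i * f (inv (ladder_map (a i) (b i) (e i)) x)) * indicat_real {a i..b i} x
        + indicat_real {b i<..} x) * \<rho> i)"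

text \<open>An element of \<open>L\<^sub>\<infinity>(0,1)\<close> is given by any of its representatives, so the fixed
  point equation holds almost everywhere and the values outside \<open>(0,1)\<close> are irrelevant.\<close>

definition in_Linfinity01 :: "(real \<Rightarrow> real) \<Rightarrow> bool"
  where "in_Linfinity01 f \<longleftrightarrow>
    f \<in> borel_measurable (lebesgue_on {0<..<1}) \<and>
    (\<exists>B. AE x in lebesgue_on {0<..<1}. \<bar>f x\<bar> \<le> B)"

definition cantor_ladder ::
  "nat \<Rightarrow> (nat \<Rightarrow> real) \<Rightarrow> (nat \<Rightarrow> real) \<Rightarrow> (nat \<Rightarrow> real) \<Rightarrow> (nat \<Rightarrow> nat) \<Rightarrow> (real \<Rightarrow> real) \<Rightarrow> bool"
  where "cantor_ladder m a b \<rho> e C \<longleftrightarrow>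
    ladder_params m a b \<rho> e \<and> in_Linfinity01 C \<and>
    (AE x in lebesgue_on {0<..<1}. ladder_operator m a b \<rho> e C x = C x)"

definition arithmetic_self_similarity ::
  "nat \<Rightarrow> (nat \<Rightarrow> real) \<Rightarrow> (nat \<Rightarrow> real) \<Rightarrow> (nat \<Rightarrow> real) \<Rightarrow> real \<Rightarrow> (nat \<Rightarrow> nat) \<Rightarrow> bool"
  where "arithmetic_self_similarity m a b \<rho> \<tau> k \<longleftrightarrow>
    0 < \<tau> \<and> \<tau> < 1 \<and> (\<forall>i\<in>{1..m}. \<rho> i * (b i - a i) = \<tau> ^ k i) \<and> Gcd (k ` {1..m}) = 1"

text \<open>\<open>\<phi> \<in> C\<^sub>c\<^sup>\<infinity>(0,1)\<close>, extended by zero to the real line.\<close>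

definition test_function01 :: "(real \<Rightarrow> real) \<Rightarrow> bool"
  where "test_function01 \<phi> \<longleftrightarrow>
    (\<forall>n x. (deriv ^^ n) \<phi> differentiable (at x)) \<and>
    (\<exists>c d. 0 < c \<and> c < d \<and> d < 1 \<and> (\<forall>x. x \<notin> {c..d} \<longrightarrow> \<phi> x = 0))"

text \<open>The distributional derivative of a function on \<open>(0,1)\<close> is a measure on \<open>(0,1)\<close>; it is
  regarded as a Borel measure on the line that does not charge the complement of \<open>(0,1)\<close>.\<close>

definition distributional_derivative01 :: "(real \<Rightarrow> real) \<Rightarrow> real measure \<Rightarrow> bool"
  where "distributional_derivative01 f \<mu> \<longleftrightarrow>
    sets \<mu> = sets borel \<and> finite_measure \<mu> \<and> emeasure \<mu> (- {0<..<1}) = 0 \<and>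
    (\<forall>\<phi>. test_function01 \<phi> \<longrightarrow>
      (LINT x:{0<..<1}|lebesgue. f x * deriv \<phi> x) = - (LINT x:{0<..<1}|\<mu>. \<phi> x))"

text \<open>\<open>y\<close> is the absolutely continuous representative of an element of \<open>W\<^sub>2\<^sup>1[0,1]\<close>, and
  \<open>y'\<close> is a representative of its derivative in \<open>L\<^sub>2(0,1)\<close>.\<close>

definition W21 :: "(real \<Rightarrow> real) \<Rightarrow> (real \<Rightarrow> real) \<Rightarrow> bool"
  where "W21 y y' \<longleftrightarrow>
    set_borel_measurable lebesgue {0..1} y' \<and>
    set_integrable lebesgue {0..1} (\<lambda>x. (y' x)\<^sup>2) \<and>
    (\<forall>x\<in>{0..1}. y x = y 0 + (LINT t:{0..x}|lebesgue. y' t))"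

definition neumann_eigenvalue :: "real measure \<Rightarrow> real \<Rightarrow> bool"
  where "neumann_eigenvalue \<mu> l \<longleftrightarrow>
    (\<exists>y y'. W21 y y' \<and> (\<exists>x\<in>{0..1}. y x \<noteq> 0) \<and>
      (\<forall>\<eta> \<eta>'. W21 \<eta> \<eta>' \<longrightarrow>
        (LINT x:{0..1}|lebesgue. y' x * \<eta>' x) = l * (LINT x:{0..1}|\<mu>. y x * \<eta> x)))"

text \<open>All eigenvalues of the problem are simple, so no multiplicities enter here.\<close>

definition eigenvalue_count :: "real measure \<Rightarrow> real \<Rightarrow> nat"
  where "eigenvalue_count \<mu> l = card {l'. neumann_eigenvalue \<mu> l' \<and> l' < l}"

definition eigenvalue_asymptotics :: "real measure \<Rightarrow> real \<Rightarrow> (real \<Rightarrow> real) \<Rightarrow> bool"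
  where "eigenvalue_asymptotics \<mu> D s \<longleftrightarrow>
    (\<exists>r. (r \<longlongrightarrow> 0) at_top \<and>
      (\<forall>\<^sub>F l in at_top. real (eigenvalue_count \<mu> l) = l powr D * (s (ln l) + r l)))"

definition mutually_singular :: "'a measure \<Rightarrow> 'a measure \<Rightarrow> bool"
  where "mutually_singular M N \<longleftrightarrow> (\<exists>E. E \<in> null_sets M \<and> space N - E \<in> null_sets N)"

text \<open>On \<open>[0,T]\<close>, \<open>\<sigma>\<close> is non-decreasing and is a primitive of a finite Borel measure
  singular with respect to Lebesgue measure.\<close>

definition purely_singular_nondecreasing :: "real \<Rightarrow> (real \<Rightarrow> real) \<Rightarrow> bool"
  where "purely_singular_nondecreasing T \<sigma> \<longleftrightarrow>
    mono_on {0..T} \<sigma> \<and>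
    (\<exists>\<nu>. sets \<nu> = sets borel \<and> finite_measure \<nu> \<and> mutually_singular lborel \<nu> \<and>
      (\<forall>u v. 0 \<le> u \<and> u \<le> v \<and> v \<le> T \<longrightarrow> \<sigma> v - \<sigma> u = measure \<nu> {u<..v}))"

end

theory Submission
  imports Defs
begin

text \<open>
  Write \<open>f t\<close> for the number of eigenvalues below \<open>exp t\<close>. Cutting the string at the gaps decouples it into
  scaled copies of itself, so \<open>f t = (\<Sum>i. f (t - k i * T)) - d t\<close> with a bounded defect \<open>d \<ge> 0\<close>. A gap of positive
  length contributes a positive constant to the characteristic function, which otherwise is a sum of Herglotz
  functions; an eigenvalue can therefore be lost only where one of the latter lies below a fixed negative level. By
  Bessel's inequality and integration over the levels, the measure of these \<open>t\<close> in \<open>[n * T, (n + 1) * T]\<close>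
  tends to zero. Iterating the renewal equation from time \<open>n0 * T\<close> then approximates \<open>\<sigma> t = exp (D * t) * s t\<close> in mean,
  up to \<open>o(exp (- D * n0 * T))\<close>, by step functions with only \<open>O(exp (D * n0 * T))\<close> jumps. A non-decreasing continuous
  function with such approximations grows only on sets of arbitrarily small Lebesgue measure, hence it is
  purely singular.
\<close>

section \<open>Level sets of Herglotz functions\<close>

text \<open>The number of eigenvalues in a window may grow like \<open>exp (D * n * T)\<close>, so
  an estimate of the bad set made pole by pole would be useless. The weights
  \<open>1 / (x + X)\<close> telescope along all branches at once and leave a bound through
  \<open>kern (- X) (- X)\<close> in which the number of poles does not occur. Positivity of the
  gaps enters exactly here: the bound degenerates like \<open>1 / s\<close> when the level
  \<open>- s\<close> approaches zero. The defect is controlled in mean only, never pointwise. So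
  \<sigma> is approximated in mean, and monotonicity has to turn this into information about growth.
  The error and the number of jumps are matched exactly at the borderline: the grid argument needs
  their product, not just the error, to be arbitrarily small. The definitions give the ladder only
  almost everywhere and the measure only through test functions, whereas the string equation wants
  an exactly self-similar distribution function without atoms. It is recovered from a continuous
  fixed point of the ladder operator and a du Bois-Reymond argument.\<close>

text \<open>An abstract pair of solution data of a string: \<open>\<alpha> / \<gamma>\<close> is a Herglotz function whose poles are the
  zeros of \<open>\<gamma>\<close>. The identity \<open>wronskian\<close> plays the role of its integral representation.\<close>

locale herglotz_pair =
  fixes \<nu> :: "real measure" and \<alpha> \<gamma> :: "real \<Rightarrow> real" and y :: "real \<Rightarrow> real \<Rightarrow> real"
  assumes finite_nu: "finite_measure \<nu>"
    and meas: "\<And>l. y l \<in> borel_measurable \<nu>"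
    and cont_y: "\<And>l x. isCont (\<lambda>l. y l x) l"
    and bdd: "\<And>R. \<exists>B. \<forall>l x. \<bar>l\<bar> \<le> R \<longrightarrow> \<bar>y l x\<bar> \<le> B"
    and cont_alpha: "\<And>l. isCont \<alpha> l"
    and cont_gamma: "\<And>l. isCont \<gamma> l"
    and wronskian: "\<And>l l'. \<alpha> l * \<gamma> l' - \<gamma> l * \<alpha> l' = (l - l') * (\<integral>x. y l x * y l' x \<partial>\<nu>)"
    and pos: "\<And>l. (\<integral>x. y l x * y l x \<partial>\<nu>) > 0"
    and neg: "\<And>l. l < 0 \<Longrightarrow> \<gamma> l \<noteq> 0 \<and> \<alpha> l / \<gamma> l > 0"
begin

definition inn :: "real \<Rightarrow> real \<Rightarrow> real" where "inn l l' = (\<integral>x. y l x * y l' x \<partial>\<nu>)"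

definition h :: "real \<Rightarrow> real" where "h l = \<alpha> l / \<gamma> l"

text \<open>The Nevanlinna kernel of \<open>h\<close>: off the diagonal it is the difference
  quotient of \<open>h\<close> (\<open>h_diff\<close>), on the diagonal its derivative
  (\<open>DERIV_h\<close>). Writing it through inner products makes it positive semidefinite without
  a representing measure for \<open>h\<close>.\<close>

definition kern :: "real \<Rightarrow> real \<Rightarrow> real" where "kern l l' = inn l l' / (\<gamma> l * \<gamma> l')"

lemma bddE:
  obtains B where "B \<ge> 0" "\<And>l x. \<bar>l\<bar> \<le> R \<Longrightarrow> \<bar>y l x\<bar> \<le> B"
proof -
  obtain B where "\<forall>l x. \<bar>l\<bar> \<le> R \<longrightarrow> \<bar>y l x\<bar> \<le> B" using bdd by blast
  then have "\<bar>y l x\<bar> \<le> \<bar>B\<bar>" if "\<bar>l\<bar> \<le> R" for l x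
    using that abs_ge_self[of B] order_trans by blast
  then show ?thesis by (intro that[of "\<bar>B\<bar>"]) auto
qed

lemma integrable_prod: "integrable \<nu> (\<lambda>x. y l x * y l' x)"
proof -
  interpret finite_measure \<nu> by (rule finite_nu)
  obtain B where B: "B \<ge> 0" "\<And>l'' x. \<bar>l''\<bar> \<le> \<bar>l\<bar> + \<bar>l'\<bar> \<Longrightarrow> \<bar>y l'' x\<bar> \<le> B"
    by (rule bddE[of "\<bar>l\<bar> + \<bar>l'\<bar>"]) blast
  show ?thesis
  proof (rule integrable_const_bound[of _ "B * B"])
    show "AE x in \<nu>. norm (y l x * y l' x) \<le> B * B"
      using B by (auto simp: abs_mult intro!: mult_mono)
  qed (use meas in measurable)
qed

lemma inn_commute: "inn l l' = inn l' l"
  unfolding inn_def by (simp add: mult.commute)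

lemma kern_commute: "kern l l' = kern l' l"
  unfolding kern_def by (simp add: inn_commute mult.commute)

lemma inn_psd:
  assumes "finite S"
  shows "0 \<le> (\<Sum>l\<in>S. \<Sum>l'\<in>S. c l * c l' * inn l l')"
proof -
  have "0 \<le> (\<integral>x. (\<Sum>l\<in>S. c l * y l x)\<^sup>2 \<partial>\<nu>)" by simp
  also have "\<dots> = (\<integral>x. (\<Sum>l\<in>S. \<Sum>l'\<in>S. c l * c l' * (y l x * y l' x)) \<partial>\<nu>)"
    by (simp add: power2_eq_square sum_product mult_ac)
  also have "\<dots> = (\<Sum>l\<in>S. \<Sum>l'\<in>S. c l * c l' * inn l l')"
    unfolding inn_def
    by (simp add: Bochner_Integration.integral_sum Bochner_Integration.integrable_sum integrable_prod)
  finally show ?thesis .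
qed

lemma kern_psd:
  assumes "finite S"
  shows "0 \<le> (\<Sum>l\<in>S. \<Sum>l'\<in>S. c l * c l' * kern l l')"
proof -
  have "c l / \<gamma> l * (c l' / \<gamma> l') * inn l l' = c l * c l' * kern l l'" for l l'
    by (simp add: kern_def)
  with inn_psd[OF assms, of "\<lambda>l. c l / \<gamma> l"] show ?thesis by (simp only:)
qed

lemma tendsto_inn: "((\<lambda>l'. inn l l') \<longlongrightarrow> inn l l) (at l)"
  \<comment> \<open>Dominated convergence works along sequences; a convergent sequence of parameters
    is bounded, so \<open>bdd\<close> supplies one constant majorant.\<close>
  unfolding tendsto_at_iff_sequentially comp_def
proof (intro allI impI)
  interpret finite_measure \<nu> by (rule finite_nu)
  fix X :: "nat \<Rightarrow> real" assume X: "\<forall>i. X i \<in> UNIV - {l}" "X \<longlonglongrightarrow> l"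
  from X(2) have "Bseq X" by (simp add: convergentI convergent_imp_Bseq)
  then obtain R where R: "\<And>n. \<bar>X n\<bar> \<le> R" unfolding Bseq_def by auto
  obtain B where B: "B \<ge> 0" "\<And>l'' x. \<bar>l''\<bar> \<le> \<bar>l\<bar> + \<bar>R\<bar> \<Longrightarrow> \<bar>y l'' x\<bar> \<le> B"
    by (rule bddE[of "\<bar>l\<bar> + \<bar>R\<bar>"]) blast
  have R': "\<bar>X n\<bar> \<le> \<bar>l\<bar> + \<bar>R\<bar>" for n using R[of n] by linarith
  show "(\<lambda>n. inn l (X n)) \<longlonglongrightarrow> inn l l"
    unfolding inn_def
  proof (rule integral_dominated_convergence[where w = "\<lambda>_. B * B"])
    show "AE x in \<nu>. (\<lambda>n. y l x * y (X n) x) \<longlonglongrightarrow> y l x * y l x"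
      by (intro AE_I2 tendsto_intros isCont_tendsto_compose[OF cont_y X(2)])
    show "AE x in \<nu>. norm (y l x * y (X n) x) \<le> B * B" for n
      using B R' by (auto simp: abs_mult intro!: mult_mono)
  qed (use meas in auto)
qed

lemma inn_self_pos: "inn l l > 0"
  unfolding inn_def by (rule pos)

lemma kern_self_pos: "\<gamma> l \<noteq> 0 \<Longrightarrow> kern l l > 0"
  unfolding kern_def using inn_self_pos[of l]
  by (intro divide_pos_pos) (auto simp: zero_less_mult_iff neq_iff)

lemma h_diff:
  assumes "\<gamma> l \<noteq> 0" "\<gamma> l' \<noteq> 0"
  shows "h l - h l' = (l - l') * kern l l'"
proof -
  have "h l - h l' = (\<alpha> l * \<gamma> l' - \<gamma> l * \<alpha> l') / (\<gamma> l * \<gamma> l')"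
    using assms unfolding h_def by (simp add: diff_divide_distrib)
  then show ?thesis unfolding wronskian kern_def inn_def by simp
qed

lemma DERIV_h:
  assumes "\<gamma> l \<noteq> 0"
  shows "(h has_real_derivative kern l l) (at l)"
proof -
  have "((\<lambda>l'. kern l l') \<longlongrightarrow> kern l l) (at l)"
    unfolding kern_def
    by (intro tendsto_intros tendsto_inn cont_gamma[unfolded isCont_def]) (use assms in auto)
  moreover have "\<forall>\<^sub>F l' in at l. \<gamma> l' \<noteq> 0"
    by (rule tendsto_imp_eventually_ne[OF cont_gamma[unfolded isCont_def] assms])
  then have "\<forall>\<^sub>F l' in at l. kern l l' = (h l' - h l) / (l' - l)"
    using eventually_neq_at_within[of l l UNIV]
  proof eventually_elim
    case (elim l')
    then show ?case using h_diff[OF elim(1) assms] by (simp add: field_simps kern_commute)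
  qed
  ultimately show ?thesis unfolding has_field_derivative_iff by (rule Lim_transform_eventually)
qed

lemma h_strict_mono:
  assumes "a < b" "\<And>x. a \<le> x \<Longrightarrow> x \<le> b \<Longrightarrow> \<gamma> x \<noteq> 0"
  shows "h a < h b"
proof (rule DERIV_pos_imp_increasing[OF assms(1)])
  fix x assume "a \<le> x" "x \<le> b"
  then have "\<gamma> x \<noteq> 0" by (rule assms(2))
  then show "\<exists>d. DERIV h x :> d \<and> d > 0" using DERIV_h kern_self_pos by blast
qed

lemma isCont_h: "\<gamma> l \<noteq> 0 \<Longrightarrow> isCont h l"
  using DERIV_h DERIV_isCont by blast

text \<open>By the Wronskian identity a common zero of both functions would make \<open>y p\<close>
  orthogonal to every other \<open>y l'\<close>; letting \<open>l'\<close> tend to \<open>p\<close>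
  contradicts \<open>pos\<close>.\<close>

lemma pole_alpha_nz:
  assumes "\<gamma> p = 0" shows "\<alpha> p \<noteq> 0"
proof
  assume "\<alpha> p = 0"
  with assms wronskian[of p] have "inn p l' = 0" if "l' \<noteq> p" for l'
    using that unfolding inn_def by (metis diff_zero eq_iff_diff_eq_0 mult_eq_0_iff mult_zero_left)
  then have "\<forall>\<^sub>F l' in at p. inn p l' = 0"
    by (auto simp: eventually_at_filter)
  then have "((\<lambda>l'. inn p l') \<longlongrightarrow> 0) (at p)" by (rule tendsto_eventually)
  then have "inn p p = 0" using tendsto_inn tendsto_unique[OF _ tendsto_inn] by fastforce
  with inn_self_pos show False by (metis less_irrefl)
qed

text \<open>Near a pole the reciprocal of \<open>h\<close> is the continuous object. The Wronskian
  identity at \<open>p\<close> shows that it is \<open>- (x - p)\<close> times a factor that is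
  positive near \<open>p\<close>, so \<open>h\<close> passes from plus to minus infinity at every
  pole.\<close>

lemma inverse_h_near_pole:
  assumes "\<gamma> p = 0"
  shows "\<forall>\<^sub>F x in at p. \<gamma> x / \<alpha> x * (x - p) < 0" "((\<lambda>x. \<gamma> x / \<alpha> x) \<longlongrightarrow> 0) (at p)"
proof -
  note a = pole_alpha_nz[OF assms]
  show "((\<lambda>x. \<gamma> x / \<alpha> x) \<longlongrightarrow> 0) (at p)"
    using tendsto_divide[OF cont_gamma[of p, unfolded isCont_def] cont_alpha[of p, unfolded isCont_def] a]
      assms by simp
  have 1: "((\<lambda>x. \<alpha> x * \<alpha> p) \<longlongrightarrow> \<alpha> p * \<alpha> p) (at p)"
    by (intro tendsto_intros cont_alpha[unfolded isCont_def])
  have "\<alpha> p * \<alpha> p > 0" using a by (metis not_real_square_gt_zero)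
  from order_tendstoD(1)[OF 1 this] order_tendstoD(1)[OF tendsto_inn inn_self_pos]
  show "\<forall>\<^sub>F x in at p. \<gamma> x / \<alpha> x * (x - p) < 0"
    using eventually_neq_at_within[of p p UNIV]
  proof eventually_elim
    case (elim x)
    have "\<alpha> p * \<gamma> x = (p - x) * inn p x" using wronskian[of p x] assms by (simp add: inn_def)
    have *: "\<gamma> x / \<alpha> x * (x - p) = - ((x - p)\<^sup>2 * inn p x) / (\<alpha> x * \<alpha> p)"
    proof -
      have "\<alpha> x \<noteq> 0" using elim by auto
      have "\<gamma> x = (p - x) * inn p x / \<alpha> p"
        using \<open>\<alpha> p * \<gamma> x = _\<close> a by (simp add: eq_divide_eq mult.commute)
      have "\<gamma> x / \<alpha> x * (x - p) = (p - x) * inn p x / \<alpha> p / \<alpha> x * (x - p)"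
        by (subst \<open>\<gamma> x = _\<close>) (rule refl)
      also have "\<dots> = ((p - x) * (x - p)) * inn p x / (\<alpha> x * \<alpha> p)" by (simp add: mult_ac)
      also have "(p - x) * (x - p) = - (x - p)\<^sup>2" by (simp add: power2_eq_square algebra_simps)
      finally show ?thesis by simp
    qed
    moreover have "(x - p)\<^sup>2 * inn p x > 0" using elim by simp
    ultimately show ?case unfolding * using elim(1) by (intro divide_neg_pos) auto
  qed
qed

lemma h_at_right_pole: "\<gamma> p = 0 \<Longrightarrow> filterlim h at_bot (at_right p)"
proof -
  assume p: "\<gamma> p = 0"
  have "\<forall>\<^sub>F x in at_right p. \<gamma> x / \<alpha> x < 0"
    using inverse_h_near_pole(1)[OF p, THEN filter_leD[OF at_le, OF subset_UNIV]]
      eventually_at_right_less[of p]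
    by eventually_elim (auto simp del: times_divide_eq_left simp: mult_less_0_iff[of "_ / _"])
  moreover have "((\<lambda>x. \<gamma> x / \<alpha> x) \<longlongrightarrow> 0) (at_right p)"
    using inverse_h_near_pole(2)[OF p] by (rule tendsto_within_subset) simp
  ultimately have "filterlim (\<lambda>x. \<gamma> x / \<alpha> x) (at_left 0) (at_right p)"
    unfolding filterlim_at by (auto elim!: eventually_mono)
  then have "filterlim (\<lambda>x. inverse (\<gamma> x / \<alpha> x)) at_bot (at_right p)"
    by (rule filterlim_compose[OF filterlim_inverse_at_bot_neg])
  then show ?thesis by (simp add: h_def[abs_def])
qed

lemma h_at_left_pole: "\<gamma> p = 0 \<Longrightarrow> filterlim h at_top (at_left p)"
proof -
  assume p: "\<gamma> p = 0"
  have "\<forall>\<^sub>F x in at_left p. 0 < \<gamma> x / \<alpha> x"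
    using inverse_h_near_pole(1)[OF p, THEN filter_leD[OF at_le, OF subset_UNIV]]
      eventually_at_left_real[of "p - 1" p, simplified]
    by eventually_elim (auto simp del: times_divide_eq_left simp: mult_less_0_iff[of "_ / _"])
  moreover have "((\<lambda>x. \<gamma> x / \<alpha> x) \<longlongrightarrow> 0) (at_left p)"
    using inverse_h_near_pole(2)[OF p] by (rule tendsto_within_subset) simp
  ultimately have "filterlim (\<lambda>x. \<gamma> x / \<alpha> x) (at_right 0) (at_left p)"
    unfolding filterlim_at by (auto elim!: eventually_mono)
  then have "filterlim (\<lambda>x. inverse (\<gamma> x / \<alpha> x)) at_top (at_left p)"
    by (rule filterlim_compose[OF filterlim_inverse_at_top_right])
  then show ?thesis by (simp add: h_def[abs_def])
qed

lemma h_pos: "l < 0 \<Longrightarrow> h l > 0" and gamma_neg: "l < 0 \<Longrightarrow> \<gamma> l \<noteq> 0"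
  using neg unfolding h_def by auto

text \<open>Points on a common level set are orthogonal for the kernel, so this is Bessel's inequality for the
  kernel function at \<open>- X\<close>.\<close>

lemma bessel_level_points:
  assumes S: "finite S" "\<And>x. x \<in> S \<Longrightarrow> \<gamma> x \<noteq> 0 \<and> h x = - s \<and> x \<ge> 0" and X: "X > 0" and s: "s > 0"
  shows "(\<Sum>x\<in>S. 1 / ((x + X)\<^sup>2 * kern x x)) \<le> kern (- X) (- X) / s\<^sup>2"
proof -
  let ?u = "- X"
  have u: "\<gamma> ?u \<noteq> 0" "h ?u > 0" "?u \<notin> S" using gamma_neg[of ?u] h_pos[of ?u] X S(2)[of ?u] by auto
  have orth: "kern x x' = 0" if "x \<in> S" "x' \<in> S" "x \<noteq> x'" for x x'
    using h_diff[of x x'] S(2)[OF that(1)] S(2)[OF that(2)] that(3) by simp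
  \<comment> \<open>The quadratic form with these coefficients is the squared distance of the kernel
    function at \<open>- X\<close> from its orthogonal projection onto the kernel functions at the
    points of \<open>S\<close>.\<close>
  define c where "c x = (if x = ?u then - 1 else kern x ?u / kern x x)" for x
  have cS: "c x = kern x ?u / kern x x" if "x \<in> S" for x using that u by (auto simp: c_def)
  have cu: "c ?u = -1" by (simp add: c_def)
  have row: "(\<Sum>x'\<in>S. c x * c x' * kern x x') = (kern x ?u)\<^sup>2 / kern x x" if "x \<in> S" for x
  proof -
    have "(\<Sum>x'\<in>S. c x * c x' * kern x x') = (\<Sum>x'\<in>{x}. c x * c x' * kern x x')"
      by (rule sum.mono_neutral_right) (use S that orth in auto)
    also have "\<dots> = (kern x ?u)\<^sup>2 / kern x x"
      using that S(2)[OF that] kern_self_pos[of x] by (simp add: cS power2_eq_square)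
    finally show ?thesis .
  qed
  have "0 \<le> (\<Sum>x\<in>insert ?u S. \<Sum>x'\<in>insert ?u S. c x * c x' * kern x x')"
    by (rule kern_psd) (use S in simp)
  also have "\<dots> = kern ?u ?u + (\<Sum>x'\<in>S. - c x' * kern ?u x') + (\<Sum>x\<in>S. - c x * kern x ?u)
       + (\<Sum>x\<in>S. \<Sum>x'\<in>S. c x * c x' * kern x x')"
    using S u by (simp add: cu sum.distrib sum_subtractf sum_negf)
  also have "\<dots> = kern ?u ?u - (\<Sum>x\<in>S. (kern x ?u)\<^sup>2 / kern x x)"
  proof -
    have "(\<Sum>x\<in>S. - c x * kern x ?u) = - (\<Sum>x\<in>S. (kern x ?u)\<^sup>2 / kern x x)"
      by (subst sum_negf[symmetric], rule sum.cong) (auto simp: cS power2_eq_square)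
    moreover have "(\<Sum>x\<in>S. - c x * kern ?u x) = (\<Sum>x\<in>S. - c x * kern x ?u)"
      by (rule sum.cong) (simp_all only: kern_commute)
    ultimately show ?thesis by (simp add: row)
  qed
  finally have 1: "(\<Sum>x\<in>S. (kern x ?u)\<^sup>2 / kern x x) \<le> kern ?u ?u" by simp
  have "s\<^sup>2 * (\<Sum>x\<in>S. 1 / ((x + X)\<^sup>2 * kern x x)) \<le> (\<Sum>x\<in>S. (kern x ?u)\<^sup>2 / kern x x)"
    unfolding sum_distrib_left
  proof (rule sum_mono)
    fix x assume x: "x \<in> S"
    have k: "kern x x > 0" using kern_self_pos S(2)[OF x] by blast
    have x0: "x \<ge> 0" using S(2)[OF x] by simp
    \<comment> \<open>Here \<open>h (- X) > 0\<close> is used: the kernel at \<open>x\<close> and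
      \<open>- X\<close> equals \<open>- (s + h (- X)) / (x + X)\<close>, in modulus at least
      \<open>s / (x + X)\<close>.\<close>
    have "h x - h ?u = (x - ?u) * kern x ?u" using h_diff u S(2)[OF x] by blast
    then have "kern x ?u * (x + X) = - (s + h ?u)" using S(2)[OF x] by (simp add: mult.commute)
    then have e: "(kern x ?u)\<^sup>2 * (x + X)\<^sup>2 = (s + h ?u)\<^sup>2"
      by (metis power2_minus power_mult_distrib)
    have "s\<^sup>2 \<le> (s + h ?u)\<^sup>2" using s u by (intro power_mono) auto
    then have "s\<^sup>2 / (x + X)\<^sup>2 \<le> (kern x ?u)\<^sup>2"
      using e X x0 by (simp add: pos_divide_le_eq)
    then have "s\<^sup>2 / (x + X)\<^sup>2 / kern x x \<le> (kern x ?u)\<^sup>2 / kern x x"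
      by (rule divide_right_mono) (use k in simp)
    moreover have "s\<^sup>2 * (1 / ((x + X)\<^sup>2 * kern x x)) = s\<^sup>2 / (x + X)\<^sup>2 / kern x x"
      by (simp only: divide_divide_eq_left times_divide_eq_right mult_1_right)
    ultimately show "s\<^sup>2 * (1 / ((x + X)\<^sup>2 * kern x x)) \<le> (kern x ?u)\<^sup>2 / kern x x" by (simp only:)
  qed
  with 1 have "s\<^sup>2 * (\<Sum>x\<in>S. 1 / ((x + X)\<^sup>2 * kern x x)) \<le> kern ?u ?u" by linarith
  moreover have "s\<^sup>2 > 0" using s by simp
  ultimately show ?thesis by (simp only: pos_le_divide_eq mult.commute)
qed

lemma pole_nonneg: "\<gamma> p = 0 \<Longrightarrow> p \<ge> 0"
  using gamma_neg[of p] by (cases "p < 0") auto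

text \<open>A branch starts at minus infinity to the right of its pole, so the intermediate value
  theorem reaches every level not above its final height.\<close>

lemma branch_level:
  assumes p: "\<gamma> p = 0" and e: "p < e" "\<And>x. p < x \<Longrightarrow> x \<le> e \<Longrightarrow> \<gamma> x \<noteq> 0" and s: "h e \<ge> - s"
  obtains q where "p < q" "q \<le> e" "h q = - s"
proof -
  have "\<forall>\<^sub>F x in at_right p. h x < - s"
    using h_at_right_pole[OF p] unfolding filterlim_at_bot_dense by blast
  then have "\<forall>\<^sub>F x in at_right p. h x < - s \<and> x \<in> {p<..<e}"
    using eventually_at_right_real[OF e(1)] by eventually_elim simp
  then obtain x where x: "h x < - s" "p < x" "x < e"
    using eventually_happens'[OF trivial_limit_at_right_real] by force
  have "\<exists>q\<ge>x. q \<le> e \<and> h q = - s"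
    by (rule IVT) (use x e s in \<open>auto intro: isCont_h\<close>)
  then obtain q where q: "x \<le> q" "q \<le> e" "h q = - s" by blast
  show ?thesis by (rule that[of q]) (use x q in auto)
qed

text \<open>On the branch to the right of a pole \<open>p\<close>, the point at height \<open>- s'\<close> moves as \<open>s'\<close> varies; integrating
  Bessel's inequality over all levels \<open>s' \<ge> s\<close> telescopes \<open>1 / (x + X)\<close> along each branch.\<close>

lemma branch_sum_open:
  assumes J: "finite J" "\<And>p. p \<in> J \<Longrightarrow> \<gamma> p = 0"
    and e: "\<And>p. p \<in> J \<Longrightarrow> p < e p" "\<And>p x. p \<in> J \<Longrightarrow> p < x \<Longrightarrow> x \<le> e p \<Longrightarrow> \<gamma> x \<noteq> 0"
      "\<And>p. p \<in> J \<Longrightarrow> h (e p) = - s"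
    and z: "\<And>p. p \<in> J \<Longrightarrow> p < z p \<and> z p < e p"
    and X: "X > 0" and s: "s > 0"
  shows "(\<Sum>p\<in>J. 1 / (p + X) - 1 / (z p + X)) \<le> kern (- X) (- X) / s"
proof (cases "J = {}")
  case True
  then show ?thesis using kern_self_pos[OF gamma_neg, of "-X"] X s by simp
next
  case False
  define \<kappa> where "\<kappa> = kern (- X) (- X)"
  have \<kappa>: "\<kappa> > 0" unfolding \<kappa>_def using kern_self_pos[OF gamma_neg, of "-X"] X by simp
  have "\<exists>q. p < q \<and> q \<le> e p \<and> h q = - s'" if "p \<in> J" "s' \<ge> s" for p s'
    using branch_level[OF J(2)[OF that(1)] e(1)[OF that(1)] e(2)[OF that(1)], of s'] e(3)[OF that(1)] that(2)
    by force
  \<comment> \<open>On the branch of \<open>p\<close> the function \<open>q p\<close> inverts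
    \<open>- h\<close>. Its derivative is the reciprocal of \<open>- kern\<close>, so raising
    \<open>s'\<close> moves the point back towards the pole.\<close>
  then obtain q where q: "\<And>p s'. p \<in> J \<Longrightarrow> s' \<ge> s \<Longrightarrow> p < q p s' \<and> q p s' \<le> e p \<and> h (q p s') = - s'"
    by metis
  have mono: "h x < h x'" if "p \<in> J" "p < x" "x < x'" "x' \<le> e p" for p x x'
    using that e(2) by (intro h_strict_mono) auto
  have q_inv: "q p (- h x) = x" if "p \<in> J" "p < x" "x \<le> e p" for p x
  proof -
    have "h x \<le> h (e p)" using mono[OF that(1,2), of "e p"] that(3) by (cases "x = e p") auto
    then have "s \<le> - h x" using e(3)[OF that(1)] by simp
    from q[OF that(1) this] show ?thesis
      using mono[OF that(1), of x "q p (- h x)"] mono[OF that(1), of "q p (- h x)" x] that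
      by (cases x "q p (- h x)" rule: linorder_cases) auto
  qed
  have q_nonpole: "\<gamma> (q p s') \<noteq> 0" if "p \<in> J" "s' \<ge> s" for p s' using q[OF that] e(2)[OF that(1)] by blast
  have q_lt: "q p s' < x" if "p \<in> J" "s' \<ge> s" "p < x" "x \<le> e p" "s' > - h x" for p s' x
    using q[OF that(1,2)] mono[OF that(1,3), of "q p s'"] that
    by (cases x "q p s'" rule: linorder_cases) auto
  have q_gt: "x < q p s'" if "p \<in> J" "s' \<ge> s" "p < x" "x \<le> e p" "s' < - h x" for p s' x
    using q[OF that(1,2)] mono[OF that(1), of "q p s'" x] that
    by (cases x "q p s'" rule: linorder_cases) auto
  have q_deriv: "((\<lambda>s'. q p s') has_real_derivative inverse (- kern (q p s') (q p s'))) (at s')"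
    if p: "p \<in> J" and s': "s' > s" for p s'
  proof (rule DERIV_inverse_function[where f = "\<lambda>x. - h x" and a = s and b = "s' + 1"])
    note qq = q[OF p less_imp_le[OF s']]
    show "((\<lambda>x. - h x) has_real_derivative - kern (q p s') (q p s')) (at (q p s'))"
      using DERIV_h[OF q_nonpole[OF p less_imp_le[OF s']]] by (rule DERIV_minus)
    show "- kern (q p s') (q p s') \<noteq> 0" using kern_self_pos[OF q_nonpole[OF p less_imp_le[OF s']]] by simp
    have lt: "q p s' < e p" using q_lt[OF p less_imp_le[OF s'], of "e p"] e(1,3)[OF p] s' by simp
    obtain x where x: "p < x" "x < q p s'" using qq dense by blast
    have "isCont (q p) ((\<lambda>x. - h x) (q p s'))"
    proof (rule isCont_inverse_function2[where f = "\<lambda>x. - h x" and g = "q p" and a = x and b = "e p"])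
      fix z assume z: "x \<le> z" "z \<le> e p"
      show "q p (- h z) = z" using q_inv[OF p] z x by simp
      show "isCont (\<lambda>x. - h x) z" using z x e(2)[OF p] by (intro continuous_intros isCont_h) auto
    qed (use x lt in auto)
    then show "isCont (q p) s'" using qq by simp
  qed (use s' q[OF p] in auto)
  \<comment> \<open>Bessel's inequality at level \<open>s'\<close> says exactly that
    \<open>M\<close> has a nonnegative derivative, since \<open>\<kappa> / s'\<close> has derivative
    \<open>- (\<kappa> / s'\<^sup>2)\<close>. As \<open>s'\<close> tends to infinity all points run
    back into their poles and \<open>M\<close> tends to 0; hence \<open>M\<close> is
    nonpositive.\<close>
  define M where "M s' = (\<Sum>p\<in>J. 1 / (p + X) - 1 / (q p s' + X)) - \<kappa> / s'" for s'
  have pnn: "p \<ge> 0" if "p \<in> J" for p using pole_nonneg J(2)[OF that] by blast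
  have qpos: "q p s' > 0" if "p \<in> J" "s' \<ge> s" for p s' using q[OF that] pnn[OF that(1)] by force
  \<comment> \<open>Bessel's inequality sums over points, the telescoping over poles; distinct
    branches carry distinct points because each branch contains no further pole.\<close>
  have q_inj: "inj_on (\<lambda>p. q p s') J" if "s' \<ge> s" for s'
  proof (rule inj_onI, rule ccontr)
    fix p p' assume a: "p \<in> J" "p' \<in> J" "q p s' = q p' s'" "p \<noteq> p'"
    note b = q[OF a(1) that] q[OF a(2) that]
    show False using e(2)[OF a(1), of p'] e(2)[OF a(2), of p] J(2)[OF a(1)] J(2)[OF a(2)] a b
      by (cases p p' rule: linorder_cases) auto
  qed
  have M_deriv: "\<exists>d. DERIV M s' :> d \<and> d \<ge> 0" if s': "s' > s" for s'
  proof -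
    let ?k = "\<lambda>p. kern (q p s') (q p s')"
    have "DERIV M s' :> (\<Sum>p\<in>J. inverse (- ?k p) / (q p s' + X)\<^sup>2) + \<kappa> / s'\<^sup>2"
    proof -
      have "DERIV (\<lambda>s'. 1 / (p + X) - 1 / (q p s' + X)) s' :> inverse (- ?k p) / (q p s' + X)\<^sup>2" if "p \<in> J" for p
        using qpos[OF that less_imp_le[OF s']] X
        by (auto intro!: derivative_eq_intros q_deriv[OF that s'] simp: power2_eq_square field_simps)
      then have "DERIV (\<lambda>s'. \<Sum>p\<in>J. 1 / (p + X) - 1 / (q p s' + X)) s' :>
          (\<Sum>p\<in>J. inverse (- ?k p) / (q p s' + X)\<^sup>2)" by (rule DERIV_sum)
      moreover have "DERIV (\<lambda>s'. \<kappa> / s') s' :> - (\<kappa> / s'\<^sup>2)"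
        using s s' by (auto intro!: derivative_eq_intros simp: power2_eq_square)
      ultimately show ?thesis unfolding M_def using DERIV_diff by fastforce
    qed
    moreover have "(\<Sum>p\<in>J. 1 / ((q p s' + X)\<^sup>2 * ?k p)) \<le> \<kappa> / s'\<^sup>2"
    proof -
      have "(\<Sum>x\<in>(\<lambda>p. q p s') ` J. 1 / ((x + X)\<^sup>2 * kern x x)) \<le> \<kappa> / s'\<^sup>2"
        unfolding \<kappa>_def
      proof (rule bessel_level_points)
        fix x assume "x \<in> (\<lambda>p. q p s') ` J"
        then obtain p where p: "p \<in> J" "x = q p s'" by blast
        show "\<gamma> x \<noteq> 0 \<and> h x = - s' \<and> 0 \<le> x"
          using q[OF p(1) less_imp_le[OF s']] q_nonpole[OF p(1) less_imp_le[OF s']]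
            qpos[OF p(1) less_imp_le[OF s']] p(2) by auto
      qed (use J X s s' in auto)
      then show ?thesis using q_inj[OF less_imp_le[OF s']] by (simp add: sum.reindex)
    qed
    moreover have "(\<Sum>p\<in>J. inverse (- ?k p) / (q p s' + X)\<^sup>2) = - (\<Sum>p\<in>J. 1 / ((q p s' + X)\<^sup>2 * ?k p))"
      by (simp add: sum_negf[symmetric] divide_inverse mult.commute)
    ultimately show ?thesis by fastforce
  qed
  have q_lim: "(q p \<longlongrightarrow> p) at_top" if p: "p \<in> J" for p
  proof (rule order_tendstoI)
    fix a assume "a < p"
    then show "\<forall>\<^sub>F s' in at_top. a < q p s'"
      by (intro eventually_mono[OF eventually_ge_at_top[of s]]) (use q[OF p] \<open>a < p\<close> in \<open>auto intro: order.strict_trans\<close>)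
  next
    fix a assume a: "p < a"
    define x where "x = min a (e p)"
    have x: "p < x" "x \<le> e p" "x \<le> a" using a e(1)[OF p] by (auto simp: x_def)
    show "\<forall>\<^sub>F s' in at_top. q p s' < a"
      using eventually_ge_at_top[of s] eventually_gt_at_top[of "- h x"]
    proof eventually_elim
      case (elim s')
      then show ?case using q_lt[OF p _ x(1,2)] x(3) by force
    qed
  qed
  have "(M \<longlongrightarrow> (\<Sum>p\<in>J. 1 / (p + X) - 1 / (p + X)) - 0) at_top"
    unfolding M_def
    by (intro tendsto_intros q_lim real_tendsto_divide_at_top[OF tendsto_const] filterlim_ident)
       (use X in \<open>auto dest!: pnn\<close>)
  then have M_lim: "(M \<longlongrightarrow> 0) at_top" by simp
  have M_le: "M s1 \<le> 0" if s1: "s1 > s" for s1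
  proof (rule tendsto_lowerbound[OF M_lim])
    show "\<forall>\<^sub>F S in at_top. M s1 \<le> M S"
      using eventually_ge_at_top[of s1]
    proof eventually_elim
      case (elim S)
      show ?case by (rule DERIV_nonneg_imp_nondecreasing[OF elim]) (use M_deriv s1 in force)
    qed
  qed simp
  \<comment> \<open>The derivative of \<open>q\<close> is available only for levels strictly above
    \<open>s\<close>. This \<open>s1\<close> is the least of the midpoints between \<open>s\<close>
    and \<open>- h (z p)\<close>, so at level \<open>s1\<close> every branch point still lies to the
    right of \<open>z p\<close>.\<close>
  define s1 where "s1 = Min ((\<lambda>p. (s - h (z p)) / 2) ` J)"
  have zl: "h (z p) < - s" if "p \<in> J" for p
    using mono[OF that, of "z p" "e p"] z[OF that] e(3)[OF that] by simp
  have s1: "s1 > s" unfolding s1_def using J False by (subst Min_gr_iff) (auto dest!: zl)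
  have s1z: "s1 < - h (z p)" if "p \<in> J" for p
  proof -
    have "s1 \<le> (s - h (z p)) / 2" unfolding s1_def using J that by (intro Min_le) auto
    also have "\<dots> < - h (z p)" using zl[OF that] by (simp add: field_simps)
    finally show ?thesis .
  qed
  have "(\<Sum>p\<in>J. 1 / (p + X) - 1 / (z p + X)) \<le> (\<Sum>p\<in>J. 1 / (p + X) - 1 / (q p s1 + X))"
  proof (rule sum_mono)
    fix p assume p: "p \<in> J"
    have "z p < q p s1" using z[OF p] s1 s1z[OF p] by (intro q_gt[OF p]) auto
    then show "1 / (p + X) - 1 / (z p + X) \<le> 1 / (p + X) - 1 / (q p s1 + X)"
      using z[OF p] pnn[OF p] X by (simp add: frac_le)
  qed
  also have "\<dots> \<le> \<kappa> / s1" using M_le[OF s1] unfolding M_def by simp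
  also have "\<dots> \<le> \<kappa> / s" using s s1 \<kappa> by (simp add: frac_le)
  finally show ?thesis unfolding \<kappa>_def .
qed

text \<open>The interior points \<open>z p\<close> served only to stay away from the level
  \<open>s\<close> itself; moving them to \<open>e p\<close> removes them.\<close>

lemma branch_sum:
  assumes J: "finite J" "\<And>p. p \<in> J \<Longrightarrow> \<gamma> p = 0"
    and e: "\<And>p. p \<in> J \<Longrightarrow> p < e p" "\<And>p x. p \<in> J \<Longrightarrow> p < x \<Longrightarrow> x \<le> e p \<Longrightarrow> \<gamma> x \<noteq> 0"
      "\<And>p. p \<in> J \<Longrightarrow> h (e p) = - s"
    and X: "X > 0" and s: "s > 0"
  shows "(\<Sum>p\<in>J. 1 / (p + X) - 1 / (e p + X)) \<le> kern (- X) (- X) / s"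
proof (rule tendsto_upperbound)
  let ?z = "\<lambda>t p. e p - t * (e p - p)"
  show "((\<lambda>t. \<Sum>p\<in>J. 1 / (p + X) - 1 / (?z t p + X)) \<longlongrightarrow> (\<Sum>p\<in>J. 1 / (p + X) - 1 / (e p + X))) (at_right 0)"
  proof (intro tendsto_sum tendsto_diff tendsto_const tendsto_divide)
    fix p assume p: "p \<in> J"
    have "((\<lambda>t. ?z t p + X) \<longlongrightarrow> e p - 0 * (e p - p) + X) (at_right 0)" by (intro tendsto_intros)
    then show "((\<lambda>t. ?z t p + X) \<longlongrightarrow> e p + X) (at_right 0)" by simp
    show "e p + X \<noteq> 0" using pole_nonneg[OF J(2)[OF p]] e(1)[OF p] X by simp
  qed
  show "\<forall>\<^sub>F t in at_right 0. (\<Sum>p\<in>J. 1 / (p + X) - 1 / (?z t p + X)) \<le> kern (- X) (- X) / s"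
    using eventually_at_right_real[of 0 1, simplified]
  proof eventually_elim
    case (elim t)
    show ?case
    proof (rule branch_sum_open[OF J e _ X s])
      fix p assume p: "p \<in> J"
      have "t * (e p - p) > 0" "(1 - t) * (e p - p) > 0" using elim e(1)[OF p] by auto
      then show "p < ?z t p \<and> ?z t p < e p" by (simp add: algebra_simps)
    qed
  qed
qed simp

end

text \<open>Translates the telescoping weight into logarithmic length: \<open>ln e - ln p'\<close>
  is at most \<open>(e - p') / L\<close>, and \<open>e - p'\<close> is the difference of the
  reciprocals times \<open>(p' + X) * (e + X)\<close>, where both factors are at most
  \<open>2 * X\<close>.\<close>

lemma emeasure_exp_preimage_le:
  fixes p e L X :: real
  assumes "0 \<le> p" "p < e" "e \<le> X" "0 < L"
  shows "emeasure lborel {t. L < exp t \<and> p < exp t \<and> exp t \<le> e}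
    \<le> ennreal (4 * X\<^sup>2 / L * (1 / (p + X) - 1 / (e + X)))"
proof (cases "L < e")
  case False
  then have "{t. L < exp t \<and> p < exp t \<and> exp t \<le> e} = {}" by (auto simp: set_eq_iff)
  then show ?thesis by (simp only: emeasure_empty zero_le)
next
  case True
  define p' where "p' = max p L"
  have p': "p \<le> p'" "L \<le> p'" "p' < e" "0 < p'" using assms True by (auto simp: p'_def)
  have X: "X > 0" using assms by simp
  have "emeasure lborel {t. L < exp t \<and> p < exp t \<and> exp t \<le> e} \<le> emeasure lborel {ln p'..ln e}"
  proof (rule emeasure_mono)
    show "{t. L < exp t \<and> p < exp t \<and> exp t \<le> e} \<subseteq> {ln p'..ln e}"
    proof (clarsimp)
      fix t assume a: "L < exp t" "p < exp t" "exp t \<le> e"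
      have "ln p' \<le> ln (exp t)" using a p' by (intro ln_mono) (auto simp: p'_def)
      moreover have "ln (exp t) \<le> ln e" using a by (intro ln_mono) auto
      ultimately show "ln p' \<le> t \<and> t \<le> ln e" by simp
    qed
  qed simp
  also have "\<dots> = ennreal (ln (e / p'))" using p' by (simp add: ln_div)
  also have "ln (e / p') \<le> e / p' - 1" using p' by (intro ln_le_minus_one) simp
  also have "e / p' - 1 = (e - p') / p'" using p' by (simp add: field_simps)
  also have "\<dots> \<le> (e - p') / L" using p' assms by (intro divide_left_mono) auto
  also have "e - p' = (1 / (p' + X) - 1 / (e + X)) * ((p' + X) * (e + X))"
  proof -
    have "p' + X \<noteq> 0" "e + X \<noteq> 0" using p' X by auto
    then show ?thesis by (simp only: left_diff_distrib) simp
  qed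
  also have "\<dots> \<le> (1 / (p + X) - 1 / (e + X)) * ((2 * X) * (2 * X))"
  proof (rule mult_mono)
    show "1 / (p' + X) - 1 / (e + X) \<le> 1 / (p + X) - 1 / (e + X)"
      using p' X assms by (intro diff_right_mono divide_left_mono) auto
    show "(p' + X) * (e + X) \<le> (2 * X) * (2 * X)" using p' assms X by (intro mult_mono) auto
    show "0 \<le> 1 / (p + X) - 1 / (e + X)" using assms X by (simp add: frac_le)
  qed (use p' assms X in auto)
  finally show ?thesis using assms by (simp add: ennreal_leI divide_right_mono power2_eq_square mult_ac)
qed

context herglotz_pair
begin

text \<open>A point below level \<open>- s\<close> lies on the branch of the last pole before it. If
  this branch reaches \<open>- s\<close> up to \<open>Y\<close>, the point lies before the crossing
  (\<open>Q1\<close>). Otherwise the branch cannot end at another pole, where \<open>h\<close> tends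
  to plus infinity, so it runs up to \<open>Y\<close>; that happens for one pole at most
  (\<open>Q2\<close>). Each family contributes \<open>4 * X\<^sup>2 / L\<close>, hence the
  8.\<close>

lemma emeasure_below_level_le:
  assumes fin: "finite {p. \<gamma> p = 0 \<and> p < Y}" and L: "0 < L" "L < Y" "Y \<le> X" and s: "s > 0"
  shows "emeasure lborel {t. L < exp t \<and> exp t < Y \<and> \<gamma> (exp t) \<noteq> 0 \<and> h (exp t) \<le> - s}
    \<le> ennreal (8 * X\<^sup>2 / L * (kern (- X) (- X) / s))"
proof -
  define Q where "Q = {p. \<gamma> p = 0 \<and> p < Y}"
  define \<kappa> where "\<kappa> = kern (- X) (- X)"
  have X: "X > 0" using L by simp
  have finQ: "finite Q" using fin by (simp add: Q_def)
  define good where "good p e \<longleftrightarrow> p < e \<and> e \<le> Y \<and> (\<forall>x. p < x \<and> x \<le> e \<longrightarrow> \<gamma> x \<noteq> 0)" for p e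
  define Q1 where "Q1 = {p\<in>Q. \<exists>e. good p e \<and> h e = - s}"
  define Q2 where "Q2 = {p\<in>Q. good p Y \<and> h Y \<le> - s}"
  have "\<exists>e. good p e \<and> h e = - s" if "p \<in> Q1" for p using that by (simp add: Q1_def)
  then obtain e where e: "\<And>p. p \<in> Q1 \<Longrightarrow> good p (e p) \<and> h (e p) = - s" by metis
  have Q1: "Q1 \<subseteq> Q" and Q2: "Q2 \<subseteq> Q" by (auto simp: Q1_def Q2_def)
  have pnn: "p \<ge> 0" if "p \<in> Q" for p using that pole_nonneg by (auto simp: Q_def)
  let ?c = "4 * X\<^sup>2 / L"
  let ?V = "\<lambda>p e. {t. L < exp t \<and> p < exp t \<and> exp t \<le> e}"
  have cover: "{t. L < exp t \<and> exp t < Y \<and> \<gamma> (exp t) \<noteq> 0 \<and> h (exp t) \<le> - s}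
      \<subseteq> (\<Union>p\<in>Q1. ?V p (e p)) \<union> (\<Union>p\<in>Q2. ?V p Y)"
  proof
    fix t assume "t \<in> {t. L < exp t \<and> exp t < Y \<and> \<gamma> (exp t) \<noteq> 0 \<and> h (exp t) \<le> - s}"
    then have t: "L < exp t" "exp t < Y" "\<gamma> (exp t) \<noteq> 0" "h (exp t) \<le> - s" by auto
    define x where "x = exp t"
    let ?A = "{p\<in>Q. p < x}"
    \<comment> \<open>Without a pole on its left the point would be reached by an increasing
      \<open>h\<close> from the positive value at \<open>- 1\<close>.\<close>
    have "?A \<noteq> {}"
    proof
      assume "?A = {}"
      have "\<gamma> z \<noteq> 0" if "z \<le> x" for z
      proof
        assume "\<gamma> z = 0"
        then have "z \<in> ?A" using that t by (cases "z = x") (auto simp: Q_def x_def)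
        with \<open>?A = {}\<close> show False by blast
      qed
      then have "h (-1) < h x" by (intro h_strict_mono) (auto simp: x_def intro: less_trans[of _ "0 :: real"])
      then show False using h_pos[of "-1"] t s by (simp add: x_def)
    qed
    define p where "p = Max ?A"
    have pA: "p \<in> ?A" unfolding p_def using finQ \<open>?A \<noteq> {}\<close> by (intro Max_in) auto
    have nop: "\<gamma> z \<noteq> 0" if "p < z" "z \<le> x" for z
    proof
      assume z: "\<gamma> z = 0"
      then have "z < x" using that t by (cases "z = x") (auto simp: x_def)
      then have "z \<in> ?A" using z t by (auto simp: Q_def x_def)
      then have "z \<le> p" unfolding p_def using finQ by (intro Max_ge) auto
      with that show False by simp
    qed
    have gx: "good p x" using pA nop t by (auto simp: good_def x_def)
    have hx: "h x \<le> - s" using t by (simp add: x_def)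
    consider (a) "p \<in> Q1" | (b) "p \<notin> Q1" by blast
    then show "t \<in> (\<Union>p\<in>Q1. ?V p (e p)) \<union> (\<Union>p\<in>Q2. ?V p Y)"
    proof cases
      case a
      have "x \<le> e p"
      proof (rule ccontr)
        assume "\<not> x \<le> e p"
        then have "h (e p) < h x" using e[OF a] nop by (intro h_strict_mono) (auto simp: good_def)
        then show False using e[OF a] hx by simp
      qed
      then show ?thesis using a pA t by (auto simp: x_def)
    next
      case b
      have noq: "\<not> (h z > - s \<and> good p z)" for z
      proof
        assume z: "h z > - s \<and> good p z"
        then obtain q where "p < q" "q \<le> z" "h q = - s"
          using branch_level[of p z s] pA by (auto simp: Q_def good_def)
        then have "good p q \<and> h q = - s" using z by (auto simp: good_def)
        then show False using b pA by (auto simp: Q1_def)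
      qed
      have "\<gamma> z \<noteq> 0" if "p < z" "z \<le> Y" for z
      proof
        assume z: "\<gamma> z = 0"
        let ?B = "{z. \<gamma> z = 0 \<and> p < z \<and> z \<le> Y}"
        have fB: "finite ?B" by (rule finite_subset[of _ "insert Y Q"]) (use finQ in \<open>auto simp: Q_def\<close>)
        define z' where "z' = Min ?B"
        have z': "z' \<in> ?B" unfolding z'_def using fB z that by (intro Min_in) auto
        have least: "z' \<le> w" if "w \<in> ?B" for w unfolding z'_def using fB that by (intro Min_le) auto
        have "\<forall>\<^sub>F w in at_left z'. - s < h w"
          using h_at_left_pole[of z'] z' unfolding filterlim_at_top_dense by blast
        moreover have "\<forall>\<^sub>F w in at_left z'. w \<in> {p<..<z'}"
          by (rule eventually_at_left_real) (use z' in simp)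
        ultimately have "\<forall>\<^sub>F w in at_left z'. - s < h w \<and> w \<in> {p<..<z'}" by (rule eventually_conj)
        then obtain w where w: "- s < h w" "p < w" "w < z'"
          using eventually_happens'[OF trivial_limit_at_left_real] by force
        have "good p w" unfolding good_def
        proof (intro conjI allI impI)
          show "w \<le> Y" using w z' by simp
          fix v assume v: "p < v \<and> v \<le> w"
          show "\<gamma> v \<noteq> 0" using least[of v] v w z' by force
        qed (use w in simp)
        then show False using noq w by blast
      qed
      then have "good p Y" using pA t by (auto simp: good_def Q_def)
      then have "p \<in> Q2" using noq[of Y] pA by (auto simp: Q2_def)
      then show ?thesis using pA t by (auto simp: x_def)
    qed
  qed
  have V1: "emeasure lborel (\<Union>p\<in>Q1. ?V p (e p)) \<le> ennreal (?c * (\<kappa> / s))"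
  proof -
    have "emeasure lborel (\<Union>p\<in>Q1. ?V p (e p)) \<le> (\<Sum>p\<in>Q1. emeasure lborel (?V p (e p)))"
      by (rule emeasure_subadditive_finite) (use finQ Q1 finite_subset in auto)
    also have "\<dots> \<le> (\<Sum>p\<in>Q1. ennreal (?c * (1 / (p + X) - 1 / (e p + X))))"
    proof (rule sum_mono)
      fix p assume p: "p \<in> Q1"
      show "emeasure lborel (?V p (e p)) \<le> ennreal (?c * (1 / (p + X) - 1 / (e p + X)))"
        using e[OF p] pnn[of p] p Q1 L by (intro emeasure_exp_preimage_le) (auto simp: good_def)
    qed
    also have "\<dots> = ennreal (\<Sum>p\<in>Q1. ?c * (1 / (p + X) - 1 / (e p + X)))"
    proof (rule sum_ennreal)
      fix p assume p: "p \<in> Q1"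
      show "0 \<le> ?c * (1 / (p + X) - 1 / (e p + X))"
        using e[OF p] pnn[of p] p Q1 L X by (intro mult_nonneg_nonneg) (auto simp: good_def frac_le)
    qed
    also have "\<dots> \<le> ennreal (?c * (\<kappa> / s))"
      unfolding sum_distrib_left[symmetric] \<kappa>_def
      by (intro ennreal_leI mult_left_mono branch_sum)
         (use finQ Q1 finite_subset e X s L in \<open>auto simp: good_def Q_def\<close>)
    finally show ?thesis .
  qed
  have V2: "emeasure lborel (\<Union>p\<in>Q2. ?V p Y) \<le> ennreal (?c * (\<kappa> / s))"
  proof (cases "Q2 = {}")
    case False
    then obtain p where p: "p \<in> Q2" by blast
    have "p' = p" if "p' \<in> Q2" for p'
      using p that Q2 by (cases p p' rule: linorder_cases) (auto simp: Q2_def good_def Q_def)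
    then have "Q2 = {p}" using p by blast
    then have "emeasure lborel (\<Union>p\<in>Q2. ?V p Y) = emeasure lborel (?V p Y)" by simp
    also have "\<dots> \<le> ennreal (?c * (1 / (p + X) - 1 / (Y + X)))"
      using p pnn[of p] Q2 L by (intro emeasure_exp_preimage_le) (auto simp: Q2_def good_def)
    also have "\<dots> \<le> ennreal (?c * (\<kappa> / s))"
    proof (intro ennreal_leI mult_left_mono)
      \<comment> \<open>The endpoint must lie exactly on the level, so \<open>branch_sum\<close> is
        applied with \<open>- h Y\<close> in place of \<open>s\<close>; this number is at least
        \<open>s\<close>.\<close>
      have "(\<Sum>p\<in>{p}. 1 / (p + X) - 1 / (Y + X)) \<le> \<kappa> / (- h Y)" unfolding \<kappa>_def
        by (rule branch_sum) (use p X s in \<open>auto simp: Q2_def good_def Q_def\<close>)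
      also have "\<dots> \<le> \<kappa> / s"
        using p s kern_self_pos[OF gamma_neg, of "-X"] X by (intro divide_left_mono) (auto simp: Q2_def \<kappa>_def mult_less_0_iff)
      finally show "1 / (p + X) - 1 / (Y + X) \<le> \<kappa> / s" by simp
    qed (use L in simp)
    finally show ?thesis .
  qed (simp)
  have "emeasure lborel {t. L < exp t \<and> exp t < Y \<and> \<gamma> (exp t) \<noteq> 0 \<and> h (exp t) \<le> - s}
    \<le> emeasure lborel ((\<Union>p\<in>Q1. ?V p (e p)) \<union> (\<Union>p\<in>Q2. ?V p Y))"
    by (rule emeasure_mono[OF cover]) (use finite_subset[OF Q1 finQ] finite_subset[OF Q2 finQ] in \<open>auto intro!: sets.finite_UN\<close>)
  also have "\<dots> \<le> emeasure lborel (\<Union>p\<in>Q1. ?V p (e p)) + emeasure lborel (\<Union>p\<in>Q2. ?V p Y)"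
    by (rule emeasure_subadditive) (use finite_subset[OF Q1 finQ] finite_subset[OF Q2 finQ] in \<open>auto intro!: sets.finite_UN\<close>)
  also have "\<dots> \<le> ennreal (?c * (\<kappa> / s)) + ennreal (?c * (\<kappa> / s))" by (intro add_mono V1 V2)
  also have "\<dots> = ennreal (?c * (\<kappa> / s) + ?c * (\<kappa> / s))"
    using kern_self_pos[OF gamma_neg, of "-X"] X L s by (intro ennreal_plus[symmetric]) (auto simp: \<kappa>_def)
  also have "?c * (\<kappa> / s) + ?c * (\<kappa> / s) = 8 * X\<^sup>2 / L * (\<kappa> / s)" by simp
  finally show ?thesis unfolding \<kappa>_def .
qed

text \<open>The mean value theorem provides \<open>X\<close> for which \<open>X * kern (- X) (- X)\<close> is controlled by the increment of \<open>h\<close>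
  over a window on the negative axis. There \<open>h\<close> is monotone and bounded, so these increments tend to zero.\<close>

lemma emeasure_below_level_window:
  assumes fin: "\<And>Y. finite {p. \<gamma> p = 0 \<and> p < Y}" and T: "T > 0" and s: "s > 0" and \<epsilon>: "\<epsilon> > 0"
  shows "\<forall>\<^sub>F n in sequentially.
    emeasure lborel {t. real n * T < t \<and> t < real (Suc n) * T \<and> \<gamma> (exp t) \<noteq> 0 \<and> h (exp t) \<le> - s} \<le> ennreal \<epsilon>"
proof -
  define Y where "Y n = exp (real (Suc n) * T)" for n
  define w where "w n = h (- Y n)" for n
  \<comment> \<open>Collects constants: with \<open>X < exp T * Y n\<close> and
    \<open>Y n = exp T * exp (n * T)\<close> the previous bound becomes
    \<open>8 * exp (3 * T) / s\<close> times \<open>kern (- X) (- X) * Y n\<close>, and the choice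
    of \<open>X\<close> makes this product an increment of \<open>w\<close> divided by
    \<open>exp T - 1\<close>.\<close>
  define c where "c = 8 * exp (3 * T) / ((exp T - 1) * s)"
  have YS: "Y (Suc n) = exp T * Y n" for n by (simp add: Y_def exp_add[symmetric] algebra_simps)
  have eT: "exp T > 1" using T by simp
  have Ypos: "Y n > 0" for n by (simp add: Y_def)
  have Ylt: "Y n < Y (Suc n)" for n using eT Ypos[of n] by (simp add: YS)
  have "w (Suc n) \<le> w n" for n unfolding w_def
  proof (intro less_imp_le h_strict_mono)
    fix x assume "- Y (Suc n) \<le> x" "x \<le> - Y n"
    then show "\<gamma> x \<noteq> 0" using gamma_neg[of x] Ypos[of n] by linarith
  qed (use Ylt in simp)
  then have "decseq w" by (rule decseq_SucI)
  moreover have "w n \<ge> 0" for n unfolding w_def using h_pos[of "- Y n"] Ypos[of n] by simp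
  ultimately obtain l where l: "w \<longlonglongrightarrow> l" using decseq_convergent[of w 0] by blast
  have "(\<lambda>n. c * (w n - w (Suc n))) \<longlonglongrightarrow> c * (l - l)" by (intro tendsto_intros l LIMSEQ_Suc)
  then have "\<forall>\<^sub>F n in sequentially. c * (w n - w (Suc n)) < \<epsilon>" using \<epsilon> by (auto dest: order_tendstoD)
  then show ?thesis
  proof eventually_elim
    case (elim n)
    let ?L = "exp (real n * T)"
    have YL: "Y n = exp T * ?L" by (simp add: Y_def exp_add[symmetric] algebra_simps)
    have "\<exists>z>- Y (Suc n). z < - Y n \<and> h (- Y n) - h (- Y (Suc n)) = (- Y n - - Y (Suc n)) * kern z z"
      by (rule MVT2) (use Ylt[of n] Ypos[of n] gamma_neg in \<open>auto intro!: DERIV_h\<close>)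
    then obtain z where z: "- Y (Suc n) < z" "z < - Y n" "w n - w (Suc n) = (Y (Suc n) - Y n) * kern z z"
      by (auto simp: w_def)
    define X where "X = - z"
    have X: "Y n < X" "X < Y (Suc n)" using z by (auto simp: X_def)
    have k: "kern (- X) (- X) > 0" using kern_self_pos gamma_neg X Ypos[of n] by simp
    have kw: "kern (- X) (- X) * Y n = (w n - w (Suc n)) / (exp T - 1)"
      using z(3) eT by (simp add: X_def YS field_simps)
    have eq: "{t. real n * T < t \<and> t < real (Suc n) * T \<and> \<gamma> (exp t) \<noteq> 0 \<and> h (exp t) \<le> - s} =
      {t. ?L < exp t \<and> exp t < Y n \<and> \<gamma> (exp t) \<noteq> 0 \<and> h (exp t) \<le> - s}" by (simp add: Y_def)
    have "emeasure lborel {t. ?L < exp t \<and> exp t < Y n \<and> \<gamma> (exp t) \<noteq> 0 \<and> h (exp t) \<le> - s}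
      \<le> ennreal (8 * X\<^sup>2 / ?L * (kern (- X) (- X) / s))"
      by (rule emeasure_below_level_le) (use fin X s eT in \<open>auto simp: YL\<close>)
    also have "8 * X\<^sup>2 / ?L * (kern (- X) (- X) / s) \<le> 8 * (exp T * Y n)\<^sup>2 / ?L * (kern (- X) (- X) / s)"
      using X Ypos[of n] k s by (intro mult_right_mono divide_right_mono mult_left_mono power_mono) (auto simp: YS)
    also have "\<dots> = 8 * exp T ^ 3 * (kern (- X) (- X) * Y n) / s"
      by (simp add: YL power2_eq_square power3_eq_cube)
    also have "\<dots> = c * (w n - w (Suc n))"
      unfolding kw c_def by (simp add: exp_of_nat_mult[symmetric] del: exp_of_nat_mult)
    also have "\<dots> \<le> \<epsilon>" using elim by simp
    finally show ?case unfolding eq by (simp add: ennreal_leI)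
  qed
qed

end

section \<open>Interlacing of zeros and poles\<close>

text \<open>The features of a Herglotz function on which the zero count rests. Unlike
  \<open>herglotz_pair\<close> they are visibly preserved by sums, even when the data behind the two
  summands have nothing in common. Positivity on the negative half-line fixes the start of the
  count.\<close>

definition increasing_between_poles :: "(real \<Rightarrow> real) \<Rightarrow> real set \<Rightarrow> bool" where
  "increasing_between_poles F P \<longleftrightarrow>
    (\<forall>x. x \<notin> P \<longrightarrow> isCont F x) \<and>
    (\<forall>a b. a < b \<longrightarrow> {a..b} \<inter> P = {} \<longrightarrow> F a < F b) \<and>
    (\<forall>p\<in>P. filterlim F at_bot (at_right p) \<and> filterlim F at_top (at_left p)) \<and>
    (\<forall>x<0. x \<notin> P \<and> F x > 0)"

lemma filterlim_at_bot_add_bounded: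
  fixes f g :: "'a \<Rightarrow> real"
  assumes "filterlim f at_bot F" "\<forall>\<^sub>F x in F. g x \<le> K"
  shows "filterlim (\<lambda>x. f x + g x) at_bot F"
  unfolding filterlim_at_bot
proof
  fix Z :: real
  have "\<forall>\<^sub>F x in F. f x \<le> Z - K" using assms(1) unfolding filterlim_at_bot by blast
  with assms(2) show "\<forall>\<^sub>F x in F. f x + g x \<le> Z" by eventually_elim simp
qed

lemma filterlim_at_top_add_bounded:
  fixes f g :: "'a \<Rightarrow> real"
  assumes "filterlim f at_top F" "\<forall>\<^sub>F x in F. K \<le> g x"
  shows "filterlim (\<lambda>x. f x + g x) at_top F"
  unfolding filterlim_at_top
proof
  fix Z :: real
  have "\<forall>\<^sub>F x in F. Z - K \<le> f x" using assms(1) unfolding filterlim_at_top by blast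
  with assms(2) show "\<forall>\<^sub>F x in F. Z \<le> f x + g x" by eventually_elim simp
qed

text \<open>Poles cannot cancel: immediately to the right of any point both summands are bounded
  above, immediately to the left both are bounded below, pole or not. So an infinite one-sided limit
  of one summand survives.\<close>

lemma increasing_between_poles_add:
  assumes F: "increasing_between_poles F P" and G: "increasing_between_poles G Q"
  shows "increasing_between_poles (\<lambda>x. F x + G x) (P \<union> Q)"
proof -
  have near: "(\<exists>K. \<forall>\<^sub>F x in at_right p. H x \<le> K) \<and> (\<exists>K. \<forall>\<^sub>F x in at_left p. K \<le> H x)"
    if "increasing_between_poles H R" for H R p
  proof (cases "p \<in> R")
    case True
    then show ?thesis using that unfolding increasing_between_poles_def filterlim_at_bot filterlim_at_top by blast
  next
    case False
    then have "isCont H p" using that unfolding increasing_between_poles_def by blast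
    then have "\<forall>\<^sub>F x in at p. H x < H p + 1" "\<forall>\<^sub>F x in at p. H p - 1 < H x"
      by (auto simp: isCont_def intro: order_tendstoD)
    then have "\<forall>\<^sub>F x in at_right p. H x < H p + 1" "\<forall>\<^sub>F x in at_left p. H p - 1 < H x"
      by (auto simp: eventually_at_split)
    then show ?thesis by (meson eventually_mono less_imp_le)
  qed
  have "filterlim (\<lambda>x. F x + G x) at_bot (at_right p)" "filterlim (\<lambda>x. F x + G x) at_top (at_left p)"
    if "p \<in> P \<union> Q" for p
  proof -
    obtain K1 K2 K3 K4 where K: "\<forall>\<^sub>F x in at_right p. F x \<le> K1" "\<forall>\<^sub>F x in at_left p. K2 \<le> F x"
      "\<forall>\<^sub>F x in at_right p. G x \<le> K3" "\<forall>\<^sub>F x in at_left p. K4 \<le> G x"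
      using near[OF F] near[OF G] by blast
    show "filterlim (\<lambda>x. F x + G x) at_bot (at_right p)"
    proof (cases "p \<in> P")
      case True
      then show ?thesis using F K(3) unfolding increasing_between_poles_def
        by (blast intro: filterlim_at_bot_add_bounded)
    next
      case False
      then have "filterlim (\<lambda>x. G x + F x) at_bot (at_right p)"
        using that G K(1) unfolding increasing_between_poles_def
        by (blast intro: filterlim_at_bot_add_bounded)
      then show ?thesis by (simp add: add.commute)
    qed
    show "filterlim (\<lambda>x. F x + G x) at_top (at_left p)"
    proof (cases "p \<in> P")
      case True
      then show ?thesis using F K(4) unfolding increasing_between_poles_def
        by (blast intro: filterlim_at_top_add_bounded)
    next
      case False
      then have "filterlim (\<lambda>x. G x + F x) at_top (at_left p)"
        using that G K(2) unfolding increasing_between_poles_def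
        by (blast intro: filterlim_at_top_add_bounded)
      then show ?thesis by (simp add: add.commute)
    qed
  qed
  moreover have "F a + G a < F b + G b" if "a < b" "{a..b} \<inter> (P \<union> Q) = {}" for a b
  proof -
    from that(2) have "{a..b} \<inter> P = {}" "{a..b} \<inter> Q = {}" by auto
    with that(1) F G have "F a < F b" "G a < G b" unfolding increasing_between_poles_def by blast+
    then show ?thesis by simp
  qed
  ultimately show ?thesis using F G unfolding increasing_between_poles_def
    by (auto intro!: continuous_add add_pos_pos)
qed

lemma increasing_between_poles_const_add:
  assumes F: "increasing_between_poles F P" and g: "0 \<le> g"
  shows "increasing_between_poles (\<lambda>x. g + F x) P"
proof -
  have "filterlim (\<lambda>x. g + F x) at_bot (at_right p) \<and> filterlim (\<lambda>x. g + F x) at_top (at_left p)" if "p \<in> P" for p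
  proof -
    have "filterlim F at_bot (at_right p)" "filterlim F at_top (at_left p)"
      using F that unfolding increasing_between_poles_def by blast+
    then have "filterlim (\<lambda>x. F x + g) at_bot (at_right p)" "filterlim (\<lambda>x. F x + g) at_top (at_left p)"
      by (auto intro: filterlim_at_bot_add_bounded[where K = g] filterlim_at_top_add_bounded[where K = g])
    then show ?thesis by (simp add: add.commute)
  qed
  then show ?thesis using F g unfolding increasing_between_poles_def
    by (auto intro!: continuous_add add_nonneg_pos)
qed

lemma (in herglotz_pair) increasing_between_poles_h:
  assumes "0 < c" "0 < k"
  shows "increasing_between_poles (\<lambda>x. c * h (k * x)) {x. \<gamma> (k * x) = 0}"
  unfolding increasing_between_poles_def
proof (intro conjI allI impI ballI)
  fix x assume "x \<notin> {x. \<gamma> (k * x) = 0}"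
  then have "isCont h (k * x)" by (intro isCont_h) simp
  then have "isCont (\<lambda>x. h (k * x)) x" by (intro isCont_o2[where f = "\<lambda>x. k * x" and g = h]) simp_all
  then show "isCont (\<lambda>x. c * h (k * x)) x" by simp
next
  fix a b :: real assume ab: "a < b" "{a..b} \<inter> {x. \<gamma> (k * x) = 0} = {}"
  have "h (k * a) < h (k * b)"
  proof (rule h_strict_mono)
    fix x assume "k * a \<le> x" "x \<le> k * b"
    then have "x / k \<in> {a..b}"
      using pos_le_divide_eq[OF assms(2), of a x] pos_divide_le_eq[OF assms(2), of x b] by (simp add: mult.commute)
    then have "\<gamma> (k * (x / k)) \<noteq> 0" using ab(2) by blast
    then show "\<gamma> x \<noteq> 0" using assms by simp
  qed (use ab assms in simp)
  then show "c * h (k * a) < c * h (k * b)" using assms by simp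
next
  fix p assume "p \<in> {x. \<gamma> (k * x) = 0}"
  then have p: "\<gamma> (k * p) = 0" by simp
  have "filterlim (\<lambda>x. k * x) (at_right (k * p)) (at_right p)"
    unfolding filterlim_at
  proof
    show "\<forall>\<^sub>F x in at_right p. k * x \<in> {k * p<..} \<and> k * x \<noteq> k * p"
      using eventually_at_right_less[of p] by eventually_elim (use assms in auto)
  qed (intro tendsto_intros)
  then have "filterlim (\<lambda>x. h (k * x)) at_bot (at_right p)"
    by (rule filterlim_compose[OF h_at_right_pole[OF p]])
  then show "filterlim (\<lambda>x. c * h (k * x)) at_bot (at_right p)"
    by (rule filterlim_tendsto_pos_mult_at_bot[OF tendsto_const assms(1)])
  have "filterlim (\<lambda>x. k * x) (at_left (k * p)) (at_left p)"
    unfolding filterlim_at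
  proof
    show "\<forall>\<^sub>F x in at_left p. k * x \<in> {..<k * p} \<and> k * x \<noteq> k * p"
      using eventually_at_left_real[of "p - 1" p, simplified] by eventually_elim (use assms in auto)
  qed (intro tendsto_intros)
  then have "filterlim (\<lambda>x. h (k * x)) at_top (at_left p)"
    by (rule filterlim_compose[OF h_at_left_pole[OF p]])
  then show "filterlim (\<lambda>x. c * h (k * x)) at_top (at_left p)"
    by (rule filterlim_tendsto_pos_mult_at_top[OF tendsto_const assms(1)])
next
  fix x :: real assume "x < 0"
  then have "k * x < 0" using assms by (simp add: mult_pos_neg)
  then show "x \<notin> {x. \<gamma> (k * x) = 0}" "0 < c * h (k * x)" using gamma_neg h_pos assms by auto
qed

text \<open>Each zero is matched with the last pole before it. Strict growth makes the matching
  injective, and positivity on the negative axis provides a pole before every zero. Between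
  consecutive poles the function runs from minus to plus infinity, so at most the last pole below
  \<open>l\<close> stays unmatched; it is matched as well if \<open>l\<close> is a pole or the
  function is already positive at \<open>l\<close>.\<close>

lemma zeros_interlace_poles:
  assumes F: "increasing_between_poles F P" and fin: "\<And>Y. finite {p\<in>P. p < Y}"
  defines "Z \<equiv> {z. z \<notin> P \<and> F z = 0}"
  shows "finite {z\<in>Z. z < l}" "card {z\<in>Z. z < l} \<le> card {p\<in>P. p < l}"
    "card {p\<in>P. p < l} \<le> Suc (card {z\<in>Z. z < l})"
    "l \<in> P \<or> F l > 0 \<Longrightarrow> card {z\<in>Z. z < l} = card {p\<in>P. p < l}"
proof -
  have cont: "isCont F x" if "x \<notin> P" for x using F that unfolding increasing_between_poles_def by blast
  have mono: "F a < F b" if "a < b" "\<And>x. a \<le> x \<Longrightarrow> x \<le> b \<Longrightarrow> x \<notin> P" for a b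
  proof -
    have "{a..b} \<inter> P = {}" using that(2) by auto
    then show ?thesis using F that(1) unfolding increasing_between_poles_def by blast
  qed
  have neg: "x \<notin> P" "F x > 0" if "x < 0" for x using F that unfolding increasing_between_poles_def by auto
  define \<phi> where "\<phi> z = Max {p\<in>P. p < z}" for z
  have phi_eq: "\<phi> z = p" if "p \<in> P" "p < z" "\<And>x. p < x \<Longrightarrow> x < z \<Longrightarrow> x \<notin> P" for z p
    unfolding \<phi>_def using fin[of z] that by (intro Max_eqI) (auto intro: leI)
  have phi: "\<phi> z \<in> P" "\<phi> z < z" "\<And>x. \<phi> z < x \<Longrightarrow> x \<le> z \<Longrightarrow> x \<notin> P" if z: "z \<in> Z" for z
  proof -
    have ne: "{p\<in>P. p < z} \<noteq> {}"
    proof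
      assume e: "{p\<in>P. p < z} = {}"
      then have nop: "x \<notin> P" if "x \<le> z" for x using that z by (cases "x = z") (auto simp: Z_def)
      have "z \<ge> 0" using neg[of z] z by (force simp: Z_def)
      then have "F (-1) < F z" using nop by (intro mono) auto
      then show False using neg(2)[of "-1"] z by (simp add: Z_def)
    qed
    have "\<phi> z \<in> {p\<in>P. p < z}" unfolding \<phi>_def using fin[of z] ne by (rule Max_in)
    then show "\<phi> z \<in> P" "\<phi> z < z" by auto
    fix x assume x: "\<phi> z < x" "x \<le> z"
    show "x \<notin> P"
    proof
      assume "x \<in> P"
      then have "x < z" using z x by (cases "x = z") (auto simp: Z_def)
      then have "x \<le> \<phi> z" unfolding \<phi>_def using fin[of z] \<open>x \<in> P\<close> by (intro Max_ge) auto
      with x show False by simp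
    qed
  qed
  have inj: "inj_on \<phi> Z"
  proof (rule inj_onI, rule ccontr)
    have *: False if "z \<in> Z" "z' \<in> Z" "\<phi> z = \<phi> z'" "z < z'" for z z'
    proof -
      have "F z < F z'" using phi[OF that(1)] phi[OF that(2)] that by (intro mono) auto
      then show False using that by (simp add: Z_def)
    qed
    fix z z' assume "z \<in> Z" "z' \<in> Z" "\<phi> z = \<phi> z'" "z \<noteq> z'"
    then show False using *[of z z'] *[of z' z] by (cases z z' rule: linorder_cases) auto
  qed
  let ?Zl = "{z\<in>Z. z < l}" and ?Pl = "{p\<in>P. p < l}"
  have inj': "inj_on \<phi> ?Zl" by (rule inj_on_subset[OF inj]) auto
  have img: "\<phi> ` ?Zl \<subseteq> ?Pl"
  proof
    fix p assume "p \<in> \<phi> ` ?Zl"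
    then obtain z where z: "z \<in> Z" "z < l" "p = \<phi> z" by auto
    then show "p \<in> ?Pl" using phi(1,2)[OF z(1)] by auto
  qed
  show finZ: "finite ?Zl"
    using finite_imageD[OF finite_subset[OF img fin] inj'] .
  show le: "card ?Zl \<le> card ?Pl" using card_inj_on_le[OF inj' img fin] .
  have surj: "p \<in> \<phi> ` ?Zl" if p: "p \<in> P" and w: "p < w" "w \<le> l" "\<And>x. p < x \<Longrightarrow> x \<le> w \<Longrightarrow> x \<notin> P" "F w > 0" for p w
  proof -
    have "\<forall>\<^sub>F x in at_right p. F x < 0"
      using F p unfolding increasing_between_poles_def filterlim_at_bot_dense by blast
    then have "\<forall>\<^sub>F x in at_right p. F x < 0 \<and> x \<in> {p<..<w}"
      using eventually_at_right_real[OF w(1)] by eventually_elim simp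
    then obtain x where x: "F x < 0" "p < x" "x < w"
      using eventually_happens'[OF trivial_limit_at_right_real] by force
    have "\<exists>z\<ge>x. z \<le> w \<and> F z = 0"
      by (rule IVT) (use x w cont in auto)
    then obtain z where z: "x \<le> z" "z \<le> w" "F z = 0" by blast
    then have "z < w" using w by (cases "z = w") auto
    have "z \<in> ?Zl" using z x w \<open>z < w\<close> by (auto simp: Z_def)
    moreover have "\<phi> z = p" by (rule phi_eq) (use p z x w in auto)
    ultimately show ?thesis by blast
  qed
  have surj': "p \<in> \<phi> ` ?Zl" if p: "p \<in> P" "p' \<in> P" "p < p'" "p' \<le> l" for p p'
  proof -
    let ?B = "{q\<in>P. p < q \<and> q \<le> l}"
    have fB: "finite ?B" by (rule finite_subset[OF _ fin[of "l + 1"]]) auto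
    define q where "q = Min ?B"
    have q: "q \<in> ?B" unfolding q_def using fB p by (intro Min_in) auto
    have least: "q \<le> w" if "w \<in> ?B" for w unfolding q_def using fB that by (intro Min_le) auto
    have "\<forall>\<^sub>F w in at_left q. 0 < F w"
      using F q unfolding increasing_between_poles_def filterlim_at_top_dense by blast
    moreover have "\<forall>\<^sub>F w in at_left q. w \<in> {p<..<q}"
      by (rule eventually_at_left_real) (use q in simp)
    ultimately have "\<forall>\<^sub>F w in at_left q. 0 < F w \<and> w \<in> {p<..<q}" by (rule eventually_conj)
    then obtain w where w: "0 < F w" "p < w" "w < q"
      using eventually_happens'[OF trivial_limit_at_left_real] by force
    show ?thesis
    proof (rule surj[OF p(1), of w])
      fix x assume "p < x" "x \<le> w"
      then show "x \<notin> P" using least[of x] w q by force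
    qed (use w q in auto)
  qed
  show "card ?Pl \<le> Suc (card ?Zl)"
  proof (cases "?Pl = {}")
    case False
    have "?Pl - {Max ?Pl} \<subseteq> \<phi> ` ?Zl"
    proof
      fix p assume p: "p \<in> ?Pl - {Max ?Pl}"
      have M: "Max ?Pl \<in> ?Pl" using fin False by (intro Max_in) auto
      have "p \<le> Max ?Pl" using fin p by (intro Max_ge) auto
      then show "p \<in> \<phi> ` ?Zl" using p M by (intro surj'[of p "Max ?Pl"]) auto
    qed
    then have "card (?Pl - {Max ?Pl}) \<le> card ?Zl"
      using card_mono[OF finite_imageI[OF finZ]] card_image_le[OF finZ] order_trans by blast
    then show ?thesis by (simp add: card_Diff_singleton_if split: if_splits)
  next
    case True
    then show ?thesis by (simp only: card.empty zero_le)
  qed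
  assume l: "l \<in> P \<or> F l > 0"
  have "?Pl \<subseteq> \<phi> ` ?Zl"
  proof
    fix p assume p: "p \<in> ?Pl"
    show "p \<in> \<phi> ` ?Zl"
    proof (cases "\<exists>p'\<in>P. p < p' \<and> p' \<le> l")
      case True
      then show ?thesis using p surj' by auto
    next
      case False
      then have "F l > 0" using l p by auto
      then show ?thesis using False p by (intro surj[of p l]) auto
    qed
  qed
  then have "card ?Pl \<le> card ?Zl"
    using card_mono[OF finite_imageI[OF finZ]] card_image_le[OF finZ] order_trans by blast
  with le show "card ?Zl = card ?Pl" by simp
qed

text \<open>The union of \<open>P\<close> and \<open>Q\<close> counts common poles once; inclusion
  and exclusion restores them, since they belong to \<open>R\<close> too. If at \<open>l\<close>
  neither summand is at or below half of \<open>- g\<close>, then \<open>l\<close> is a pole or the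
  coupled function is positive there, and no zero is lost.\<close>

lemma coupled_count:
  assumes F: "increasing_between_poles F P" "\<And>Y. finite {p\<in>P. p < Y}"
    and G: "increasing_between_poles G Q" "\<And>Y. finite {p\<in>Q. p < Y}"
    and g: "g > 0"
    and R: "\<And>x. x \<in> R \<longleftrightarrow> x \<in> P \<inter> Q \<or> x \<notin> P \<union> Q \<and> g + (F x + G x) = 0"
  shows "finite {x\<in>R. x < l}"
    "card {x\<in>R. x < l} \<le> card {x\<in>P. x < l} + card {x\<in>Q. x < l}"
    "card {x\<in>P. x < l} + card {x\<in>Q. x < l} \<le> Suc (card {x\<in>R. x < l})"
    "\<not> (l \<notin> P \<and> F l \<le> - (g / 2)) \<Longrightarrow> \<not> (l \<notin> Q \<and> G l \<le> - (g / 2)) \<Longrightarrow>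
      card {x\<in>R. x < l} = card {x\<in>P. x < l} + card {x\<in>Q. x < l}"
proof -
  let ?Z = "{z. z \<notin> P \<union> Q \<and> g + (F z + G z) = 0}"
  have fin: "finite {p \<in> P \<union> Q. p < Y}" for Y
    using finite_UnI[OF F(2)[of Y] G(2)[of Y]] by (rule rev_finite_subset) auto
  note I = zeros_interlace_poles[OF increasing_between_poles_const_add[OF increasing_between_poles_add[OF F(1) G(1)]] fin, of g]
  have eq: "{x\<in>R. x < l} = {z\<in>?Z. z < l} \<union> {x\<in>P \<inter> Q. x < l}" by (auto simp: R)
  have finPQ: "finite {x\<in>P \<inter> Q. x < l}" by (rule finite_subset[OF _ F(2)[of l]]) auto
  have finZ: "finite {z\<in>?Z. z < l}" using I(1) g by simp
  show "finite {x\<in>R. x < l}" unfolding eq using finPQ finZ by simp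
  have c1: "card {x\<in>R. x < l} = card {z\<in>?Z. z < l} + card {x\<in>P \<inter> Q. x < l}"
    unfolding eq using finPQ finZ by (intro card_Un_disjoint) auto
  have c2: "card {x\<in>P. x < l} + card {x\<in>Q. x < l} = card {x\<in>P \<union> Q. x < l} + card {x\<in>P \<inter> Q. x < l}"
  proof -
    have "{x\<in>P. x < l} \<union> {x\<in>Q. x < l} = {x\<in>P \<union> Q. x < l}" "{x\<in>P. x < l} \<inter> {x\<in>Q. x < l} = {x\<in>P \<inter> Q. x < l}"
      by auto
    then show ?thesis using card_Un_Int[OF F(2)[of l] G(2)[of l]] by simp
  qed
  show "card {x\<in>R. x < l} \<le> card {x\<in>P. x < l} + card {x\<in>Q. x < l}"
    "card {x\<in>P. x < l} + card {x\<in>Q. x < l} \<le> Suc (card {x\<in>R. x < l})"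
    unfolding c1 c2 using I(2,3)[of l] g by auto
  assume "\<not> (l \<notin> P \<and> F l \<le> - (g / 2))" "\<not> (l \<notin> Q \<and> G l \<le> - (g / 2))"
  then have "l \<in> P \<union> Q \<or> 0 < g + (F l + G l)" by auto
  then show "card {x\<in>R. x < l} = card {x\<in>P. x < l} + card {x\<in>Q. x < l}"
    unfolding c1 c2 using I(4)[of l] g by auto
qed

section \<open>Singularity and the renewal equation\<close>

text \<open>The cells are closed, so a common endpoint belongs to two of them.\<close>

lemma grid_cells_containing_le_2:
  fixes w z :: real
  assumes w: "w > 0"
  shows "card {i::nat. i < N \<and> z \<in> {real i * w..real (Suc i) * w}} \<le> 2"
proof -
  have "{i::nat. i < N \<and> z \<in> {real i * w..real (Suc i) * w}} \<subseteq> {nat \<lfloor>z / w\<rfloor>, nat (\<lfloor>z / w\<rfloor> - 1)}"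
  proof
    fix i assume "i \<in> {i::nat. i < N \<and> z \<in> {real i * w..real (Suc i) * w}}"
    then have "real i * w \<le> z" "z \<le> (real i + 1) * w" by (auto simp: algebra_simps)
    then have "real i \<le> z / w" "z / w \<le> real i + 1" using w by (simp_all add: pos_le_divide_eq pos_divide_le_eq)
    then have "int i \<le> \<lfloor>z / w\<rfloor>" "\<lfloor>z / w\<rfloor> \<le> int i + 1" by linarith+
    then show "i \<in> {nat \<lfloor>z / w\<rfloor>, nat (\<lfloor>z / w\<rfloor> - 1)}" by auto
  qed
  then have "card {i::nat. i < N \<and> z \<in> {real i * w..real (Suc i) * w}} \<le> card {nat \<lfloor>z / w\<rfloor>, nat (\<lfloor>z / w\<rfloor> - 1)}"
    by (intro card_mono) auto
  also have "\<dots> \<le> 2" by (simp add: card_insert_if)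
  finally show ?thesis .
qed

text \<open>Whichever side of the midpoint of \<open>\<sigma> (p + d)\<close> and
  \<open>\<sigma> (q - d)\<close> the constant lies on, monotonicity keeps \<sigma> at least half
  the increment away from it on the entire strip of length \<open>d\<close> at the opposite
  end.\<close>

lemma monotone_far_from_constant:
  fixes \<sigma> :: "real \<Rightarrow> real"
  assumes mono: "mono_on {p..q} \<sigma>" and d: "0 < d" "2 * d < q - p"
  obtains A where "A \<in> sets borel" "A \<subseteq> {p<..<q}" "emeasure lborel A = ennreal d"
    "\<And>t. t \<in> A \<Longrightarrow> \<bar>\<sigma> t - c\<bar> \<ge> (\<sigma> (q - d) - \<sigma> (p + d)) / 2"
proof (cases "\<sigma> (q - d) - c \<ge> (\<sigma> (q - d) - \<sigma> (p + d)) / 2")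
  case True
  show ?thesis
  proof (rule that[of "{q - d<..<q}"])
    fix t assume "t \<in> {q - d<..<q}"
    then have "\<sigma> (q - d) \<le> \<sigma> t" using d by (intro mono_onD[OF mono]) auto
    then show "\<bar>\<sigma> t - c\<bar> \<ge> (\<sigma> (q - d) - \<sigma> (p + d)) / 2" using True by linarith
  qed (use d in auto)
next
  case False
  show ?thesis
  proof (rule that[of "{p<..<p + d}"])
    fix t assume "t \<in> {p<..<p + d}"
    then have "\<sigma> t \<le> \<sigma> (p + d)" using d by (intro mono_onD[OF mono]) auto
    then show "\<bar>\<sigma> t - c\<bar> \<ge> (\<sigma> (q - d) - \<sigma> (p + d)) / 2"
      using False abs_ge_minus_self[of "\<sigma> t - c"] by argo
  qed (use d in auto)
qed

text \<open>On a grid much finer than the number of jumps of the step function, most cells see a constant \<open>g\<close>;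
  a monotone function close to a constant in mean can only grow near the ends of such a cell.\<close>

lemma step_approximation_concentrates_growth:
  fixes \<sigma> g :: "real \<Rightarrow> real" and Z :: "real set"
  assumes T: "T > 0" and mono: "mono_on {0..T} \<sigma>" and \<eta>: "0 < \<eta>" "\<eta> < 1/2"
    and Z: "finite Z" "\<And>u v. 0 < u \<Longrightarrow> u < v \<Longrightarrow> v < T \<Longrightarrow> {u..v} \<inter> Z = {} \<Longrightarrow> g u = g v"
    and approx: "(\<integral>\<^sup>+t. ennreal \<bar>\<sigma> t - g t\<bar> * indicator {0<..<T} t \<partial>lborel)
      \<le> ennreal (\<eta> ^ 3 * T / 4 / (real (card Z) + 1))"
  obtains G :: "nat set" and N :: nat and w :: real where "finite G" "w > 0" "real N * w = T" "G \<subseteq> {..<N}"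
    "emeasure lborel ({0<..T} - (\<Union>i\<in>G. {real i * w + \<eta> * w<..real (Suc i) * w - \<eta> * w})) \<le> ennreal (4 * \<eta> * T)"
    "(\<Sum>i\<in>G. \<sigma> (real (Suc i) * w - \<eta> * w) - \<sigma> (real i * w + \<eta> * w)) \<le> \<eta>"
proof -
  define K where "K = real (card Z) + 1"
  have K: "K \<ge> 1" by (simp add: K_def)
  \<comment> \<open>With about \<open>K / \<eta>\<close> cells, the at most
    \<open>2 * card Z\<close> cells meeting \<open>Z\<close> have total length at most
    \<open>2 * \<eta> * T\<close>, and the trimmed ends of all cells take another
    \<open>2 * \<eta> * T\<close>. This is the bound \<open>4 * \<eta> * T\<close>.\<close>
  define N where "N = nat \<lceil>K / \<eta>\<rceil>"
  have N: "K / \<eta> \<le> real N" "real N \<le> K / \<eta> + 1" unfolding N_def using K \<eta> by (auto simp: of_nat_nat)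
  have N0: "real N > 0" using N(1) K \<eta> by (meson divide_pos_pos less_le_trans zero_less_one)
  define w where "w = T / real N"
  have w: "w > 0" "real N * w = T" using N0 T by (auto simp: w_def)
  let ?c = "\<lambda>i. {real i * w..real (Suc i) * w}"
  define B where "B = {i. i < N \<and> ?c i \<inter> Z \<noteq> {}}"
  define G where "G = {..<N} - B"
  have finB: "finite B" and finG: "finite G" by (auto simp: B_def G_def)
  have "B = (\<Union>z\<in>Z. {i::nat. i < N \<and> z \<in> ?c i})" by (auto simp: B_def)
  then have "card B \<le> (\<Sum>z\<in>Z. card {i::nat. i < N \<and> z \<in> ?c i})"
    using card_UN_le[OF Z(1)] by simp
  also have "\<dots> \<le> (\<Sum>z\<in>Z. 2)" by (intro sum_mono grid_cells_containing_le_2 w)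
  finally have "card B \<le> 2 * card Z" by simp
  then have "real (card B) \<le> real (2 * card Z)" by (simp only: of_nat_le_iff)
  then have cardB: "real (card B) \<le> 2 * K" unfolding K_def by simp
  let ?l = "\<lambda>i::nat. real i * w + \<eta> * w" and ?r = "\<lambda>i::nat. real (Suc i) * w - \<eta> * w"
  let ?U = "\<Union>i\<in>G. {?l i<..?r i}"
  have cell: "0 \<le> real i * w" "real (Suc i) * w \<le> T" if "i < N" for i
  proof -
    have "real (Suc i) * w \<le> real N * w" using that w by (intro mult_right_mono) auto
    then show "real (Suc i) * w \<le> T" using w by simp
  qed (use w in simp)
  have \<eta>w: "0 < \<eta> * w" "2 * (\<eta> * w) < w" using \<eta> w by auto
  show ?thesis
  proof (rule that[of G w N])
    show "emeasure lborel ({0<..T} - ?U) \<le> ennreal (4 * \<eta> * T)"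
    proof -
      let ?V = "(\<Union>i\<in>B. {real i * w<..real (Suc i) * w}) \<union>
        (\<Union>i\<in>{..<N}. {real i * w<..?l i} \<union> {?r i<..real (Suc i) * w})"
      have "{0<..T} - ?U \<subseteq> ?V"
      proof
        fix t assume t: "t \<in> {0<..T} - ?U"
        \<comment> \<open>The cells of this covering are open on the left, hence the ceiling minus
          one rather than the floor.\<close>
        define i where "i = nat (\<lceil>t / w\<rceil> - 1)"
        have tw: "t / w > 0" using t w by simp
        then have "real i = \<lceil>t / w\<rceil> - 1" unfolding i_def by (simp add: of_nat_nat)
        then have "real i < t / w" "t / w \<le> real i + 1" by linarith+
        then have i: "real i * w < t" "t \<le> real (Suc i) * w"
          using w by (simp_all add: pos_less_divide_eq pos_divide_le_eq algebra_simps)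
        have "real i * w < real N * w" unfolding w(2) using i t by simp
        then have iN: "i < N" using w(1) mult_less_cancel_right_pos[of w] by simp
        show "t \<in> ?V"
        proof (cases "i \<in> B")
          case True
          then show ?thesis using i by auto
        next
          case False
          then have "i \<in> G" using iN by (simp add: G_def)
          then have "\<not> (?l i < t \<and> t \<le> ?r i)" using t by auto
          then show ?thesis using i iN by (auto simp: not_less)
        qed
      qed
      then have "emeasure lborel ({0<..T} - ?U) \<le> emeasure lborel ?V"
        by (rule emeasure_mono) (auto intro!: sets.Un sets.finite_UN finB)
      also have "\<dots> \<le> emeasure lborel (\<Union>i\<in>B. {real i * w<..real (Suc i) * w}) +
         emeasure lborel (\<Union>i\<in>{..<N}. {real i * w<..?l i} \<union> {?r i<..real (Suc i) * w})"
        by (rule emeasure_subadditive) (auto intro!: sets.Un sets.finite_UN finB)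
      also have "\<dots> \<le> (\<Sum>i\<in>B. emeasure lborel {real i * w<..real (Suc i) * w}) +
         (\<Sum>i\<in>{..<N}. emeasure lborel ({real i * w<..?l i} \<union> {?r i<..real (Suc i) * w}))"
        by (intro add_mono emeasure_subadditive_finite) (auto intro: finB)
      also have "\<dots> \<le> (\<Sum>i\<in>B. ennreal w) + (\<Sum>i\<in>{..<N}. ennreal (2 * (\<eta> * w)))"
      proof (intro add_mono sum_mono)
        fix i :: nat
        show "emeasure lborel {real i * w<..real (Suc i) * w} \<le> ennreal w"
          using w by (simp add: algebra_simps)
        have "emeasure lborel ({real i * w<..?l i} \<union> {?r i<..real (Suc i) * w})
          \<le> emeasure lborel {real i * w<..?l i} + emeasure lborel {?r i<..real (Suc i) * w}"
          by (rule emeasure_subadditive) auto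
        also have "\<dots> = ennreal (\<eta> * w) + ennreal (\<eta> * w)" using \<eta>w by (simp add: algebra_simps)
        also have "\<dots> = ennreal (2 * (\<eta> * w))" using \<eta>w by (subst ennreal_plus[symmetric]) auto
        finally show "emeasure lborel ({real i * w<..?l i} \<union> {?r i<..real (Suc i) * w}) \<le> ennreal (2 * (\<eta> * w))" .
      qed
      also have "\<dots> = ennreal (real (card B) * w + real N * (2 * (\<eta> * w)))"
        using \<eta>w w by (simp add: ennreal_of_nat_eq_real_of_nat ennreal_mult[symmetric] ennreal_plus[symmetric] del: ennreal_plus)
      also have "\<dots> \<le> ennreal (4 * \<eta> * T)"
      proof (rule ennreal_leI)
        have "real (card B) * w \<le> 2 * K * w" using cardB w by (intro mult_right_mono) auto
        also have "\<dots> \<le> 2 * (\<eta> * real N) * w" using N(1) \<eta> w by (intro mult_right_mono mult_left_mono) (auto simp: pos_divide_le_eq mult.commute)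
        finally show "real (card B) * w + real N * (2 * (\<eta> * w)) \<le> 4 * \<eta> * T"
          unfolding w(2)[symmetric] by (simp add: algebra_simps)
      qed
      finally show ?thesis .
    qed
    show "(\<Sum>i\<in>G. \<sigma> (?r i) - \<sigma> (?l i)) \<le> \<eta>"
    proof -
      have "\<exists>A. A \<in> sets borel \<and> A \<subseteq> {real i * w<..<real (Suc i) * w} \<and> emeasure lborel A = ennreal (\<eta> * w) \<and>
          (\<forall>t\<in>A. \<bar>\<sigma> t - g t\<bar> \<ge> (\<sigma> (?r i) - \<sigma> (?l i)) / 2)" if i: "i \<in> G" for i
      proof -
        have iN: "i < N" using i by (simp add: G_def)
        have noZ: "?c i \<inter> Z = {}" using i by (auto simp: G_def B_def)
        \<comment> \<open>Comparison with the midpoint keeps both arguments strictly between 0 and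
          \<open>T\<close>, where the constancy hypothesis on \<open>g\<close> applies.\<close>
        define mid where "mid = real i * w + w / 2"
        have gc: "g t = g mid" if t: "t \<in> {real i * w<..<real (Suc i) * w}" for t
        proof -
          have m: "mid \<in> {real i * w<..<real (Suc i) * w}" using w by (auto simp: mid_def algebra_simps)
          show ?thesis
          proof (cases t mid rule: linorder_cases)
            case less
            have "{t..mid} \<subseteq> ?c i" using t m by auto
            then have "{t..mid} \<inter> Z = {}" using noZ by blast
            moreover have "0 < t" "mid < T" using t m cell[OF iN] by auto
            ultimately show ?thesis using less by (intro Z(2))
          next
            case greater
            have "{mid..t} \<subseteq> ?c i" using t m by auto
            then have "{mid..t} \<inter> Z = {}" using noZ by blast
            moreover have "0 < mid" "t < T" using t m cell[OF iN] by auto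
            ultimately show ?thesis using greater by (intro Z(2)[symmetric])
          qed simp
        qed
        obtain A where A: "A \<in> sets borel" "A \<subseteq> {real i * w<..<real (Suc i) * w}" "emeasure lborel A = ennreal (\<eta> * w)"
          "\<And>t. t \<in> A \<Longrightarrow> \<bar>\<sigma> t - g mid\<bar> \<ge> (\<sigma> (?r i) - \<sigma> (?l i)) / 2"
        proof (rule monotone_far_from_constant[of "real i * w" "real (Suc i) * w" \<sigma> "\<eta> * w" "g mid"])
          show "mono_on {real i * w..real (Suc i) * w} \<sigma>"
            by (rule mono_on_subset[OF mono]) (use cell[OF iN] in auto)
          show "2 * (\<eta> * w) < real (Suc i) * w - real i * w" using \<eta>w by (simp add: algebra_simps)
        qed (use \<eta>w in auto)
        then show ?thesis using gc by (intro exI[of _ A]) (auto simp: subset_iff)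
      qed
      then obtain A where A: "\<And>i. i \<in> G \<Longrightarrow> A i \<in> sets borel" "\<And>i. i \<in> G \<Longrightarrow> A i \<subseteq> {real i * w<..<real (Suc i) * w}"
        "\<And>i. i \<in> G \<Longrightarrow> emeasure lborel (A i) = ennreal (\<eta> * w)"
        "\<And>i t. i \<in> G \<Longrightarrow> t \<in> A i \<Longrightarrow> \<bar>\<sigma> t - g t\<bar> \<ge> (\<sigma> (?r i) - \<sigma> (?l i)) / 2"
        by metis
      define \<delta> where "\<delta> i = (\<sigma> (?r i) - \<sigma> (?l i)) / 2" for i
      have \<delta>: "\<delta> i \<ge> 0" if "i \<in> G" for i
      proof -
        have iN: "i < N" using that by (simp add: G_def)
        have "\<sigma> (?l i) \<le> \<sigma> (?r i)"
        proof (rule mono_onD[OF mono])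
          have "w * \<eta> * 2 < w" using \<eta>w by (simp add: mult_ac)
          then show "?l i \<le> ?r i" by (simp add: algebra_simps)
          then show "?l i \<in> {0..T}" "?r i \<in> {0..T}" using cell[OF iN] \<eta>w unfolding atLeastAtMost_iff by linarith+
        qed
        then show ?thesis by (simp add: \<delta>_def)
      qed
      have disj: "i = j" if "i \<in> G" "j \<in> G" "t \<in> A i" "t \<in> A j" for i j t
      proof -
        have "real i * w < real (Suc j) * w" "real j * w < real (Suc i) * w"
          using A(2)[OF that(1)] A(2)[OF that(2)] that(3,4) by (auto simp: subset_iff intro: less_trans)
        then show ?thesis using w by simp
      qed
      have "ennreal ((\<Sum>i\<in>G. \<delta> i) * (\<eta> * w)) = (\<Sum>i\<in>G. ennreal (\<delta> i) * ennreal (\<eta> * w))"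
        using \<delta> \<eta>w by (simp add: sum_distrib_right ennreal_mult[symmetric] sum_ennreal)
      also have "\<dots> = (\<integral>\<^sup>+t. (\<Sum>i\<in>G. ennreal (\<delta> i) * indicator (A i) t) \<partial>lborel)"
        using A(1,3) by (subst nn_integral_sum) (auto simp: nn_integral_cmult_indicator intro!: sum.cong)
      also have "\<dots> \<le> (\<integral>\<^sup>+t. ennreal \<bar>\<sigma> t - g t\<bar> * indicator {0<..<T} t \<partial>lborel)"
      proof (rule nn_integral_mono)
        fix t
        show "(\<Sum>i\<in>G. ennreal (\<delta> i) * indicator (A i) t) \<le> ennreal \<bar>\<sigma> t - g t\<bar> * indicator {0<..<T} t"
        proof (cases "\<exists>i\<in>G. t \<in> A i")
          case True
          then obtain i where i: "i \<in> G" "t \<in> A i" by blast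
          have "(\<Sum>j\<in>G. ennreal (\<delta> j) * indicator (A j) t) = (\<Sum>j\<in>{i}. ennreal (\<delta> j) * indicator (A j) t)"
            by (rule sum.mono_neutral_right) (use finG i disj in \<open>auto simp: indicator_def\<close>)
          also have "\<dots> = ennreal (\<delta> i)" using i by simp
          also have "\<dots> \<le> ennreal \<bar>\<sigma> t - g t\<bar>" using A(4)[OF i] by (intro ennreal_leI) (simp add: \<delta>_def)
          also have "t \<in> {0<..<T}" using A(2)[OF i(1)] i cell[of i] by (force simp: G_def)
          ultimately show ?thesis by simp
        next
          case False
          then have "(\<Sum>i\<in>G. ennreal (\<delta> i) * indicator (A i) t) = 0" by (intro sum.neutral) auto
          then show ?thesis by simp
        qed
      qed
      also note approx
      \<comment> \<open>Dividing by \<open>\<eta> * w\<close> leaves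
        \<open>\<eta>\<^sup>2 * N / (4 * K)\<close>, which is at most \<open>\<eta> / 2\<close>
        because \<open>N\<close> is at most \<open>2 * K / \<eta>\<close>. The increments are twice
        the \<open>\<delta> i\<close>. The cube of \<eta> in the hypothesis is made for this
        computation.\<close>
      finally have "(\<Sum>i\<in>G. \<delta> i) * (\<eta> * w) \<le> \<eta> ^ 3 * T / 4 / K"
        unfolding K_def using T \<eta> by (subst (asm) ennreal_le_iff) auto
      then have "(\<Sum>i\<in>G. \<delta> i) \<le> \<eta> ^ 3 * T / 4 / K / (\<eta> * w)" by (simp only: pos_le_divide_eq[OF \<eta>w(1)])
      also have "\<dots> = \<eta>\<^sup>2 / 4 / K * real N" using \<eta> T N0 by (simp add: w_def power2_eq_square power3_eq_cube)
      also have "\<dots> \<le> \<eta>\<^sup>2 / 4 / K * (2 * K / \<eta>)"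
      proof (rule mult_left_mono)
        have "1 \<le> K / \<eta>" using K \<eta> by (simp add: pos_le_divide_eq)
        then show "real N \<le> 2 * K / \<eta>" using N(2) by simp
      qed (use K in simp)
      also have "\<dots> = \<eta> / 2" using K \<eta> by (simp add: power2_eq_square)
      finally show ?thesis unfolding \<delta>_def by (simp add: sum_divide_distrib[symmetric])
    qed
  qed (use w finG in \<open>auto simp: G_def\<close>)
qed

text \<open>There are sets \<open>U n\<close> missing at most \<open>4 * \<eta> n * T\<close> of
  Lebesgue measure but carrying \<nu>-mass at most \<open>\<eta> n\<close>. By the Borel-Cantelli
  lemma the upper limit of their complements is Lebesgue null; what remains of the interval lies in
  the lower limit of the \<open>U n\<close> and is \<nu>-null.\<close>

lemma purely_singular_of_step_approximation:
  fixes \<sigma> :: "real \<Rightarrow> real"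
  assumes T: "T > 0" and mono: "mono_on {0..T} \<sigma>" and cont: "continuous_on {0..T} \<sigma>"
    and approx: "\<And>\<epsilon>. \<epsilon> > 0 \<Longrightarrow> \<exists>Z g. finite Z \<and>
      (\<forall>u v. 0 < u \<longrightarrow> u < v \<longrightarrow> v < T \<longrightarrow> {u..v} \<inter> Z = {} \<longrightarrow> g u = g v) \<and>
      (\<integral>\<^sup>+t. ennreal \<bar>\<sigma> t - g t\<bar> * indicator {0<..<T} t \<partial>lborel) \<le> ennreal (\<epsilon> / (real (card Z) + 1))"
  shows "purely_singular_nondecreasing T \<sigma>"
proof -
  \<comment> \<open>Continued by constants, so that \<open>interval_measure\<close> applies and puts
    no mass outside \<open>{0<..T}\<close>.\<close>
  define F where "F x = \<sigma> (max 0 (min T x))" for x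
  have F_mono: "F x \<le> F y" if "x \<le> y" for x y
    unfolding F_def using that T by (intro mono_onD[OF mono]) auto
  have F_cont: "continuous (at_right x) F" for x
  proof -
    have "continuous_on UNIV (\<lambda>x. \<sigma> (max 0 (min T x)))"
      by (rule continuous_on_compose2[OF cont]) (use T in \<open>auto intro!: continuous_intros\<close>)
    then show ?thesis unfolding F_def[abs_def] by (meson UNIV_I continuous_on_eq_continuous_at open_UNIV continuous_at_imp_continuous_at_within)
  qed
  define \<nu> where "\<nu> = interval_measure F"
  have sets_nu[measurable_cong, simp]: "sets \<nu> = sets borel" by (simp add: \<nu>_def)
  have nu_Ioc: "emeasure \<nu> {x<..y} = ennreal (F y - F x)" if "x \<le> y" for x y
    unfolding \<nu>_def using that by (rule emeasure_interval_measure_Ioc) (auto intro: F_mono F_cont)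
  have F_eq: "F x = \<sigma> x" if "0 \<le> x" "x \<le> T" for x using that by (simp add: F_def)
  have out1: "emeasure \<nu> {- real n<..0} = 0" for n
    using nu_Ioc[of "- real n" 0] T by (simp add: F_def max_def)
  have out2: "emeasure \<nu> {T<..T + real n} = 0" for n
    using nu_Ioc[of T "T + real n"] T by (simp add: F_def max_def)
  have out: "UNIV - {0<..T} \<in> null_sets \<nu>"
  proof -
    have "UNIV - {0<..T} = (\<Union>n. {- real n<..0}) \<union> (\<Union>n. {T<..T + real n})"
    proof -
      have "\<exists>n. - real n < x" for x using reals_Archimedean2[of "- x"] by (auto intro: exI)  (metis minus_less_iff)
      moreover have "\<exists>n. x \<le> T + real n" for x using real_arch_simple[of "x - T"] by (auto simp: algebra_simps)
      ultimately show ?thesis by (auto simp: not_less not_le)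
    qed
    also have "\<dots> \<in> null_sets \<nu>"
      using out1 out2 by (intro null_sets.Un null_sets_UN) (auto simp: null_sets_def)
    finally show ?thesis .
  qed
  have fin: "finite_measure \<nu>"
  proof
    have "emeasure \<nu> (space \<nu>) = emeasure \<nu> ({0<..T} \<union> (UNIV - {0<..T}))"
      by (rule arg_cong[where f = "emeasure \<nu>"]) (auto simp: \<nu>_def)
    also have "\<dots> = emeasure \<nu> {0<..T}" by (rule emeasure_Un_null_set[OF _ out]) simp
    also have "\<dots> \<noteq> \<infinity>" using nu_Ioc[of 0 T] T by simp
    finally show "emeasure \<nu> (space \<nu>) \<noteq> \<infinity>" .
  qed
  interpret finite_measure \<nu> by (rule fin)
  define \<eta> where "\<eta> n = (1/2 :: real) ^ (n + 2)" for n :: nat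
  have \<eta>: "0 < \<eta> n" "\<eta> n < 1/2" for n
  proof -
    have "(1/2::real) ^ (n + 2) < (1/2) ^ 1" by (intro power_strict_decreasing) auto
    then show "\<eta> n < 1/2" by (simp add: \<eta>_def)
  qed (simp add: \<eta>_def)
  have "\<exists>U. U \<in> sets borel \<and> U \<subseteq> {0<..T} \<and> emeasure lborel ({0<..T} - U) \<le> ennreal (4 * \<eta> n * T) \<and> emeasure \<nu> U \<le> ennreal (\<eta> n)" for n
  proof -
    have "\<eta> n ^ 3 * T / 4 > 0" using \<eta>[of n] T by simp
    from approx[OF this] obtain Z g where Z: "finite Z"
      "\<And>u v. 0 < u \<Longrightarrow> u < v \<Longrightarrow> v < T \<Longrightarrow> {u..v} \<inter> Z = {} \<Longrightarrow> g u = g v"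
      "(\<integral>\<^sup>+t. ennreal \<bar>\<sigma> t - g t\<bar> * indicator {0<..<T} t \<partial>lborel) \<le> ennreal (\<eta> n ^ 3 * T / 4 / (real (card Z) + 1))"
      by blast
    obtain G N w where G: "finite G" "w > 0" "real N * w = T" "G \<subseteq> {..<N}"
      "emeasure lborel ({0<..T} - (\<Union>i\<in>G. {real i * w + \<eta> n * w<..real (Suc i) * w - \<eta> n * w})) \<le> ennreal (4 * \<eta> n * T)"
      "(\<Sum>i\<in>G. \<sigma> (real (Suc i) * w - \<eta> n * w) - \<sigma> (real i * w + \<eta> n * w)) \<le> \<eta> n"
      by (rule step_approximation_concentrates_growth[OF T mono \<eta>[of n] Z])
    let ?l = "\<lambda>i::nat. real i * w + \<eta> n * w" and ?r = "\<lambda>i::nat. real (Suc i) * w - \<eta> n * w"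
    have lr: "0 \<le> ?l i" "?l i \<le> ?r i" "?r i \<le> T" if "i \<in> G" for i
    proof -
      have "\<eta> n * w * 2 \<le> w" using \<eta>[of n] G(2) by simp
      then show "?l i \<le> ?r i" by (simp add: algebra_simps)
      have "real (Suc i) * w \<le> real N * w" using that G by (intro mult_right_mono) auto
      then show "?r i \<le> T" using G(3) \<eta>[of n] G(2) by (smt (verit) mult_nonneg_nonneg)
      show "0 \<le> ?l i" using G(2) \<eta>[of n] by simp
    qed
    have "emeasure \<nu> (\<Union>i\<in>G. {?l i<..?r i}) \<le> (\<Sum>i\<in>G. emeasure \<nu> {?l i<..?r i})"
      by (rule emeasure_subadditive_finite) (use G in auto)
    also have "\<dots> = (\<Sum>i\<in>G. ennreal (\<sigma> (?r i) - \<sigma> (?l i)))"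
    proof (rule sum.cong)
      fix i assume i: "i \<in> G"
      have "0 \<le> ?r i" "?l i \<le> T" using lr[OF i] by linarith+
      then show "emeasure \<nu> {?l i<..?r i} = ennreal (\<sigma> (?r i) - \<sigma> (?l i))"
        using nu_Ioc[OF lr(2)[OF i]] lr[OF i] by (simp only: F_eq)
    qed simp
    also have "\<dots> = ennreal (\<Sum>i\<in>G. \<sigma> (?r i) - \<sigma> (?l i))"
    proof (rule sum_ennreal)
      fix i assume i: "i \<in> G"
      have "?l i \<in> {0..T}" "?r i \<in> {0..T}" using lr[OF i] unfolding atLeastAtMost_iff by linarith+
      from mono_onD[OF mono this lr(2)[OF i]] show "0 \<le> \<sigma> (?r i) - \<sigma> (?l i)" by simp
    qed
    also have "\<dots> \<le> ennreal (\<eta> n)" by (rule ennreal_leI[OF G(6)])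
    finally have "emeasure \<nu> (\<Union>i\<in>G. {?l i<..?r i}) \<le> ennreal (\<eta> n)" .
    moreover have "(\<Union>i\<in>G. {?l i<..?r i}) \<subseteq> {0<..T}" using lr by fastforce
    ultimately show ?thesis using G by (intro exI[of _ "\<Union>i\<in>G. {?l i<..?r i}"]) auto
  qed
  then obtain U where U: "\<And>n. U n \<in> sets borel" "\<And>n. U n \<subseteq> {0<..T}"
    "\<And>n. emeasure lborel ({0<..T} - U n) \<le> ennreal (4 * \<eta> n * T)" "\<And>n. emeasure \<nu> (U n) \<le> ennreal (\<eta> n)"
    by metis
  define E where "E = limsup (\<lambda>n. {0<..T} - U n)"
  have E_null: "E \<in> null_sets lborel"
    unfolding E_def
  proof (rule borel_cantelli_limsup1)
    show "{0<..T} - U n \<in> sets lborel" for n using U(1)[of n] by simp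
    show "emeasure lborel ({0<..T} - U n) < \<infinity>" for n
      using U(3)[of n] by (rule le_less_trans) simp
    show "summable (\<lambda>n. measure lborel ({0<..T} - U n))"
    proof (rule summable_comparison_test')
      show "norm (measure lborel ({0<..T} - U n)) \<le> 4 * \<eta> n * T" if "n \<ge> 0" for n
        using U(3)[of n] \<eta>[of n] T by (simp add: measure_def enn2real_leI)
      show "summable (\<lambda>n. 4 * \<eta> n * T)"
        unfolding \<eta>_def power_add by (intro summable_mult summable_mult2 summable_geometric) simp
    qed
  qed
  have E_nu: "UNIV - E \<in> null_sets \<nu>"
  proof (rule null_sets_subset)
    show "(UNIV - {0<..T}) \<union> (\<Union>n. \<Inter>k\<in>{n..}. U k) \<in> null_sets \<nu>"
    proof (rule null_sets.Un[OF out], rule null_sets_UN)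
      fix n
      have m: "(\<Inter>k\<in>{n..}. U k) \<in> sets \<nu>" using U(1) by (intro sets.countable_INT'') auto
      have "emeasure \<nu> (\<Inter>k\<in>{n..}. U k) \<le> ennreal (\<eta> k)" if "k \<ge> n" for k
      proof -
        have "emeasure \<nu> (\<Inter>k\<in>{n..}. U k) \<le> emeasure \<nu> (U k)"
          by (rule emeasure_mono) (use that U(1) in auto)
        then show ?thesis using U(4)[of k] by (rule order_trans)
      qed
      then have "\<forall>\<^sub>F k in sequentially. emeasure \<nu> (\<Inter>k\<in>{n..}. U k) \<le> ennreal (\<eta> k)"
        by (auto simp: eventually_sequentially)
      moreover have "(\<lambda>k. ennreal (\<eta> k)) \<longlonglongrightarrow> ennreal 0"
      proof (rule tendsto_ennrealI)
        have "(\<lambda>n. (1/2::real) ^ n * (1/2)\<^sup>2) \<longlonglongrightarrow> 0 * (1/2)\<^sup>2" by (intro tendsto_intros) simp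
        then show "\<eta> \<longlonglongrightarrow> 0" unfolding \<eta>_def[abs_def] power_add by simp
      qed
      ultimately have "emeasure \<nu> (\<Inter>k\<in>{n..}. U k) \<le> ennreal 0"
        by (intro tendsto_lowerbound[where F = sequentially]) auto
      then show "(\<Inter>k\<in>{n..}. U k) \<in> null_sets \<nu>" using m by (auto simp: null_sets_def)
    qed
    show "UNIV - E \<in> sets \<nu>" using E_null by (auto dest: null_setsD2)
    show "UNIV - E \<subseteq> (UNIV - {0<..T}) \<union> (\<Union>n. \<Inter>k\<in>{n..}. U k)"
      unfolding E_def by (auto simp: limsup_INF_SUP)
  qed
  show ?thesis
    unfolding purely_singular_nondecreasing_def mutually_singular_def
  proof (intro conjI exI[of _ \<nu>] exI[of _ E] allI impI)
    show "space \<nu> - E \<in> null_sets \<nu>" using E_nu by (simp add: \<nu>_def)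
    fix u v assume uv: "0 \<le> u \<and> u \<le> v \<and> v \<le> T"
    then have "\<sigma> u \<le> \<sigma> v" by (intro mono_onD[OF mono]) auto
    then show "\<sigma> v - \<sigma> u = measure \<nu> {u<..v}"
      using nu_Ioc[of u v] uv by (simp add: measure_def F_eq)
  qed (use mono fin E_null in auto)
qed

text \<open>Solving the renewal equation without defect from the values before time \<open>n0 * T\<close> produces step functions whose
  jumps, modulo \<open>T\<close>, all come from the \<open>O(p ^ n0)\<close> jumps before \<open>n0 * T\<close>, while the error made is \<open>o(p ^ (n - n0))\<close>.\<close>

lemma renewal_step_approximation:
  fixes f \<sigma> :: "real \<Rightarrow> real" and k :: "nat \<Rightarrow> nat" and p T C :: real and \<Lambda> :: "real set"
  assumes T: "T > 0" and p: "p > 1" and C: "C \<ge> 0" and m: "m \<ge> 2"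
    and k: "\<And>i. i \<in> {1..m} \<Longrightarrow> k i \<ge> 1" and weights: "(\<Sum>i=1..m. (1 / p) ^ k i) = 1"
    and f: "mono f"
    and const: "\<And>u v. u < v \<Longrightarrow> {u..v} \<inter> \<Lambda> = {} \<Longrightarrow> f u = f v"
    and jumps: "\<And>n. finite {l\<in>\<Lambda>. l < real n * T}" "\<And>n. real (card {l\<in>\<Lambda>. l < real n * T}) \<le> C * p ^ n"
    and defect: "\<And>\<epsilon>. \<epsilon> > 0 \<Longrightarrow> \<forall>\<^sub>F n in sequentially.
      (\<integral>\<^sup>+t. ennreal \<bar>f (real n * T + t) - (\<Sum>i=1..m. f (real n * T + t - real (k i) * T))\<bar>
        * indicator {0<..<T} t \<partial>lborel) \<le> ennreal \<epsilon>"
    and conv: "\<And>\<delta>. \<delta> > 0 \<Longrightarrow> \<forall>\<^sub>F n in sequentially. \<forall>t\<in>{0..T}. \<bar>\<sigma> t - f (real n * T + t) / p ^ n\<bar> \<le> \<delta>"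
    and \<epsilon>: "\<epsilon> > 0"
  shows "\<exists>Z g. finite Z \<and>
      (\<forall>u v. 0 < u \<longrightarrow> u < v \<longrightarrow> v < T \<longrightarrow> {u..v} \<inter> Z = {} \<longrightarrow> g u = g v) \<and>
      (\<integral>\<^sup>+t. ennreal \<bar>\<sigma> t - g t\<bar> * indicator {0<..<T} t \<partial>lborel) \<le> ennreal (\<epsilon> / (real (card Z) + 1))"
proof -
  define kmax where "kmax = (\<Sum>i=1..m. k i)"
  have kmax: "k i \<le> kmax" if "i \<in> {1..m}" for i
    unfolding kmax_def using that by (intro member_le_sum) auto
  have f_meas[measurable]: "f \<in> borel_measurable borel" by (rule borel_measurable_mono[OF f])
  \<comment> \<open>Chosen backwards: after division by \<open>p ^ n\<close> the accumulated error
    is at most \<open>\<epsilon>1 * p ^ kmax / p ^ n0\<close>, to be half of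
    \<open>\<epsilon> / ((C + 1) * p ^ n0)\<close>. The power \<open>p ^ n0\<close> cancels, so
    \<open>\<epsilon>1\<close> can be fixed before \<open>n0\<close>.\<close>
  define \<epsilon>1 where "\<epsilon>1 = \<epsilon> / (2 * (C + 1) * p ^ kmax)"
  have \<epsilon>1: "\<epsilon>1 > 0" unfolding \<epsilon>1_def using \<epsilon> C p by simp
  obtain n1 where n1: "\<And>n. n \<ge> n1 \<Longrightarrow>
      (\<integral>\<^sup>+t. ennreal \<bar>f (real n * T + t) - (\<Sum>i=1..m. f (real n * T + t - real (k i) * T))\<bar>
        * indicator {0<..<T} t \<partial>lborel) \<le> ennreal \<epsilon>1"
    using defect[OF \<epsilon>1] unfolding eventually_sequentially by blast
  \<comment> \<open>The recursion from \<open>n0\<close> on looks back by at most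
    \<open>kmax\<close> windows, and these must have nonnegative index.\<close>
  define n0 where "n0 = n1 + kmax"
  \<comment> \<open>All approximations are sums of translates of \<open>f\<close> taken from windows
    before \<open>n0\<close>, so the positions of these jumps modulo \<open>T\<close> suffice for
    every \<open>n\<close>.\<close>
  define Z where "Z = (\<lambda>l. l - of_int \<lfloor>l / T\<rfloor> * T) ` {l\<in>\<Lambda>. l < real n0 * T}"
  have finZ: "finite Z" unfolding Z_def using jumps(1) by simp
  have "card Z \<le> card {l\<in>\<Lambda>. l < real n0 * T}" unfolding Z_def by (rule card_image_le[OF jumps(1)])
  then have "real (card Z) \<le> real (card {l\<in>\<Lambda>. l < real n0 * T})" by (simp only: of_nat_le_iff)
  also have "\<dots> \<le> C * p ^ n0" by (rule jumps(2))
  finally have "real (card Z) \<le> C * p ^ n0" .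
  have cardZ: "real (card Z) + 1 \<le> (C + 1) * p ^ n0"
  proof -
    have "1 \<le> p ^ n0" using p by (intro one_le_power) simp
    with \<open>real (card Z) \<le> C * p ^ n0\<close> show ?thesis by (simp add: distrib_right)
  qed
  \<comment> \<open>The factor for which \<open>A * p ^ n - \<epsilon>1\<close> is zero at the first
    base window, \<open>n = n0 - kmax\<close>.\<close>
  define A where "A = \<epsilon>1 * p ^ kmax / p ^ n0"
  have A: "A \<ge> 0" unfolding A_def using \<epsilon>1 p by simp
  have Apos: "A * p ^ n - \<epsilon>1 \<ge> 0" if "n0 \<le> n + kmax" for n
  proof -
    have "p ^ n0 \<le> p ^ (n + kmax)" using that p by (intro power_increasing) auto
    then have "1 \<le> p ^ kmax / p ^ n0 * p ^ n" using p by (simp add: pos_le_divide_eq power_add mult.commute)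
    then have "\<epsilon>1 * 1 \<le> \<epsilon>1 * (p ^ kmax / p ^ n0 * p ^ n)" using \<epsilon>1 by (intro mult_left_mono) auto
    then show ?thesis by (simp add: A_def)
  qed
  \<comment> \<open>The term \<open>- \<epsilon>1\<close> makes the induction close: adding the
    \<open>m\<close> earlier bounds gives \<open>A * p ^ n - m * \<epsilon>1\<close>, and since
    \<open>m\<close> is at least 2 the fresh defect \<open>\<epsilon>1\<close> still fits. A plain
    bound \<open>A * p ^ n\<close> would not reproduce itself.\<close>
  have approx: "\<exists>g\<in>borel_measurable borel. (\<forall>u v. 0 < u \<longrightarrow> u < v \<longrightarrow> v < T \<longrightarrow> {u..v} \<inter> Z = {} \<longrightarrow> g u = g v) \<and>
      (\<integral>\<^sup>+t. ennreal \<bar>f (real n * T + t) - g t\<bar> * indicator {0<..<T} t \<partial>lborel) \<le> ennreal (A * p ^ n - \<epsilon>1)"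
    if "n0 \<le> n + kmax" for n
    using that
  proof (induction n rule: less_induct)
    case (less n)
    show ?case
    \<comment> \<open>Base windows take \<open>f\<close> itself; later ones take the sum of the
      earlier approximations.\<close>
    proof (cases "n < n0")
      case True
      show ?thesis
      proof (intro bexI[of _ "\<lambda>t. f (real n * T + t)"] conjI allI impI)
        fix u v assume uv: "0 < u" "u < v" "v < T" "{u..v} \<inter> Z = {}"
        show "f (real n * T + u) = f (real n * T + v)"
        proof (rule const)
          show "{real n * T + u..real n * T + v} \<inter> \<Lambda> = {}"
          proof (rule ccontr)
            assume "{real n * T + u..real n * T + v} \<inter> \<Lambda> \<noteq> {}"
            then obtain l where l: "l \<in> \<Lambda>" "real n * T + u \<le> l" "l \<le> real n * T + v" by auto
            have "real (Suc n) * T \<le> real n0 * T" using True T by (intro mult_right_mono) auto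
            then have "l < real n0 * T" using l uv by (simp add: algebra_simps)
            moreover have "\<lfloor>l / T\<rfloor> = int n"
              using l uv T by (intro floor_unique) (auto simp: pos_le_divide_eq pos_divide_less_eq algebra_simps)
            ultimately have "l - real n * T \<in> Z" unfolding Z_def using l(1) by (intro image_eqI[of _ _ l]) auto
            moreover have "l - real n * T \<in> {u..v}" using l by auto
            ultimately show False using uv(4) by blast
          qed
        qed (use uv in simp)
      next
        show "(\<integral>\<^sup>+t. ennreal \<bar>f (real n * T + t) - f (real n * T + t)\<bar> * indicator {0<..<T} t \<partial>lborel)
          \<le> ennreal (A * p ^ n - \<epsilon>1)" by simp
      qed simp
    next
      case False
      then have n: "n0 \<le> n" by simp
      have kn: "k i \<le> n" "n - k i < n" "n0 \<le> (n - k i) + kmax" if "i \<in> {1..m}" for i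
        using kmax[OF that] k[OF that] n n0_def by auto
      have "\<forall>i\<in>{1..m}. \<exists>g. g \<in> borel_measurable borel \<and> (\<forall>u v. 0 < u \<longrightarrow> u < v \<longrightarrow> v < T \<longrightarrow> {u..v} \<inter> Z = {} \<longrightarrow> g u = g v) \<and>
        (\<integral>\<^sup>+t. ennreal \<bar>f (real (n - k i) * T + t) - g t\<bar> * indicator {0<..<T} t \<partial>lborel) \<le> ennreal (A * p ^ (n - k i) - \<epsilon>1)"
        using less.IH[OF kn(2,3)] unfolding Bex_def by blast
      from bchoice[OF this] obtain g where g0: "\<forall>i\<in>{1..m}. g i \<in> borel_measurable borel \<and>
        (\<forall>u v. 0 < u \<longrightarrow> u < v \<longrightarrow> v < T \<longrightarrow> {u..v} \<inter> Z = {} \<longrightarrow> g i u = g i v) \<and>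
        (\<integral>\<^sup>+t. ennreal \<bar>f (real (n - k i) * T + t) - g i t\<bar> * indicator {0<..<T} t \<partial>lborel) \<le> ennreal (A * p ^ (n - k i) - \<epsilon>1)"
        by blast
      have g: "g i \<in> borel_measurable borel"
        "\<And>u v. 0 < u \<Longrightarrow> u < v \<Longrightarrow> v < T \<Longrightarrow> {u..v} \<inter> Z = {} \<Longrightarrow> g i u = g i v"
        "(\<integral>\<^sup>+t. ennreal \<bar>f (real (n - k i) * T + t) - g i t\<bar> * indicator {0<..<T} t \<partial>lborel)
          \<le> ennreal (A * p ^ (n - k i) - \<epsilon>1)" if "i \<in> {1..m}" for i
        using bspec[OF g0 that] by blast+
      have shift: "real n * T + t - real (k i) * T = real (n - k i) * T + t" if "i \<in> {1..m}" for i t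
        using kn(1)[OF that] by (simp add: of_nat_diff algebra_simps)
      let ?g = "\<lambda>t. \<Sum>i=1..m. g i t"
      let ?I = "indicator {0<..<T} :: real \<Rightarrow> ennreal"
      show ?thesis
      proof (intro bexI[of _ ?g] conjI allI impI)
        show "?g \<in> borel_measurable borel" using g(1) by (intro borel_measurable_sum) auto
        fix u v assume "0 < u" "u < v" "v < T" "{u..v} \<inter> Z = {}"
        then show "?g u = ?g v" using g(2) by (intro sum.cong) auto
      next
        let ?d = "\<lambda>t. ennreal \<bar>f (real n * T + t) - (\<Sum>i=1..m. f (real n * T + t - real (k i) * T))\<bar>"
        let ?e = "\<lambda>i t. ennreal \<bar>f (real (n - k i) * T + t) - g i t\<bar>"
        have pt: "ennreal \<bar>f (real n * T + t) - ?g t\<bar> * ?I t \<le> ?d t * ?I t + (\<Sum>i=1..m. ?e i t * ?I t)" for t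
        proof -
          have "f (real n * T + t) - ?g t = (f (real n * T + t) - (\<Sum>i=1..m. f (real n * T + t - real (k i) * T)))
              + (\<Sum>i=1..m. f (real (n - k i) * T + t) - g i t)"
          proof -
            have "(\<Sum>i=1..m. f (real n * T + t - real (k i) * T)) = (\<Sum>i=1..m. f (real (n - k i) * T + t))"
              by (rule sum.cong) (simp_all only: shift)
            then show ?thesis by (simp add: sum_subtractf)
          qed
          then have "\<bar>f (real n * T + t) - ?g t\<bar> \<le> \<bar>f (real n * T + t) - (\<Sum>i=1..m. f (real n * T + t - real (k i) * T))\<bar>
              + (\<Sum>i=1..m. \<bar>f (real (n - k i) * T + t) - g i t\<bar>)"
            using sum_abs[of "\<lambda>i. f (real (n - k i) * T + t) - g i t" "{1..m}"] by linarith
          then have "ennreal \<bar>f (real n * T + t) - ?g t\<bar> \<le> ennreal (\<bar>f (real n * T + t) - (\<Sum>i=1..m. f (real n * T + t - real (k i) * T))\<bar>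
              + (\<Sum>i=1..m. \<bar>f (real (n - k i) * T + t) - g i t\<bar>))" by (rule ennreal_leI)
          also have "\<dots> = ?d t + (\<Sum>i=1..m. ?e i t)" by (simp add: sum_nonneg sum_ennreal)
          finally have "ennreal \<bar>f (real n * T + t) - ?g t\<bar> * ?I t \<le> (?d t + (\<Sum>i=1..m. ?e i t)) * ?I t"
            by (rule mult_right_mono) simp
          then show ?thesis by (simp only: distrib_right sum_distrib_right)
        qed
        have "(\<integral>\<^sup>+t. ennreal \<bar>f (real n * T + t) - ?g t\<bar> * ?I t \<partial>lborel)
          \<le> (\<integral>\<^sup>+t. ?d t * ?I t + (\<Sum>i=1..m. ?e i t * ?I t) \<partial>lborel)"
          by (intro nn_integral_mono pt)
        also have "\<dots> = (\<integral>\<^sup>+t. ?d t * ?I t \<partial>lborel) + (\<Sum>i=1..m. \<integral>\<^sup>+t. ?e i t * ?I t \<partial>lborel)"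
        proof -
          have m1: "(\<lambda>t. ?e i t * ?I t) \<in> borel_measurable lborel" if "i \<in> {1..m}" for i
            using g(1)[OF that] by measurable
          have m_ge_2: "(\<lambda>t. ?d t * ?I t) \<in> borel_measurable lborel" by measurable
          have "(\<integral>\<^sup>+t. ?d t * ?I t + (\<Sum>i=1..m. ?e i t * ?I t) \<partial>lborel)
            = (\<integral>\<^sup>+t. ?d t * ?I t \<partial>lborel) + (\<integral>\<^sup>+t. (\<Sum>i=1..m. ?e i t * ?I t) \<partial>lborel)"
            by (rule nn_integral_add[OF m_ge_2 borel_measurable_sum[OF m1]])
          also have "(\<integral>\<^sup>+t. (\<Sum>i=1..m. ?e i t * ?I t) \<partial>lborel) = (\<Sum>i=1..m. \<integral>\<^sup>+t. ?e i t * ?I t \<partial>lborel)"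
            by (rule nn_integral_sum[OF m1])
          finally show ?thesis .
        qed
        also have "\<dots> \<le> ennreal \<epsilon>1 + (\<Sum>i=1..m. ennreal (A * p ^ (n - k i) - \<epsilon>1))"
          by (intro add_mono sum_mono n1 g(3)) (use n n0_def in auto)
        also have "\<dots> = ennreal (\<epsilon>1 + (\<Sum>i=1..m. A * p ^ (n - k i) - \<epsilon>1))"
        proof -
          have nn: "0 \<le> A * p ^ (n - k i) - \<epsilon>1" if "i \<in> {1..m}" for i by (rule Apos[OF kn(3)[OF that]])
          have "(\<Sum>i=1..m. ennreal (A * p ^ (n - k i) - \<epsilon>1)) = ennreal (\<Sum>i=1..m. A * p ^ (n - k i) - \<epsilon>1)"
            by (rule sum_ennreal[OF nn])
          moreover have "0 \<le> (\<Sum>i=1..m. A * p ^ (n - k i) - \<epsilon>1)" by (rule sum_nonneg[OF nn])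
          ultimately show ?thesis using \<epsilon>1 by (simp only: ennreal_plus less_imp_le)
        qed
        also have "\<dots> \<le> ennreal (A * p ^ n - \<epsilon>1)"
        proof (rule ennreal_leI)
          have "(\<Sum>i=1..m. A * p ^ (n - k i)) = (\<Sum>i=1..m. A * p ^ n * (1 / p) ^ k i)"
            using kn(1) p by (intro sum.cong) (auto simp: power_diff power_one_over field_simps)
          also have "\<dots> = A * p ^ n" using weights by (simp add: sum_distrib_left[symmetric])
          finally have "(\<Sum>i=1..m. A * p ^ (n - k i) - \<epsilon>1) = A * p ^ n - real m * \<epsilon>1" by (simp add: sum_subtractf)
          moreover have "2 * \<epsilon>1 \<le> real m * \<epsilon>1" using m \<epsilon>1 by (intro mult_right_mono) auto
          ultimately show "\<epsilon>1 + (\<Sum>i=1..m. A * p ^ (n - k i) - \<epsilon>1) \<le> A * p ^ n - \<epsilon>1" by linarith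
        qed
        finally show "(\<integral>\<^sup>+t. ennreal \<bar>f (real n * T + t) - ?g t\<bar> * ?I t \<partial>lborel) \<le> ennreal (A * p ^ n - \<epsilon>1)" .
      qed
    qed
  qed
  \<comment> \<open>The other half of \<epsilon> goes into the uniform convergence. It may require a
    large \<open>n\<close>, but the jumps stay in \<open>Z\<close> whatever \<open>n\<close>
    is.\<close>
  define \<delta> where "\<delta> = \<epsilon> / (2 * T * (C + 1) * p ^ n0)"
  have \<delta>: "\<delta> > 0" unfolding \<delta>_def using \<epsilon> T C p by simp
  obtain n2 where n2: "\<And>n t. n \<ge> n2 \<Longrightarrow> t \<in> {0..T} \<Longrightarrow> \<bar>\<sigma> t - f (real n * T + t) / p ^ n\<bar> \<le> \<delta>"
    using conv[OF \<delta>] unfolding eventually_sequentially by blast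
  define n where "n = n0 + n2"
  obtain g where g[measurable]: "g \<in> borel_measurable borel"
    and gc: "\<And>u v. 0 < u \<Longrightarrow> u < v \<Longrightarrow> v < T \<Longrightarrow> {u..v} \<inter> Z = {} \<Longrightarrow> g u = g v"
    and gi: "(\<integral>\<^sup>+t. ennreal \<bar>f (real n * T + t) - g t\<bar> * indicator {0<..<T} t \<partial>lborel) \<le> ennreal (A * p ^ n - \<epsilon>1)"
    using approx[of n] n_def by auto
  show ?thesis
  proof (intro exI[of _ Z] exI[of _ "\<lambda>t. g t / p ^ n"] conjI allI impI finZ)
    fix u v assume "0 < u" "u < v" "v < T" "{u..v} \<inter> Z = {}"
    from gc[OF this] show "g u / p ^ n = g v / p ^ n" by simp
  next
    let ?I = "indicator {0<..<T} :: real \<Rightarrow> ennreal"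
    have pn: "p ^ n > 0" using p by simp
    have pt: "ennreal \<bar>\<sigma> t - g t / p ^ n\<bar> * ?I t \<le>
      ennreal \<delta> * ?I t + ennreal (1 / p ^ n) * (ennreal \<bar>f (real n * T + t) - g t\<bar> * ?I t)" for t
    proof (cases "t \<in> {0<..<T}")
      case True
      have "\<bar>\<sigma> t - g t / p ^ n\<bar> \<le> \<bar>\<sigma> t - f (real n * T + t) / p ^ n\<bar> + \<bar>f (real n * T + t) / p ^ n - g t / p ^ n\<bar>" by simp
      also have "\<dots> \<le> \<delta> + 1 / p ^ n * \<bar>f (real n * T + t) - g t\<bar>"
        using n2[of n t] True n_def pn by (intro add_mono) (auto simp: diff_divide_distrib[symmetric])
      finally have "ennreal \<bar>\<sigma> t - g t / p ^ n\<bar> \<le> ennreal (\<delta> + 1 / p ^ n * \<bar>f (real n * T + t) - g t\<bar>)" by (rule ennreal_leI)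
      also have "\<dots> = ennreal \<delta> + ennreal (1 / p ^ n) * ennreal \<bar>f (real n * T + t) - g t\<bar>"
        using \<delta> pn by (subst ennreal_plus) (auto simp: ennreal_mult[symmetric])
      finally show ?thesis using True by simp
    qed simp
    have "(\<integral>\<^sup>+t. ennreal \<bar>\<sigma> t - g t / p ^ n\<bar> * ?I t \<partial>lborel) \<le>
      (\<integral>\<^sup>+t. ennreal \<delta> * ?I t + ennreal (1 / p ^ n) * (ennreal \<bar>f (real n * T + t) - g t\<bar> * ?I t) \<partial>lborel)"
      by (intro nn_integral_mono pt)
    also have "\<dots> = ennreal \<delta> * ennreal T + ennreal (1 / p ^ n) * (\<integral>\<^sup>+t. ennreal \<bar>f (real n * T + t) - g t\<bar> * ?I t \<partial>lborel)"
      using T by (subst nn_integral_add) (auto simp: nn_integral_cmult nn_integral_cmult_indicator)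
    also have "\<dots> \<le> ennreal \<delta> * ennreal T + ennreal (1 / p ^ n) * ennreal (A * p ^ n - \<epsilon>1)"
      by (intro add_left_mono mult_left_mono gi) simp
    also have "\<dots> = ennreal (\<delta> * T + 1 / p ^ n * (A * p ^ n - \<epsilon>1))"
      using \<delta> T pn Apos[of n] n_def by (simp add: ennreal_mult[symmetric] ennreal_plus[symmetric] del: ennreal_plus)
    also have "\<dots> \<le> ennreal (\<epsilon> / (real (card Z) + 1))"
    proof (rule ennreal_leI)
      have "1 / p ^ n * (A * p ^ n - \<epsilon>1) \<le> 1 / p ^ n * (A * p ^ n)" using pn \<epsilon>1 by (intro mult_left_mono) auto
      also have "\<dots> = A" using pn p by simp
      also have "A = \<epsilon> / (2 * (C + 1) * p ^ n0)" using p by (simp add: A_def \<epsilon>1_def)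
      finally have "\<delta> * T + 1 / p ^ n * (A * p ^ n - \<epsilon>1) \<le> \<delta> * T + \<epsilon> / (2 * (C + 1) * p ^ n0)" by simp
      also have "\<dots> = \<epsilon> / ((C + 1) * p ^ n0)"
      proof -
        define u where "u = (C + 1) * p ^ n0"
        have "\<delta> * T = \<epsilon> / u / 2" using T by (simp add: \<delta>_def u_def)
        moreover have "\<epsilon> / (2 * (C + 1) * p ^ n0) = \<epsilon> / u / 2" by (simp add: u_def)
        ultimately show ?thesis by (simp only: u_def[symmetric] field_sum_of_halves)
      qed
      also have "\<dots> \<le> \<epsilon> / (real (card Z) + 1)" using cardZ \<epsilon> by (intro divide_left_mono) (auto intro: mult_pos_pos)
      finally show "\<delta> * T + 1 / p ^ n * (A * p ^ n - \<epsilon>1) \<le> \<epsilon> / (real (card Z) + 1)" .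
    qed
    finally show "(\<integral>\<^sup>+t. ennreal \<bar>\<sigma> t - g t / p ^ n\<bar> * ?I t \<partial>lborel) \<le> ennreal (\<epsilon> / (real (card Z) + 1))" .
  qed
qed

section \<open>The string equation\<close>

text \<open>Covers both \<mu> and \<open>lborel\<close>, so that bounds and termwise integration
  serve the two integral operators alike. Only the mass of \<open>{0..1}\<close> is assumed finite
  because \<open>lborel\<close> is not a finite measure.\<close>

locale unit_interval_measure =
  fixes N :: "real measure"
  assumes sets_N [measurable_cong, simp]: "sets N = sets borel"
    and finite_N: "emeasure N {0..1} < \<infinity>"
begin

lemma space_N [simp]: "space N = UNIV"
  using sets_eq_imp_space_eq[OF sets_N] by simp

lemma set_integrable_cont:
  assumes "continuous_on {0..1} f" "A \<in> sets borel" "A \<subseteq> {0..1}"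
  shows "set_integrable N A (f :: real \<Rightarrow> real)"
proof -
  obtain B where B: "\<forall>x\<in>{0..1}. \<bar>f x\<bar> \<le> B"
    using compact_imp_bounded[OF compact_continuous_image[OF assms(1) compact_Icc]]
    unfolding bounded_iff by auto
  have "set_integrable N {0..1} f"
    unfolding set_integrable_def
  proof (rule integrableI_bounded_set[where A = "{0..1}" and B = B])
    show "(\<lambda>x. indicator {0..1} x *\<^sub>R f x) \<in> borel_measurable N"
      unfolding measurable_cong_sets[OF sets_N refl]
      by (rule borel_measurable_continuous_on_indicator[OF _ assms(1)]) simp
  qed (use finite_N B in auto)
  then show ?thesis by (rule set_integrable_subset) (use assms in auto)
qed

lemma abs_integral_le:
  assumes "continuous_on {0..1} f" "A \<in> sets borel" "A \<subseteq> {0..1}" "\<And>x. x \<in> A \<Longrightarrow> \<bar>f x\<bar> \<le> B"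
  shows "\<bar>LINT x:A|N. f x\<bar> \<le> B * measure N A"
proof -
  have fA: "emeasure N A < \<infinity>"
    using emeasure_mono[OF assms(3), of N] finite_N by (auto intro: le_less_trans)
  have "\<bar>LINT x:A|N. f x\<bar> \<le> (LINT x:A|N. \<bar>f x\<bar>)"
    using set_integral_norm_bound[OF set_integrable_cont[OF assms(1-3)]] by simp
  also have "\<dots> \<le> (LINT x:A|N. B)"
  proof (rule set_integral_mono)
    show "set_integrable N A (\<lambda>x. \<bar>f x\<bar>)" by (intro set_integrable_abs set_integrable_cont assms)
    show "set_integrable N A (\<lambda>x. B)"
      by (rule set_integrable_cont) (use assms in auto)
  qed (use assms in auto)
  also have "\<dots> = B * measure N A"
    unfolding set_lebesgue_integral_def by (simp add: mult.commute)
  finally show ?thesis .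
qed

lemma integral_sums:
  assumes f: "\<And>n. continuous_on {0..1} (f n)" and A: "A \<in> sets borel" "A \<subseteq> {0..1}"
    and M: "summable M" "\<And>n x. x \<in> {0..1} \<Longrightarrow> \<bar>f n x\<bar> \<le> (M n :: real)"
  shows "(\<lambda>n. LINT x:A|N. f n x) sums (LINT x:A|N. (\<Sum>n. f n x))"
proof -
  have fA: "emeasure N A < \<infinity>"
    using emeasure_mono[OF A(2), of N] finite_N by (auto intro: le_less_trans)
  have "(\<lambda>n. \<integral>x. indicator A x *\<^sub>R f n x \<partial>N) sums (\<integral>x. (\<Sum>n. indicator A x *\<^sub>R f n x) \<partial>N)"
  proof (rule sums_integral)
    show "integrable N (\<lambda>x. indicator A x *\<^sub>R f n x)" for n
      using set_integrable_cont[OF f A] unfolding set_integrable_def .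
    show "AE x in N. summable (\<lambda>n. norm (indicator A x *\<^sub>R f n x))"
    proof (rule AE_I2, rule summable_comparison_test'[OF M(1)])
      fix x n show "norm (norm (indicator A x *\<^sub>R f n x)) \<le> M n"
        using M(2)[of x n] M(2)[of 0 n] A by (auto simp: indicator_def)
    qed
    show "summable (\<lambda>n. \<integral>x. norm (indicator A x *\<^sub>R f n x) \<partial>N)"
    proof (rule summable_comparison_test'[OF summable_mult2[OF M(1), of "measure N A"]])
      fix n
      have "\<bar>LINT x:A|N. \<bar>f n x\<bar>\<bar> \<le> M n * measure N A"
        using M(2) A by (intro abs_integral_le continuous_intros f) auto
      then show "norm (\<integral>x. norm (indicator A x *\<^sub>R f n x) \<partial>N) \<le> M n * measure N A"
        unfolding set_lebesgue_integral_def by (simp add: abs_mult)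
    qed
  qed
  moreover have "(\<Sum>n. indicator A x *\<^sub>R f n x) = indicator A x *\<^sub>R (\<Sum>n. f n x)" for x
    by (cases "x \<in> A") auto
  ultimately show ?thesis unfolding set_lebesgue_integral_def by simp
qed

end

interpretation lborel01: unit_interval_measure lborel
  by unfold_locales auto

text \<open>The indicators of \<open>{0..X n}\<close> converge except at \<open>x\<close>, a null
  point. The measure is arbitrary because the lemma serves \<mu>, \<open>lborel\<close> and
  \<open>lebesgue\<close>.\<close>

lemma continuous_on_primitive:
  fixes f :: "real \<Rightarrow> real"
  assumes N: "\<And>x. {x} \<in> null_sets N" "\<And>x y. {x..y} \<in> sets N" and f: "set_integrable N {0..1} f"
  shows "continuous_on {0..1} (\<lambda>x. LINT t:{0..x}|N. f t)"
proof (rule continuous_on_sequentiallyI)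
  fix X :: "nat \<Rightarrow> real" and x
  assume X: "\<forall>n. X n \<in> {0..1}" "x \<in> {0..1}" "X \<longlonglongrightarrow> x"
  have g: "integrable N (\<lambda>t. indicator {0..1} t *\<^sub>R f t)"
    using f unfolding set_integrable_def by simp
  have m: "(\<lambda>t. indicator {0..z} t *\<^sub>R f t) \<in> borel_measurable N" if "z \<in> {0..1}" for z
    using set_integrable_subset[OF f, of "{0..z}"] N(2) that unfolding set_integrable_def by auto
  show "(\<lambda>n. LINT t:{0..X n}|N. f t) \<longlonglongrightarrow> (LINT t:{0..x}|N. f t)"
    unfolding set_lebesgue_integral_def
  proof (rule integral_dominated_convergence[where w = "\<lambda>t. norm (indicator {0..1} t *\<^sub>R f t)"])
    show "(\<lambda>t. indicator {0..x} t *\<^sub>R f t) \<in> borel_measurable N" by (rule m[OF X(2)])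
    show "(\<lambda>t. indicator {0..X n} t *\<^sub>R f t) \<in> borel_measurable N" for n
      by (rule m[OF X(1)[rule_format]])
    show "integrable N (\<lambda>t. norm (indicator {0..1} t *\<^sub>R f t))" using g by (rule integrable_norm)
    show "AE t in N. norm (indicator {0..X n} t *\<^sub>R f t) \<le> norm (indicator {0..1} t *\<^sub>R f t)" for n
      using X(1)[rule_format, of n] by (intro AE_I2) (auto simp: indicator_def)
    have "AE t in N. t \<notin> {x}" by (rule AE_not_in[OF N(1)])
    then show "AE t in N. (\<lambda>n. indicator {0..X n} t *\<^sub>R f t) \<longlonglongrightarrow> indicator {0..x} t *\<^sub>R f t"
    proof eventually_elim
      case (elim t)
      then consider "t < x" | "x < t" by fastforce
      then have "\<forall>\<^sub>F n in sequentially. indicator {0..X n} t *\<^sub>R f t = indicator {0..x} t *\<^sub>R f t"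
      proof cases
        case 1
        from order_tendstoD(1)[OF X(3) 1] show ?thesis
          by eventually_elim (use 1 in \<open>auto simp: indicator_def\<close>)
      next
        case 2
        from order_tendstoD(2)[OF X(3) 2] show ?thesis
          by eventually_elim (use 2 in \<open>auto simp: indicator_def\<close>)
      qed
      then show ?case by (rule tendsto_eventually)
    qed
  qed
qed

section \<open>The integral operators of the string and its solutions\<close>

locale string_measure =
  fixes \<mu> :: "real measure"
  assumes sets_mu: "sets \<mu> = sets borel"
    and finite_mu: "finite_measure \<mu>"
    and mass_mu: "measure \<mu> {0..1} = 1"
    and no_atoms: "\<And>x. measure \<mu> {x} = 0"

sublocale string_measure \<subseteq> finite_measure \<mu> by (rule finite_mu)

sublocale string_measure \<subseteq> unit_interval_measure \<mu>
proof
  show "sets \<mu> = sets borel" by (rule sets_mu)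
  show "emeasure \<mu> {0..1} < \<infinity>" by (simp add: emeasure_eq_measure)
qed

text \<open>Kept apart from \<open>string_measure\<close> because the Fubini formula is already
  needed while the distribution function of \<mu> is being identified, before total mass and absence
  of atoms are known.\<close>

locale borel_finite_measure = finite_measure \<mu> for \<mu> :: "real measure" +
  assumes sets_borel [measurable_cong, simp]: "sets \<mu> = sets borel"
begin

text \<open>Closed intervals on both sides make the formula valid in the presence of atoms.\<close>

lemma integral_by_parts_lborel:
  fixes w f :: "real \<Rightarrow> real"
  assumes w: "set_integrable lborel {p..q} w" and f: "set_integrable \<mu> {p..q} f"
  shows "(LINT t:{p..q}|\<mu>. f t * (LINT x:{t..q}|lborel. w x)) = (LINT x:{p..q}|lborel. w x * (LINT t:{p..x}|\<mu>. f t))"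
proof -
  interpret P: pair_sigma_finite lborel \<mu> by unfold_locales
  define W where "W x = indicator {p..q} x * w x" for x
  define G where "G t = indicator {p..q} t * f t" for t
  have W: "integrable lborel W" and G: "integrable \<mu> G"
    using w f unfolding set_integrable_def W_def G_def by simp_all
  then have [measurable]: "W \<in> borel_measurable borel" "G \<in> borel_measurable \<mu>" by auto
  have "integrable (lborel \<Otimes>\<^sub>M \<mu>) (\<lambda>z. W (fst z) * G (snd z))"
  proof (rule P.Fubini_integrable)
    show "(\<lambda>z. W (fst z) * G (snd z)) \<in> borel_measurable (lborel \<Otimes>\<^sub>M \<mu>)" by measurable
    show "integrable lborel (\<lambda>x. \<integral>y. norm (W (fst (x, y)) * G (snd (x, y))) \<partial>\<mu>)"
      using integrable_mult_left[OF integrable_norm[OF W], of "\<integral>y. \<bar>G y\<bar> \<partial>\<mu>"] by (simp add: abs_mult)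
    show "AE x in lborel. integrable \<mu> (\<lambda>y. W (fst (x, y)) * G (snd (x, y)))"
      using G by simp
  qed
  moreover have "(\<lambda>z. if snd z \<le> fst z then W (fst z) * G (snd z) else 0) \<in> borel_measurable (lborel \<Otimes>\<^sub>M \<mu>)"
  proof -
    have [measurable]: "(\<lambda>z. snd z) \<in> borel_measurable (lborel \<Otimes>\<^sub>M \<mu>)"
      using measurable_snd[of lborel \<mu>] unfolding measurable_cong_sets[OF refl sets_borel] .
    have [measurable]: "(\<lambda>z. fst z) \<in> borel_measurable (lborel \<Otimes>\<^sub>M \<mu>)"
      using measurable_fst[of lborel \<mu>] unfolding measurable_cong_sets[OF refl sets_lborel] .
    have [measurable]: "Measurable.pred (lborel \<Otimes>\<^sub>M \<mu>) (\<lambda>z. snd z \<le> fst z)"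
      by measurable
    show ?thesis by measurable
  qed
  ultimately have "integrable (lborel \<Otimes>\<^sub>M \<mu>) (\<lambda>z. if snd z \<le> fst z then W (fst z) * G (snd z) else 0)"
    by (rule Bochner_Integration.integrable_bound) (rule AE_I2, simp)
  then have I: "integrable (lborel \<Otimes>\<^sub>M \<mu>) (\<lambda>(x, t). if t \<le> x then W x * G t else 0)"
    by (simp only: split_beta')
  have "(LINT t:{p..q}|\<mu>. f t * (LINT x:{t..q}|lborel. w x)) = (\<integral>t. (\<integral>x. (if t \<le> x then W x * G t else 0) \<partial>lborel) \<partial>\<mu>)"
    unfolding set_lebesgue_integral_def
  proof (rule Bochner_Integration.integral_cong[OF refl])
    fix t
    have "(\<integral>x. (if t \<le> x then W x * G t else 0) \<partial>lborel) = (\<integral>x. G t * (indicator {t..q} x * w x) \<partial>lborel)"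
      by (rule Bochner_Integration.integral_cong[OF refl]) (auto simp: W_def G_def indicator_def)
    then show "indicator {p..q} t *\<^sub>R (f t * (\<integral>x. indicator {t..q} x *\<^sub>R w x \<partial>lborel)) = (\<integral>x. (if t \<le> x then W x * G t else 0) \<partial>lborel)"
      by (simp add: G_def)
  qed
  also have "\<dots> = (\<integral>x. (\<integral>t. (if t \<le> x then W x * G t else 0) \<partial>\<mu>) \<partial>lborel)"
    by (rule P.Fubini_integral[OF I])
  also have "\<dots> = (LINT x:{p..q}|lborel. w x * (LINT t:{p..x}|\<mu>. f t))"
    unfolding set_lebesgue_integral_def
  proof (rule Bochner_Integration.integral_cong[OF refl])
    fix x
    have "(\<integral>t. (if t \<le> x then W x * G t else 0) \<partial>\<mu>) = (\<integral>t. W x * (indicator {p..x} t * f t) \<partial>\<mu>)"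
      by (rule Bochner_Integration.integral_cong[OF refl]) (auto simp: W_def G_def indicator_def)
    then show "(\<integral>t. (if t \<le> x then W x * G t else 0) \<partial>\<mu>) = indicator {p..q} x *\<^sub>R (w x * (\<integral>t. indicator {p..x} t *\<^sub>R f t \<partial>\<mu>))"
      by (simp add: W_def)
  qed
  finally show ?thesis .
qed

end

sublocale string_measure \<subseteq> borel_finite_measure \<mu>
  by unfold_locales (rule sets_mu)

lemma lborel_integral_split:
  fixes v :: "real \<Rightarrow> real"
  assumes "set_integrable lborel {p..q} v" "p \<le> t" "t \<le> q"
  shows "(LINT x:{p..q}|lborel. v x) = (LINT x:{p..t}|lborel. v x) + (LINT x:{t..q}|lborel. v x)"
proof -
  have e: "{p..q} = {p..t} \<union> {t..q}" using assms by auto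
  have i: "set_integrable lborel {p..t} v" "set_integrable lborel {t..q} v"
    by (rule set_integrable_subset[OF assms(1)]; use assms in auto)+
  have "AE x in lborel. \<not> (x \<in> {p..t} \<and> x \<in> {t..q})"
    using AE_lborel_singleton[of t] by eventually_elim auto
  then show ?thesis unfolding e using i by (intro set_integral_Un_AE) auto
qed

context string_measure
begin

definition I :: "(real \<Rightarrow> real) \<Rightarrow> real \<Rightarrow> real" where "I f x = (LINT t:{0..x}|\<mu>. f t)"
definition J :: "(real \<Rightarrow> real) \<Rightarrow> real \<Rightarrow> real" where "J f x = (LINT t:{0..x}|lborel. f t)"

lemma I_0 [simp]: "I f 0 = 0"
proof -
  have "{0::real} \<in> null_sets \<mu>" using no_atoms[of 0] by (simp add: null_sets_def emeasure_eq_measure)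
  then have "AE t in \<mu>. t \<notin> {0}" by (rule AE_not_in)
  then have "AE t in \<mu>. indicator {0..0} t *\<^sub>R f t = 0" by eventually_elim auto
  then show ?thesis unfolding I_def set_lebesgue_integral_def by (rule integral_eq_zero_AE)
qed

lemma J_0 [simp]: "J f 0 = 0"
proof -
  have "AE t in lborel. indicator {0..0} t *\<^sub>R f t = 0" using AE_lborel_singleton[of 0] by eventually_elim auto
  then show ?thesis unfolding J_def set_lebesgue_integral_def by (rule integral_eq_zero_AE)
qed

lemma singleton_null_mu: "{x} \<in> null_sets \<mu>"
  using no_atoms[of x] by (simp add: null_sets_def emeasure_eq_measure)

lemma set_integrable_mu: "continuous_on {0..1} f \<Longrightarrow> 0 \<le> p \<Longrightarrow> q \<le> 1 \<Longrightarrow> set_integrable \<mu> {p..q} (f :: real \<Rightarrow> real)"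
  by (rule set_integrable_cont) auto

lemma set_integrable_lborel: "continuous_on {0..1} f \<Longrightarrow> 0 \<le> p \<Longrightarrow> q \<le> 1 \<Longrightarrow> set_integrable lborel {p..q} (f :: real \<Rightarrow> real)"
  by (rule lborel01.set_integrable_cont) auto

lemma continuous_on_I: "continuous_on {0..1} f \<Longrightarrow> continuous_on {0..1} (I f)"
  unfolding I_def[abs_def]
  by (rule continuous_on_primitive) (auto intro: singleton_null_mu set_integrable_mu)

lemma continuous_on_J: "continuous_on {0..1} f \<Longrightarrow> continuous_on {0..1} (J f)"
  unfolding J_def[abs_def]
  by (rule continuous_on_primitive) (auto intro: set_integrable_lborel)

text \<open>The integrated form of the system \<open>y' = v\<close>,
  \<open>dv = - l * y d\<mu>\<close>; it makes sense although \<mu> need not have a density.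
  Continuity of \<open>v\<close> follows from that of \<open>y\<close>.\<close>

definition sol :: "real \<Rightarrow> (real \<Rightarrow> real) \<Rightarrow> (real \<Rightarrow> real) \<Rightarrow> bool" where
  "sol l y v \<longleftrightarrow> continuous_on {0..1} y \<and>
    (\<forall>x\<in>{0..1}. v x = v 0 - l * I y x) \<and> (\<forall>x\<in>{0..1}. y x = y 0 + J v x)"

lemma sol_cont_y: "sol l y v \<Longrightarrow> continuous_on {0..1} y"
  by (simp add: sol_def)

lemma sol_y: "sol l y v \<Longrightarrow> x \<in> {0..1} \<Longrightarrow> y x = y 0 + J v x"
  and sol_v: "sol l y v \<Longrightarrow> x \<in> {0..1} \<Longrightarrow> v x = v 0 - l * I y x"
  unfolding sol_def by blast+

lemma sol_cont_v: "sol l y v \<Longrightarrow> continuous_on {0..1} v"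
proof -
  assume s: "sol l y v"
  then have "continuous_on {0..1} (\<lambda>x. v 0 - l * I y x)"
    by (intro continuous_intros continuous_on_I sol_cont_y)
  then show ?thesis by (rule continuous_on_eq) (rule sol_v[OF s, symmetric])
qed

text \<open>Integration by parts through Fubini. Apart from the boundary values, only the factor
  \<open>l2\<close> on the right distinguishes the two solutions, so subtracting the version with
  exchanged roles gives the Wronskian identity at once.\<close>

lemma sol_product:
  assumes 1: "sol l1 y1 v1" and 2: "sol l2 y2 v2" and x: "x \<in> {0..1}"
  shows "y1 x * v2 x = v2 0 * y1 0 + J (\<lambda>s. v1 s * v2 s) x - l2 * I (\<lambda>t. y1 t * y2 t) x"
proof -
  have cs: "continuous_on {0..1} y1" "continuous_on {0..1} v1" "continuous_on {0..1} y2" "continuous_on {0..1} v2"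
    using 1 2 by (auto intro: sol_cont_y sol_cont_v)
  have ibp: "(LINT t:{0..x}|\<mu>. y2 t * (LINT s:{t..x}|lborel. v1 s)) = (LINT s:{0..x}|lborel. v1 s * I y2 s)"
    unfolding I_def using x by (intro integral_by_parts_lborel set_integrable_lborel set_integrable_mu cs) auto
  have "(LINT t:{0..x}|\<mu>. y2 t * (LINT s:{t..x}|lborel. v1 s)) = (LINT t:{0..x}|\<mu>. y1 x * y2 t - y1 t * y2 t)"
  proof (rule set_lebesgue_integral_cong)
    show "\<forall>t. t \<in> {0..x} \<longrightarrow> y2 t * (LINT s:{t..x}|lborel. v1 s) = y1 x * y2 t - y1 t * y2 t"
    proof (intro allI impI)
      fix t assume t: "t \<in> {0..x}"
      have "(LINT s:{0..x}|lborel. v1 s) = (LINT s:{0..t}|lborel. v1 s) + (LINT s:{t..x}|lborel. v1 s)"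
        using t x by (intro lborel_integral_split set_integrable_lborel cs) auto
      moreover have "y1 x = y1 0 + (LINT s:{0..x}|lborel. v1 s)" by (rule sol_y[OF 1 x, unfolded J_def])
      moreover have "y1 t = y1 0 + (LINT s:{0..t}|lborel. v1 s)"
        by (rule sol_y[OF 1, unfolded J_def]) (use x t in simp)
      ultimately have X: "(LINT s:{t..x}|lborel. v1 s) = y1 x - y1 t" by linarith
      show "y2 t * (LINT s:{t..x}|lborel. v1 s) = y1 x * y2 t - y1 t * y2 t" unfolding X by (simp add: algebra_simps)
    qed
  qed simp
  also have "\<dots> = y1 x * I y2 x - I (\<lambda>t. y1 t * y2 t) x"
    unfolding I_def using x
    by (subst set_integral_diff(2)) (auto intro!: set_integrable_mu continuous_intros cs)
  finally have L: "y1 x * I y2 x - I (\<lambda>t. y1 t * y2 t) x = J (\<lambda>s. v1 s * I y2 s) x"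
    unfolding J_def using ibp by simp
  have "l2 * J (\<lambda>s. v1 s * I y2 s) x = J (\<lambda>s. v1 s * (l2 * I y2 s)) x"
    unfolding J_def by (subst set_integral_mult_right[symmetric]) (simp add: mult_ac)
  also have "\<dots> = J (\<lambda>s. v2 0 * v1 s - v1 s * v2 s) x"
    unfolding J_def
  proof (rule set_lebesgue_integral_cong)
    show "\<forall>s. s \<in> {0..x} \<longrightarrow> v1 s * (l2 * I y2 s) = v2 0 * v1 s - v1 s * v2 s"
    proof (intro allI impI)
      fix s assume "s \<in> {0..x}"
      then have "v2 s = v2 0 - l2 * I y2 s" using x by (intro sol_v[OF 2]) simp
      then have X: "l2 * I y2 s = v2 0 - v2 s" by simp
      show "v1 s * (l2 * I y2 s) = v2 0 * v1 s - v1 s * v2 s" unfolding X by (simp add: algebra_simps)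
    qed
  qed simp
  also have "\<dots> = v2 0 * J v1 x - J (\<lambda>s. v1 s * v2 s) x"
    unfolding J_def using x
    by (subst set_integral_diff(2)) (auto intro!: set_integrable_lborel continuous_intros cs)
  finally have R: "l2 * J (\<lambda>s. v1 s * I y2 s) x = v2 0 * J v1 x - J (\<lambda>s. v1 s * v2 s) x" .
  have "J v1 x = y1 x - y1 0" "l2 * I y2 x = v2 0 - v2 x" using sol_y[OF 1 x] sol_v[OF 2 x] by simp_all
  moreover have "y1 x * (l2 * I y2 x) - l2 * I (\<lambda>t. y1 t * y2 t) x = l2 * J (\<lambda>s. v1 s * I y2 s) x"
    unfolding L[symmetric] by (simp add: algebra_simps)
  ultimately have "y1 x * (v2 0 - v2 x) - l2 * I (\<lambda>t. y1 t * y2 t) x = v2 0 * (y1 x - y1 0) - J (\<lambda>s. v1 s * v2 s) x"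
    using R by (simp only:)
  then show ?thesis by (simp add: algebra_simps)
qed

lemma sol_wronskian:
  assumes "sol l1 y1 v1" "sol l2 y2 v2" "x \<in> {0..1}"
  shows "y1 x * v2 x - v1 x * y2 x = y1 0 * v2 0 - v1 0 * y2 0 + (l1 - l2) * I (\<lambda>t. y1 t * y2 t) x"
  using sol_product[OF assms] sol_product[OF assms(2,1,3)] by (simp add: mult.commute algebra_simps)

lemma sol_lincomb:
  assumes "sol l y1 v1" "sol l y2 v2"
  shows "sol l (\<lambda>x. a * y1 x + b * y2 x) (\<lambda>x. a * v1 x + b * v2 x)"
proof -
  have cs: "continuous_on {0..1} y1" "continuous_on {0..1} v1" "continuous_on {0..1} y2" "continuous_on {0..1} v2"
    using assms by (auto intro: sol_cont_y sol_cont_v)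
  have E1: "I (\<lambda>x. a * y1 x + b * y2 x) x = a * I y1 x + b * I y2 x" if "x \<in> {0..1}" for x
    unfolding I_def using that
    by (subst set_integral_add(2)) (auto intro!: set_integrable_mu continuous_intros cs)
  have E2: "J (\<lambda>x. a * v1 x + b * v2 x) x = a * J v1 x + b * J v2 x" if "x \<in> {0..1}" for x
    unfolding J_def using that
    by (subst set_integral_add(2)) (auto intro!: set_integrable_lborel continuous_intros cs)
  have E3: "a * y1 x + b * y2 x = (a * y1 0 + b * y2 0) + (a * J v1 x + b * J v2 x)" if "x \<in> {0..1}" for x
    using arg_cong[OF sol_y[OF assms(1) that], of "\<lambda>z. a * z"] arg_cong[OF sol_y[OF assms(2) that], of "\<lambda>z. b * z"]
    by (simp add: algebra_simps)
  have E4: "a * v1 x + b * v2 x = (a * v1 0 + b * v2 0) - l * (a * I y1 x + b * I y2 x)" if "x \<in> {0..1}" for x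
    using arg_cong[OF sol_v[OF assms(1) that], of "\<lambda>z. a * z"] arg_cong[OF sol_v[OF assms(2) that], of "\<lambda>z. b * z"]
    by (simp add: algebra_simps)
  show ?thesis unfolding sol_def
  proof (intro conjI ballI)
    show "continuous_on {0..1} (\<lambda>x. a * y1 x + b * y2 x)" by (intro continuous_intros cs)
    fix x :: real assume x: "x \<in> {0..1}"
    show "a * v1 x + b * v2 x = a * v1 0 + b * v2 0 - l * I (\<lambda>x. a * y1 x + b * y2 x) x"
      unfolding E1[OF x] by (rule E4[OF x])
    show "a * y1 x + b * y2 x = a * y1 0 + b * y2 0 + J (\<lambda>x. a * v1 x + b * v2 x) x"
      unfolding E2[OF x] by (rule E3[OF x])
  qed
qed

end

lemma set_lebesgue_integral_nonneg:
  fixes f :: "'a \<Rightarrow> real"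
  assumes "\<And>x. x \<in> A \<Longrightarrow> 0 \<le> f x"
  shows "0 \<le> (LINT x:A|M. f x)"
  unfolding set_lebesgue_integral_def using assms
  by (intro integral_nonneg_AE AE_I2) (auto simp: indicator_def)

context string_measure
begin

text \<open>The fundamental system of the string equation is a power series in the spectral parameter.\<close>

definition term_fun :: "real \<Rightarrow> real \<Rightarrow> nat \<Rightarrow> real \<Rightarrow> real" where
  "term_fun c0 c1 n = ((\<lambda>f. J (I f)) ^^ n) (\<lambda>x. c0 + c1 * x)"

definition fund :: "real \<Rightarrow> real \<Rightarrow> real \<Rightarrow> real \<Rightarrow> real" where
  "fund c0 c1 l x = (\<Sum>n. (- l) ^ n * term_fun c0 c1 n x)"

definition fund_deriv :: "real \<Rightarrow> real \<Rightarrow> real \<Rightarrow> real \<Rightarrow> real" where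
  "fund_deriv c0 c1 l x = c1 - l * I (fund c0 c1 l) x"

lemma measure_mu_le: "measure \<mu> {0..x} \<le> 1" if "x \<le> 1"
  using finite_measure_mono[of "{0..x}" "{0..1}"] that mass_mu by auto

context
  fixes c0 c1 :: real
  assumes c: "0 \<le> c0" "0 \<le> c1" "c0 + c1 \<le> 1"
begin

lemma term_fun_Suc: "term_fun c0 c1 (Suc n) = J (I (term_fun c0 c1 n))"
  by (simp add: term_fun_def)

lemma continuous_on_term_fun: "continuous_on {0..1} (term_fun c0 c1 n)"
proof (induction n)
  case 0
  show ?case by (simp add: term_fun_def) (intro continuous_intros)
next
  case (Suc n)
  then show ?case unfolding term_fun_Suc by (intro continuous_on_J continuous_on_I)
qed

text \<open>Integration against \<mu> costs nothing because its mass is at most 1, and the Lebesgue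
  integration produces \<open>x ^ Suc n / fact (Suc n)\<close>. So the exponential series dominates
  everything that follows.\<close>

lemma term_fun_bounds: "x \<in> {0..1} \<Longrightarrow> 0 \<le> term_fun c0 c1 n x \<and> term_fun c0 c1 n x \<le> x ^ n / fact n"
proof (induction n arbitrary: x)
  case 0
  have "c1 * x \<le> c1 * 1" using 0 c by (intro mult_left_mono) auto
  then show ?case using 0 c by (simp add: term_fun_def)
next
  case (Suc n)
  note co = continuous_on_term_fun[of n]
  have I: "0 \<le> I (term_fun c0 c1 n) t \<and> I (term_fun c0 c1 n) t \<le> t ^ n / fact n" if t: "t \<in> {0..1}" for t
  proof
    show "0 \<le> I (term_fun c0 c1 n) t" unfolding I_def
      by (rule set_lebesgue_integral_nonneg) (use t Suc.IH in auto)
    have "\<bar>I (term_fun c0 c1 n) t\<bar> \<le> (t ^ n / fact n) * measure \<mu> {0..t}"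
      unfolding I_def
    proof (rule abs_integral_le[OF co])
      fix x assume x: "x \<in> {0..t}"
      have "term_fun c0 c1 n x \<le> x ^ n / fact n" "0 \<le> term_fun c0 c1 n x" using Suc.IH[of x] x t by auto
      moreover have "x ^ n / fact n \<le> t ^ n / fact n" using x by (intro divide_right_mono power_mono) auto
      ultimately show "\<bar>term_fun c0 c1 n x\<bar> \<le> t ^ n / fact n" by linarith
    qed (use t in auto)
    also have "\<dots> \<le> (t ^ n / fact n) * 1" using t measure_mu_le[of t] by (intro mult_left_mono) auto
    finally show "I (term_fun c0 c1 n) t \<le> t ^ n / fact n" by simp
  qed
  have cI: "continuous_on {0..1} (I (term_fun c0 c1 n))" by (rule continuous_on_I[OF co])
  show ?case unfolding term_fun_Suc
  proof
    show "0 \<le> J (I (term_fun c0 c1 n)) x" unfolding J_def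
      by (rule set_lebesgue_integral_nonneg) (use Suc.prems I in auto)
    have "J (I (term_fun c0 c1 n)) x \<le> (LINT t:{0..x}|lborel. t ^ n / fact n)"
      unfolding J_def
    proof (rule set_integral_mono)
      show "set_integrable lborel {0..x} (I (term_fun c0 c1 n))" using Suc.prems by (intro set_integrable_lborel cI) auto
      show "set_integrable lborel {0..x} (\<lambda>t. t ^ n / fact n)"
        using Suc.prems by (intro set_integrable_lborel continuous_intros) auto
    qed (use Suc.prems I in auto)
    also have "\<dots> = x ^ Suc n / fact (Suc n)"
      using integral_power[of 0 x n] Suc.prems unfolding set_lebesgue_integral_def by (simp add: mult.commute)
    finally show "J (I (term_fun c0 c1 n)) x \<le> x ^ Suc n / fact (Suc n)" .
  qed
qed

lemma term_fun_le: "x \<in> {0..1} \<Longrightarrow> \<bar>term_fun c0 c1 n x\<bar> \<le> 1 / fact n"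
proof -
  assume x: "x \<in> {0..1}"
  have "x ^ n / fact n \<le> 1 / fact n" using x by (intro divide_right_mono power_le_one) auto
  then show ?thesis using term_fun_bounds[OF x, of n] by linarith
qed

lemma fund_term_le: "x \<in> {0..1} \<Longrightarrow> \<bar>(- l) ^ n * term_fun c0 c1 n x\<bar> \<le> inverse (fact n) * \<bar>l\<bar> ^ n"
  using mult_left_mono[OF term_fun_le[of x n], of "\<bar>l\<bar> ^ n"]
  by (simp add: abs_mult power_abs divide_inverse mult.commute)

lemma summable_fund: "x \<in> {0..1} \<Longrightarrow> summable (\<lambda>n. (- l) ^ n * term_fun c0 c1 n x)"
  by (rule summable_comparison_test'[OF summable_exp[of "\<bar>l\<bar>"]]) (use fund_term_le in simp)

lemma continuous_on_fund: "continuous_on {0..1} (fund c0 c1 l)"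
proof -
  have "uniform_limit {0..1} (\<lambda>n x. \<Sum>i<n. (- l) ^ i * term_fun c0 c1 i x) (\<lambda>x. \<Sum>i. (- l) ^ i * term_fun c0 c1 i x) sequentially"
    by (rule Weierstrass_m_test[OF _ summable_exp[of "\<bar>l\<bar>"]]) (use fund_term_le in simp)
  then show ?thesis unfolding fund_def[abs_def]
    by (rule uniform_limit_theorem[rotated]) (auto intro!: always_eventually continuous_intros continuous_on_term_fun)
qed

text \<open>Applying \<open>J\<close> after \<open>I\<close> shifts the series by one index; the
  exponential majorant permits both termwise integrations.\<close>

lemma fund_eq:
  assumes x: "x \<in> {0..1}"
  shows "fund c0 c1 l x = c0 + c1 * x - l * J (I (fund c0 c1 l)) x"
proof -
  let ?t = "\<lambda>n x. (- l) ^ n * term_fun c0 c1 n x"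
  have I_sums: "(\<lambda>n. I (?t n) t) sums I (fund c0 c1 l) t" if "t \<in> {0..1}" for t
    unfolding I_def fund_def
    by (rule integral_sums[OF _ _ _ summable_exp[of "\<bar>l\<bar>"] fund_term_le])
       (use that in \<open>auto intro!: continuous_intros continuous_on_term_fun\<close>)
  have I_le: "\<bar>I (?t n) t\<bar> \<le> inverse (fact n) * \<bar>l\<bar> ^ n" if t: "t \<in> {0..1}" for n t
  proof -
    have "\<bar>I (?t n) t\<bar> \<le> inverse (fact n) * \<bar>l\<bar> ^ n * measure \<mu> {0..t}"
      unfolding I_def using t
      by (intro abs_integral_le fund_term_le) (auto intro!: continuous_intros continuous_on_term_fun)
    also have "\<dots> \<le> inverse (fact n) * \<bar>l\<bar> ^ n * 1" using t measure_mu_le[of t] by (intro mult_left_mono) auto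
    finally show ?thesis by simp
  qed
  have "(\<lambda>n. J (I (?t n)) x) sums (LINT t:{0..x}|lborel. (\<Sum>n. I (?t n) t))"
    unfolding J_def
    by (rule lborel01.integral_sums[OF _ _ _ summable_exp[of "\<bar>l\<bar>"] I_le])
       (use x in \<open>auto intro!: continuous_on_I continuous_intros continuous_on_term_fun\<close>)
  also have "(LINT t:{0..x}|lborel. (\<Sum>n. I (?t n) t)) = J (I (fund c0 c1 l)) x"
    unfolding J_def using x sums_unique[OF I_sums] by (intro set_lebesgue_integral_cong) auto
  finally have "(\<lambda>n. J (I (?t n)) x) sums J (I (fund c0 c1 l)) x" .
  moreover have "J (I (?t n)) x = (- l) ^ n * term_fun c0 c1 (Suc n) x" for n
    unfolding term_fun_Suc I_def J_def by simp
  ultimately have "(\<lambda>n. (- l) ^ n * term_fun c0 c1 (Suc n) x) sums J (I (fund c0 c1 l)) x" by simp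
  from sums_mult[OF this, of "- l"] have "(\<lambda>n. ?t (Suc n) x) sums (- l * J (I (fund c0 c1 l)) x)"
    by (simp add: mult_ac)
  then have "(\<lambda>n. ?t n x) sums (- l * J (I (fund c0 c1 l)) x + ?t 0 x)" by (rule sums_Suc)
  from sums_unique[OF this] show ?thesis unfolding fund_def by (simp add: term_fun_def)
qed

lemma sol_fund: "sol l (fund c0 c1 l) (fund_deriv c0 c1 l)"
  and fund_0: "fund c0 c1 l 0 = c0" and fund_deriv_0: "fund_deriv c0 c1 l 0 = c1"
proof -
  show 0: "fund c0 c1 l 0 = c0" using fund_eq[of 0 l] by simp
  show 1: "fund_deriv c0 c1 l 0 = c1" by (simp add: fund_deriv_def)
  show "sol l (fund c0 c1 l) (fund_deriv c0 c1 l)"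
    unfolding sol_def
  proof (intro conjI ballI)
    show "continuous_on {0..1} (fund c0 c1 l)" by (rule continuous_on_fund)
    fix x :: real assume x: "x \<in> {0..1}"
    show "fund_deriv c0 c1 l x = fund_deriv c0 c1 l 0 - l * I (fund c0 c1 l) x"
      unfolding 1 by (simp add: fund_deriv_def)
    have "J (fund_deriv c0 c1 l) x = (LINT t:{0..x}|lborel. c1) - (LINT t:{0..x}|lborel. l * I (fund c0 c1 l) t)"
      unfolding J_def fund_deriv_def using x
      by (intro set_integral_diff(2)) (auto intro!: set_integrable_lborel continuous_intros continuous_on_I continuous_on_fund)
    also have "(LINT t:{0..x}|lborel. c1) = c1 * x"
      using x unfolding set_lebesgue_integral_def by simp
    also have "(LINT t:{0..x}|lborel. l * I (fund c0 c1 l) t) = l * J (I (fund c0 c1 l)) x"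
      unfolding J_def by simp
    finally show "fund c0 c1 l x = fund c0 c1 l 0 + J (fund_deriv c0 c1 l) x"
      unfolding 0 using fund_eq[OF x, of l] by simp
  qed
qed

lemma abs_fund_le: "x \<in> {0..1} \<Longrightarrow> \<bar>fund c0 c1 l x\<bar> \<le> exp \<bar>l\<bar>"
proof -
  assume x: "x \<in> {0..1}"
  have "\<bar>fund c0 c1 l x\<bar> \<le> (\<Sum>n. inverse (fact n) * \<bar>l\<bar> ^ n)"
    unfolding fund_def real_norm_def[symmetric]
    by (rule norm_suminf_le[OF _ summable_exp]) (use fund_term_le[OF x] in simp)
  then show ?thesis by (simp add: exp_def divide_inverse)
qed

text \<open>For \<open>l\<close> at most 0 all terms of the series are nonnegative, so the term of
  index 0 is a lower bound. This is the source of positivity on the negative half-line.\<close>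

lemma fund_ge:
  assumes x: "x \<in> {0..1}" and l: "l \<le> 0"
  shows "fund c0 c1 l x \<ge> c0 + c1 * x"
proof -
  have "(\<Sum>n\<in>{0::nat}. (- l) ^ n * term_fun c0 c1 n x) \<le> (\<Sum>n. (- l) ^ n * term_fun c0 c1 n x)"
    by (rule sum_le_suminf[OF summable_fund[OF x]]) (use term_fun_bounds[OF x] l in auto)
  then show ?thesis unfolding fund_def by (simp add: term_fun_def)
qed

lemma abs_power_diff_le:
  fixes z w :: real
  assumes "\<bar>z\<bar> \<le> R" "\<bar>w\<bar> \<le> R"
  shows "\<bar>z ^ n - w ^ n\<bar> \<le> real n * R ^ (n - 1) * \<bar>z - w\<bar>"
proof (induction n)
  case (Suc n)
  have R: "R \<ge> 0" using assms by linarith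
  have "z ^ Suc n - w ^ Suc n = z * (z ^ n - w ^ n) + w ^ n * (z - w)" by (simp add: algebra_simps)
  then have "\<bar>z ^ Suc n - w ^ Suc n\<bar> \<le> \<bar>z\<bar> * \<bar>z ^ n - w ^ n\<bar> + \<bar>w\<bar> ^ n * \<bar>z - w\<bar>"
    by (metis abs_mult abs_triangle_ineq power_abs)
  also have "\<dots> \<le> R * (real n * R ^ (n - 1) * \<bar>z - w\<bar>) + R ^ n * \<bar>z - w\<bar>"
    using assms R Suc.IH by (intro add_mono mult_mono power_mono) auto
  also have "\<dots> = real (Suc n) * R ^ (Suc n - 1) * \<bar>z - w\<bar>"
    by (cases n) (simp_all add: algebra_simps)
  finally show ?case .
qed simp

text \<open>The Lipschitz constants of the single terms are \<open>n * R ^ (n - 1) / fact n\<close>,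
  and these sum to \<open>exp R\<close> again.\<close>

lemma fund_lipschitz:
  assumes x: "x \<in> {0..1}" and l: "\<bar>l\<bar> \<le> R" "\<bar>l'\<bar> \<le> R"
  shows "\<bar>fund c0 c1 l x - fund c0 c1 l' x\<bar> \<le> exp R * \<bar>l - l'\<bar>"
proof -
  let ?d = "\<lambda>n. ((- l) ^ n - (- l') ^ n) * term_fun c0 c1 n x"
  let ?b = "\<lambda>n. real n * R ^ (n - 1) / fact n * \<bar>l - l'\<bar>"
  have s: "(\<lambda>n. R ^ n / fact n) sums exp R"
    using exp_converges[of R] by (simp add: divide_inverse mult.commute)
  have "(\<lambda>n. real (Suc n) * R ^ (Suc n - 1) / fact (Suc n)) sums exp R"
    using s by (simp del: of_nat_Suc)
  then have "(\<lambda>n. real n * R ^ (n - 1) / fact n) sums (exp R + real 0 * R ^ (0 - 1) / fact 0)"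
    by (rule sums_Suc)
  then have b: "?b sums (exp R * \<bar>l - l'\<bar>)" using sums_mult2 by force
  have le: "norm (?d n) \<le> ?b n" for n
  proof -
    have "\<bar>(- l) ^ n - (- l') ^ n\<bar> * \<bar>term_fun c0 c1 n x\<bar> \<le> (real n * R ^ (n - 1) * \<bar>- l - - l'\<bar>) * (1 / fact n)"
      using l by (intro mult_mono abs_power_diff_le term_fun_le x) auto
    then show ?thesis by (simp add: abs_mult abs_minus_commute)
  qed
  have "fund c0 c1 l x - fund c0 c1 l' x = (\<Sum>n. ?d n)"
    unfolding fund_def by (subst suminf_diff) (use summable_fund[OF x] in \<open>auto simp: left_diff_distrib\<close>)
  also have "\<bar>\<dots>\<bar> \<le> (\<Sum>n. ?b n)"
    by (rule norm_suminf_le[OF le sums_summable[OF b], unfolded real_norm_def])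
  also have "\<dots> = exp R * \<bar>l - l'\<bar>" using sums_unique[OF b] by simp
  finally show ?thesis .
qed

lemma isCont_fund: "x \<in> {0..1} \<Longrightarrow> isCont (\<lambda>l. fund c0 c1 l x) l"
proof -
  assume x: "x \<in> {0..1}"
  have "(exp (\<bar>l\<bar> + 1))-lipschitz_on (ball l 1) (\<lambda>l. fund c0 c1 l x)"
  proof (rule lipschitz_onI)
    fix a b assume "a \<in> ball l 1" "b \<in> ball l 1"
    then have "\<bar>a\<bar> \<le> \<bar>l\<bar> + 1" "\<bar>b\<bar> \<le> \<bar>l\<bar> + 1" by (auto simp: dist_real_def)
    from fund_lipschitz[OF x this] show "dist (fund c0 c1 a x) (fund c0 c1 b x) \<le> exp (\<bar>l\<bar> + 1) * dist a b"
      by (simp add: dist_real_def)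
  qed simp
  then have "continuous_on (ball l 1) (\<lambda>l. fund c0 c1 l x)" by (rule lipschitz_on_continuous_on)
  then show ?thesis by (simp add: continuous_on_eq_continuous_at)
qed

lemma isCont_fund_deriv:
  assumes x: "x \<in> {0..1}"
  shows "isCont (\<lambda>l. fund_deriv c0 c1 l x) l"
proof -
  have "isCont (\<lambda>l. I (fund c0 c1 l) x) l"
  proof -
    have "(exp (\<bar>l\<bar> + 1))-lipschitz_on (ball l 1) (\<lambda>l. I (fund c0 c1 l) x)"
    proof (rule lipschitz_onI)
      fix a b assume ab: "a \<in> ball l 1" "b \<in> ball l 1"
      then have ab': "\<bar>a\<bar> \<le> \<bar>l\<bar> + 1" "\<bar>b\<bar> \<le> \<bar>l\<bar> + 1" by (auto simp: dist_real_def)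
      have "I (fund c0 c1 a) x - I (fund c0 c1 b) x = (LINT t:{0..x}|\<mu>. fund c0 c1 a t - fund c0 c1 b t)"
        unfolding I_def using x by (subst set_integral_diff(2)) (auto intro!: set_integrable_mu continuous_on_fund)
      also have "\<bar>\<dots>\<bar> \<le> exp (\<bar>l\<bar> + 1) * \<bar>a - b\<bar> * measure \<mu> {0..x}"
        using x ab' by (intro abs_integral_le fund_lipschitz continuous_intros continuous_on_fund) auto
      also have "\<dots> \<le> exp (\<bar>l\<bar> + 1) * \<bar>a - b\<bar> * 1"
        using measure_mu_le[of x] x by (intro mult_left_mono) auto
      finally show "dist (I (fund c0 c1 a) x) (I (fund c0 c1 b) x) \<le> exp (\<bar>l\<bar> + 1) * dist a b"
        by (simp add: dist_real_def)
    qed simp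
    then have "continuous_on (ball l 1) (\<lambda>l. I (fund c0 c1 l) x)" by (rule lipschitz_on_continuous_on)
    then show ?thesis by (simp add: continuous_on_eq_continuous_at)
  qed
  then show ?thesis unfolding fund_deriv_def by (intro continuous_intros)
qed

end

text \<open>The entries of the transfer matrix from 0 to \<open>x\<close>: \<open>A\<close> and
  \<open>B\<close> are the values, \<open>C\<close> and \<open>D\<close> the derivatives of the
  solutions with initial data (1, 0) and (0, 1). The zeros of \<open>C l 1\<close> will be the
  Neumann eigenvalues.\<close>

abbreviation "A \<equiv> fund 1 0"
abbreviation "B \<equiv> fund 0 1"
abbreviation "C \<equiv> fund_deriv 1 0"
abbreviation "D \<equiv> fund_deriv 0 1"

lemma sol_AC: "sol l (A l) (C l)" and A_0 [simp]: "A l 0 = 1" and C_0 [simp]: "C l 0 = 0"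
  using sol_fund[of 1 0 l] fund_0[of 1 0 l] fund_deriv_0[of 1 0 l] by auto

lemma sol_BD: "sol l (B l) (D l)" and B_0 [simp]: "B l 0 = 0" and D_0 [simp]: "D l 0 = 1"
  using sol_fund[of 0 1 l] fund_0[of 0 1 l] fund_deriv_0[of 0 1 l] by auto

lemma det_fund: "x \<in> {0..1} \<Longrightarrow> A l x * D l x - C l x * B l x = 1"
  using sol_wronskian[OF sol_AC[of l] sol_BD[of l]] by simp

text \<open>For equal parameters Wronskians do not depend on the point. Those with the two
  fundamental solutions return the initial data, and the resulting linear system has determinant 1.
  This also yields uniqueness of the initial value problem without a Gronwall estimate.\<close>

lemma sol_transfer:
  assumes s: "sol l y v" and x: "x \<in> {0..1}"
  shows "y x = A l x * y 0 + B l x * v 0" "v x = C l x * y 0 + D l x * v 0"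
proof -
  have 1: "A l x * v x - C l x * y x = v 0"
    using sol_wronskian[OF sol_AC[of l] s x] by simp
  have 2: "B l x * v x - D l x * y x = - y 0"
    using sol_wronskian[OF sol_BD[of l] s x] by simp
  have d: "A l x * D l x - C l x * B l x = 1" by (rule det_fund[OF x])
  have "y x = y x * (A l x * D l x - C l x * B l x)" by (simp add: d)
  also have "\<dots> = - A l x * (B l x * v x - D l x * y x) + B l x * (A l x * v x - C l x * y x)"
    by (simp add: algebra_simps)
  also have "\<dots> = A l x * y 0 + B l x * v 0" unfolding 1 2 by simp
  finally show "y x = A l x * y 0 + B l x * v 0" .
  have "v x = v x * (A l x * D l x - C l x * B l x)" by (simp add: d)
  also have "\<dots> = - C l x * (B l x * v x - D l x * y x) + D l x * (A l x * v x - C l x * y x)"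
    by (simp add: algebra_simps)
  also have "\<dots> = C l x * y 0 + D l x * v 0" unfolding 1 2 by simp
  finally show "v x = C l x * y 0 + D l x * v 0" .
qed

text \<open>A solution vanishing \<mu>-almost everywhere does not feel the mass: its derivative is
  constant and it is affine.\<close>

lemma sol_square_integral_zero:
  assumes s: "sol l y v" and q: "q \<in> {0..1}" and z: "I (\<lambda>t. y t * y t) q = 0" and x: "x \<in> {0..q}"
  shows "v x = v 0" "y x = y 0 + v 0 * x"
proof -
  have cy: "continuous_on {0..1} y" by (rule sol_cont_y[OF s])
  have int: "integrable \<mu> (\<lambda>t. indicator {0..q} t *\<^sub>R (y t * y t))"
    using set_integrable_mu[of "\<lambda>t. y t * y t" 0 q] cy q unfolding set_integrable_def by (auto intro: continuous_intros)
  have "AE t in \<mu>. indicator {0..q} t *\<^sub>R (y t * y t) = 0"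
    using z integral_nonneg_eq_0_iff_AE[OF int] unfolding I_def set_lebesgue_integral_def by simp
  then have ae: "AE t in \<mu>. t \<in> {0..q} \<longrightarrow> y t = 0" by eventually_elim auto
  have v: "v x = v 0" if x: "x \<in> {0..q}" for x
  proof -
    have "AE t in \<mu>. indicator {0..x} t *\<^sub>R y t = 0"
      using ae by eventually_elim (use x in \<open>auto simp: indicator_def\<close>)
    then have "I y x = 0" unfolding I_def set_lebesgue_integral_def by (rule integral_eq_zero_AE)
    moreover have "x \<in> {0..1}" using x q by auto
    ultimately show ?thesis using sol_v[OF s, of x] by simp
  qed
  show "v x = v 0" by (rule v[OF x])
  have "J v x = (LINT t:{0..x}|lborel. v 0)"
    unfolding J_def
  proof (intro set_lebesgue_integral_cong allI impI)
    fix t assume "t \<in> {0..x}"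
    then show "v t = v 0" using x by (intro v) auto
  qed simp
  also have "\<dots> = v 0 * x" using x unfolding set_lebesgue_integral_def by simp
  finally have "J v x = v 0 * x" .
  moreover have "x \<in> {0..1}" using x q by auto
  ultimately show "y x = y 0 + v 0 * x" using sol_y[OF s, of x] by simp
qed

lemma I_const: "I (\<lambda>t. c) x = c * measure \<mu> {0..x}"
  unfolding I_def set_lebesgue_integral_def by (simp add: mult.commute)

text \<open>Otherwise the solution would be affine; a vanishing derivative at one end makes it a
  constant, nonzero by \<open>yq\<close>, and a nonzero constant has positive square integral over
  positive mass.\<close>

lemma I_square_pos:
  assumes s: "sol l y v" and q: "q \<in> {0..1}" "measure \<mu> {0..q} > 0" and v: "v 0 = 0 \<or> v q = 0" and yq: "y 0 \<noteq> 0 \<or> y q \<noteq> 0"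
  shows "I (\<lambda>t. y t * y t) q > 0"
proof (rule ccontr)
  assume "\<not> I (\<lambda>t. y t * y t) q > 0"
  moreover have "I (\<lambda>t. y t * y t) q \<ge> 0" unfolding I_def by (rule set_lebesgue_integral_nonneg) simp
  ultimately have z: "I (\<lambda>t. y t * y t) q = 0" by simp
  have q': "q \<in> {0..q}" using q by simp
  have v0: "v 0 = 0" using v sol_square_integral_zero(1)[OF s q(1) z q'] by auto
  have y0: "y x = y 0" if "x \<in> {0..q}" for x using sol_square_integral_zero(2)[OF s q(1) z that] v0 by simp
  have "y 0 \<noteq> 0" using yq y0[OF q'] by metis
  have "I (\<lambda>t. y t * y t) q = I (\<lambda>t. y 0 * y 0) q"
    unfolding I_def
  proof (intro set_lebesgue_integral_cong allI impI)
    fix t assume t: "t \<in> {0..q}"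
    show "y t * y t = y 0 * y 0" by (rule arg_cong2[where f = "(*)", OF y0[OF t] y0[OF t]])
  qed simp
  then have "y 0 * y 0 * measure \<mu> {0..q} = 0" using z by (simp add: I_const)
  then show False using q \<open>y 0 \<noteq> 0\<close> by simp
qed

section \<open>Quotients of solution data as Herglotz functions\<close>

lemma abs_AB_le: "x \<in> {0..1} \<Longrightarrow> \<bar>A l x\<bar> \<le> exp \<bar>l\<bar>" "x \<in> {0..1} \<Longrightarrow> \<bar>B l x\<bar> \<le> exp \<bar>l\<bar>"
  by (auto intro: abs_fund_le)

lemma C_neg_pos:
  assumes "l < 0" "x \<in> {0..1}" "measure \<mu> {0..x} > 0"
  shows "C l x > 0"
proof -
  have "1 * measure \<mu> {0..x} \<le> I (A l) x"
    unfolding I_const[symmetric] I_def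
    using assms fund_ge[of 1 0 _ l]
    by (intro set_integral_mono set_integrable_mu continuous_on_fund) (auto intro!: continuous_on_fund)
  then have "I (A l) x > 0" using assms by simp
  then show ?thesis using assms by (simp add: fund_deriv_def mult_neg_pos)
qed

text \<open>The quotient of value and derivative at \<open>q\<close> of the solution satisfying the
  Neumann condition at 0. Its Wronskian at 0 vanishes for any two parameters, which leaves the
  integral term only.\<close>

lemma herglotz_pair_right:
  assumes q: "q \<in> {0..1}" "measure \<mu> {0..q} > 0"
  shows "herglotz_pair \<mu> (\<lambda>l. A l q) (\<lambda>l. C l q) (\<lambda>l x. indicator {0..q} x *\<^sub>R A l x)"
proof
  have sq: "(\<integral>x. indicator {0..q} x *\<^sub>R A l x * indicator {0..q} x *\<^sub>R A l' x \<partial>\<mu>) = I (\<lambda>t. A l t * A l' t) q" for l l'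
    unfolding I_def set_lebesgue_integral_def by (rule Bochner_Integration.integral_cong) (auto simp: indicator_def)
  show "(\<lambda>x. indicator {0..q} x *\<^sub>R A l x) \<in> borel_measurable \<mu>" for l
    using set_integrable_mu[of "A l" 0 q] q sol_cont_y[OF sol_AC] unfolding set_integrable_def by auto
  show "isCont (\<lambda>l. indicator {0..q} x *\<^sub>R A l x) l" for l x
    using q by (cases "x \<in> {0..q}") (auto intro!: isCont_fund)
  show "\<exists>Ba. \<forall>l x. \<bar>l\<bar> \<le> R \<longrightarrow> \<bar>indicator {0..q} x *\<^sub>R A l x\<bar> \<le> Ba" for R
  proof (intro exI[of _ "exp R"] allI impI)
    fix l x :: real assume l: "\<bar>l\<bar> \<le> R"
    show "\<bar>indicator {0..q} x *\<^sub>R A l x\<bar> \<le> exp R"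
    proof (cases "x \<in> {0..q}")
      case True
      then have "\<bar>A l x\<bar> \<le> exp \<bar>l\<bar>" using q by (intro abs_AB_le) auto
      also have "\<dots> \<le> exp R" using l by simp
      finally show ?thesis using True by simp
    qed simp
  qed
  show "isCont (\<lambda>l. A l q) l" "isCont (\<lambda>l. C l q) l" for l
    using q by (auto intro: isCont_fund isCont_fund_deriv)
  show "A l q * C l' q - C l q * A l' q = (l - l') * (\<integral>x. indicator {0..q} x *\<^sub>R A l x * indicator {0..q} x *\<^sub>R A l' x \<partial>\<mu>)" for l l'
    unfolding sq using sol_wronskian[OF sol_AC[of l] sol_AC[of l'] q(1)] by simp
  show "0 < (\<integral>x. indicator {0..q} x *\<^sub>R A l x * indicator {0..q} x *\<^sub>R A l x \<partial>\<mu>)" for l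
    unfolding sq by (rule I_square_pos[OF sol_AC[of l] q]) auto
  show "C l q \<noteq> 0 \<and> 0 < A l q / C l q" if "l < 0" for l
    using C_neg_pos[OF that q] fund_ge[of 1 0 q l] q that by auto
qed

text \<open>The combination \<open>u\<close> of \<open>A\<close> and \<open>B\<close> is the
  solution with value 1 and derivative 0 at the right end; at 0 it has value \<open>D l 1\<close>
  and derivative \<open>- C l 1\<close>. So this is the mirror image of
  \<open>herglotz_pair_right\<close>, with the Wronskian evaluated at the other end.\<close>

lemma herglotz_pair_left:
  "herglotz_pair \<mu> (\<lambda>l. D l 1) (\<lambda>l. C l 1) (\<lambda>l x. indicator {0..1} x *\<^sub>R (D l 1 * A l x + - C l 1 * B l x))"
proof
  define u du where "u l x = D l 1 * A l x + - C l 1 * B l x" and "du l x = D l 1 * C l x + - C l 1 * D l x" for l x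
  have sol: "sol l (u l) (du l)" for l
    unfolding u_def[abs_def] du_def[abs_def] by (rule sol_lincomb[OF sol_AC sol_BD])
  have ends: "u l 0 = D l 1" "du l 0 = - C l 1" "u l 1 = 1" "du l 1 = 0" for l
    using det_fund[of 1 l] by (simp_all add: u_def du_def algebra_simps)
  have sq: "(\<integral>x. indicator {0..1} x *\<^sub>R u l x * indicator {0..1} x *\<^sub>R u l' x \<partial>\<mu>) = I (\<lambda>t. u l t * u l' t) 1" for l l'
    unfolding I_def set_lebesgue_integral_def by (rule Bochner_Integration.integral_cong) (auto simp: indicator_def)
  have cont1: "isCont (\<lambda>l. D l 1) l" "isCont (\<lambda>l. C l 1) l" for l
    by (auto intro: isCont_fund_deriv)
  show "isCont (\<lambda>l. D l 1) l" "isCont (\<lambda>l. C l 1) l" for l by (rule cont1)+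
  show "(\<lambda>x. indicator {0..1} x *\<^sub>R (D l 1 * A l x + - C l 1 * B l x)) \<in> borel_measurable \<mu>" for l
    using set_integrable_mu[OF sol_cont_y[OF sol], of 0 1 l] unfolding set_integrable_def u_def by auto
  show "isCont (\<lambda>l. indicator {0..1} x *\<^sub>R (D l 1 * A l x + - C l 1 * B l x)) l" for l x :: real
    by (cases "x \<in> {0..1}") (auto intro!: continuous_intros isCont_fund cont1)
  show "\<exists>K. \<forall>l x. \<bar>l\<bar> \<le> R \<longrightarrow> \<bar>indicator {0..1} x *\<^sub>R (D l 1 * A l x + - C l 1 * B l x)\<bar> \<le> K" for R
  proof -
    have "continuous_on {-R..R} (\<lambda>l. \<bar>D l 1\<bar> + \<bar>C l 1\<bar>)"
      by (intro continuous_intros continuous_at_imp_continuous_on ballI cont1)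
    then have "bounded ((\<lambda>l. \<bar>D l 1\<bar> + \<bar>C l 1\<bar>) ` {-R..R})"
      using compact_continuous_image compact_imp_bounded compact_Icc by blast
    then obtain K where K: "\<forall>l\<in>{-R..R}. \<bar>D l 1\<bar> + \<bar>C l 1\<bar> \<le> K" unfolding bounded_iff by auto
    show ?thesis
    proof (intro exI[of _ "\<bar>K\<bar> * exp R"] allI impI)
      fix l x :: real assume l: "\<bar>l\<bar> \<le> R"
      show "\<bar>indicator {0..1} x *\<^sub>R (D l 1 * A l x + - C l 1 * B l x)\<bar> \<le> \<bar>K\<bar> * exp R"
      proof (cases "x \<in> {0..1}")
        case True
        have e: "exp \<bar>l\<bar> \<le> exp R" using l by simp
        have "\<bar>D l 1 * A l x + - C l 1 * B l x\<bar> \<le> \<bar>D l 1\<bar> * \<bar>A l x\<bar> + \<bar>C l 1\<bar> * \<bar>B l x\<bar>"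
          using abs_triangle_ineq[of "D l 1 * A l x" "- C l 1 * B l x"] by (simp add: abs_mult)
        also have "\<dots> \<le> \<bar>D l 1\<bar> * exp R + \<bar>C l 1\<bar> * exp R"
          by (intro add_mono mult_left_mono order_trans[OF abs_AB_le(1)[OF True] e] order_trans[OF abs_AB_le(2)[OF True] e]) auto
        also have "\<dots> = (\<bar>D l 1\<bar> + \<bar>C l 1\<bar>) * exp R" by (simp add: algebra_simps)
        also have "\<dots> \<le> \<bar>K\<bar> * exp R"
        proof (rule mult_right_mono)
          have "l \<in> {-R..R}" using l by auto
          then have "\<bar>D l 1\<bar> + \<bar>C l 1\<bar> \<le> K" using K by blast
          then show "\<bar>D l 1\<bar> + \<bar>C l 1\<bar> \<le> \<bar>K\<bar>" using abs_ge_self[of K] by (rule order_trans)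
        qed simp
        finally show ?thesis using True by simp
      qed simp
    qed
  qed
  show "D l 1 * C l' 1 - C l 1 * D l' 1 = (l - l') *
     (\<integral>x. indicator {0..1} x *\<^sub>R (D l 1 * A l x + - C l 1 * B l x) * indicator {0..1} x *\<^sub>R (D l' 1 * A l' x + - C l' 1 * B l' x) \<partial>\<mu>)" for l l'
    using sol_wronskian[OF sol[of l] sol[of l'], of 1] sq[of l l'] unfolding ends u_def by simp
  show "0 < (\<integral>x. indicator {0..1} x *\<^sub>R (D l 1 * A l x + - C l 1 * B l x) * indicator {0..1} x *\<^sub>R (D l 1 * A l x + - C l 1 * B l x) \<partial>\<mu>)" for l
  proof -
    have "I (\<lambda>t. u l t * u l t) 1 > 0"
      by (rule I_square_pos[OF sol[of l]]) (use mass_mu ends in auto)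
    then show ?thesis using sq[of l l] unfolding u_def by simp
  qed
  show "C l 1 \<noteq> 0 \<and> 0 < D l 1 / C l 1" if "l < 0" for l
  proof -
    have "I (B l) 1 \<ge> 0" unfolding I_def using fund_ge[of 0 1 _ l] that by (intro set_lebesgue_integral_nonneg) force+
    then have "D l 1 > 0" using that unfolding fund_deriv_def
      by (smt (verit) mult_nonpos_nonneg)
    then show ?thesis using C_neg_pos[OF that, of 1] mass_mu by simp
  qed
qed

section \<open>Neumann eigenvalues and self-similar pieces\<close>

text \<open>Derivatives of W21 functions are only Lebesgue measurable, while Fubini is available on
  the product of \<open>lborel\<close> and \<mu>; the integrand is therefore replaced by a Borel
  representative \<open>w'\<close>.\<close>

lemma by_parts_lebesgue:
  assumes w: "set_integrable lebesgue {0..1} w" and f: "continuous_on {0..1} f"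
  shows "(LINT t:{0..1}|\<mu>. f t * (LINT x:{t..1}|lebesgue. w x)) = (LINT x:{0..1}|lebesgue. w x * I f x)"
proof -
  have int: "integrable lebesgue (\<lambda>x. indicator {0..1} x *\<^sub>R w x)" using w unfolding set_integrable_def .
  then obtain w' where w': "w' \<in> borel_measurable lborel" "AE x in lborel. indicator {0..1} x *\<^sub>R w x = w' x"
    using completion_ex_borel_measurable_real[of "\<lambda>x. indicator {0..1} x *\<^sub>R w x" lborel] by auto
  have [measurable]: "w' \<in> borel_measurable borel" using w'(1) by simp
  have ae: "AE x in lebesgue. indicator {0..1} x *\<^sub>R w x = w' x" using w'(2) by (rule AE_completion)
  have conv: "(\<integral>x. indicator A x *\<^sub>R (w x * h x) \<partial>lebesgue) = (\<integral>x. indicator A x *\<^sub>R (w' x * h x) \<partial>lborel)"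
    if A: "A \<in> sets borel" "A \<subseteq> {0..1}" and h: "(\<lambda>x. indicator {0..1} x *\<^sub>R h x) \<in> borel_measurable borel" for A :: "real set" and h
  proof -
    have "(\<integral>x. indicator A x *\<^sub>R (w x * h x) \<partial>lebesgue) = (\<integral>x. indicator A x *\<^sub>R (w' x * (indicator {0..1} x *\<^sub>R h x)) \<partial>lebesgue)"
    proof (rule integral_cong_AE)
      have eq: "indicator A x *\<^sub>R (w x * h x) = indicator A x *\<^sub>R ((indicator {0..1} x *\<^sub>R w x) * (indicator {0..1} x *\<^sub>R h x))" for x
        using A(2) by (auto simp: indicator_def)
      have mh: "(\<lambda>x. indicator {0..1} x *\<^sub>R h x) \<in> borel_measurable lebesgue"
        using h by (intro measurable_completion) simp
      have mA: "(\<lambda>x. indicator A x :: real) \<in> borel_measurable lebesgue"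
        using A(1) by (intro measurable_completion) simp
      have mw: "w' \<in> borel_measurable lebesgue" using w'(1) by (rule measurable_completion)
      show "(\<lambda>x. indicator A x *\<^sub>R (w x * h x)) \<in> borel_measurable lebesgue"
        unfolding eq by (intro borel_measurable_scaleR borel_measurable_times mA mh borel_measurable_integrable[OF int])
      show "(\<lambda>x. indicator A x *\<^sub>R (w' x * (indicator {0..1} x *\<^sub>R h x))) \<in> borel_measurable lebesgue"
        by (intro borel_measurable_scaleR borel_measurable_times mA mh mw)
      show "AE x in lebesgue. indicator A x *\<^sub>R (w x * h x) = indicator A x *\<^sub>R (w' x * (indicator {0..1} x *\<^sub>R h x))"
        using ae by eventually_elim (simp only: eq)
    qed
    also have "\<dots> = (\<integral>x. indicator A x *\<^sub>R (w' x * (indicator {0..1} x *\<^sub>R h x)) \<partial>lborel)"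
      using A(1) h by (intro integral_completion) simp
    also have "\<dots> = (\<integral>x. indicator A x *\<^sub>R (w' x * h x) \<partial>lborel)"
      using A(2) by (intro Bochner_Integration.integral_cong) (auto simp: indicator_def)
    finally show ?thesis .
  qed
  have "integrable lebesgue w'"
    using int ae by (subst integrable_cong_AE[where g = "\<lambda>x. indicator {0..1} x *\<^sub>R w x"])
      (auto intro: measurable_completion[OF w'(1)] elim: eventually_mono)
  then have "integrable lborel w'" using integrable_completion[OF w'(1)] by simp
  then have "integrable lborel (\<lambda>x. indicator {0..1} x *\<^sub>R w' x)"
    using integrable_mult_indicator[of "{0..1}" lborel w'] by simp
  then have w'_int: "set_integrable lborel {0..1} w'" unfolding set_integrable_def .
  have "(LINT t:{0..1}|\<mu>. f t * (LINT x:{t..1}|lebesgue. w x)) = (LINT t:{0..1}|\<mu>. f t * (LINT x:{t..1}|lborel. w' x))"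
  proof (rule set_lebesgue_integral_cong)
    show "\<forall>t. t \<in> {0..1} \<longrightarrow> f t * (LINT x:{t..1}|lebesgue. w x) = f t * (LINT x:{t..1}|lborel. w' x)"
      using conv[of "{t..1}" "\<lambda>_. 1" for t] unfolding set_lebesgue_integral_def by auto
  qed simp
  also have "\<dots> = (LINT x:{0..1}|lborel. w' x * I f x)"
    unfolding I_def by (rule integral_by_parts_lborel[OF w'_int]) (use f set_integrable_mu in auto)
  also have "\<dots> = (LINT x:{0..1}|lebesgue. w x * I f x)"
    using conv[of "{0..1}" "I f"] borel_measurable_continuous_on_indicator[OF _ continuous_on_I[OF f]]
    unfolding set_lebesgue_integral_def by auto
  finally show ?thesis .
qed

lemma lebesgue_integral_eq_lborel:
  fixes f :: "real \<Rightarrow> real"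
  assumes "continuous_on {0..1} f" "0 \<le> p" "q \<le> 1"
  shows "(LINT t:{p..q}|lebesgue. f t) = (LINT t:{p..q}|lborel. f t)"
proof -
  have "(\<lambda>t. indicator {p..q} t *\<^sub>R f t) \<in> borel_measurable lborel"
    using set_integrable_lborel[OF assms] unfolding set_integrable_def by auto
  then show ?thesis unfolding set_lebesgue_integral_def by (rule integral_completion)
qed

lemma set_integrable_lebesgue:
  fixes f :: "real \<Rightarrow> real"
  assumes "continuous_on {0..1} f"
  shows "set_integrable lebesgue {0..1} f"
  using absolutely_integrable_continuous_real[OF assms] .

lemma W21_deriv_integrable:
  assumes "W21 y y'"
  shows "set_integrable lebesgue {0..1} y'"
proof -
  have b: "set_integrable lebesgue {0..1} (\<lambda>x. 1 + (y' x)\<^sup>2)"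
    using assms unfolding W21_def
    by (intro set_integral_add(1)) (auto intro!: set_integrable_lebesgue)
  show ?thesis
  proof (rule set_integrable_bound[OF b])
    show "set_borel_measurable lebesgue {0..1} y'" using assms unfolding W21_def by simp
    show "AE x in lebesgue. x \<in> {0..1} \<longrightarrow> norm (y' x) \<le> norm (1 + (y' x)\<^sup>2)"
    proof (intro AE_I2 impI)
      fix x
      have "0 \<le> (\<bar>y' x\<bar> - 1)\<^sup>2" by simp
      then have "2 * \<bar>y' x\<bar> \<le> 1 + (y' x)\<^sup>2" by (simp add: power2_diff)
      then show "norm (y' x) \<le> norm (1 + (y' x)\<^sup>2)" by simp
    qed
  qed
qed

lemma W21_eq: "W21 y y' \<Longrightarrow> x \<in> {0..1} \<Longrightarrow> y x = y 0 + (LINT t:{0..x}|lebesgue. y' t)"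
  unfolding W21_def by blast

lemma W21_continuous:
  assumes "W21 y y'"
  shows "continuous_on {0..1} y"
proof -
  have "continuous_on {0..1} (\<lambda>x. y 0 + (LINT t:{0..x}|lebesgue. y' t))"
    by (intro continuous_intros continuous_on_primitive W21_deriv_integrable[OF assms]) auto
  then show ?thesis
    by (rule continuous_on_eq) (rule W21_eq[OF assms, symmetric])
qed

lemma W21_tail:
  assumes "W21 y y'" "t \<in> {0..1}"
  shows "(LINT x:{t..1}|lebesgue. y' x) = y 1 - y t"
proof -
  have i: "set_integrable lebesgue {0..t} y'" "set_integrable lebesgue {t..1} y'"
    by (rule set_integrable_subset[OF W21_deriv_integrable[OF assms(1)]]; use assms in auto)+
  have e: "{0..1} = {0..t} \<union> {t..1}" using assms by auto
  have "AE x in lebesgue. x \<notin> {t}" by (rule AE_not_in) auto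
  then have "AE x in lebesgue. \<not> (x \<in> {0..t} \<and> x \<in> {t..1})" by eventually_elim auto
  then have "(LINT x:{0..1}|lebesgue. y' x) = (LINT x:{0..t}|lebesgue. y' x) + (LINT x:{t..1}|lebesgue. y' x)"
    unfolding e using i by (intro set_integral_Un_AE) auto
  moreover have "y 1 = y 0 + (LINT x:{0..1}|lebesgue. y' x)" by (rule W21_eq[OF assms(1)]) simp
  moreover have "y t = y 0 + (LINT x:{0..t}|lebesgue. y' x)" by (rule W21_eq[OF assms])
  ultimately show ?thesis by linarith
qed

lemma W21_by_parts:
  assumes \<eta>: "W21 \<eta> \<eta>'" and f: "continuous_on {0..1} f"
  shows "(LINT x:{0..1}|lebesgue. \<eta>' x * I f x) = \<eta> 1 * I f 1 - (LINT t:{0..1}|\<mu>. f t * \<eta> t)"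
proof -
  have "(LINT x:{0..1}|lebesgue. \<eta>' x * I f x) = (LINT t:{0..1}|\<mu>. f t * (LINT x:{t..1}|lebesgue. \<eta>' x))"
    by (rule by_parts_lebesgue[OF W21_deriv_integrable[OF \<eta>] f, symmetric])
  also have "\<dots> = (LINT t:{0..1}|\<mu>. \<eta> 1 * f t - f t * \<eta> t)"
  proof (intro set_lebesgue_integral_cong allI impI)
    fix t :: real assume t: "t \<in> {0..1}"
    show "f t * (LINT x:{t..1}|lebesgue. \<eta>' x) = \<eta> 1 * f t - f t * \<eta> t"
      unfolding W21_tail[OF \<eta> t] by (simp add: algebra_simps)
  qed simp
  also have "\<dots> = (LINT t:{0..1}|\<mu>. \<eta> 1 * f t) - (LINT t:{0..1}|\<mu>. f t * \<eta> t)"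
    by (intro set_integral_diff(2) set_integrable_mu continuous_intros f W21_continuous[OF \<eta>]) auto
  also have "(LINT t:{0..1}|\<mu>. \<eta> 1 * f t) = \<eta> 1 * I f 1" unfolding I_def by simp
  finally show ?thesis .
qed

text \<open>If \<open>C l 1 = 0\<close>, integration by parts leaves exactly the boundary term
  \<open>\<eta> 1 * C l 1\<close>. Conversely the weak equation is tested with a function whose
  derivative is its own residual \<open>g\<close>; this forces \<open>g = 0\<close> almost
  everywhere, so that \<open>y\<close> solves the integral equation with initial derivative
  0.\<close>

lemma neumann_eigenvalue_iff: "neumann_eigenvalue \<mu> l \<longleftrightarrow> C l 1 = 0"
proof
  assume z: "C l 1 = 0"
  have cA: "continuous_on {0..1} (A l)" and cC: "continuous_on {0..1} (C l)"
    using sol_cont_y[OF sol_AC] sol_cont_v[OF sol_AC] by blast+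
  have "W21 (A l) (C l)" unfolding W21_def
  proof (intro conjI ballI)
    show "set_borel_measurable lebesgue {0..1} (C l)"
      using set_integrable_lebesgue[OF cC] unfolding set_integrable_def set_borel_measurable_def by auto
    show "set_integrable lebesgue {0..1} (\<lambda>x. (C l x)\<^sup>2)"
      by (intro set_integrable_lebesgue continuous_intros cC)
    fix x :: real assume "x \<in> {0..1}"
    then show "A l x = A l 0 + (LINT t:{0..x}|lebesgue. C l t)"
      using sol_y[OF sol_AC, of x l] lebesgue_integral_eq_lborel[OF cC, of 0 x] by (simp add: J_def)
  qed
  moreover have "(LINT x:{0..1}|lebesgue. C l x * \<eta>' x) = l * (LINT x:{0..1}|\<mu>. A l x * \<eta> x)" if \<eta>: "W21 \<eta> \<eta>'" for \<eta> \<eta>'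
  proof -
    have "(LINT x:{0..1}|lebesgue. C l x * \<eta>' x) = (LINT x:{0..1}|lebesgue. - l * (\<eta>' x * I (A l) x))"
      by (intro set_lebesgue_integral_cong) (auto simp: fund_deriv_def)
    also have "\<dots> = - l * (LINT x:{0..1}|lebesgue. \<eta>' x * I (A l) x)" by (rule set_integral_mult_right)
    also have "\<dots> = \<eta> 1 * C l 1 + l * (LINT x:{0..1}|\<mu>. A l x * \<eta> x)"
      unfolding W21_by_parts[OF \<eta> cA] by (simp add: fund_deriv_def algebra_simps)
    finally show ?thesis using z by simp
  qed
  moreover have "\<exists>x\<in>{0..1}. A l x \<noteq> 0" using A_0[of l] by (intro bexI[of _ 0]) auto
  ultimately show "neumann_eigenvalue \<mu> l" unfolding neumann_eigenvalue_def by blast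
next
  assume "neumann_eigenvalue \<mu> l"
  then obtain y y' where y: "W21 y y'" "\<exists>x\<in>{0..1}. y x \<noteq> 0" and
    weak: "\<And>\<eta> \<eta>'. W21 \<eta> \<eta>' \<Longrightarrow> (LINT x:{0..1}|lebesgue. y' x * \<eta>' x) = l * (LINT x:{0..1}|\<mu>. y x * \<eta> x)"
    unfolding neumann_eigenvalue_def by blast
  have cy: "continuous_on {0..1} y" by (rule W21_continuous[OF y(1)])
  have cI: "continuous_on {0..1} (\<lambda>x. l * I y x)" by (intro continuous_intros continuous_on_I cy)
  \<comment> \<open>Constants are admissible test functions; they give the Neumann condition at the
    right end.\<close>
  have "W21 (\<lambda>_. 1) (\<lambda>_. 0)" unfolding W21_def by (auto simp: set_borel_measurable_def set_lebesgue_integral_def)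
  from weak[OF this] have I1: "l * I y 1 = 0" by (simp add: I_def)
  define g where "g x = y' x + l * I y x" for x
  have y'_int: "set_integrable lebesgue {0..1} y'" by (rule W21_deriv_integrable[OF y(1)])
  have g_int: "set_integrable lebesgue {0..1} g"
    unfolding g_def by (intro set_integral_add(1) y'_int set_integrable_lebesgue cI)
  then have g_meas: "set_borel_measurable lebesgue {0..1} g"
    unfolding set_integrable_def set_borel_measurable_def by auto
  have g2_int: "set_integrable lebesgue {0..1} (\<lambda>x. (g x)\<^sup>2)"
  proof (rule set_integrable_bound)
    show "set_integrable lebesgue {0..1} (\<lambda>x. 2 * (y' x)\<^sup>2 + 2 * (l * I y x)\<^sup>2)"
      using y(1) unfolding W21_def
      by (intro set_integral_add(1)) (auto intro!: set_integrable_lebesgue continuous_intros continuous_on_I cy)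
    have eq: "indicator {0..1} x *\<^sub>R (g x)\<^sup>2 = (indicator {0..1} x *\<^sub>R g x)\<^sup>2" for x
      by (auto simp: indicator_def)
    show "set_borel_measurable lebesgue {0..1} (\<lambda>x. (g x)\<^sup>2)"
      using g_meas unfolding set_borel_measurable_def eq by (intro borel_measurable_power)
    show "AE x in lebesgue. x \<in> {0..1} \<longrightarrow> norm ((g x)\<^sup>2) \<le> norm (2 * (y' x)\<^sup>2 + 2 * (l * I y x)\<^sup>2)"
    proof (intro AE_I2 impI)
      fix x
      have "0 \<le> (y' x - l * I y x)\<^sup>2" by simp
      then have "(g x)\<^sup>2 \<le> 2 * (y' x)\<^sup>2 + 2 * (l * I y x)\<^sup>2"
        unfolding g_def by (simp add: power2_sum power2_diff)
      then show "norm ((g x)\<^sup>2) \<le> norm (2 * (y' x)\<^sup>2 + 2 * (l * I y x)\<^sup>2)" by simp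
    qed
  qed
  define \<eta> where "\<eta> x = (LINT t:{0..x}|lebesgue. g t)" for x
  have \<eta>: "W21 \<eta> g" unfolding W21_def
  proof (intro conjI ballI)
    have "AE t in lebesgue. t \<notin> {0::real}" by (rule AE_not_in) auto
    then have "AE t in lebesgue. indicator {0..0} t *\<^sub>R g t = 0" by eventually_elim auto
    then have "\<eta> 0 = 0" unfolding \<eta>_def set_lebesgue_integral_def by (rule integral_eq_zero_AE)
    then show "\<eta> x = \<eta> 0 + (LINT t:{0..x}|lebesgue. g t)" for x by (simp add: \<eta>_def)
  qed (rule g_meas g2_int)+
  have i1: "set_integrable lebesgue {0..1} (\<lambda>x. g x * (l * I y x))"
  proof (rule set_integrable_bound)
    show "set_integrable lebesgue {0..1} (\<lambda>x. (g x)\<^sup>2 + (l * I y x)\<^sup>2)"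
      by (intro set_integral_add(1) g2_int set_integrable_lebesgue continuous_intros continuous_on_I cy)
    have eq: "indicator {0..1} x *\<^sub>R (g x * (l * I y x)) = (indicator {0..1} x *\<^sub>R g x) * (indicator {0..1} x *\<^sub>R (l * I y x))" for x
      by (auto simp: indicator_def)
    show "set_borel_measurable lebesgue {0..1} (\<lambda>x. g x * (l * I y x))"
      using g_meas set_integrable_lebesgue[OF cI]
      unfolding set_borel_measurable_def set_integrable_def eq by (intro borel_measurable_times) auto
    show "AE x in lebesgue. x \<in> {0..1} \<longrightarrow> norm (g x * (l * I y x)) \<le> norm ((g x)\<^sup>2 + (l * I y x)\<^sup>2)"
    proof (intro AE_I2 impI)
      fix x
      have "0 \<le> (\<bar>g x\<bar> - \<bar>l * I y x\<bar>)\<^sup>2" by simp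
      then have "2 * (\<bar>g x\<bar> * \<bar>l * I y x\<bar>) \<le> (g x)\<^sup>2 + (l * I y x)\<^sup>2" by (simp add: power2_diff)
      moreover have "0 \<le> \<bar>g x\<bar> * \<bar>l * I y x\<bar>" by simp
      ultimately have "\<bar>g x\<bar> * \<bar>l * I y x\<bar> \<le> (g x)\<^sup>2 + (l * I y x)\<^sup>2" by linarith
      then show "norm (g x * (l * I y x)) \<le> norm ((g x)\<^sup>2 + (l * I y x)\<^sup>2)" by (simp add: abs_mult)
    qed
  qed
  have p: "(LINT x:{0..1}|lebesgue. g x * (l * I y x)) = - l * (LINT x:{0..1}|\<mu>. y x * \<eta> x)"
  proof -
    have "(LINT x:{0..1}|lebesgue. g x * (l * I y x)) = (LINT x:{0..1}|lebesgue. l * (g x * I y x))"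
      by (simp add: mult_ac)
    also have "\<dots> = l * (LINT x:{0..1}|lebesgue. g x * I y x)" by (rule set_integral_mult_right)
    also have "\<dots> = \<eta> 1 * (l * I y 1) - l * (LINT x:{0..1}|\<mu>. y x * \<eta> x)"
      unfolding W21_by_parts[OF \<eta> cy] by (simp add: algebra_simps)
    finally show ?thesis by (simp add: I1)
  qed
  have "(LINT x:{0..1}|lebesgue. (g x)\<^sup>2) = (LINT x:{0..1}|lebesgue. g x * (l * I y x)) + (LINT x:{0..1}|lebesgue. y' x * g x)"
  proof -
    have "(LINT x:{0..1}|lebesgue. y' x * g x) = (LINT x:{0..1}|lebesgue. (g x)\<^sup>2 - g x * (l * I y x))"
      by (rule set_lebesgue_integral_cong) (auto simp: g_def power2_eq_square algebra_simps)
    also have "\<dots> = (LINT x:{0..1}|lebesgue. (g x)\<^sup>2) - (LINT x:{0..1}|lebesgue. g x * (l * I y x))"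
      by (rule set_integral_diff(2)[OF g2_int i1])
    finally show ?thesis by simp
  qed
  also have "\<dots> = 0" unfolding p using weak[OF \<eta>] by simp
  finally have "AE x in lebesgue. indicator {0..1} x *\<^sub>R (g x)\<^sup>2 = 0"
    using g2_int integral_nonneg_eq_0_iff_AE[of lebesgue "\<lambda>x. indicator {0..1} x *\<^sub>R (g x)\<^sup>2"]
    unfolding set_integrable_def set_lebesgue_integral_def by simp
  then have g0: "AE x in lebesgue. x \<in> {0..1} \<longrightarrow> y' x = - l * I y x"
    by eventually_elim (auto simp: g_def)
  have s: "sol l y (\<lambda>x. - l * I y x)" unfolding sol_def
  proof (intro conjI ballI cy)
    fix x :: real assume x: "x \<in> {0..1}"
    show "- l * I y x = - l * I y 0 - l * I y x" by simp
    have c: "continuous_on {0..1} (\<lambda>x. - l * I y x)" by (intro continuous_intros continuous_on_I cy)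
    have "(LINT t:{0..x}|lebesgue. y' t) = (LINT t:{0..x}|lebesgue. - l * I y t)"
      unfolding set_lebesgue_integral_def
    proof (rule integral_cong_AE)
      show "(\<lambda>t. indicator {0..x} t *\<^sub>R y' t) \<in> borel_measurable lebesgue"
        using set_integrable_subset[OF y'_int, of "{0..x}"] x unfolding set_integrable_def by auto
      show "(\<lambda>t. indicator {0..x} t *\<^sub>R (- l * I y t)) \<in> borel_measurable lebesgue"
        using set_integrable_subset[OF set_integrable_lebesgue[OF c], of "{0..x}"] x unfolding set_integrable_def by auto
      show "AE t in lebesgue. indicator {0..x} t *\<^sub>R y' t = indicator {0..x} t *\<^sub>R (- l * I y t)"
        using g0 by eventually_elim (use x in \<open>auto simp: indicator_def\<close>)
    qed
    also have "\<dots> = J (\<lambda>t. - l * I y t) x" unfolding J_def using x by (intro lebesgue_integral_eq_lborel c) auto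
    finally show "y x = y 0 + J (\<lambda>x. - l * I y x) x" using W21_eq[OF y(1) x] by (simp only:)
  qed
  \<comment> \<open>With initial derivative 0 the solution is a multiple of \<open>A l\<close>, so a
    nontrivial one is nonzero at 0, and its final derivative is the same multiple of
    \<open>C l 1\<close>.\<close>
  have yA: "y x = A l x * y 0" if "x \<in> {0..1}" for x using sol_transfer(1)[OF s that] by simp
  have "y 0 \<noteq> 0"
  proof
    assume "y 0 = 0"
    then have "y x = 0" if "x \<in> {0..1}" for x using yA[OF that] by (simp only: mult_zero_right)
    then show False using y(2) by blast
  qed
  moreover have "C l 1 * y 0 = 0" using sol_transfer(2)[OF s, of 1] I1 by simp
  ultimately show "C l 1 = 0" by simp
qed

section \<open>Distribution function, gaps and self-similar pieces\<close>

definition M :: "real \<Rightarrow> real" where "M t = measure \<mu> {0..t}"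

lemma M_0 [simp]: "M 0 = 0" and M_1 [simp]: "M 1 = 1"
  using no_atoms[of 0] mass_mu by (simp_all add: M_def)

lemma measure_Ioc: "0 \<le> u \<Longrightarrow> u \<le> v \<Longrightarrow> measure \<mu> {u<..v} = M v - M u"
proof -
  assume "0 \<le> u" "u \<le> v"
  then have "{u<..v} = {0..v} - {0..u}" by auto
  then show ?thesis unfolding M_def using \<open>u \<le> v\<close> by (simp add: finite_measure_Diff)
qed

lemma M_mono: "u \<le> v \<Longrightarrow> M u \<le> M v"
  unfolding M_def by (intro finite_measure_mono) auto

lemma I_diff:
  assumes f: "continuous_on {0..1} f" and uv: "0 \<le> u" "u \<le> v" "v \<le> 1"
  shows "I f v - I f u = (LINT t:{u<..v}|\<mu>. f t)"
proof -
  have e: "{0..v} = {0..u} \<union> {u<..v}" using uv by auto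
  have "set_integrable \<mu> {0..v} f" using uv by (intro set_integrable_mu f) auto
  then have i: "set_integrable \<mu> {0..u} f" "set_integrable \<mu> {u<..v} f"
    by (rule set_integrable_subset; use uv in auto)+
  have "I f v = I f u + (LINT t:{u<..v}|\<mu>. f t)"
    unfolding I_def e by (rule set_integral_Un[OF _ i]) auto
  then show ?thesis by simp
qed

text \<open>Where there is no mass the string is free. The term \<open>(p - r) * v r\<close> is what
  later becomes the positive constant in the coupled function.\<close>

lemma sol_across_gap:
  assumes s: "sol l y v" and rp: "0 \<le> r" "r \<le> p" "p \<le> 1" and gap: "M r = M p"
  shows "v p = v r" "y p = y r + (p - r) * v r"
proof -
  have cy: "continuous_on {0..1} y" and cv: "continuous_on {0..1} v" using sol_cont_y[OF s] sol_cont_v[OF s] by blast+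
  have Ix: "I y x = I y r" if x: "r \<le> x" "x \<le> p" for x
  proof -
    have "M x = M r" using M_mono[OF x(1)] M_mono[OF x(2)] gap by simp
    then have "measure \<mu> {r<..x} = 0" using measure_Ioc[of r x] rp x by simp
    then have "{r<..x} \<in> null_sets \<mu>" by (simp add: null_sets_def emeasure_eq_measure)
    then have "AE t in \<mu>. t \<notin> {r<..x}" by (rule AE_not_in)
    then have "AE t in \<mu>. indicator {r<..x} t *\<^sub>R y t = 0" by eventually_elim auto
    then have "(LINT t:{r<..x}|\<mu>. y t) = 0" unfolding set_lebesgue_integral_def by (rule integral_eq_zero_AE)
    then show ?thesis using I_diff[OF cy, of r x] rp x by simp
  qed
  have vx: "v x = v r" if x: "x \<in> {r..p}" for x
    using sol_v[OF s, of x] sol_v[OF s, of r] Ix[of x] x rp by simp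
  show "v p = v r" using rp by (intro vx) auto
  have "J v p = J v r + (LINT t:{r..p}|lborel. v t)"
    unfolding J_def using rp by (intro lborel_integral_split set_integrable_lborel cv) auto
  also have "(LINT t:{r..p}|lborel. v t) = (LINT t:{r..p}|lborel. v r)"
    by (intro set_lebesgue_integral_cong allI impI vx) auto
  also have "\<dots> = (p - r) * v r" using rp unfolding set_lebesgue_integral_def by simp
  finally have "J v p = J v r + (p - r) * v r" .
  moreover have "y p = y 0 + J v p" "y r = y 0 + J v r" by (rule sol_y[OF s]; use rp in simp)+
  ultimately show "y p = y r + (p - r) * v r" by linarith
qed

end

text \<open>Self-similarity is imposed on the distribution function because this is what the fixed
  point equation of the ladder delivers; \<open>R\<close> is the mass to the left of
  \<open>p\<close> in either orientation.\<close>

locale string_piece = string_measure +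
  fixes p q \<rho> R :: real and e :: nat
  assumes pq: "0 \<le> p" "p < q" "q \<le> 1" and rho: "\<rho> > 0"
    and carrier: "measure \<mu> (UNIV - {0..1}) = 0"
    and cdf: "\<And>t. t \<in> {0..1} \<Longrightarrow> M (ladder_map p q e t) = R + \<rho> * (if e = 0 then M t else 1 - M t)"
begin

abbreviation "S \<equiv> ladder_map p q e"

lemma S_range: "t \<in> {0..1} \<Longrightarrow> S t \<in> {p..q}"
proof -
  assume t: "t \<in> {0..1}"
  then have "0 \<le> (q - p) * t" "(q - p) * t \<le> (q - p) * 1" using pq by (auto intro: mult_left_mono)
  then show ?thesis unfolding ladder_map_def by auto
qed

lemma measure_Ioi: "measure \<mu> {t<..} = (if t < 0 then 1 else if t \<le> 1 then 1 - M t else 0)"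
proof -
  have eq: "measure \<mu> {t<..} = measure \<mu> ({t<..} \<inter> {0..1})"
  proof -
    have "{t<..} = ({t<..} \<inter> {0..1}) \<union> ({t<..} \<inter> (UNIV - {0..1}))" by auto
    moreover have "measure \<mu> ({t<..} \<inter> (UNIV - {0..1})) = 0"
      using finite_measure_mono[of "{t<..} \<inter> (UNIV - {0..1})" "UNIV - {0..1}"] carrier
      by (simp add: measure_le_0_iff)
    moreover have "measure \<mu> (({t<..} \<inter> {0..1}) \<union> ({t<..} \<inter> (UNIV - {0..1})))
      = measure \<mu> ({t<..} \<inter> {0..1}) + measure \<mu> ({t<..} \<inter> (UNIV - {0..1}))"
      by (rule finite_measure_Union) auto
    ultimately show ?thesis by (simp only: add_0_right)
  qed
  consider "t < 0" | "0 \<le> t" "t \<le> 1" | "t > 1" by linarith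
  then show ?thesis
  proof cases
    case 1
    then have "{t<..} \<inter> {0..1} = {0..1}" by auto
    then show ?thesis using eq 1 mass_mu by simp
  next
    case 2
    then have "{t<..} \<inter> {0..1} = {t<..1}" by auto
    then show ?thesis using eq 2 measure_Ioc[of t 1] by simp
  next
    case 3
    then have "{t<..} \<inter> {0..1} = {}" by auto
    then show ?thesis using eq 3 by simp
  qed
qed

lemma measure_Iio: "measure \<mu> {..<t} = (if t < 0 then 0 else if t \<le> 1 then M t else 1)"
proof -
  have tot: "measure \<mu> UNIV = 1"
  proof -
    have "measure \<mu> UNIV = measure \<mu> {0..1} + measure \<mu> (UNIV - {0..1})"
      by (subst finite_measure_Union[symmetric]) (auto simp: Un_absorb1)
    then show ?thesis using mass_mu carrier by simp
  qed
  have "measure \<mu> UNIV = measure \<mu> {..<t} + measure \<mu> {t..}"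
    by (subst finite_measure_Union[symmetric]) (auto intro: arg_cong[where f = "measure \<mu>"])
  moreover have "measure \<mu> {t..} = measure \<mu> {t} + measure \<mu> {t<..}"
    by (subst finite_measure_Union[symmetric]) (auto intro: arg_cong[where f = "measure \<mu>"])
  ultimately show ?thesis using no_atoms[of t] measure_Ioi[of t] tot M_0
    by (cases "t < 0"; cases "t \<le> 1") auto
qed

text \<open>Finite measures agreeing on right half-lines coincide. For a reflected piece the
  preimage of a right half-line is a left half-line, which is why both kinds were computed.\<close>

lemma restricted_measure_eq: "density \<mu> (indicator {p..q}) = density (distr \<mu> borel S) (\<lambda>_. ennreal \<rho>)"
proof (rule measure_eqI_lessThan)
  have S_meas[measurable]: "S \<in> borel_measurable borel" unfolding ladder_map_def by measurable
  have E1: "emeasure (density \<mu> (indicator {p..q})) {x<..} = ennreal (measure \<mu> ({p..q} \<inter> {x<..}))" for x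
    by (subst emeasure_density) (auto simp: nn_integral_indicator indicator_inter_arith[symmetric] emeasure_eq_measure)
  have E2: "emeasure (density (distr \<mu> borel S) (\<lambda>_. ennreal \<rho>)) {x<..} = ennreal (\<rho> * measure \<mu> (S -` {x<..}))" for x
    using rho by (subst emeasure_density)
      (auto simp: nn_integral_cmult_indicator emeasure_distr emeasure_eq_measure ennreal_mult)
  show "emeasure (density \<mu> (indicator {p..q})) {x<..} < \<infinity>" for x unfolding E1 by simp
  have Ml: "measure \<mu> ({p..q} \<inter> {x<..}) = (if x < p then M q - M p else if x \<le> q then M q - M x else 0)" for x
  proof -
    consider "x < p" | "p \<le> x" "x \<le> q" | "q < x" by linarith
    then show ?thesis
    proof cases
      case 1
      then have "{p..q} \<inter> {x<..} = {p} \<union> {p<..q}" using pq by auto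
      moreover have "measure \<mu> ({p} \<union> {p<..q}) = measure \<mu> {p} + measure \<mu> {p<..q}"
        by (rule finite_measure_Union) auto
      ultimately show ?thesis using 1 pq no_atoms[of p] measure_Ioc[of p q] by simp
    next
      case 2
      then have "{p..q} \<inter> {x<..} = {x<..q}" using pq by auto
      then show ?thesis using 2 pq measure_Ioc[of x q] by simp
    next
      case 3
      then have "{p..q} \<inter> {x<..} = {}" by auto
      then show ?thesis using 3 pq by simp
    qed
  qed
  have "measure \<mu> ({p..q} \<inter> {x<..}) = \<rho> * measure \<mu> (S -` {x<..})" for x
  proof (cases "e = 0")
    case True
    define t where "t = (x - p) / (q - p)"
    have xt: "x = p + (q - p) * t" using pq by (simp add: t_def)
    have "S -` {x<..} = {t<..}" using True pq by (auto simp: ladder_map_def xt)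
    moreover have "x < p \<longleftrightarrow> t < 0" "x \<le> q \<longleftrightarrow> t \<le> 1"
      using pq by (auto simp: t_def divide_less_0_iff pos_divide_le_eq)
    moreover have "M x = R + \<rho> * M t" if "t \<in> {0..1}" using cdf[OF that] True by (simp add: ladder_map_def xt)
    moreover have "M p = R" "M q = R + \<rho>" using cdf[of 0] cdf[of 1] True by (simp_all add: ladder_map_def)
    ultimately show ?thesis unfolding Ml using measure_Ioi[of t] by (auto simp: algebra_simps)
  next
    case False
    define t where "t = (q - x) / (q - p)"
    have xt: "x = q - (q - p) * t" using pq by (simp add: t_def)
    have "S -` {x<..} = {..<t}" using False pq by (auto simp: ladder_map_def xt)
    moreover have "x < p \<longleftrightarrow> 1 < t" "x \<le> q \<longleftrightarrow> 0 \<le> t"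
      using pq by (auto simp: t_def zero_le_divide_iff pos_less_divide_eq)
    moreover have "M x = R + \<rho> * (1 - M t)" if "t \<in> {0..1}" using cdf[OF that] False by (simp add: ladder_map_def xt)
    moreover have "M q = R + \<rho>" "M p = R" using cdf[of 0] cdf[of 1] False by (simp_all add: ladder_map_def)
    ultimately show ?thesis unfolding Ml using measure_Iio[of t] by (auto simp: algebra_simps)
  qed
  then show "emeasure (density \<mu> (indicator {p..q})) {x<..} = emeasure (density (distr \<mu> borel S) (\<lambda>_. ennreal \<rho>)) {x<..}" for x
    unfolding E1 E2 by simp
qed auto

lemma integral_piece:
  assumes g: "g \<in> borel_measurable borel"
  shows "(\<integral>x. indicator {p..q} x *\<^sub>R g x \<partial>\<mu>) = \<rho> * (\<integral>t. g (S t) \<partial>\<mu> :: real)"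
proof -
  have S_meas: "S \<in> borel_measurable \<mu>" unfolding ladder_map_def measurable_cong_sets[OF sets_mu refl] by measurable
  have g': "g \<in> borel_measurable \<mu>" using g unfolding measurable_cong_sets[OF sets_mu refl] .
  have "(\<integral>x. indicator {p..q} x *\<^sub>R g x \<partial>\<mu>) = (\<integral>x. g x \<partial>density \<mu> (\<lambda>x. ennreal (indicator {p..q} x)))"
    by (subst integral_density) (use g' in auto)
  also have "density \<mu> (\<lambda>x. ennreal (indicator {p..q} x)) = density \<mu> (indicator {p..q})"
    by (simp add: ennreal_indicator)
  also have "\<dots> = density (distr \<mu> borel S) (\<lambda>_. ennreal \<rho>)" by (rule restricted_measure_eq)
  also have "(\<integral>x. g x \<partial>\<dots>) = (\<integral>x. \<rho> *\<^sub>R g x \<partial>distr \<mu> borel S)"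
    using rho g by (subst integral_density) auto
  also have "\<dots> = \<rho> * (\<integral>t. g (S t) \<partial>\<mu>)"
    using integral_distr[OF S_meas, of g] g by simp
  finally show ?thesis .
qed

text \<open>The spectral parameter seen by a piece of relative mass \<rho> and length
  \<open>q - p\<close>.\<close>

definition \<kappa> :: "real \<Rightarrow> real" where "\<kappa> l = \<rho> * (q - p) * l"
definition sgn_e :: real where "sgn_e = (if e = 0 then 1 else - 1)"

lemma S_cont: "continuous_on U S"
  unfolding ladder_map_def by (cases "e = 0") (auto intro!: continuous_intros)

lemma AE_carrier: "AE x in \<mu>. x \<in> {0..1}"
proof -
  have "UNIV - {0..1} \<in> null_sets \<mu>" using carrier by (simp add: null_sets_def emeasure_eq_measure)
  then have "AE x in \<mu>. x \<notin> UNIV - {0..1}" by (rule AE_not_in)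
  then show ?thesis by eventually_elim auto
qed

lemma S_in_iff: "t \<in> {0..1} \<Longrightarrow> x \<in> {0..1} \<Longrightarrow>
    (if e = 0 then S x \<in> {p<..S t} \<longleftrightarrow> x \<in> {0<..t} else S x \<in> {S t<..q} \<longleftrightarrow> x \<in> {0..<t})"
  using pq by (auto simp: ladder_map_def zero_less_mult_iff)

lemma I_piece:
  assumes y: "continuous_on {0..1} y" and t: "t \<in> {0..1}"
  shows "\<rho> * I (\<lambda>s. y (S s)) t = (if e = 0 then I y (S t) - I y p else I y q - I y (S t))"
proof -
  \<comment> \<open>In both orientations the points of \<open>{0..1}\<close> that \<open>S\<close>
    maps into \<open>U\<close> form the interval up to \<open>t\<close>, except for one endpoint,
    which is a null point.\<close>
  define U where "U = (if e = 0 then {p<..S t} else {S t<..q})"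
  have St: "S t \<in> {p..q}" by (rule S_range[OF t])
  have U: "U \<subseteq> {p..q}" using St by (auto simp: U_def)
  have [measurable]: "U \<in> sets borel" by (simp add: U_def)
  have yb: "(\<lambda>x. indicator {0..1} x *\<^sub>R y x) \<in> borel_measurable borel"
    by (rule borel_measurable_continuous_on_indicator[OF _ y]) simp
  then have [measurable]: "(\<lambda>x. indicator {0..1} x * y x) \<in> borel_measurable borel" by simp
  define g where "g x = indicator U x * (indicator {0..1} x * y x)" for x
  have g: "g \<in> borel_measurable borel" unfolding g_def by measurable
  have "(if e = 0 then I y (S t) - I y p else I y q - I y (S t)) = (LINT x:U|\<mu>. y x)"
    using I_diff[OF y, of p "S t"] I_diff[OF y, of "S t" q] St pq by (cases "e = 0") (auto simp: U_def)
  also have "\<dots> = (\<integral>x. indicator {p..q} x *\<^sub>R g x \<partial>\<mu>)"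
    unfolding set_lebesgue_integral_def using U pq
    by (intro Bochner_Integration.integral_cong) (auto simp: g_def indicator_def)
  also have "\<dots> = \<rho> * (\<integral>x. g (S x) \<partial>\<mu>)" by (rule integral_piece[OF g])
  also have "(\<integral>x. g (S x) \<partial>\<mu>) = I (\<lambda>s. y (S s)) t"
    unfolding I_def set_lebesgue_integral_def
  proof (rule integral_cong_AE)
    have [measurable]: "S \<in> borel_measurable borel" unfolding ladder_map_def by measurable
    have "(\<lambda>x. g (S x)) \<in> borel_measurable borel" using g by measurable
    then show "(\<lambda>x. g (S x)) \<in> borel_measurable \<mu>" unfolding measurable_cong_sets[OF sets_mu refl] .
    have "continuous_on {0..1} (\<lambda>s. y (S s))"
      by (rule continuous_on_compose2[OF y S_cont]) (use S_range pq in fastforce)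
    then show "(\<lambda>x. indicator {0..t} x *\<^sub>R y (S x)) \<in> borel_measurable \<mu>"
      using set_integrable_mu[of "\<lambda>s. y (S s)" 0 t] t unfolding set_integrable_def by auto
    have "AE x in \<mu>. x \<notin> {0}" "AE x in \<mu>. x \<notin> {t}" by (rule AE_not_in[OF singleton_null_mu])+
    then show "AE x in \<mu>. g (S x) = indicator {0..t} x *\<^sub>R y (S x)"
      using AE_carrier
    proof eventually_elim
      case (elim x)
      have "S x \<in> {0..1}" using S_range[OF elim(3)] pq by auto
      moreover have "S x \<in> U \<longleftrightarrow> x \<in> {0..t}"
        using S_in_iff[OF t elim(3)] elim by (auto simp: U_def split: if_splits)
      ultimately show ?case by (simp add: g_def indicator_def)
    qed
  qed
  finally show ?thesis by simp
qed

lemma J_piece: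
  assumes v: "continuous_on {0..1} v" and t: "t \<in> {0..1}"
  shows "(q - p) * J (\<lambda>s. v (S s)) t = (if e = 0 then J v (S t) - J v p else J v q - J v (S t))"
proof -
  define U where "U = (if e = 0 then {p..S t} else {S t..q})"
  have St: "S t \<in> {p..q}" by (rule S_range[OF t])
  have "J v (S t) = J v p + (LINT x:{p..S t}|lborel. v x)" "J v q = J v (S t) + (LINT x:{S t..q}|lborel. v x)"
    unfolding J_def using St pq by (auto intro!: lborel_integral_split set_integrable_lborel v)
  then have "(if e = 0 then J v (S t) - J v p else J v q - J v (S t)) = (LINT x:U|lborel. v x)"
    by (cases "e = 0") (auto simp: U_def)
  also have "\<dots> = (q - p) * (\<integral>s. indicator U (S s) *\<^sub>R v (S s) \<partial>lborel)"
  proof (cases "e = 0")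
    case True
    show ?thesis unfolding set_lebesgue_integral_def
      by (subst lborel_integral_real_affine[where c = "q - p" and t = p]) (use True pq in \<open>auto simp: ladder_map_def\<close>)
  next
    case False
    show ?thesis unfolding set_lebesgue_integral_def
      by (subst lborel_integral_real_affine[where c = "- (q - p)" and t = q]) (use False pq in \<open>auto simp: ladder_map_def algebra_simps\<close>)
  qed
  also have "(\<integral>s. indicator U (S s) *\<^sub>R v (S s) \<partial>lborel) = J (\<lambda>s. v (S s)) t"
    unfolding J_def set_lebesgue_integral_def
  proof (rule Bochner_Integration.integral_cong[OF refl])
    fix s
    have "S s \<in> U \<longleftrightarrow> s \<in> {0..t}" using pq t by (auto simp: U_def ladder_map_def zero_le_mult_iff)
    then show "indicator U (S s) *\<^sub>R v (S s) = indicator {0..t} s *\<^sub>R v (S s)" by (simp add: indicator_def)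
  qed
  finally show ?thesis by simp
qed

text \<open>The orientation enters twice into the equation for the derivative, once through its
  definition and once through the integral, so the sign cancels.\<close>

lemma sol_piece:
  assumes s: "sol l y v"
  shows "sol (\<kappa> l) (\<lambda>t. y (S t)) (\<lambda>t. sgn_e * (q - p) * v (S t))"
  unfolding sol_def
proof (intro conjI ballI)
  have cy: "continuous_on {0..1} y" and cv: "continuous_on {0..1} v" using sol_cont_y[OF s] sol_cont_v[OF s] by blast+
  have S01: "S t \<in> {0..1}" if "t \<in> {0..1}" for t using S_range[OF that] pq by auto
  show "continuous_on {0..1} (\<lambda>t. y (S t))"
    by (rule continuous_on_compose2[OF cy S_cont]) (use S01 in blast)
  fix t :: real assume t: "t \<in> {0..1}"
  have S0: "S 0 = (if e = 0 then p else q)" by (simp add: ladder_map_def)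
  have "v (S t) = v (S 0) - l * (I y (S t) - I y (S 0))"
    using sol_v[OF s S01[OF t]] sol_v[OF s S01[of 0]] by (simp add: algebra_simps)
  also have "I y (S t) - I y (S 0) = sgn_e * (\<rho> * I (\<lambda>s. y (S s)) t)"
    unfolding I_piece[OF cy t] S0 sgn_e_def by simp
  finally have V: "v (S t) = v (S 0) - l * (sgn_e * (\<rho> * I (\<lambda>s. y (S s)) t))" .
  have sg: "sgn_e * sgn_e = 1" by (simp add: sgn_e_def)
  have "sgn_e * (q - p) * (v (S 0) - l * (sgn_e * (\<rho> * I (\<lambda>s. y (S s)) t)))
    = sgn_e * (q - p) * v (S 0) - (sgn_e * sgn_e) * (\<rho> * (q - p) * l * I (\<lambda>s. y (S s)) t)"
    by (simp add: algebra_simps)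
  then show "sgn_e * (q - p) * v (S t) = sgn_e * (q - p) * v (S 0) - \<kappa> l * I (\<lambda>t. y (S t)) t"
    unfolding V[symmetric] sg \<kappa>_def by simp
  have "y (S t) = y (S 0) + (J v (S t) - J v (S 0))"
    using sol_y[OF s S01[OF t]] sol_y[OF s S01[of 0]] by (simp add: algebra_simps)
  also have "J v (S t) - J v (S 0) = sgn_e * ((q - p) * J (\<lambda>s. v (S s)) t)"
    unfolding J_piece[OF cv t] S0 sgn_e_def by simp
  also have "sgn_e * ((q - p) * J (\<lambda>s. v (S s)) t) = J (\<lambda>t. sgn_e * (q - p) * v (S t)) t"
    unfolding J_def by simp
  finally show "y (S t) = y (S 0) + J (\<lambda>t. sgn_e * (q - p) * v (S t)) t" .
qed

text \<open>For a reflected piece the transfer relation runs from \<open>q\<close> to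
  \<open>p\<close>. Inverting the matrix, whose determinant is 1, exchanges \<open>A\<close> and
  \<open>D\<close> and leaves \<open>C\<close> in place once the sign of the derivative is taken
  into account.\<close>

lemma piece_transfer:
  assumes s: "sol l y v"
  shows "(q - p) * v q = C (\<kappa> l) 1 * y p + (if e = 0 then D (\<kappa> l) 1 else A (\<kappa> l) 1) * ((q - p) * v p)"
proof -
  have 1: "(1::real) \<in> {0..1}" by simp
  note T = sol_transfer[OF sol_piece[OF s] 1]
  show ?thesis
  proof (cases "e = 0")
    case True
    then show ?thesis using T(2) unfolding ladder_map_def sgn_e_def by simp
  next
    case False
    have E1: "y p = A (\<kappa> l) 1 * y q + B (\<kappa> l) 1 * (- (q - p) * v q)"
      and E2: "- (q - p) * v p = C (\<kappa> l) 1 * y q + D (\<kappa> l) 1 * (- (q - p) * v q)"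
      using T False unfolding ladder_map_def sgn_e_def by simp_all
    have d: "A (\<kappa> l) 1 * D (\<kappa> l) 1 - C (\<kappa> l) 1 * B (\<kappa> l) 1 = 1" by (rule det_fund[OF 1])
    have "C (\<kappa> l) 1 * y p - A (\<kappa> l) 1 * (- (q - p) * v p)
      = (A (\<kappa> l) 1 * D (\<kappa> l) 1 - C (\<kappa> l) 1 * B (\<kappa> l) 1) * ((q - p) * v q)"
      unfolding E1 E2 by (simp add: algebra_simps)
    then show ?thesis using False unfolding d by (simp add: algebra_simps)
  qed
qed

end

section \<open>The distribution function of a distributional derivative\<close>

text \<open>The classical flat function together with its products with negative powers of
  \<open>t\<close>, taken as one family because differentiation leads from index \<open>n\<close> to
  indices \<open>n + 1\<close> and \<open>n + 2\<close>.\<close>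

definition flat_exp :: "nat \<Rightarrow> real \<Rightarrow> real" where
  "flat_exp n t = (if t > 0 then exp (- inverse t) * inverse t ^ n else 0)"

lemma flat_exp_nonneg: "0 \<le> flat_exp n t"
  by (simp add: flat_exp_def)

lemma power_div_fact_le_exp: "x ^ n / fact n \<le> exp x" if "x \<ge> 0" for x :: real
proof -
  have "(\<Sum>k\<in>{n}. inverse (fact k) * x ^ k) \<le> (\<Sum>k. inverse (fact k) * x ^ k)"
    by (rule sum_le_suminf[OF summable_exp]) (use that in auto)
  then show ?thesis by (simp add: exp_def divide_inverse mult.commute)
qed

text \<open>With \<open>u = inverse t\<close> this is the bound of
  \<open>u ^ Suc n / fact (Suc n)\<close> by \<open>exp u\<close>. At the origin the difference
  quotient of index \<open>n\<close> is the function of index \<open>Suc n\<close>, so this bound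
  also gives the derivative 0 there.\<close>

lemma flat_exp_le: "flat_exp n t \<le> fact (Suc n) * \<bar>t\<bar>"
proof (cases "t > 0")
  case True
  define u where "u = inverse t"
  have u: "u > 0" "u * t = 1" using True by (simp_all add: u_def)
  have "exp (- u) * (u ^ Suc n / fact (Suc n)) \<le> exp (- u) * exp u"
    using u by (intro mult_left_mono power_div_fact_le_exp) auto
  also have "exp (- u) * exp u = 1" by (simp add: exp_minus)
  finally have "exp (- u) * u ^ Suc n / fact (Suc n) \<le> 1" by (simp only: times_divide_eq_right)
  then have "exp (- u) * u ^ Suc n \<le> 1 * fact (Suc n)" by (subst (asm) pos_divide_le_eq) (simp_all del: fact_Suc)
  then have "exp (- u) * u ^ Suc n * t \<le> 1 * fact (Suc n) * t" using True by (intro mult_right_mono) auto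
  moreover have "exp (- u) * u ^ Suc n * t = exp (- u) * u ^ n * (u * t)" by (simp only: power_Suc mult_ac)
  then have "exp (- u) * u ^ Suc n * t = flat_exp n t"
    using True by (simp only: u(2) flat_exp_def if_True u_def[symmetric] mult_1_right)
  ultimately show ?thesis using True by (simp only: abs_of_pos mult_1)
qed (simp add: flat_exp_def mult_nonneg_nonpos del: fact_Suc)

lemma DERIV_flat_exp:
  "(flat_exp n has_real_derivative flat_exp (n + 2) t - real n * flat_exp (n + 1) t) (at t)"
proof -
  consider "t > 0" | "t < 0" | "t = 0" by linarith
  then show ?thesis
  proof cases
    case 1
    have 1: "((\<lambda>t. exp (- inverse t)) has_real_derivative exp (- inverse t) * (inverse t)\<^sup>2) (at t)"
      using 1 by (auto intro!: derivative_eq_intros simp: power2_eq_square)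
    have 2: "((\<lambda>t. inverse t ^ n) has_real_derivative real n * inverse t ^ (n - 1) * - (inverse t)\<^sup>2) (at t)"
      using \<open>t > 0\<close> by (auto intro!: derivative_eq_intros simp: power2_eq_square)
    have "((\<lambda>t. exp (- inverse t) * inverse t ^ n) has_real_derivative flat_exp (n + 2) t - real n * flat_exp (n + 1) t) (at t)"
    proof (rule DERIV_cong[OF DERIV_mult[OF 1 2]])
      have A1: "real n * inverse t ^ (n - 1) * (inverse t)\<^sup>2 = real n * inverse t ^ (n + 1)"
        by (cases n) (simp_all add: power2_eq_square)
      have A2: "inverse t ^ n * (inverse t)\<^sup>2 = inverse t ^ (n + 2)" by (simp only: power_add)
      show "exp (- inverse t) * (inverse t)\<^sup>2 * inverse t ^ n + real n * inverse t ^ (n - 1) * - (inverse t)\<^sup>2 * exp (- inverse t)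
        = flat_exp (n + 2) t - real n * flat_exp (n + 1) t"
      proof -
        have "exp (- inverse t) * (inverse t)\<^sup>2 * inverse t ^ n + real n * inverse t ^ (n - 1) * - (inverse t)\<^sup>2 * exp (- inverse t)
          = exp (- inverse t) * (inverse t ^ n * (inverse t)\<^sup>2) - exp (- inverse t) * (real n * inverse t ^ (n - 1) * (inverse t)\<^sup>2)"
          by (simp add: mult_ac)
        also have "\<dots> = exp (- inverse t) * inverse t ^ (n + 2) - exp (- inverse t) * (real n * inverse t ^ (n + 1))"
          by (simp only: A1 A2)
        finally show ?thesis using \<open>t > 0\<close> unfolding flat_exp_def by (simp add: mult_ac)
      qed
    qed
    then show ?thesis
      by (rule has_field_derivative_transform_within_open[where S = "{0<..}"]) (use \<open>t > 0\<close> in \<open>auto simp: flat_exp_def\<close>)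
  next
    case 2
    have "((\<lambda>t. 0 :: real) has_real_derivative flat_exp (n + 2) t - real n * flat_exp (n + 1) t) (at t)"
      using 2 by (simp add: flat_exp_def)
    then show ?thesis
      by (rule has_field_derivative_transform_within_open[where S = "{..<0}"]) (use 2 in \<open>auto simp: flat_exp_def\<close>)
  next
    case 3
    have "((\<lambda>s. flat_exp n s / s) \<longlongrightarrow> 0) (at 0)"
    proof (rule Lim_null_comparison)
      show "\<forall>\<^sub>F s in at 0. norm (flat_exp n s / s) \<le> fact (Suc (Suc n)) * \<bar>s\<bar>"
      proof (rule always_eventually, rule allI)
        fix s :: real
        have "flat_exp n s / s = flat_exp (Suc n) s" by (simp add: flat_exp_def divide_inverse)
        then show "norm (flat_exp n s / s) \<le> fact (Suc (Suc n)) * \<bar>s\<bar>"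
          using flat_exp_le[of "Suc n" s] flat_exp_nonneg[of "Suc n" s] by (simp del: fact_Suc)
      qed
      have "((\<lambda>s::real. fact (Suc (Suc n)) * \<bar>s\<bar>) \<longlongrightarrow> fact (Suc (Suc n)) * \<bar>0\<bar>) (at 0)"
        by (intro tendsto_intros)
      then show "((\<lambda>s::real. fact (Suc (Suc n)) * \<bar>s\<bar>) \<longlongrightarrow> 0) (at 0)" by simp
    qed
    then show ?thesis using 3 by (simp add: has_field_derivative_iff flat_exp_def)
  qed
qed

text \<open>A class of functions closed under differentiation, which makes smoothness an induction.\<close>

inductive bump_span :: "(real \<Rightarrow> real) \<Rightarrow> bool" where
  base: "bump_span (\<lambda>x. flat_exp i (x - c) * flat_exp j (d - x))"
| lin: "bump_span f \<Longrightarrow> bump_span g \<Longrightarrow> bump_span (\<lambda>x. a * f x + b * g x)"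

lemma bump_span_deriv: "bump_span f \<Longrightarrow> \<exists>g. bump_span g \<and> (\<forall>x. (f has_real_derivative g x) (at x))"
proof (induction rule: bump_span.induct)
  case (base i c j d)
  let ?b = "\<lambda>i j x. flat_exp i (x - c) * flat_exp j (d - x)"
  let ?g = "\<lambda>x. 1 * (1 * ?b (i + 2) j x + (- real i) * ?b (i + 1) j x) + 1 * ((-1) * ?b i (j + 2) x + real j * ?b i (j + 1) x)"
  have "bump_span ?g" by (intro bump_span.intros)
  moreover have "(?b i j has_real_derivative ?g x) (at x)" for x
  proof -
    have 1: "((\<lambda>x. flat_exp i (x - c)) has_real_derivative (flat_exp (i + 2) (x - c) - real i * flat_exp (i + 1) (x - c)) * 1) (at x)"
      by (rule DERIV_chain2[OF DERIV_flat_exp]) (auto intro!: derivative_eq_intros)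
    have 2: "((\<lambda>x. flat_exp j (d - x)) has_real_derivative (flat_exp (j + 2) (d - x) - real j * flat_exp (j + 1) (d - x)) * (-1)) (at x)"
      by (rule DERIV_chain2[OF DERIV_flat_exp]) (auto intro!: derivative_eq_intros)
    show ?thesis by (rule DERIV_cong[OF DERIV_mult[OF 1 2]]) (simp add: algebra_simps)
  qed
  ultimately show ?case by blast
next
  case (lin f g a b)
  then obtain f' g' where fg: "bump_span f'" "\<And>x. (f has_real_derivative f' x) (at x)"
    "bump_span g'" "\<And>x. (g has_real_derivative g' x) (at x)" by blast
  show ?case
  proof (intro exI[of _ "\<lambda>x. a * f' x + b * g' x"] conjI allI)
    show "bump_span (\<lambda>x. a * f' x + b * g' x)" by (intro bump_span.intros fg)
    show "((\<lambda>x. a * f x + b * g x) has_real_derivative a * f' x + b * g' x) (at x)" for x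
      by (intro DERIV_add DERIV_cmult fg)
  qed
qed

lemma deriv_eq_all: "(\<And>x. (f has_real_derivative g x) (at x)) \<Longrightarrow> deriv f = g"
  by (rule ext) (rule DERIV_imp_deriv)

lemma bump_span_smooth: "bump_span f \<Longrightarrow> (deriv ^^ n) f differentiable (at x)"
proof (induction n arbitrary: f)
  case 0
  then show ?case using bump_span_deriv real_differentiable_def by (metis funpow_0)
next
  case (Suc n)
  obtain g where g: "bump_span g" "\<And>x. (f has_real_derivative g x) (at x)" using bump_span_deriv[OF Suc.prems] by blast
  have "(deriv ^^ Suc n) f = (deriv ^^ n) g" using deriv_eq_all[OF g(2)] by (simp add: funpow_swap1)
  then show ?case using Suc.IH[OF g(1)] by simp
qed

lemma smooth_of_deriv:
  assumes "\<And>x. (f has_real_derivative g x) (at x)" "\<And>n x. (deriv ^^ n) g differentiable (at x)"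
  shows "(deriv ^^ n) f differentiable (at (x::real))"
proof (cases n)
  case 0
  then show ?thesis using assms(1) real_differentiable_def by auto
next
  case (Suc k)
  have "(deriv ^^ Suc k) f = (deriv ^^ k) g" using deriv_eq_all[OF assms(1)] by (simp add: funpow_swap1)
  then show ?thesis using assms(2) Suc by simp
qed

lemma antiderivative_exists:
  assumes "\<And>x. isCont f x"
  obtains F where "\<And>x :: real. (F has_real_derivative f x) (at x)"
proof -
  have "\<exists>F. \<forall>x. - \<infinity> < ereal x \<longrightarrow> ereal x < \<infinity> \<longrightarrow> (F has_vector_derivative f x) (at x)"
    by (rule einterval_antiderivative) (use assms in auto)
  then obtain F where "\<And>x. (F has_vector_derivative f x) (at x)" by auto
  then show ?thesis by (intro that[of F]) (simp only: has_real_derivative_iff_has_vector_derivative)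
qed

text \<open>A normalised primitive of a bump living on the interval from 0 to \<epsilon>. Translates
  of the derivative are recorded as a separate conclusion because \<open>bump_span\<close> comes
  with no rule for translations.\<close>

lemma smooth_step_exists:
  assumes \<epsilon>: "\<epsilon> > 0"
  obtains \<theta> \<theta>' where "bump_span \<theta>'" "\<And>x. (\<theta> has_real_derivative \<theta>' x) (at x)"
    "\<And>x. x \<le> 0 \<Longrightarrow> \<theta> x = 0" "\<And>x. x \<ge> \<epsilon> \<Longrightarrow> \<theta> x = 1" "\<And>x. 0 \<le> \<theta> x" "\<And>x. \<theta> x \<le> 1"
    "\<And>c. bump_span (\<lambda>x. \<theta>' (x - c))"
proof -
  define b where "b x = flat_exp 0 (x - 0) * flat_exp 0 (\<epsilon> - x)" for x
  have b: "bump_span b" unfolding b_def[abs_def] by (rule bump_span.base)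
  have cont: "isCont b x" for x using bump_span_deriv[OF b] DERIV_isCont by blast
  obtain F where F: "\<And>x. (F has_real_derivative b x) (at x)" using antiderivative_exists[of b] cont by blast
  have bnn: "b x \<ge> 0" for x unfolding b_def by (intro mult_nonneg_nonneg flat_exp_nonneg)
  have mono: "F x \<le> F y" if "x \<le> y" for x y
    by (rule DERIV_nonneg_imp_nondecreasing[OF that]) (use F bnn in blast)
  have left: "F x = F 0" if "x \<le> 0" for x
  proof (rule antisym[OF mono[OF that]])
    show "F 0 \<le> F x"
      by (rule DERIV_nonpos_imp_nonincreasing[OF that]) (use F in \<open>auto simp: b_def flat_exp_def intro!: exI\<close>)
  qed
  have right: "F x = F \<epsilon>" if "x \<ge> \<epsilon>" for x
  proof (rule antisym[OF _ mono[OF that]])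
    show "F x \<le> F \<epsilon>"
      by (rule DERIV_nonpos_imp_nonincreasing[OF that]) (use F in \<open>auto simp: b_def flat_exp_def intro!: exI\<close>)
  qed
  have pos: "F 0 < F \<epsilon>"
  proof (rule DERIV_pos_imp_increasing_open[OF \<epsilon>])
    fix x assume "0 < x" "x < \<epsilon>"
    then have "b x > 0" by (simp add: b_def flat_exp_def)
    then show "\<exists>y. DERIV F x :> y \<and> y > 0" using F by blast
  qed (use F DERIV_continuous_on has_field_derivative_at_within in blast)
  define K where "K = F \<epsilon> - F 0"
  have K: "K > 0" using pos by (simp add: K_def)
  show ?thesis
  proof (rule that[of "\<lambda>x. (1 / K) * b x + 0 * b x" "\<lambda>x. (F x - F 0) / K"])
    show "bump_span (\<lambda>x. (1 / K) * b x + 0 * b x)" by (intro bump_span.lin b)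
    show "((\<lambda>x. (F x - F 0) / K) has_real_derivative (1 / K) * b x + 0 * b x) (at x)" for x
      using K by (auto intro!: derivative_eq_intros F)
    show "bump_span (\<lambda>x. (1 / K) * b (x - c) + 0 * b (x - c))" for c
    proof (intro bump_span.lin)
      have "b (x - c) = flat_exp 0 (x - c) * flat_exp 0 ((\<epsilon> + c) - x)" for x by (simp add: b_def algebra_simps)
      then show "bump_span (\<lambda>x. b (x - c))" by (simp only: bump_span.base)
      then show "bump_span (\<lambda>x. b (x - c))" .
    qed
    show "(F x - F 0) / K = 0" if "x \<le> 0" for x using left[OF that] by simp
    show "(F x - F 0) / K = 1" if "x \<ge> \<epsilon>" for x using right[OF that] K by (simp add: K_def)
    show "0 \<le> (F x - F 0) / K" for x
      using mono[of 0 x] left[of x] K by (cases "x \<le> 0") auto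
    show "(F x - F 0) / K \<le> 1" for x
      using mono[of x \<epsilon>] right[of x] K by (cases "x \<le> \<epsilon>") (auto simp: K_def divide_le_eq)
  qed
qed

text \<open>The derivative of the test function is a mollified indicator of \<open>(u, w]\<close> minus a
  multiple of a fixed bump, which makes its total integral vanish.\<close>

lemma test_function_exists:
  assumes "0 < u" "u < w" "0 < \<epsilon>" "w + \<epsilon> < 1"
    and \<beta>: "bump_span \<beta>'" "\<And>x. (\<beta> has_real_derivative \<beta>' x) (at x)" "\<And>x. x \<le> 1/4 \<Longrightarrow> \<beta> x = 0" "\<And>x. x \<ge> 1/2 \<Longrightarrow> \<beta> x = 1"
  obtains \<phi> \<theta> where "test_function01 \<phi>"
    "\<And>x. (\<phi> has_real_derivative (\<theta> (x - u) - \<theta> (x - w) - (w - u) * \<beta>' x)) (at x)"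
    "\<And>x. x \<le> 0 \<Longrightarrow> \<theta> x = 0" "\<And>x. x \<ge> \<epsilon> \<Longrightarrow> \<theta> x = 1" "\<And>x. 0 \<le> \<theta> x" "\<And>x. \<theta> x \<le> 1"
    "\<And>x. isCont \<theta> x"
proof -
  obtain \<theta> \<theta>' where \<theta>: "bump_span \<theta>'" "\<And>x. (\<theta> has_real_derivative \<theta>' x) (at x)"
    "\<And>x. x \<le> 0 \<Longrightarrow> \<theta> x = 0" "\<And>x. x \<ge> \<epsilon> \<Longrightarrow> \<theta> x = 1" "\<And>x. 0 \<le> \<theta> x" "\<And>x. \<theta> x \<le> 1"
    "\<And>c. bump_span (\<lambda>x. \<theta>' (x - c))" by (rule smooth_step_exists[OF assms(3)]) blast
  have cont: "isCont \<theta> x" for x using \<theta>(2) DERIV_isCont by blast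
  obtain B0 where B0: "\<And>x. (B0 has_real_derivative \<theta> x) (at x)" using antiderivative_exists[of \<theta>] cont by blast
  define B where "B x = B0 x - B0 0" for x
  have B: "(B has_real_derivative \<theta> x) (at x)" for x unfolding B_def[abs_def] by (auto intro!: derivative_eq_intros B0)
  have B_left: "B x = 0" if "x \<le> 0" for x
  proof -
    have "B0 x = B0 0"
    proof (cases "x = 0")
      case False
      with that have x: "x < 0" by simp
      have "\<exists>z>x. z < 0 \<and> B0 0 - B0 x = (0 - x) * \<theta> z" by (rule MVT2[OF x]) (rule B0)
      then show ?thesis using \<theta>(3) by force
    qed simp
    then show ?thesis by (simp add: B_def)
  qed
  have B_right: "B x = B \<epsilon> + (x - \<epsilon>)" if "x \<ge> \<epsilon>" for x
  proof (cases "x = \<epsilon>")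
    case False
    with that have x: "\<epsilon> < x" by simp
    have "\<exists>z>\<epsilon>. z < x \<and> B x - B \<epsilon> = (x - \<epsilon>) * \<theta> z" by (rule MVT2[OF x]) (rule B)
    then show ?thesis using \<theta>(4) by force
  qed simp
  \<comment> \<open>To the right of \<open>w + \<epsilon>\<close> the two ramps are parallel and
    differ by \<open>w - u\<close>; the multiple of \<beta> cancels this difference and makes the
    support compact.\<close>
  define \<phi> where "\<phi> x = B (x - u) - B (x - w) - (w - u) * \<beta> x" for x
  define \<phi>' where "\<phi>' x = \<theta> (x - u) - \<theta> (x - w) - (w - u) * \<beta>' x" for x
  have Bs: "((\<lambda>x. B (x - c)) has_real_derivative \<theta> (x - c)) (at x)" for c x
  proof -
    have "((\<lambda>x. B (x - c)) has_real_derivative \<theta> (x - c) * 1) (at x)"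
      by (rule DERIV_chain2[OF B]) (auto intro!: derivative_eq_intros)
    then show ?thesis by simp
  qed
  have \<theta>s: "((\<lambda>x. \<theta> (x - c)) has_real_derivative \<theta>' (x - c)) (at x)" for c x
  proof -
    have "((\<lambda>x. \<theta> (x - c)) has_real_derivative \<theta>' (x - c) * 1) (at x)"
      by (rule DERIV_chain2[OF \<theta>(2)]) (auto intro!: derivative_eq_intros)
    then show ?thesis by simp
  qed
  have \<phi>: "(\<phi> has_real_derivative \<phi>' x) (at x)" for x
    unfolding \<phi>_def[abs_def] \<phi>'_def by (intro DERIV_diff Bs DERIV_cmult \<beta>)
  obtain \<beta>'' where \<beta>'': "bump_span \<beta>''" "\<And>x. (\<beta>' has_real_derivative \<beta>'' x) (at x)"
    using bump_span_deriv[OF \<beta>(1)] by blast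
  define \<phi>'' where "\<phi>'' x = 1 * (1 * \<theta>' (x - u) + (-1) * \<theta>' (x - w)) + (- (w - u)) * \<beta>'' x" for x
  have s2: "bump_span \<phi>''" unfolding \<phi>''_def[abs_def] by (intro bump_span.lin \<theta> \<beta>'')
  have \<phi>': "(\<phi>' has_real_derivative \<phi>'' x) (at x)" for x
    unfolding \<phi>'_def[abs_def] \<phi>''_def
    by (rule DERIV_cong[OF DERIV_diff[OF DERIV_diff[OF \<theta>s \<theta>s] DERIV_cmult[OF \<beta>''(2)]]]) (simp add: algebra_simps)
  have "test_function01 \<phi>" unfolding test_function01_def
  proof
    show "\<forall>n x. (deriv ^^ n) \<phi> differentiable (at x)"
      using smooth_of_deriv[OF \<phi> smooth_of_deriv[OF \<phi>' bump_span_smooth[OF s2]]] by blast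
    show "\<exists>c d. 0 < c \<and> c < d \<and> d < 1 \<and> (\<forall>x. x \<notin> {c..d} \<longrightarrow> \<phi> x = 0)"
    proof (rule exI[of _ "min u (1/4)"], rule exI[of _ "max (w + \<epsilon>) (1/2)"], intro conjI allI impI)
      fix x assume x: "x \<notin> {min u (1/4)..max (w + \<epsilon>) (1/2)}"
      then consider "x < min u (1/4)" | "x > max (w + \<epsilon>) (1/2)" by fastforce
      then show "\<phi> x = 0"
      proof cases
        case 1
        then show ?thesis using B_left[of "x - u"] B_left[of "x - w"] \<beta>(3)[of x] assms by (simp add: \<phi>_def)
      next
        case 2
        then show ?thesis using B_right[of "x - u"] B_right[of "x - w"] \<beta>(4)[of x] assms by (simp add: \<phi>_def)
      qed
    qed (use assms in auto)
  qed
  from that[OF this \<phi>[unfolded \<phi>'_def] \<theta>(3-6) cont] show ?thesis .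
qed

text \<open>The positive and the negative part are densities of two finite measures that agree on
  half-lines, hence the densities agree almost everywhere.\<close>

lemma AE_zero_of_halfline_integrals:
  fixes h :: "real \<Rightarrow> real"
  assumes h: "integrable lborel h" and z: "\<And>x. (\<integral>t. indicator {x<..} t * h t \<partial>lborel) = 0"
  shows "AE t in lborel. h t = 0"
proof -
  have [measurable]: "h \<in> borel_measurable borel" using h by auto
  let ?p = "\<lambda>t. max 0 (h t)" and ?n = "\<lambda>t. max 0 (- h t)"
  have pi: "integrable lborel ?p" and ni: "integrable lborel ?n" using h by auto
  have e: "emeasure (density lborel (\<lambda>t. ennreal (max 0 (f t)))) {x<..} = ennreal (\<integral>t. indicator {x<..} t * max 0 (f t) \<partial>lborel)"
    if f: "integrable lborel (\<lambda>t. max 0 (f t))" "f \<in> borel_measurable borel" for f :: "real \<Rightarrow> real" and x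
  proof -
    have [measurable]: "f \<in> borel_measurable borel" by (rule f)
    have "emeasure (density lborel (\<lambda>t. ennreal (max 0 (f t)))) {x<..} = (\<integral>\<^sup>+t. ennreal (max 0 (f t)) * indicator {x<..} t \<partial>lborel)"
      by (rule emeasure_density) auto
    also have "\<dots> = (\<integral>\<^sup>+t. ennreal (indicator {x<..} t * max 0 (f t)) \<partial>lborel)"
      by (intro nn_integral_cong) (auto simp: indicator_def)
    also have "\<dots> = ennreal (\<integral>t. indicator {x<..} t * max 0 (f t) \<partial>lborel)"
      using integrable_real_mult_indicator[OF _ f(1), of "{x<..}"]
      by (intro nn_integral_eq_integral) (auto simp: mult.commute)
    finally show ?thesis .
  qed
  have ep: "emeasure (density lborel (\<lambda>t. ennreal (?p t))) {x<..} = ennreal (\<integral>t. indicator {x<..} t * ?p t \<partial>lborel)" for x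
    by (rule e[OF pi]) simp
  have en: "emeasure (density lborel (\<lambda>t. ennreal (?n t))) {x<..} = ennreal (\<integral>t. indicator {x<..} t * ?n t \<partial>lborel)" for x
    by (rule e[OF ni]) simp
  have "density lborel (\<lambda>t. ennreal (?p t)) = density lborel (\<lambda>t. ennreal (?n t))"
  proof (rule measure_eqI_lessThan)
    fix x
    show "emeasure (density lborel (\<lambda>t. ennreal (?p t))) {x<..} < \<infinity>" unfolding ep by simp
    have "(\<integral>t. indicator {x<..} t * ?p t \<partial>lborel) - (\<integral>t. indicator {x<..} t * ?n t \<partial>lborel)
      = (\<integral>t. indicator {x<..} t * ?p t - indicator {x<..} t * ?n t \<partial>lborel)"
      using integrable_real_mult_indicator[OF _ pi, of "{x<..}"] integrable_real_mult_indicator[OF _ ni, of "{x<..}"]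
      by (intro Bochner_Integration.integral_diff[symmetric]) (auto simp: mult.commute)
    also have "\<dots> = (\<integral>t. indicator {x<..} t * h t \<partial>lborel)"
      by (intro Bochner_Integration.integral_cong) (auto simp: indicator_def)
    finally show "emeasure (density lborel (\<lambda>t. ennreal (?p t))) {x<..} = emeasure (density lborel (\<lambda>t. ennreal (?n t))) {x<..}"
      unfolding ep en z by simp
  qed auto
  moreover have "(\<integral>\<^sup>+t. ennreal (?p t) \<partial>lborel) \<noteq> \<infinity>"
    using nn_integral_eq_integral[OF pi] by simp
  ultimately have "AE t in lborel. ennreal (?p t) = ennreal (?n t)"
    by (subst (asm) finite_density_unique) auto
  then show ?thesis by eventually_elim (auto simp: max_def split: if_splits)
qed

text \<open>At 0 the limit is 0, in agreement with the open half-line, so differences of such limits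
  are indicators of intervals \<open>{u<..w}\<close>.\<close>

lemma smooth_step_limit:
  fixes \<theta> :: "nat \<Rightarrow> real \<Rightarrow> real"
  assumes "\<And>n x. x \<le> 0 \<Longrightarrow> \<theta> n x = 0" "\<And>n x. x \<ge> \<epsilon> n \<Longrightarrow> \<theta> n x = 1" "\<epsilon> \<longlonglongrightarrow> 0"
  shows "(\<lambda>n. \<theta> n x) \<longlonglongrightarrow> indicator {0<..} x"
proof (cases "x > 0")
  case True
  have "\<forall>\<^sub>F n in sequentially. \<epsilon> n < x" by (rule order_tendstoD(2)[OF assms(3) True])
  then have "\<forall>\<^sub>F n in sequentially. \<theta> n x = indicator {0<..} x"
    by eventually_elim (use assms(2) True in auto)
  then show ?thesis by (rule tendsto_eventually)
qed (use assms(1) in auto)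

text \<open>The distribution function of \<mu> is one function with distributional derivative \<mu>;
  any other can then be compared with it.\<close>

lemma (in borel_finite_measure) integral_test_function:
  fixes \<phi> \<phi>' :: "real \<Rightarrow> real"
  assumes \<phi>: "\<And>x. (\<phi> has_real_derivative \<phi>' x) (at x)" "\<And>x. isCont \<phi>' x" and ends: "\<phi> 0 = 0" "\<phi> 1 = 0"
  shows "(LINT x:{0..1}|lborel. \<phi>' x * measure \<mu> {0..x}) = - (LINT x:{0<..<1}|\<mu>. \<phi> x)"
proof -
  have c: "continuous_on UNIV \<phi>'" using \<phi>(2) by (simp add: continuous_on_eq_continuous_at)
  have w: "set_integrable lborel {0..1} \<phi>'"
    by (rule borel_integrable_atLeastAtMost') (rule continuous_on_subset[OF c], simp)
  have "set_integrable \<mu> {0..1} (\<lambda>_. 1 :: real)"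
    unfolding set_integrable_def by (rule integrable_const_bound[of _ 1]) (auto simp: indicator_def)
  from integral_by_parts_lborel[OF w this]
  have "(LINT x:{0..1}|lborel. \<phi>' x * (LINT t:{0..x}|\<mu>. 1)) = (LINT t:{0..1}|\<mu>. 1 * (LINT x:{t..1}|lborel. \<phi>' x))" by simp
  also have "\<dots> = (LINT t:{0..1}|\<mu>. - \<phi> t)"
  proof (rule set_lebesgue_integral_cong)
    show "\<forall>t. t \<in> {0..1} \<longrightarrow> 1 * (LINT x:{t..1}|lborel. \<phi>' x) = - \<phi> t"
    proof (intro allI impI)
      fix t :: real assume "t \<in> {0..1}"
      then have "(\<integral>x. \<phi>' x * indicator {t..1} x \<partial>lborel) = \<phi> 1 - \<phi> t"
        by (intro integral_FTC_Icc_real \<phi>) auto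
      then show "1 * (LINT x:{t..1}|lborel. \<phi>' x) = - \<phi> t"
        unfolding set_lebesgue_integral_def by (simp add: ends mult.commute)
    qed
  qed simp
  also have "\<dots> = - (LINT x:{0<..<1}|\<mu>. \<phi> x)"
  proof -
    have "(LINT t:{0..1}|\<mu>. - \<phi> t) = (\<integral>t. - (indicator {0<..<1} t *\<^sub>R \<phi> t) \<partial>\<mu>)"
      unfolding set_lebesgue_integral_def
    proof (rule Bochner_Integration.integral_cong[OF refl])
      fix t :: real
      show "indicator {0..1} t *\<^sub>R - \<phi> t = - (indicator {0<..<1} t *\<^sub>R \<phi> t)"
        using ends by (cases "t = 0"; cases "t = 1") (auto simp: indicator_def)
    qed
    then show ?thesis unfolding set_lebesgue_integral_def by simp
  qed
  finally show ?thesis unfolding set_lebesgue_integral_def by simp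
qed

text \<open>The lemma of du Bois-Reymond: the difference \<open>g\<close> of \<open>f\<close> and
  the distribution function annihilates all derivatives of test functions. Approximating indicators
  by such derivatives shows that the integral of \<open>g\<close> over an interval is proportional
  to its length.\<close>

lemma distributional_derivative_cdf:
  assumes f: "in_Linfinity01 f" and d: "distributional_derivative01 f \<mu>"
  obtains c where "AE x in lborel. x \<in> {0<..<1} \<longrightarrow> f x = measure \<mu> {0..x} + c"
proof -
  have "finite_measure \<mu>" and sets_mu: "sets \<mu> = sets borel" using d by (auto simp: distributional_derivative01_def)
  then interpret borel_finite_measure \<mu> by (simp add: borel_finite_measure_def borel_finite_measure_axioms_def)
  let ?I = "{0<..<1::real}"
  have "(\<lambda>x. indicator ?I x *\<^sub>R f x) \<in> borel_measurable lebesgue"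
    using f unfolding in_Linfinity01_def by (subst (asm) borel_measurable_restrict_space_iff) auto
  \<comment> \<open>Here \<open>f'\<close> is a Borel representative of \<open>f\<close> cut off
    outside the interval, not a derivative.\<close>
  then obtain f' where f'[measurable]: "f' \<in> borel_measurable lborel" and ff': "AE x in lborel. indicator ?I x *\<^sub>R f x = f' x"
    using completion_ex_borel_measurable_real by blast
  obtain K0 where "AE x in lebesgue_on ?I. \<bar>f x\<bar> \<le> K0" using f unfolding in_Linfinity01_def by blast
  then have "AE x in lebesgue. x \<in> ?I \<longrightarrow> \<bar>f x\<bar> \<le> K0" by (subst (asm) AE_restrict_space_iff) auto
  then have K0: "AE x in lborel. x \<in> ?I \<longrightarrow> \<bar>f x\<bar> \<le> K0" by (simp add: AE_completion_iff)
  define F where "F x = measure \<mu> {0..x}" for x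
  have "mono F" unfolding F_def by (intro monoI finite_measure_mono) auto
  then have F_meas[measurable]: "F \<in> borel_measurable borel" by (rule borel_measurable_mono)
  define K where "K = \<bar>K0\<bar> + measure \<mu> UNIV"
  have F_le: "0 \<le> F x" "F x \<le> measure \<mu> UNIV" for x unfolding F_def by (auto intro: finite_measure_mono)
  define g where "g x = indicator ?I x * (f' x - F x)" for x
  have g_meas[measurable]: "g \<in> borel_measurable borel" unfolding g_def using f' by measurable
  have g_bd: "AE x in lborel. \<bar>g x\<bar> \<le> K"
    using K0 ff'
  proof eventually_elim
    case (elim x)
    show ?case
    proof (cases "x \<in> ?I")
      case True
      then have "f' x = f x" "\<bar>f x\<bar> \<le> K0" using elim by auto
      then show ?thesis using True F_le[of x] by (auto simp: g_def K_def)
    next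
      case False
      then show ?thesis using F_le[of 0] by (simp add: g_def K_def)
    qed
  qed
  have g_int: "integrable lborel g"
  proof (rule integrableI_bounded_set[where A = ?I and B = K])
    show "AE x in lborel. x \<in> ?I \<longrightarrow> norm (g x) \<le> K" using g_bd by eventually_elim simp
  qed (auto simp: g_def)
  have zero: "(\<integral>x. g x * \<phi>' x \<partial>lborel) = 0"
    if \<phi>: "test_function01 \<phi>" "\<And>x. (\<phi> has_real_derivative \<phi>' x) (at x)" "\<And>x. isCont \<phi>' x" for \<phi> \<phi>'
  proof -
    have c: "continuous_on UNIV \<phi>'" using \<phi>(3) by (simp add: continuous_on_eq_continuous_at)
    then have m[measurable]: "\<phi>' \<in> borel_measurable borel" by (rule borel_measurable_continuous_onI)
    have ends: "\<phi> 0 = 0" "\<phi> 1 = 0" using \<phi>(1) unfolding test_function01_def by force+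
    have dphi: "deriv \<phi> = \<phi>'" by (rule ext) (rule DERIV_imp_deriv[OF \<phi>(2)])
    have "(LINT x:?I|lebesgue. f x * \<phi>' x) = - (LINT x:?I|\<mu>. \<phi> x)"
      using d \<phi>(1) unfolding distributional_derivative01_def dphi[symmetric] by blast
    moreover have "(LINT x:?I|lebesgue. f x * \<phi>' x) = (\<integral>x. f' x * \<phi>' x \<partial>lebesgue)"
      unfolding set_lebesgue_integral_def
    proof (rule integral_cong_AE)
      have mm: "(\<lambda>x. f' x * \<phi>' x) \<in> borel_measurable lebesgue"
        by (intro measurable_completion) measurable
      have mf: "(\<lambda>x. (indicator ?I x *\<^sub>R f x) * \<phi>' x) \<in> borel_measurable lebesgue"
        by (intro borel_measurable_times \<open>(\<lambda>x. indicator ?I x *\<^sub>R f x) \<in> borel_measurable lebesgue\<close> measurable_completion) (use m in simp)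
      then show "(\<lambda>x. indicator ?I x *\<^sub>R (f x * \<phi>' x)) \<in> borel_measurable lebesgue" by (simp add: mult.assoc)
      show "(\<lambda>x. f' x * \<phi>' x) \<in> borel_measurable lebesgue" by (rule mm)
      show "AE x in lebesgue. indicator ?I x *\<^sub>R (f x * \<phi>' x) = f' x * \<phi>' x"
        using AE_completion[OF ff'] by eventually_elim (auto simp: mult.assoc[symmetric])
    qed
    moreover have "(\<integral>x. f' x * \<phi>' x \<partial>lebesgue) = (\<integral>x. f' x * \<phi>' x \<partial>lborel)"
      by (rule integral_completion) measurable
    moreover have "(\<integral>x. indicator ?I x * (F x * \<phi>' x) \<partial>lborel) = - (LINT x:?I|\<mu>. \<phi> x)"
    proof -
      have "(\<integral>x. indicator ?I x * (F x * \<phi>' x) \<partial>lborel) = (LINT x:{0..1}|lborel. \<phi>' x * F x)"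
        unfolding set_lebesgue_integral_def
      proof (rule integral_cong_AE)
        show "AE x in lborel. indicator ?I x * (F x * \<phi>' x) = indicator {0..1} x *\<^sub>R (\<phi>' x * F x)"
          using AE_lborel_singleton[of 0] AE_lborel_singleton[of 1] by eventually_elim (auto simp: indicator_def)
      qed measurable
      then show ?thesis using integral_test_function[OF \<phi>(2,3) ends] by (simp add: F_def)
    qed
    moreover have "(\<integral>x. g x * \<phi>' x \<partial>lborel) = (\<integral>x. f' x * \<phi>' x \<partial>lborel) - (\<integral>x. indicator ?I x * (F x * \<phi>' x) \<partial>lborel)"
    proof -
      obtain L where L: "\<forall>x\<in>{0..1}. \<bar>\<phi>' x\<bar> \<le> L"
        using compact_imp_bounded[OF compact_continuous_image[OF continuous_on_subset[OF c subset_UNIV] compact_Icc[of 0 1]]]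
        unfolding bounded_iff by auto
      have "(0::real) \<in> {0..1}" by simp
      then have L0: "L \<ge> 0" using L abs_ge_zero order_trans by blast
      have i1: "integrable lborel (\<lambda>x. f' x * \<phi>' x)"
      proof (rule integrableI_bounded_set[where A = ?I and B = "\<bar>K0\<bar> * L"])
        show "AE x in lborel. x \<in> ?I \<longrightarrow> norm (f' x * \<phi>' x) \<le> \<bar>K0\<bar> * L"
          using K0 ff'
        proof eventually_elim
          case (elim x)
          show ?case
          proof
            assume x: "x \<in> ?I"
            then have "\<bar>f' x\<bar> \<le> \<bar>K0\<bar>" "\<bar>\<phi>' x\<bar> \<le> L" using elim L by auto
            then show "norm (f' x * \<phi>' x) \<le> \<bar>K0\<bar> * L" by (simp add: abs_mult mult_mono)
          qed
        qed
        show "AE x in lborel. x \<notin> ?I \<longrightarrow> f' x * \<phi>' x = 0" using ff' by eventually_elim auto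
      qed (use f' in auto)
      have i2: "integrable lborel (\<lambda>x. indicator ?I x * (F x * \<phi>' x))"
      proof (rule integrableI_bounded_set[where A = ?I and B = "measure \<mu> UNIV * L"])
        show "AE x in lborel. x \<in> ?I \<longrightarrow> norm (indicator ?I x * (F x * \<phi>' x)) \<le> measure \<mu> UNIV * L"
          using F_le L L0 by (intro AE_I2) (auto simp: abs_mult intro!: mult_mono)
      qed (auto)
      have "(\<integral>x. g x * \<phi>' x \<partial>lborel) = (\<integral>x. f' x * \<phi>' x - indicator ?I x * (F x * \<phi>' x) \<partial>lborel)"
      proof (rule integral_cong_AE)
        show "AE x in lborel. g x * \<phi>' x = f' x * \<phi>' x - indicator ?I x * (F x * \<phi>' x)"
          using ff'
        proof eventually_elim
          case (elim x)
          then show ?case by (cases "x \<in> ?I") (auto simp: g_def algebra_simps)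
        qed
      qed (use f' in measurable)
      then show ?thesis using Bochner_Integration.integral_diff[OF i1 i2] by simp
    qed
    ultimately show ?thesis by simp
  qed
  obtain b b' where b: "bump_span b'" "\<And>x. (b has_real_derivative b' x) (at x)"
    "\<And>x. x \<le> 0 \<Longrightarrow> b x = 0" "\<And>x. x \<ge> 1/4 \<Longrightarrow> b x = 1" "\<And>x. 0 \<le> b x" "\<And>x. b x \<le> 1"
    "\<And>c. bump_span (\<lambda>x. b' (x - c))" by (rule smooth_step_exists[of "1/4"]) auto
  define \<beta> \<beta>' where "\<beta> x = b (x - 1/4)" and "\<beta>' x = b' (x - 1/4)" for x
  have \<beta>: "bump_span \<beta>'" "\<And>x. (\<beta> has_real_derivative \<beta>' x) (at x)" "\<And>x. x \<le> 1/4 \<Longrightarrow> \<beta> x = 0" "\<And>x. x \<ge> 1/2 \<Longrightarrow> \<beta> x = 1"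
  proof -
    show "bump_span \<beta>'" unfolding \<beta>'_def[abs_def] by (rule b(7))
    show "(\<beta> has_real_derivative \<beta>' x) (at x)" for x
    proof -
      have "((\<lambda>x. b (x - 1/4)) has_real_derivative b' (x - 1/4) * 1) (at x)"
        by (rule DERIV_chain2[OF b(2)]) (auto intro!: derivative_eq_intros)
      then show ?thesis unfolding \<beta>_def[abs_def] \<beta>'_def by simp
    qed
  qed (auto simp: \<beta>_def b)
  have \<beta>'_cont: "isCont \<beta>' x" for x using bump_span_deriv[OF \<beta>(1)] DERIV_isCont by blast
  then have \<beta>'_c: "continuous_on A \<beta>'" for A by (simp add: continuous_at_imp_continuous_on)
  then have [measurable]: "\<beta>' \<in> borel_measurable borel" by (intro borel_measurable_continuous_onI)
  obtain L where L: "\<forall>x\<in>{0..1}. \<bar>\<beta>' x\<bar> \<le> L"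
    using compact_imp_bounded[OF compact_continuous_image[OF \<beta>'_c compact_Icc[of 0 1]]] unfolding bounded_iff by auto
  \<comment> \<open>The constant by which the two functions will differ: the mean of
    \<open>g\<close> with respect to the fixed bump.\<close>
  define c where "c = (\<integral>x. g x * \<beta>' x \<partial>lborel)"
  have gb_int: "integrable lborel (\<lambda>x. g x * \<beta>' x)"
  proof (rule integrableI_bounded_set[where A = ?I and B = "K * L"])
    show "AE x in lborel. x \<in> ?I \<longrightarrow> norm (g x * \<beta>' x) \<le> K * L"
      using g_bd by eventually_elim (use L in \<open>auto simp: abs_mult intro!: mult_mono\<close>)
  qed (auto simp: g_def)
  have lin: "(\<integral>x. g x * indicator {u<..w} x \<partial>lborel) = (w - u) * c" if uw: "0 < u" "u < w" "w < 1" for u w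
  proof -
    \<comment> \<open>The shift by 2 keeps \<open>w + \<epsilon> n\<close> strictly below 1 for
      \<open>n = 0\<close> as well.\<close>
    define \<epsilon> where "\<epsilon> n = (1 - w) / real (n + 2)" for n
    have \<epsilon>: "0 < \<epsilon> n" "w + \<epsilon> n < 1" for n
    proof -
      show "0 < \<epsilon> n" using uw by (simp add: \<epsilon>_def)
      have "\<epsilon> n < (1 - w) / 1" unfolding \<epsilon>_def using uw by (intro divide_strict_left_mono) auto
      then show "w + \<epsilon> n < 1" by simp
    qed
    have "(\<lambda>n. (1 - w) / real (n + 2)) \<longlonglongrightarrow> 0"
      by (rule LIMSEQ_ignore_initial_segment[OF lim_const_over_n])
    then have \<epsilon>0: "\<epsilon> \<longlonglongrightarrow> 0" unfolding \<epsilon>_def[abs_def] .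
    have "\<exists>\<phi> \<theta>. test_function01 \<phi> \<and> (\<forall>x. (\<phi> has_real_derivative (\<theta> (x - u) - \<theta> (x - w) - (w - u) * \<beta>' x)) (at x)) \<and>
      (\<forall>x\<le>0. \<theta> x = 0) \<and> (\<forall>x\<ge>\<epsilon> n. \<theta> x = 1) \<and> (\<forall>x. 0 \<le> \<theta> x \<and> \<theta> x \<le> 1) \<and> (\<forall>x. isCont \<theta> x)" for n
    proof -
      obtain \<phi> \<theta> where t: "test_function01 \<phi>"
        "\<And>x. (\<phi> has_real_derivative (\<theta> (x - u) - \<theta> (x - w) - (w - u) * \<beta>' x)) (at x)"
        "\<And>x. x \<le> 0 \<Longrightarrow> \<theta> x = 0" "\<And>x. x \<ge> \<epsilon> n \<Longrightarrow> \<theta> x = 1" "\<And>x. 0 \<le> \<theta> x" "\<And>x. \<theta> x \<le> 1"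
        "\<And>x. isCont \<theta> x" by (rule test_function_exists[OF uw(1,2) \<epsilon>[of n] \<beta>], assumption, assumption, rule that)
      show ?thesis by (rule exI[of _ \<phi>], rule exI[of _ \<theta>]) (use t in auto)
    qed
    then obtain \<phi> \<theta> where \<phi>: "\<And>n. test_function01 (\<phi> n)"
      "\<And>n x. (\<phi> n has_real_derivative (\<theta> n (x - u) - \<theta> n (x - w) - (w - u) * \<beta>' x)) (at x)"
      "\<And>n x. x \<le> 0 \<Longrightarrow> \<theta> n x = 0" "\<And>n x. x \<ge> \<epsilon> n \<Longrightarrow> \<theta> n x = 1" "\<And>n x. 0 \<le> \<theta> n x \<and> \<theta> n x \<le> 1" "\<And>n x. isCont (\<theta> n) x"
      by metis
    have \<theta>_meas[measurable]: "\<theta> n \<in> borel_measurable borel" for n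
      by (intro borel_measurable_continuous_onI continuous_at_imp_continuous_on ballI \<phi>(6))
    define \<psi> where "\<psi> n x = \<theta> n (x - u) - \<theta> n (x - w) - (w - u) * \<beta>' x" for n x
    have \<psi>0: "(\<integral>x. g x * \<psi> n x \<partial>lborel) = 0" for n
    proof (rule zero[OF \<phi>(1)[of n]])
      show "(\<phi> n has_real_derivative \<psi> n x) (at x)" for x unfolding \<psi>_def by (rule \<phi>(2))
      show "isCont (\<psi> n) x" for x unfolding \<psi>_def[abs_def]
        by (intro continuous_intros \<beta>'_cont isCont_o2[OF _ \<phi>(6)])
    qed
    have "(\<lambda>n. \<integral>x. g x * \<psi> n x \<partial>lborel) \<longlonglongrightarrow> (\<integral>x. g x * (indicator {u<..w} x - (w - u) * \<beta>' x) \<partial>lborel)"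
    proof (rule integral_dominated_convergence[where w = "\<lambda>x. 2 * \<bar>g x\<bar> + (w - u) * \<bar>g x * \<beta>' x\<bar>"])
      show "integrable lborel (\<lambda>x. 2 * \<bar>g x\<bar> + (w - u) * \<bar>g x * \<beta>' x\<bar>)"
        using g_int gb_int by (intro Bochner_Integration.integrable_add integrable_mult_right integrable_abs)
      show "AE x in lborel. norm (g x * \<psi> n x) \<le> 2 * \<bar>g x\<bar> + (w - u) * \<bar>g x * \<beta>' x\<bar>" for n
      proof (rule AE_I2)
        fix x
        have "\<bar>\<theta> n (x - u) - \<theta> n (x - w)\<bar> \<le> 2" using \<phi>(5)[of n "x - u"] \<phi>(5)[of n "x - w"] by linarith
        moreover have "\<bar>(w - u) * \<beta>' x\<bar> = (w - u) * \<bar>\<beta>' x\<bar>" using uw by (simp add: abs_mult)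
        ultimately have "\<bar>\<psi> n x\<bar> \<le> 2 + (w - u) * \<bar>\<beta>' x\<bar>" unfolding \<psi>_def by linarith
        then have "\<bar>g x\<bar> * \<bar>\<psi> n x\<bar> \<le> \<bar>g x\<bar> * (2 + (w - u) * \<bar>\<beta>' x\<bar>)" by (intro mult_left_mono) auto
        then show "norm (g x * \<psi> n x) \<le> 2 * \<bar>g x\<bar> + (w - u) * \<bar>g x * \<beta>' x\<bar>"
          by (simp add: abs_mult algebra_simps)
      qed
      show "AE x in lborel. (\<lambda>n. g x * \<psi> n x) \<longlonglongrightarrow> g x * (indicator {u<..w} x - (w - u) * \<beta>' x)"
      proof (rule AE_I2)
        fix x
        have "(\<lambda>n. \<psi> n x) \<longlonglongrightarrow> indicator {0<..} (x - u) - indicator {0<..} (x - w) - (w - u) * \<beta>' x"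
          unfolding \<psi>_def using \<phi>(3,4) \<epsilon>0 by (intro tendsto_intros smooth_step_limit[where \<epsilon> = \<epsilon>]) auto
        moreover have "indicator {0<..} (x - u) - indicator {0<..} (x - w) = (indicator {u<..w} x :: real)"
          using uw by (auto simp: indicator_def)
        ultimately show "(\<lambda>n. g x * \<psi> n x) \<longlonglongrightarrow> g x * (indicator {u<..w} x - (w - u) * \<beta>' x)"
          by (intro tendsto_mult tendsto_const) simp
      qed
    qed (auto simp: \<psi>_def)
    then have "(\<integral>x. g x * (indicator {u<..w} x - (w - u) * \<beta>' x) \<partial>lborel) = 0"
      unfolding \<psi>0 by (rule LIMSEQ_unique) simp
    moreover have "(\<integral>x. g x * (indicator {u<..w} x - (w - u) * \<beta>' x) \<partial>lborel) =
      (\<integral>x. g x * indicator {u<..w} x \<partial>lborel) - (\<integral>x. (w - u) * (g x * \<beta>' x) \<partial>lborel)"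
    proof -
      have i1: "integrable lborel (\<lambda>x. g x * indicator {u<..w} x)"
        by (rule integrable_real_mult_indicator[OF _ g_int]) simp
      have i2: "integrable lborel (\<lambda>x. (w - u) * (g x * \<beta>' x))"
        by (rule integrable_mult_right) (rule gb_int)
      have "(\<integral>x. g x * (indicator {u<..w} x - (w - u) * \<beta>' x) \<partial>lborel) =
        (\<integral>x. g x * indicator {u<..w} x - (w - u) * (g x * \<beta>' x) \<partial>lborel)"
        by (rule Bochner_Integration.integral_cong) (simp_all add: algebra_simps)
      then show ?thesis using Bochner_Integration.integral_diff[OF i1 i2] by (simp only:)
    qed
    ultimately show ?thesis by (simp add: c_def)
  qed
  \<comment> \<open>The increments of this primitive are linear inside the interval; continuity
    extends this to the endpoints, and \<open>P 0 = 0\<close> excludes an additive constant.\<close>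
  define P where "P x = (LINT t:{0..x}|lborel. g t)" for x
  have P: "P x = c * x" if "x \<in> {0..1}" for x
  proof -
    have cP: "continuous_on {0..1} P"
    proof -
      have sg: "set_integrable lborel {0..1} g"
        using integrable_mult_indicator[of "{0..1}" lborel g] g_int unfolding set_integrable_def by simp
      show ?thesis unfolding P_def[abs_def]
        by (rule continuous_on_primitive[OF _ _ sg]) auto
    qed
    have diff: "P w - P u = (w - u) * c" if uw: "0 < u" "u < w" "w < 1" for u w
    proof -
      have e: "{0..w} = {0..u} \<union> {u<..w}" using uw by auto
      have i: "set_integrable lborel A g" if "A \<in> sets borel" for A
        using integrable_mult_indicator[of A lborel g] g_int that unfolding set_integrable_def by simp
      have "P w = P u + (LINT t:{u<..w}|lborel. g t)"
        unfolding P_def e by (rule set_integral_Un) (auto intro: i)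
      then show ?thesis using lin[OF uw] unfolding set_lebesgue_integral_def by (simp add: mult.commute)
    qed
    define a where "a = P (1/2) - c / 2"
    have on: "P x - c * x = a" if "x \<in> {0<..<1}" for x
    proof (cases x "1/2 :: real" rule: linorder_cases)
      case less
      then show ?thesis using diff[of x "1/2"] that by (simp add: a_def algebra_simps)
    next
      case equal
      show ?thesis unfolding equal a_def by simp
    next
      case greater
      then show ?thesis using diff[of "1/2" x] that by (simp add: a_def algebra_simps)
    qed
    have cl: "closure {0<..<1::real} = {0..1}" by (rule closure_greaterThanLessThan) simp
    have all: "P x - c * x = a" if "x \<in> {0..1}" for x
      by (rule continuous_constant_on_closure[where S = "{0<..<1}" and f = "\<lambda>x. P x - c * x"])
         (use that on in \<open>auto simp: cl intro!: continuous_intros cP\<close>)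
    have "P 0 = 0"
    proof -
      have "AE t in lborel. indicator {0..0} t *\<^sub>R g t = 0" using AE_lborel_singleton[of 0] by eventually_elim auto
      then show ?thesis unfolding P_def set_lebesgue_integral_def by (rule integral_eq_zero_AE)
    qed
    then have "a = 0" using all[of 0] by simp
    then show ?thesis using all[OF that] by simp
  qed
  define h where "h x = g x - indicator ?I x * c" for x
  have h_int: "integrable lborel h" unfolding h_def by (intro Bochner_Integration.integrable_diff g_int) auto
  have h_upto: "(\<integral>t. indicator {..x} t * h t \<partial>lborel) = 0" for x
  proof -
    have *: "(\<integral>t. indicator {0..y} t * h t \<partial>lborel) = 0" if y: "y \<in> {0..1}" for y
    proof -
      have "(\<integral>t. indicator {0..y} t * h t \<partial>lborel) = (\<integral>t. indicator {0..y} t * g t - c * indicator {0..y} t \<partial>lborel)"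
      proof (rule integral_cong_AE)
        show "AE t in lborel. indicator {0..y} t * h t = indicator {0..y} t * g t - c * indicator {0..y} t"
          using AE_lborel_singleton[of 0] AE_lborel_singleton[of 1]
          by eventually_elim (use y in \<open>auto simp: h_def indicator_def algebra_simps\<close>)
      qed (auto simp: h_def)
      also have "\<dots> = P y - c * y"
        unfolding P_def set_lebesgue_integral_def using y g_int integrable_real_mult_indicator[of "{0..y}" lborel g]
        by (subst Bochner_Integration.integral_diff) (auto simp: mult.commute)
      finally show ?thesis using P[OF y] by simp
    qed
    have "(\<integral>t. indicator {..x} t * h t \<partial>lborel) = (\<integral>t. indicator {0..max 0 (min 1 x)} t * h t \<partial>lborel)"
    proof (rule integral_cong_AE)
      show "AE t in lborel. indicator {..x} t * h t = indicator {0..max 0 (min 1 x)} t * h t"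
        using AE_lborel_singleton[of 0]
        by eventually_elim (auto simp: h_def g_def indicator_def)
    qed (auto simp: h_def)
    then show ?thesis using *[of "max 0 (min 1 x)"] by simp
  qed
  have h_total: "(\<integral>t. h t \<partial>lborel) = 0"
  proof -
    have "(\<integral>t. h t \<partial>lborel) = (\<integral>t. indicator {..1} t * h t \<partial>lborel)"
      by (rule Bochner_Integration.integral_cong) (auto simp: h_def g_def indicator_def)
    then show ?thesis using h_upto by simp
  qed
  have "AE t in lborel. h t = 0"
  proof (rule AE_zero_of_halfline_integrals[OF h_int])
    fix x
    have "(\<integral>t. indicator {x<..} t * h t \<partial>lborel) = (\<integral>t. h t - indicator {..x} t * h t \<partial>lborel)"
      by (rule Bochner_Integration.integral_cong) (auto simp: indicator_def)
    also have "\<dots> = 0"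
      using h_upto[of x] h_total h_int integrable_real_mult_indicator[of "{..x}" lborel h]
      by (subst Bochner_Integration.integral_diff) (auto simp: mult.commute)
    finally show "(\<integral>t. indicator {x<..} t * h t \<partial>lborel) = 0" .
  qed
  then have "AE x in lborel. x \<in> ?I \<longrightarrow> f x = measure \<mu> {0..x} + c"
    using ff' by eventually_elim (auto simp: h_def g_def F_def)
  then show ?thesis by (rule that)
qed

section \<open>The ladder as a distribution function\<close>

lemma inv_ladder_map:
  assumes "a < b"
  shows "inv (ladder_map a b e) x = (if e = 0 then (x - a) / (b - a) else (b - x) / (b - a))"
proof (rule inv_f_eq)
  show "inj (ladder_map a b e)" using assms by (auto simp: inj_def ladder_map_def)
  show "ladder_map a b e (if e = 0 then (x - a) / (b - a) else (b - x) / (b - a)) = x"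
    using assms by (simp add: ladder_map_def)
qed

definition clamp01 :: "real \<Rightarrow> real" where "clamp01 x = max 0 (min 1 x)"

lemma clamp01_cont [continuous_intros]: "continuous_on A f \<Longrightarrow> continuous_on A (\<lambda>x. clamp01 (f x))"
  unfolding clamp01_def by (intro continuous_intros)

lemma clamp01_simps: "x \<le> 0 \<Longrightarrow> clamp01 x = 0" "1 \<le> x \<Longrightarrow> clamp01 x = 1" "0 \<le> x \<Longrightarrow> x \<le> 1 \<Longrightarrow> clamp01 x = x"
  by (auto simp: clamp01_def)

locale gapped_ladder =
  fixes m :: nat and a b \<rho> :: "nat \<Rightarrow> real" and e :: "nat \<Rightarrow> nat"
  assumes params: "ladder_params m a b \<rho> e"
    and gaps: "\<And>i. i \<in> {2..m} \<Longrightarrow> b (i - 1) < a i"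
begin

lemma m_ge_2: "2 \<le> m" and rho_sum: "(\<Sum>i=1..m. \<rho> i) = 1"
  using params unfolding ladder_params_def by simp_all

lemma ab: "i \<in> {1..m} \<Longrightarrow> 0 \<le> a i \<and> a i < b i \<and> b i \<le> 1"
  using params unfolding ladder_params_def by blast

lemma rho_pos: "i \<in> {1..m} \<Longrightarrow> 0 < \<rho> i"
  using params unfolding ladder_params_def by blast

lemma e01: "i \<in> {1..m} \<Longrightarrow> e i = 0 \<or> e i = 1"
  using params unfolding ladder_params_def by blast

lemma order: "i \<in> {1..m} \<Longrightarrow> j \<in> {1..m} \<Longrightarrow> i < j \<Longrightarrow> b i < a j"
proof (induction j)
  case (Suc j)
  have g: "b j < a (Suc j)" if "1 \<le> j" using gaps[of "Suc j"] Suc.prems that by auto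
  show ?case
  proof (cases "i = j")
    case True
    then show ?thesis using g Suc.prems by auto
  next
    case False
    then have "b i < a j" using Suc by auto
    then show ?thesis using g ab[of j] Suc.prems False by force
  qed
qed simp

definition U :: "nat \<Rightarrow> real \<Rightarrow> real" where
  "U i x = (if e i = 0 then (x - a i) / (b i - a i) else (b i - x) / (b i - a i))"

lemma U_eq_inv: "i \<in> {1..m} \<Longrightarrow> inv (ladder_map (a i) (b i) (e i)) x = U i x"
  using inv_ladder_map[of "a i" "b i" "e i" x] ab[of i] by (simp add: U_def)

lemma U_range:
  assumes "i \<in> {1..m}"
  shows "x \<le> a i \<Longrightarrow> (if e i = 0 then U i x \<le> 0 else 1 \<le> U i x)"
    "b i \<le> x \<Longrightarrow> (if e i = 0 then 1 \<le> U i x else U i x \<le> 0)"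
    "a i \<le> x \<Longrightarrow> x \<le> b i \<Longrightarrow> 0 \<le> U i x \<and> U i x \<le> 1"
    "a i < x \<Longrightarrow> x < b i \<Longrightarrow> 0 < U i x \<and> U i x < 1"
proof -
  have d: "0 < b i - a i" using ab[OF assms] by simp
  show "x \<le> a i \<Longrightarrow> (if e i = 0 then U i x \<le> 0 else 1 \<le> U i x)"
    "b i \<le> x \<Longrightarrow> (if e i = 0 then 1 \<le> U i x else U i x \<le> 0)"
    "a i \<le> x \<Longrightarrow> x \<le> b i \<Longrightarrow> 0 \<le> U i x \<and> U i x \<le> 1"
    "a i < x \<Longrightarrow> x < b i \<Longrightarrow> 0 < U i x \<and> U i x < 1"
    using d by (simp_all add: U_def pos_le_divide_eq pos_divide_le_eq pos_less_divide_eq pos_divide_less_eq)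
qed

text \<open>On functions with \<open>f 0 = 0\<close> and \<open>f 1 = 1\<close> this is the ladder operator, in a form
  that makes continuity of the image evident.\<close>

definition smooth_op :: "(real \<Rightarrow> real) \<Rightarrow> real \<Rightarrow> real" where
  "smooth_op f x = (\<Sum>i=1..m. \<rho> i * (if e i = 0 then f (clamp01 (U i x)) else 1 - f (clamp01 (U i x))))"

lemma smooth_op_cont:
  assumes "continuous_on UNIV f"
  shows "continuous_on UNIV (smooth_op f)"
  unfolding smooth_op_def[abs_def]
proof (intro continuous_on_sum continuous_intros)
  fix i assume "i \<in> {1..m}"
  have "continuous_on UNIV (U i)"
    unfolding U_def[abs_def] using ab[OF \<open>i \<in> {1..m}\<close>] by (cases "e i = 0") (auto intro!: continuous_intros)
  then have "continuous_on UNIV (\<lambda>x. f (clamp01 (U i x)))"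
    by (intro continuous_on_compose2[OF assms] clamp01_cont) auto
  then show "continuous_on UNIV (\<lambda>x. if e i = 0 then f (clamp01 (U i x)) else 1 - f (clamp01 (U i x)))"
    by (cases "e i = 0") (auto intro!: continuous_intros)
qed

lemma piece_value:
  assumes i: "i \<in> {1..m}" and f: "f 0 = 0" "f 1 = (1::real)"
  shows "(if e i = 0 then f (clamp01 (U i x)) else 1 - f (clamp01 (U i x))) =
    (if x \<le> a i then 0 else if b i \<le> x then 1 else if e i = 0 then f (U i x) else 1 - f (U i x))"
proof -
  consider "x \<le> a i" | "a i < x" "b i \<le> x" | "a i < x" "x < b i" by linarith
  then show ?thesis
  proof cases
    case 1
    then show ?thesis using U_range(1)[OF i 1] f by (cases "e i = 0") (simp_all add: clamp01_simps)
  next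
    case 2
    then show ?thesis using U_range(2)[OF i 2(2)] f by (cases "e i = 0") (simp_all add: clamp01_simps)
  next
    case 3
    then show ?thesis using U_range(3)[OF i, of x] f by (cases "e i = 0") (simp_all add: clamp01_simps)
  qed
qed

lemma smooth_op_ends:
  assumes f: "f 0 = 0" "f 1 = 1"
  shows "smooth_op f 0 = 0" "smooth_op f 1 = 1"
proof -
  have "smooth_op f 0 = (\<Sum>i=1..m. \<rho> i * 0)"
    unfolding smooth_op_def
  proof (rule sum.cong)
    fix i assume i: "i \<in> {1..m}"
    show "\<rho> i * (if e i = 0 then f (clamp01 (U i 0)) else 1 - f (clamp01 (U i 0))) = \<rho> i * 0"
      unfolding piece_value[OF i f] using ab[OF i] by simp
  qed simp
  then show "smooth_op f 0 = 0" by simp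
  have "smooth_op f 1 = (\<Sum>i=1..m. \<rho> i * 1)"
    unfolding smooth_op_def
  proof (rule sum.cong)
    fix i assume i: "i \<in> {1..m}"
    show "\<rho> i * (if e i = 0 then f (clamp01 (U i 1)) else 1 - f (clamp01 (U i 1))) = \<rho> i * 1"
      unfolding piece_value[OF i f] using ab[OF i] by simp
  qed simp
  then show "smooth_op f 1 = 1" using rho_sum by simp
qed

definition rmax :: real where "rmax = Max (\<rho> ` {1..m})"

lemma rho_le_rmax: "i \<in> {1..m} \<Longrightarrow> \<rho> i \<le> rmax"
  unfolding rmax_def by (intro Max_ge) auto

lemma rho_lt_1: "i \<in> {1..m} \<Longrightarrow> \<rho> i < 1"
proof -
  assume i: "i \<in> {1..m}"
  obtain j where j: "j \<in> {1..m}" "j \<noteq> i" using m_ge_2 i by (metis One_nat_def Suc_1 Suc_leD atLeastAtMost_iff n_not_Suc_n order_refl)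
  have "\<rho> i + \<rho> j = (\<Sum>k\<in>{i, j}. \<rho> k)" using j by simp
  also have "\<dots> \<le> (\<Sum>k=1..m. \<rho> k)"
    by (rule sum_mono2) (use i j rho_pos in \<open>auto intro: less_imp_le\<close>)
  finally show ?thesis using rho_sum rho_pos[OF j(1)] by simp
qed

lemma rmax: "0 \<le> rmax" "rmax < 1"
proof -
  have 1: "1 \<in> {1..m}" using m_ge_2 by simp
  show "0 \<le> rmax" using rho_le_rmax[OF 1] rho_pos[OF 1] by simp
  show "rmax < 1" unfolding rmax_def using 1 rho_lt_1 by (subst Max_less_iff) auto
qed

text \<open>The open pieces are disjoint, so at each \<open>x\<close> at most one term survives. The
  contraction factor is therefore the largest weight and not the sum of the weights, which is
  1.\<close>

lemma sum_at_most_one: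
  assumes g: "\<And>i. i \<in> {1..m} \<Longrightarrow> g i \<noteq> 0 \<Longrightarrow> a i < x \<and> x < b i"
    and B: "\<And>i. i \<in> {1..m} \<Longrightarrow> \<bar>g i\<bar> \<le> B" "B \<ge> 0"
  shows "\<bar>\<Sum>i=1..m. \<rho> i * g i\<bar> \<le> rmax * B"
proof (cases "\<exists>i\<in>{1..m}. g i \<noteq> 0")
  case False
  then have "(\<Sum>i=1..m. \<rho> i * g i) = 0" by (intro sum.neutral) auto
  then show ?thesis using rmax B by simp
next
  case True
  then obtain i where i: "i \<in> {1..m}" "g i \<noteq> 0" by blast
  have "g j = 0" if "j \<in> {1..m}" "j \<noteq> i" for j
  proof (rule ccontr)
    assume "g j \<noteq> 0"
    then show False using g[OF i] g[OF that(1)] order[of i j] order[of j i] i that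
      by (cases i j rule: linorder_cases) auto
  qed
  then have "(\<Sum>j=1..m. \<rho> j * g j) = (\<Sum>j\<in>{i}. \<rho> j * g j)"
    by (intro sum.mono_neutral_right) (use i in auto)
  then have "\<bar>\<Sum>j=1..m. \<rho> j * g j\<bar> = \<rho> i * \<bar>g i\<bar>" using rho_pos[OF i(1)] by (simp add: abs_mult)
  also have "\<dots> \<le> rmax * B" using rho_pos[OF i(1)] rho_le_rmax[OF i(1)] B(1)[OF i(1)] B(2) rmax by (intro mult_mono) auto
  finally show ?thesis .
qed

lemma smooth_op_contraction:
  assumes f: "f 0 = 0" "f 1 = 1" and g: "g 0 = 0" "g 1 = 1" and B: "\<And>x. \<bar>f x - g x\<bar> \<le> B"
  shows "\<bar>smooth_op f x - smooth_op g x\<bar> \<le> rmax * B"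
proof -
  let ?v = "\<lambda>f i. if e i = 0 then f (clamp01 (U i x)) else 1 - f (clamp01 (U i x))"
  have "smooth_op f x - smooth_op g x = (\<Sum>i=1..m. \<rho> i * (?v f i - ?v g i))"
    unfolding smooth_op_def by (simp add: sum_subtractf right_diff_distrib)
  also have "\<bar>\<dots>\<bar> \<le> rmax * B"
  proof (rule sum_at_most_one)
    fix i assume i: "i \<in> {1..m}"
    show "?v f i - ?v g i \<noteq> 0 \<Longrightarrow> a i < x \<and> x < b i"
      unfolding piece_value[OF i f] piece_value[OF i g] by (auto split: if_splits)
    show "\<bar>?v f i - ?v g i\<bar> \<le> B" using B[of "clamp01 (U i x)"] by (auto simp: abs_minus_commute)
  next
    show "B \<ge> 0" using B[of 0] by linarith
  qed
  finally show ?thesis .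
qed

text \<open>Banach's theorem on bounded continuous functions with \<open>f 0 = 0\<close> and
  \<open>f 1 = 1\<close>. The boundary values make any two images agree outside the open pieces, as
  \<open>sum_at_most_one\<close> requires; \<open>clamp01\<close> is a member of the set.\<close>

lemma smooth_fixed_point_exists:
  obtains f where "continuous_on UNIV f" "f 0 = 0" "f 1 = 1" "smooth_op f = f"
proof -
  let ?S = "{f :: real \<Rightarrow>\<^sub>C real. apply_bcontfun f 0 = 0 \<and> apply_bcontfun f 1 = 1}"
  define T where "T f = Bcontfun (smooth_op (apply_bcontfun f))" for f :: "real \<Rightarrow>\<^sub>C real"
  have bc: "smooth_op (apply_bcontfun f) \<in> bcontfun" for f :: "real \<Rightarrow>\<^sub>C real"
  proof -
    have bf: "bounded (range (apply_bcontfun f))" and cf: "continuous_on UNIV (apply_bcontfun f)"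
      using apply_bcontfun[of f] by (auto simp: bcontfun_def)
    obtain K where K: "\<And>x. \<bar>apply_bcontfun f x\<bar> \<le> K" using bf unfolding bounded_iff by auto
    have "\<bar>smooth_op (apply_bcontfun f) x\<bar> \<le> (\<Sum>i=1..m. \<rho> i * (1 + K))" for x
      unfolding smooth_op_def
    proof (rule order_trans[OF sum_abs sum_mono])
      fix i assume i: "i \<in> {1..m}"
      have "\<bar>if e i = 0 then apply_bcontfun f (clamp01 (U i x)) else 1 - apply_bcontfun f (clamp01 (U i x))\<bar> \<le> 1 + K"
        using K[of "clamp01 (U i x)"] by auto
      then show "\<bar>\<rho> i * (if e i = 0 then apply_bcontfun f (clamp01 (U i x)) else 1 - apply_bcontfun f (clamp01 (U i x)))\<bar> \<le> \<rho> i * (1 + K)"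
        using rho_pos[OF i] by (simp add: abs_mult mult_left_mono del: if_split)
    qed
    then have "bounded (range (smooth_op (apply_bcontfun f)))" unfolding bounded_iff by auto
    then show ?thesis using smooth_op_cont[OF cf] by (simp add: bcontfun_def)
  qed
  have T: "apply_bcontfun (T f) = smooth_op (apply_bcontfun f)" for f
    unfolding T_def by (rule Bcontfun_inverse[OF bc])
  have "\<exists>!f\<in>?S. T f = f"
  proof (rule Banach_fix)
    have "closed ?S"
    proof -
      have "?S = {f. apply_bcontfun f 0 = (0::real)} \<inter> {f. apply_bcontfun f 1 = (1::real)}" by auto
      moreover have "continuous_on UNIV (\<lambda>f :: real \<Rightarrow>\<^sub>C real. apply_bcontfun f x)" for x
      proof (rule lipschitz_on_continuous_on[of 1])
        show "1-lipschitz_on UNIV (\<lambda>f :: real \<Rightarrow>\<^sub>C real. apply_bcontfun f x)"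
          by (rule lipschitz_onI) (auto intro: dist_bounded)
      qed
      ultimately show ?thesis by (auto intro!: closed_Int closed_Collect_eq continuous_intros)
    qed
    then show "complete ?S" by (simp add: complete_eq_closed)
    have "clamp01 \<in> bcontfun"
    proof -
      have "continuous_on UNIV clamp01" using clamp01_cont[of UNIV "\<lambda>x. x"] by simp
      moreover have "bounded (range clamp01)" unfolding bounded_iff by (intro exI[of _ 1]) (auto simp: clamp01_def)
      ultimately show ?thesis by (simp add: bcontfun_def)
    qed
    then have "Bcontfun clamp01 \<in> ?S" by (simp add: Bcontfun_inverse clamp01_def)
    then show "?S \<noteq> {}" by blast
    show "0 \<le> rmax" "rmax < 1" by (rule rmax)+
    show "T ` ?S \<subseteq> ?S" using smooth_op_ends by (auto simp: T)
    show "dist (T f) (T g) \<le> rmax * dist f g" if "f \<in> ?S" "g \<in> ?S" for f g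
    proof (rule dist_bound)
      fix x
      have "\<bar>smooth_op (apply_bcontfun f) x - smooth_op (apply_bcontfun g) x\<bar> \<le> rmax * dist f g"
        using that dist_bounded[of f _ g] by (intro smooth_op_contraction) (auto simp: dist_real_def)
      then show "dist (apply_bcontfun (T f) x) (apply_bcontfun (T g) x) \<le> rmax * dist f g"
        by (simp add: T dist_real_def)
    qed
  qed
  then obtain f where f: "f \<in> ?S" "T f = f" by blast
  have "smooth_op (apply_bcontfun f) = apply_bcontfun f" using T[of f] f(2) by simp
  then show ?thesis using f(1) apply_bcontfun[of f] by (intro that[of "apply_bcontfun f"]) (auto simp: bcontfun_def)
qed

lemma AE_affine:
  assumes "AE x in lborel. P (x::real)" and c: "c \<noteq> 0"
  shows "AE x in lborel. P (t + c * x)"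
proof -
  obtain N where N: "{x. \<not> P x} \<subseteq> N" "N \<in> null_sets lborel"
    using assms(1) by (auto simp: eventually_ae_filter)
  have "{x. t + c * x \<in> N} \<in> null_sets lborel"
  proof -
    have [measurable]: "N \<in> sets borel" using N(2) by auto
    have "emeasure lborel N = \<bar>c\<bar> * emeasure (density (distr lborel borel (\<lambda>x. t + c * x)) (\<lambda>_. 1)) N"
      by (subst lborel_real_affine[OF c, of t]) (simp add: emeasure_density nn_integral_cmult density_1)
    then have "emeasure (distr lborel borel (\<lambda>x. t + c * x)) N = 0" using N(2) c by (auto simp: density_1 null_sets_def)
    then have "emeasure lborel ((\<lambda>x. t + c * x) -` N) = 0" by (subst (asm) emeasure_distr) auto
    moreover have "(\<lambda>x. t + c * x) -` N \<in> sets borel"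
      using measurable_sets[of "\<lambda>x. t + c * x" borel borel N] by simp
    ultimately show ?thesis by (auto simp: null_sets_def vimage_def)
  qed
  then have "AE x in lborel. x \<notin> {x. t + c * x \<in> N}" by (rule AE_not_in)
  then show ?thesis by eventually_elim (use N(1) in auto)
qed

text \<open>The contraction argument carried out almost everywhere: a bound on the difference is
  pulled back through the affine maps \<open>U i\<close>, which preserve null sets, and improves by
  the factor \<open>rmax\<close> each time. Both functions are bounded on the interval, almost
  everywhere in the case of \<open>C\<close>, which starts the iteration.\<close>

lemma ladder_AE_eq_smooth:
  assumes C: "cantor_ladder m a b \<rho> e C" and f: "continuous_on UNIV f" "f 0 = 0" "f 1 = 1" "smooth_op f = f"
  shows "AE x in lborel. x \<in> {0<..<1} \<longrightarrow> C x = f x"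
proof -
  obtain K where "AE x in lebesgue_on {0<..<1}. \<bar>C x\<bar> \<le> K" using C unfolding cantor_ladder_def in_Linfinity01_def by blast
  then have "AE x in lebesgue. x \<in> {0<..<1} \<longrightarrow> \<bar>C x\<bar> \<le> K" by (subst (asm) AE_restrict_space_iff) auto
  then have K: "AE x in lborel. x \<in> {0<..<1} \<longrightarrow> \<bar>C x\<bar> \<le> K" by (simp add: AE_completion_iff)
  have "AE x in lebesgue. x \<in> {0<..<1} \<longrightarrow> ladder_operator m a b \<rho> e C x = C x"
    using C unfolding cantor_ladder_def by (subst (asm) AE_restrict_space_iff) auto
  then have fix1: "AE x in lborel. x \<in> {0<..<1} \<longrightarrow> ladder_operator m a b \<rho> e C x = C x" by (simp add: AE_completion_iff)
  obtain L where L: "\<forall>x\<in>{0..1}. \<bar>f x\<bar> \<le> L"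
    using compact_imp_bounded[OF compact_continuous_image[OF continuous_on_subset[OF f(1) subset_UNIV] compact_Icc[of 0 1]]]
    unfolding bounded_iff by auto
  define B where "B = \<bar>K\<bar> + \<bar>L\<bar>"
  have step: "AE x in lborel. x \<in> {0<..<1} \<longrightarrow> \<bar>C x - f x\<bar> \<le> rmax * B'"
    if AE: "AE x in lborel. x \<in> {0<..<1} \<longrightarrow> \<bar>C x - f x\<bar> \<le> B'" and B': "B' \<ge> 0" for B'
  proof -
    have "AE x in lborel. \<forall>i\<in>{1..m}. a i < x \<longrightarrow> x < b i \<longrightarrow> \<bar>C (U i x) - f (U i x)\<bar> \<le> B'"
    proof (subst AE_finite_all[of "{1..m}"], simp, intro ballI)
      fix i assume i: "i \<in> {1..m}"
      have "\<exists>t c. c \<noteq> 0 \<and> U i = (\<lambda>x. t + c * x)"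
      proof (cases "e i = 0")
        case True
        then show ?thesis using ab[OF i]
          by (intro exI[of _ "- a i / (b i - a i)"] exI[of _ "1 / (b i - a i)"])
             (auto simp: U_def fun_eq_iff diff_divide_distrib)
      next
        case False
        then show ?thesis using ab[OF i]
          by (intro exI[of _ "b i / (b i - a i)"] exI[of _ "- 1 / (b i - a i)"])
             (auto simp: U_def fun_eq_iff diff_divide_distrib)
      qed
      then obtain t c where tc: "c \<noteq> 0" "U i = (\<lambda>x. t + c * x)" by blast
      have "AE x in lborel. U i x \<in> {0<..<1} \<longrightarrow> \<bar>C (U i x) - f (U i x)\<bar> \<le> B'"
        unfolding tc(2) by (rule AE_affine[OF AE tc(1)])
      then show "AE x in lborel. a i < x \<longrightarrow> x < b i \<longrightarrow> \<bar>C (U i x) - f (U i x)\<bar> \<le> B'"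
        by eventually_elim (use U_range(4)[OF i] in auto)
    qed
    \<comment> \<open>At the endpoints of the pieces the ladder operator and its continuous form may
      disagree, since \<open>C\<close> has no prescribed values at 0 and 1.\<close>
    moreover have "AE x in lborel. \<forall>i\<in>{1..m}. x \<noteq> a i \<and> x \<noteq> b i"
      by (subst AE_finite_all[of "{1..m}"]) (auto intro: AE_lborel_singleton)
    ultimately show ?thesis using fix1
    proof eventually_elim
      case (elim x)
      show ?case
      proof
        assume x: "x \<in> {0<..<1}"
        let ?v = "\<lambda>i. if e i = 0 then f (clamp01 (U i x)) else 1 - f (clamp01 (U i x))"
        let ?w = "\<lambda>i. (real (e i) + (-1) ^ e i * C (inv (ladder_map (a i) (b i) (e i)) x)) * indicat_real {a i..b i} x
        + indicat_real {b i<..} x"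
        have Cx: "C x = (\<Sum>i=1..m. ?w i * \<rho> i)" using elim(3) x unfolding ladder_operator_def by simp
        have fx: "f x = (\<Sum>i=1..m. \<rho> i * ?v i)" using fun_cong[OF f(4), of x] unfolding smooth_op_def by simp
        have E: "C x - f x = (\<Sum>i=1..m. \<rho> i * (?w i - ?v i))"
          unfolding Cx fx by (simp add: sum_subtractf right_diff_distrib mult.commute)
        show "\<bar>C x - f x\<bar> \<le> rmax * B'" unfolding E
        proof (rule sum_at_most_one)
          fix i assume i: "i \<in> {1..m}"
          have ne: "x \<noteq> a i" "x \<noteq> b i" using elim(2) i by auto
          consider "x < a i" | "b i < x" | "a i < x" "x < b i" using ne by linarith
          then have "(?w i - ?v i \<noteq> 0 \<longrightarrow> a i < x \<and> x < b i) \<and> \<bar>?w i - ?v i\<bar> \<le> B'"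
          proof cases
            case 1
            then show ?thesis unfolding piece_value[OF i f(2,3)] using ab[OF i] B' by simp
          next
            case 2
            then show ?thesis unfolding piece_value[OF i f(2,3)] using ab[OF i] B' by simp
          next
            case 3
            then have "\<bar>C (U i x) - f (U i x)\<bar> \<le> B'" using elim(1) i by blast
            then show ?thesis unfolding piece_value[OF i f(2,3)] U_eq_inv[OF i] using 3 e01[OF i]
              by (auto simp: abs_minus_commute)
          qed
          then show "?w i - ?v i \<noteq> 0 \<Longrightarrow> a i < x \<and> x < b i" "\<bar>?w i - ?v i\<bar> \<le> B'" by blast+
        qed (rule B')
      qed
    qed
  qed
  have B0: "B \<ge> 0" by (simp add: B_def)
  have "AE x in lborel. x \<in> {0<..<1} \<longrightarrow> \<bar>C x - f x\<bar> \<le> rmax ^ n * B" for n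
  proof (induction n)
    case 0
    show ?case using K
    proof eventually_elim
      case (elim x)
      show ?case
      proof
        assume x: "x \<in> {0<..<1}"
        then have "\<bar>f x\<bar> \<le> L" "\<bar>C x\<bar> \<le> K" using elim L by auto
        then show "\<bar>C x - f x\<bar> \<le> rmax ^ 0 * B" unfolding B_def by simp
      qed
    qed
  next
    case (Suc n)
    from step[OF this] B0 rmax(1) show ?case by (simp add: mult.assoc)
  qed
  then have "AE x in lborel. \<forall>n. x \<in> {0<..<1} \<longrightarrow> \<bar>C x - f x\<bar> \<le> rmax ^ n * B"
    unfolding AE_all_countable ..
  then show ?thesis
  proof eventually_elim
    case (elim x)
    show ?case
    proof
      assume x: "x \<in> {0<..<1}"
      have "(\<lambda>n. rmax ^ n * B) \<longlonglongrightarrow> 0 * B" using rmax by (intro tendsto_intros LIMSEQ_power_zero) auto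
      then have "\<bar>C x - f x\<bar> \<le> 0 * B" by (rule tendsto_lowerbound) (use elim x in auto)
      then show "C x = f x" by simp
    qed
  qed
qed

end

section \<open>Identification of the distribution function with the fixed point\<close>

lemma AE_lborel_witness:
  assumes "AE x in lborel. P (x::real)" "u < v"
  obtains x where "u < x" "x < v" "P x"
proof -
  obtain N where N: "{x. \<not> P x} \<subseteq> N" "N \<in> null_sets lborel"
    using assms(1) by (auto simp: eventually_ae_filter)
  have "\<not> {u<..<v} \<subseteq> N"
  proof
    assume "{u<..<v} \<subseteq> N"
    then have "emeasure lborel {u<..<v} \<le> emeasure lborel N" by (rule emeasure_mono) (use N(2) in auto)
    then show False using N(2) assms(2) by (simp add: null_sets_def)
  qed
  then obtain x where "x \<in> {u<..<v}" "x \<notin> N" by blast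
  then show ?thesis using N(1) by (intro that[of x]) auto
qed

text \<open>Monotonicity of the distribution function and continuity of \<open>f\<close> upgrade the
  relation from almost everywhere to everywhere inside. The limits at 0 and 1 then determine the
  constant and the total mass, and continuity excludes atoms.\<close>

lemma cdf_eq_of_AE_eq:
  fixes \<mu> :: "real measure" and f :: "real \<Rightarrow> real"
  assumes \<mu>: "finite_measure \<mu>" "sets \<mu> = sets borel" "emeasure \<mu> (- {0<..<1}) = 0"
    and f: "continuous_on UNIV f" "f 0 = 0" "f 1 = 1"
    and ae: "AE x in lborel. x \<in> {0<..<1} \<longrightarrow> f x = measure \<mu> {0..x} + c"
  shows "\<And>x. x \<in> {0..1} \<Longrightarrow> measure \<mu> {0..x} = f x" "\<And>x. measure \<mu> {x} = 0" "measure \<mu> (UNIV - {0..1}) = 0"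
proof -
  interpret finite_measure \<mu> by (rule \<mu>(1))
  note [simp] = \<mu>(2)
  let ?F = "\<lambda>x. measure \<mu> {0..x}"
  have null_out: "measure \<mu> A = 0" if "A \<subseteq> - {0<..<1}" "A \<in> sets borel" for A
  proof -
    have "emeasure \<mu> A \<le> emeasure \<mu> (- {0<..<1})"
      by (rule emeasure_mono[OF that(1)]) (simp add: borel_comp)
    then have "emeasure \<mu> A = 0" using \<mu>(3) by simp
    then show ?thesis by (simp add: measure_def)
  qed
  have Fmono: "?F x \<le> ?F y" if "x \<le> y" for x y
    by (rule finite_measure_mono) (use that in simp_all)
  have fc: "isCont f x" for x using f(1) by (simp add: continuous_on_eq_continuous_at)
  \<comment> \<open>Points where the relation holds exist arbitrarily close to \<open>x\<close> on
    either side; monotonicity bounds \<open>?F x\<close> by its values there.\<close>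
  have inner: "?F x = f x - c" if x: "x \<in> {0<..<1}" for x
  proof (rule antisym)
    show "?F x \<le> f x - c"
    proof (rule field_le_epsilon)
      fix \<epsilon> :: real assume "\<epsilon> > 0"
      then have "\<forall>\<^sub>F y in at x. f y < f x + \<epsilon>"
        by (intro order_tendstoD(2)[OF fc[of x, unfolded isCont_def]]) simp
      then have "\<forall>\<^sub>F y in at_right x. f y < f x + \<epsilon>" by (auto simp: eventually_at_split)
      then obtain d where d: "d > x" "\<And>y. x < y \<Longrightarrow> y < d \<Longrightarrow> f y < f x + \<epsilon>" unfolding eventually_at_right_field by blast
      obtain y where y: "x < y" "y < min d 1" "y \<in> {0<..<1} \<longrightarrow> f y = ?F y + c"
        using AE_lborel_witness[OF ae, of x "min d 1"] d x by auto
      then have "f y = ?F y + c" using x by auto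
      then show "?F x \<le> f x - c + \<epsilon>" using Fmono[of x y] y d(2)[of y] by simp
    qed
    show "f x - c \<le> ?F x"
    proof (rule field_le_epsilon)
      fix \<epsilon> :: real assume "\<epsilon> > 0"
      then have "\<forall>\<^sub>F y in at x. f x - \<epsilon> < f y"
        by (intro order_tendstoD(1)[OF fc[of x, unfolded isCont_def]]) simp
      then have "\<forall>\<^sub>F y in at_left x. f x - \<epsilon> < f y" by (auto simp: eventually_at_split)
      then obtain d where d: "d < x" "\<And>y. d < y \<Longrightarrow> y < x \<Longrightarrow> f x - \<epsilon> < f y" unfolding eventually_at_left_field by blast
      obtain y where y: "max d 0 < y" "y < x" "y \<in> {0<..<1} \<longrightarrow> f y = ?F y + c"
        using AE_lborel_witness[OF ae, of "max d 0" x] d x by auto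
      then have "f y = ?F y + c" using x by auto
      then show "f x - c \<le> ?F x + \<epsilon>" using Fmono[of y x] y d(2)[of y] by simp
    qed
  qed
  define \<zeta> where "\<zeta> n = 1 / real (n + 2)" for n
  have z: "\<zeta> n \<in> {0<..<1}" for n by (simp add: \<zeta>_def)
  have z0: "\<zeta> \<longlonglongrightarrow> 0" unfolding \<zeta>_def by (rule LIMSEQ_ignore_initial_segment[OF lim_const_over_n])
  \<comment> \<open>The intervals shrink to \<open>{0}\<close>, which \<mu> does not charge because
    it lives on the open interval, while \<open>f\<close> tends to \<open>f 0 = 0\<close>.\<close>
  have c0: "c = 0"
  proof -
    have "(\<lambda>n. ?F (\<zeta> n)) \<longlonglongrightarrow> measure \<mu> (\<Inter>n. {0..\<zeta> n})"
      by (rule finite_Lim_measure_decseq) (auto simp: decseq_def frac_le \<zeta>_def intro: order_trans)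
    moreover have "(\<Inter>n. {0..\<zeta> n}) = {0}"
    proof -
      have "x \<le> 0" if "\<And>n. x \<le> \<zeta> n" for x by (rule LIMSEQ_le_const[OF z0]) (use that in auto)
      moreover have "0 \<le> \<zeta> n" for n using z[of n] by simp
      ultimately show ?thesis by (auto intro: antisym)
    qed
    moreover have "measure \<mu> {0} = 0" by (rule null_out) auto
    ultimately have l: "(\<lambda>n. ?F (\<zeta> n)) \<longlonglongrightarrow> 0" by (simp only:)
    have "(\<lambda>n. f (\<zeta> n) - c) \<longlonglongrightarrow> f 0 - c"
      by (rule tendsto_diff[OF isCont_tendsto_compose[OF fc z0] tendsto_const])
    moreover have "?F (\<zeta> n) = f (\<zeta> n) - c" for n using inner[OF z[of n]] by simp
    ultimately have "(\<lambda>n. ?F (\<zeta> n)) \<longlonglongrightarrow> - c" using f(2) by simp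
    from LIMSEQ_unique[OF l this] show ?thesis by simp
  qed
  have F1: "?F 1 = 1"
  proof -
    have "(\<lambda>n. ?F (1 - \<zeta> n)) \<longlonglongrightarrow> measure \<mu> (\<Union>n. {0..1 - \<zeta> n})"
      by (rule finite_Lim_measure_incseq) (auto simp: incseq_def frac_le \<zeta>_def intro: order_trans)
    moreover have "(\<Union>n. {0..1 - \<zeta> n}) = {0..<1}"
    proof -
      have A1: "\<exists>n. x \<le> 1 - \<zeta> n" if "x < 1" for x
      proof -
        have "\<forall>\<^sub>F n in sequentially. \<zeta> n < 1 - x" by (rule order_tendstoD(2)[OF z0]) (use that in simp)
        then obtain n where "\<zeta> n < 1 - x" by (auto simp: eventually_sequentially)
        then show ?thesis by (intro exI[of _ n]) simp
      qed
      have A2: "1 - \<zeta> n < 1" for n using z[of n] by simp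
      show ?thesis
      proof (intro equalityI subsetI)
        fix x assume "x \<in> (\<Union>n. {0..1 - \<zeta> n})"
        then obtain n where "0 \<le> x" "x \<le> 1 - \<zeta> n" by (blast dest: atLeastAtMost_iff[THEN iffD1])
        then show "x \<in> {0..<1}" using A2[of n] by simp
      next
        fix x :: real assume x: "x \<in> {0..<1}"
        then obtain n where "x \<le> 1 - \<zeta> n" using A1[of x] by fastforce
        with x show "x \<in> (\<Union>n. {0..1 - \<zeta> n})" by (intro UN_I[of n]) simp_all
      qed
    qed
    ultimately have l1: "(\<lambda>n. ?F (1 - \<zeta> n)) \<longlonglongrightarrow> measure \<mu> {0..<1}" by (simp only:)
    have "1 - \<zeta> n \<in> {0<..<1}" for n using z[of n] by simp
    then have eq: "?F (1 - \<zeta> n) = f (1 - \<zeta> n)" for n using inner[of "1 - \<zeta> n"] c0 by simp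
    have "(\<lambda>n. f (1 - \<zeta> n)) \<longlonglongrightarrow> f (1 - 0)"
      by (rule isCont_tendsto_compose[OF fc tendsto_diff[OF tendsto_const z0]])
    then have "(\<lambda>n. ?F (1 - \<zeta> n)) \<longlonglongrightarrow> 1" unfolding eq using f(3) by simp
    from LIMSEQ_unique[OF l1 this] have "measure \<mu> {0..<1} = 1" .
    moreover have "?F 1 = measure \<mu> {0..<1} + measure \<mu> {1}"
      by (subst finite_measure_Union[symmetric]) (auto intro!: arg_cong[where f = "measure \<mu>"])
    moreover have "measure \<mu> {1} = 0" by (rule null_out) auto
    ultimately show ?thesis by simp
  qed
  show F: "?F x = f x" if "x \<in> {0..1}" for x
  proof -
    have "measure \<mu> {0} = 0" by (rule null_out) auto
    then show ?thesis using that inner[of x] c0 F1 f by (cases "x = 0"; cases "x = 1") auto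
  qed
  show "measure \<mu> {x} = 0" for x
  proof (cases "x \<in> {0<..<1}")
    case False
    then show ?thesis by (intro null_out) auto
  next
    case True
    have "measure \<mu> {x} \<le> 0"
    proof (rule field_le_epsilon)
      fix \<epsilon> :: real assume "\<epsilon> > 0"
      then have "\<forall>\<^sub>F y in at x. f x - \<epsilon> < f y"
        by (intro order_tendstoD(1)[OF fc[of x, unfolded isCont_def]]) simp
      then have "\<forall>\<^sub>F y in at_left x. f x - \<epsilon> < f y" by (auto simp: eventually_at_split)
      then obtain d where d: "d < x" "\<And>y. d < y \<Longrightarrow> y < x \<Longrightarrow> f x - \<epsilon> < f y" unfolding eventually_at_left_field by blast
      define y where "y = (max d 0 + x) / 2"
      have y: "d < y" "0 < y" "y < x" using d True by (auto simp: y_def)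
      have "measure \<mu> {x} \<le> measure \<mu> ({0..x} - {0..y})" using y by (intro finite_measure_mono) auto
      also have "\<dots> = ?F x - ?F y" using y by (intro finite_measure_Diff) auto
      also have "\<dots> = f x - f y" using F[of x] F[of y] y True by simp
      finally show "measure \<mu> {x} \<le> 0 + \<epsilon>" using d(2)[of y] y by simp
    qed
    then show ?thesis using measure_nonneg[of \<mu> "{x}"] by simp
  qed
  show "measure \<mu> (UNIV - {0..1}) = 0" by (rule null_out) auto
qed

context gapped_ladder
begin

definition R :: "nat \<Rightarrow> real" where "R i = (\<Sum>j\<in>{1..<i}. \<rho> j)"

lemma fixed_point_piece:
  assumes f: "f 0 = 0" "f 1 = 1" "smooth_op f = f" and i: "i \<in> {1..m}" and t: "t \<in> {0..1}"
  shows "f (ladder_map (a i) (b i) (e i) t) = R i + \<rho> i * (if e i = 0 then f t else 1 - f t)"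
proof -
  let ?x = "ladder_map (a i) (b i) (e i) t"
  let ?v = "\<lambda>j. if e j = 0 then f (clamp01 (U j ?x)) else 1 - f (clamp01 (U j ?x))"
  have d: "0 < b i - a i" using ab[OF i] by simp
  have Ux: "U i ?x = t" using d by (simp add: U_def ladder_map_def)
  have x: "a i \<le> ?x" "?x \<le> b i"
  proof -
    have "0 \<le> (b i - a i) * t" "(b i - a i) * t \<le> (b i - a i) * 1" using d t by (auto intro: mult_left_mono)
    then show "a i \<le> ?x" "?x \<le> b i" by (auto simp: ladder_map_def)
  qed
  have lt: "?v j = 1" if "j \<in> {1..m}" "j < i" for j
    using piece_value[OF that(1) f(1,2), of ?x] order[OF that(1) i that(2)] ab[OF that(1)] x by auto
  have gt: "?v j = 0" if "j \<in> {1..m}" "i < j" for j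
    using piece_value[OF that(1) f(1,2), of ?x] order[OF i that(1) that(2)] ab[OF that(1)] x by auto
  have self: "?v i = (if e i = 0 then f t else 1 - f t)"
    unfolding Ux using t by (simp add: clamp01_simps)
  have s: "{1..m} = {1..<i} \<union> ({i} \<union> {i<..m})" using i by auto
  have "f ?x = (\<Sum>j=1..m. \<rho> j * ?v j)" using fun_cong[OF f(3), of ?x] unfolding smooth_op_def by simp
  also have "\<dots> = (\<Sum>j\<in>{1..<i}. \<rho> j * ?v j) + (\<rho> i * ?v i + (\<Sum>j\<in>{i<..m}. \<rho> j * ?v j))"
    unfolding s by (subst sum.union_disjoint, simp, simp, force, subst sum.union_disjoint) auto
  also have "(\<Sum>j\<in>{1..<i}. \<rho> j * ?v j) = R i"
    unfolding R_def
  proof (rule sum.cong)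
    fix j assume "j \<in> {1..<i}"
    then have "j \<in> {1..m}" "j < i" using i by auto
    then show "\<rho> j * ?v j = \<rho> j" using lt by (simp only: mult_1_right)
  qed simp
  also have "(\<Sum>j\<in>{i<..m}. \<rho> j * ?v j) = 0"
  proof (rule sum.neutral, rule ballI)
    fix j assume "j \<in> {i<..m}"
    then have "j \<in> {1..m}" "i < j" using i by auto
    then show "\<rho> j * ?v j = 0" using gt by (simp only: mult_zero_right)
  qed
  finally show ?thesis unfolding self by simp
qed

text \<open>The continuous fixed point is the bridge: it agrees almost everywhere with
  \<open>C\<close>, hence up to a constant with the distribution function of \<mu>, and passes its
  exact self-similarity on.\<close>

lemma string_measure_of_ladder:
  assumes C: "cantor_ladder m a b \<rho> e C" and d: "distributional_derivative01 C \<mu>"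
  shows "string_measure \<mu>" "i \<in> {1..m} \<Longrightarrow> string_piece \<mu> (a i) (b i) (\<rho> i) (R i) (e i)"
proof -
  have \<mu>: "finite_measure \<mu>" "sets \<mu> = sets borel" "emeasure \<mu> (- {0<..<1}) = 0"
    using d by (auto simp: distributional_derivative01_def)
  obtain f where f: "continuous_on UNIV f" "f 0 = 0" "f 1 = 1" "smooth_op f = f" by (rule smooth_fixed_point_exists)
  have "in_Linfinity01 C" using C by (simp add: cantor_ladder_def)
  then obtain c where "AE x in lborel. x \<in> {0<..<1} \<longrightarrow> C x = measure \<mu> {0..x} + c"
    using distributional_derivative_cdf[OF _ d] by blast
  with ladder_AE_eq_smooth[OF C f] have ae: "AE x in lborel. x \<in> {0<..<1} \<longrightarrow> f x = measure \<mu> {0..x} + c"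
    by eventually_elim auto
  note F = cdf_eq_of_AE_eq[OF \<mu> f(1-3) ae]
  show s: "string_measure \<mu>"
  proof (rule string_measure.intro)
    show "measure \<mu> {0..1} = 1" using F(1)[of 1] f(3) by simp
  qed (rule \<mu> F(2))+
  interpret string_measure \<mu> by (rule s)
  assume i: "i \<in> {1..m}"
  show "string_piece \<mu> (a i) (b i) (\<rho> i) (R i) (e i)"
  proof unfold_locales
    fix t :: real assume t: "t \<in> {0..1}"
    define w where "w = (b i - a i) * t"
    have "0 \<le> w" "w \<le> (b i - a i) * 1" unfolding w_def using ab[OF i] t by (auto intro: mult_left_mono)
    then have S: "ladder_map (a i) (b i) (e i) t \<in> {0..1}"
      unfolding ladder_map_def w_def[symmetric] using ab[OF i] by auto
    show "M (ladder_map (a i) (b i) (e i) t) = R i + \<rho> i * (if e i = 0 then M t else 1 - M t)"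
      unfolding M_def F(1)[OF t] F(1)[OF S] by (intro fixed_point_piece f(2-4) i t)
  qed (use ab[OF i] rho_pos[OF i] F(3) in simp_all)
qed

end

section \<open>Counting eigenvalues across the gaps\<close>

text \<open>Brings the sublevel estimate into the form of the defect integral: seen with delay
  \<open>j * T\<close> through window \<open>n\<close>, the set looks as it does in window
  \<open>n - j\<close>, and a fixed \<open>j\<close> does not affect the limit.\<close>

lemma (in herglotz_pair) below_level_window_integral:
  assumes fin: "\<And>Y. finite {p. \<gamma> p = 0 \<and> p < Y}" and T: "T > 0" and s: "s > 0" and \<epsilon>: "\<epsilon> > 0"
  defines "E \<equiv> {t. \<gamma> (exp t) \<noteq> 0 \<and> h (exp t) \<le> - s}"
  shows "E \<in> sets borel"
    and "\<forall>\<^sub>F n in sequentially.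
      (\<integral>\<^sup>+t. indicator E (real n * T + t - real j * T) * indicator {0<..<T} t \<partial>lborel) \<le> ennreal \<epsilon>"
proof -
  have [measurable]: "\<alpha> \<in> borel_measurable borel" "\<gamma> \<in> borel_measurable borel"
    by (intro borel_measurable_continuous_onI continuous_at_imp_continuous_on ballI cont_alpha cont_gamma)+
  show E[measurable]: "E \<in> sets borel" unfolding E_def h_def by measurable
  have shift: "(\<integral>\<^sup>+t. indicator E (real n * T + t - real j * T) * indicator {0<..<T} t \<partial>lborel)
      = emeasure lborel {t. real (n - j) * T < t \<and> t < real (Suc (n - j)) * T \<and> \<gamma> (exp t) \<noteq> 0 \<and> h (exp t) \<le> - s}"
    if n: "j \<le> n" for n
  proof -
    have r: "real (n - j) = real n - real j" using n by simp
    define X where "X = {t. real (n - j) * T < t \<and> t < real (Suc (n - j)) * T \<and> \<gamma> (exp t) \<noteq> 0 \<and> h (exp t) \<le> - s}"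
    have X: "X = E \<inter> {real (n - j) * T<..<real (Suc (n - j)) * T}" by (auto simp: X_def E_def)
    have [measurable]: "X \<in> sets borel" unfolding X by measurable
    have "emeasure lborel X = (\<integral>\<^sup>+x. indicator X x \<partial>lborel)" by simp
    also have "\<dots> = (\<integral>\<^sup>+t. indicator X ((real n - real j) * T + 1 * t) \<partial>lborel)"
      by (subst nn_integral_real_affine[where c = 1 and t = "(real n - real j) * T"]) auto
    also have "\<dots> = (\<integral>\<^sup>+t. indicator E (real n * T + t - real j * T) * indicator {0<..<T} t \<partial>lborel)"
    proof (rule nn_integral_cong)
      fix t
      have "(real n - real j) * T + 1 * t = real n * T + t - real j * T" by (simp add: algebra_simps)
      moreover have "real n * T + t - real j * T \<in> {real (n - j) * T<..<real (Suc (n - j)) * T} \<longleftrightarrow> t \<in> {0<..<T}"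
        by (auto simp: r algebra_simps)
      ultimately show "indicator X ((real n - real j) * T + 1 * t)
          = (indicator E (real n * T + t - real j * T) * indicator {0<..<T} t :: ennreal)"
        unfolding X by (simp only: indicator_inter_arith) (simp add: indicator_def)
    qed
    finally show ?thesis unfolding X_def by simp
  qed
  obtain n0 where n0: "\<And>n. n \<ge> n0 \<Longrightarrow>
      emeasure lborel {t. real n * T < t \<and> t < real (Suc n) * T \<and> \<gamma> (exp t) \<noteq> 0 \<and> h (exp t) \<le> - s} \<le> ennreal \<epsilon>"
    using emeasure_below_level_window[OF fin T s \<epsilon>] unfolding eventually_sequentially by blast
  show "\<forall>\<^sub>F n in sequentially.
      (\<integral>\<^sup>+t. indicator E (real n * T + t - real j * T) * indicator {0<..<T} t \<partial>lborel) \<le> ennreal \<epsilon>"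
    unfolding eventually_sequentially
  proof (rule exI[of _ "n0 + j"], intro allI impI)
    fix n assume n: "n0 + j \<le> n"
    have le: "j \<le> n" "n0 \<le> n - j" using n by simp_all
    show "(\<integral>\<^sup>+t. indicator E (real n * T + t - real j * T) * indicator {0<..<T} t \<partial>lborel) \<le> ennreal \<epsilon>"
      unfolding shift[OF le(1)] by (rule n0[OF le(2)])
  qed
qed

section \<open>The characteristic function of the ladder, piece by piece\<close>

locale ladder_string = gapped_ladder m a b \<rho> e + string_measure \<mu>
  for m a b \<rho> e \<mu> +
  assumes piece: "i \<in> {1..m} \<Longrightarrow> string_piece \<mu> (a i) (b i) (\<rho> i) (R i) (e i)"
begin

definition scal :: "nat \<Rightarrow> real" where "scal i = \<rho> i * (b i - a i)"
definition gap :: "nat \<Rightarrow> real" where "gap i = a (Suc i) - b i"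
text \<open>Reflecting a piece exchanges the two ends and hence the roles of \<open>A\<close> and \<open>D\<close>.\<close>

definition W :: "nat \<Rightarrow> real \<Rightarrow> real" where "W i l = (if e i = 0 then D l 1 else A l 1)"

lemma scal_pos: "i \<in> {1..m} \<Longrightarrow> 0 < scal i"
  unfolding scal_def using ab[of i] rho_pos[of i] by simp

lemma gap_pos: "i \<in> {1..<m} \<Longrightarrow> 0 < gap i"
  unfolding gap_def using gaps[of "Suc i"] by simp

lemma R_Suc: "1 \<le> i \<Longrightarrow> R (Suc i) = R i + \<rho> i"
  unfolding R_def by simp

lemma M_ends: "i \<in> {1..m} \<Longrightarrow> M (a i) = R i \<and> M (b i) = R (Suc i)"
proof -
  assume i: "i \<in> {1..m}"
  interpret string_piece \<mu> "a i" "b i" "\<rho> i" "R i" "e i" by (rule piece[OF i])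
  show ?thesis using cdf[of 0] cdf[of 1] R_Suc[of i] i by (cases "e i = 0") (simp_all add: ladder_map_def)
qed

lemma C_last: "C l (b m) = C l 1"
proof -
  have "M (b m) = 1" using M_ends[of m] m_ge_2 rho_sum by (simp add: R_def atLeastLessThanSuc_atLeastAtMost)
  then show ?thesis using sol_across_gap(1)[OF sol_AC, of "b m" 1 l] ab[of m] m_ge_2 by simp
qed

lemma AC_first: "A l (a 1) = 1" "C l (a 1) = 0"
proof -
  have "M 0 = M (a 1)" using M_ends[of 1] m_ge_2 by (simp add: R_def)
  moreover have "0 \<le> a 1" "a 1 \<le> 1" using ab[of 1] m_ge_2 by auto
  ultimately show "A l (a 1) = 1" "C l (a 1) = 0"
    using sol_across_gap[OF sol_AC, of 0 "a 1" l] by simp_all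
qed

lemma AC_gap:
  assumes i: "i \<in> {1..<m}"
  shows "C l (a (Suc i)) = C l (b i)" "A l (a (Suc i)) = A l (b i) + gap i * C l (b i)"
proof -
  have "M (b i) = M (a (Suc i))" using M_ends[of i] M_ends[of "Suc i"] i by simp
  moreover have "0 \<le> b i" "b i \<le> a (Suc i)" "a (Suc i) \<le> 1"
    using ab[of i] ab[of "Suc i"] gap_pos[OF i] i by (auto simp: gap_def)
  ultimately show "C l (a (Suc i)) = C l (b i)" "A l (a (Suc i)) = A l (b i) + gap i * C l (b i)"
    using sol_across_gap[OF sol_AC, of "b i" "a (Suc i)" l] by (simp_all add: gap_def)
qed

lemma C_piece:
  assumes i: "i \<in> {1..m}"
  shows "(b i - a i) * C l (b i) = C (scal i * l) 1 * A l (a i) + W i (scal i * l) * ((b i - a i) * C l (a i))"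
proof -
  interpret P: string_piece \<mu> "a i" "b i" "\<rho> i" "R i" "e i" by (rule piece[OF i])
  show ?thesis using P.piece_transfer[OF sol_AC, of l] unfolding P.\<kappa>_def scal_def W_def by simp
qed

lemma herglotz_right: "i \<in> {1..m} \<Longrightarrow>
    herglotz_pair \<mu> (\<lambda>l. A l (b i)) (\<lambda>l. C l (b i)) (\<lambda>l x. indicator {0..b i} x *\<^sub>R A l x)"
proof (rule herglotz_pair_right)
  assume i: "i \<in> {1..m}"
  then show "b i \<in> {0..1}" using ab[OF i] by auto
  have "0 \<le> R i" unfolding R_def using i by (intro sum_nonneg less_imp_le rho_pos) auto
  then show "measure \<mu> {0..b i} > 0" using M_ends[OF i] R_Suc[of i] rho_pos[OF i] i unfolding M_def by auto
qed

lemma herglotz_W: "\<exists>y. herglotz_pair \<mu> (W i) (\<lambda>l. C l 1) y"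
proof (cases "e i = 0")
  case True
  then have "W i = (\<lambda>l. D l 1)" by (simp add: W_def fun_eq_iff)
  then show ?thesis using herglotz_pair_left by metis
next
  case False
  then have "W i = (\<lambda>l. A l 1)" by (simp add: W_def fun_eq_iff)
  moreover have "herglotz_pair \<mu> (\<lambda>l. A l 1) (\<lambda>l. C l 1) (\<lambda>l x. indicator {0..1} x *\<^sub>R A l x)"
    by (rule herglotz_pair_right) (simp_all add: mass_mu)
  ultimately show ?thesis by metis
qed

definition N :: "real \<Rightarrow> nat" where "N l = card {x. C x 1 = 0 \<and> x < l}"

definition bad_left :: "nat \<Rightarrow> real \<Rightarrow> bool" where
  "bad_left i l \<longleftrightarrow> C l (b i) \<noteq> 0 \<and> A l (b i) / C l (b i) \<le> - (gap i / 2)"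

text \<open>In the coupled function the quotient \<open>W / C\<close> is multiplied by the length of
  piece \<open>Suc i\<close>, so the threshold \<open>- (gap i / 2)\<close> is divided by that
  length.\<close>

definition bad_right :: "nat \<Rightarrow> real \<Rightarrow> bool" where
  "bad_right i l \<longleftrightarrow> C (scal (Suc i) * l) 1 \<noteq> 0 \<and>
    W (Suc i) (scal (Suc i) * l) / C (scal (Suc i) * l) 1 \<le> - (gap i / (2 * (b (Suc i) - a (Suc i))))"

lemma scaled_zeros:
  assumes c: "c > 0"
  shows "card {x\<in>{x. C (c * x) 1 = 0}. x < l} = N (c * l)"
    and "finite {x. C x 1 = 0 \<and> x < c * l} \<Longrightarrow> finite {x\<in>{x. C (c * x) 1 = 0}. x < l}"
proof -
  have "bij_betw (\<lambda>x. c * x) {x\<in>{x. C (c * x) 1 = 0}. x < l} {x. C x 1 = 0 \<and> x < c * l}"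
    by (rule bij_betw_byWitness[where f' = "\<lambda>x. x / c"]) (use c in \<open>auto simp: pos_divide_less_eq mult.commute\<close>)
  then show "card {x\<in>{x. C (c * x) 1 = 0}. x < l} = N (c * l)"
    and "finite {x. C x 1 = 0 \<and> x < c * l} \<Longrightarrow> finite {x\<in>{x. C (c * x) 1 = 0}. x < l}"
    unfolding N_def using bij_betw_same_card bij_betw_finite by blast+
qed

text \<open>Dividing the transfer relation by the values at both sides of the gap expresses the new zeros as those of
  \<open>gap i + F + G\<close> with Herglotz functions \<open>F\<close> and \<open>G\<close>; a zero can only be lost where one of them is below
  \<open>- gap i / 2\<close>, which happens on a set of asymptotically vanishing measure.\<close>

lemma piece_count:
  assumes fin: "\<And>Y. finite {x. C x 1 = 0 \<and> x < Y}" and i: "i \<in> {1..<m}"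
    and finP: "\<And>Y. finite {x\<in>{x. C x (b i) = 0}. x < Y}"
  shows "finite {x\<in>{x. C x (b (Suc i)) = 0}. x < l}"
    "card {x\<in>{x. C x (b (Suc i)) = 0}. x < l} \<le> card {x\<in>{x. C x (b i) = 0}. x < l} + N (scal (Suc i) * l)"
    "card {x\<in>{x. C x (b i) = 0}. x < l} + N (scal (Suc i) * l) \<le> Suc (card {x\<in>{x. C x (b (Suc i)) = 0}. x < l})"
    "\<not> bad_left i l \<Longrightarrow> \<not> bad_right i l \<Longrightarrow>
      card {x\<in>{x. C x (b (Suc i)) = 0}. x < l} = card {x\<in>{x. C x (b i) = 0}. x < l} + N (scal (Suc i) * l)"
proof -
  define d c where "d = b (Suc i) - a (Suc i)" and "c = scal (Suc i)"
  have i': "i \<in> {1..m}" "Suc i \<in> {1..m}" using i by auto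
  have d: "d > 0" and c: "c > 0" and g: "gap i > 0" using ab[OF i'(2)] scal_pos[OF i'(2)] gap_pos[OF i] by (auto simp: d_def c_def)
  interpret L: herglotz_pair \<mu> "\<lambda>l. A l (b i)" "\<lambda>l. C l (b i)" "\<lambda>l x. indicator {0..b i} x *\<^sub>R A l x"
    by (rule herglotz_right[OF i'(1)])
  obtain y where "herglotz_pair \<mu> (W (Suc i)) (\<lambda>l. C l 1) y" using herglotz_W by blast
  then interpret G: herglotz_pair \<mu> "W (Suc i)" "\<lambda>l. C l 1" y .
  let ?F = "\<lambda>x. A x (b i) / C x (b i)" and ?G = "\<lambda>x. d * (W (Suc i) (c * x) / C (c * x) 1)"
  let ?P = "{x. C x (b i) = 0}" and ?Q = "{x. C (c * x) 1 = 0}"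
  have F: "increasing_between_poles ?F ?P"
    using L.increasing_between_poles_h[of 1 1] by (simp add: L.h_def)
  have G: "increasing_between_poles ?G ?Q"
    using G.increasing_between_poles_h[OF d c] by (simp only: G.h_def)
  have finQ: "finite {x\<in>?Q. x < Y}" for Y by (rule scaled_zeros(2)[OF c fin])
  have rec: "d * C x (b (Suc i)) = C (c * x) 1 * (A x (b i) + gap i * C x (b i)) + W (Suc i) (c * x) * (d * C x (b i))" for x
    using C_piece[OF i'(2), of x] unfolding AC_gap[OF i] d_def c_def .
  \<comment> \<open>At a pole of only one of the two functions a single term of \<open>rec\<close>
    survives, and it is nonzero because numerators do not vanish at poles. Where both denominators
    vanish, so does the right-hand side of \<open>rec\<close>; elsewhere it may be divided by
    both.\<close>
  have R: "x \<in> {x. C x (b (Suc i)) = 0} \<longleftrightarrow> x \<in> ?P \<inter> ?Q \<or> x \<notin> ?P \<union> ?Q \<and> gap i + (?F x + ?G x) = 0" for x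
  proof -
    have z: "C x (b (Suc i)) = 0 \<longleftrightarrow> d * C x (b (Suc i)) = 0" using d by simp
    consider "C x (b i) = 0" | "C x (b i) \<noteq> 0" "C (c * x) 1 = 0" | "C x (b i) \<noteq> 0" "C (c * x) 1 \<noteq> 0" by blast
    then show ?thesis
    proof cases
      case 1
      then have "A x (b i) \<noteq> 0" by (rule L.pole_alpha_nz)
      then show ?thesis using z 1 unfolding rec by simp
    next
      case 2
      then have "W (Suc i) (c * x) \<noteq> 0" by (intro G.pole_alpha_nz)
      then show ?thesis using z 2 d unfolding rec by simp
    next
      case 3
      have "C (c * x) 1 * (A x (b i) + gap i * C x (b i)) + W (Suc i) (c * x) * (d * C x (b i))
        = C (c * x) 1 * C x (b i) * (gap i + (?F x + ?G x))" using 3 by (simp add: field_simps)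
      then show ?thesis using z 3 unfolding rec by simp
    qed
  qed
  note cc = coupled_count[OF F finP G finQ g R, of l]
  note Nc = scaled_zeros(1)[OF c, of l]
  show "finite {x\<in>{x. C x (b (Suc i)) = 0}. x < l}" by (rule cc(1))
  show "card {x\<in>{x. C x (b (Suc i)) = 0}. x < l} \<le> card {x\<in>?P. x < l} + N (scal (Suc i) * l)"
    unfolding c_def[symmetric] Nc[symmetric] by (rule cc(2))
  show "card {x\<in>?P. x < l} + N (scal (Suc i) * l) \<le> Suc (card {x\<in>{x. C x (b (Suc i)) = 0}. x < l})"
    unfolding c_def[symmetric] Nc[symmetric] by (rule cc(3))
  assume bad: "\<not> bad_left i l" "\<not> bad_right i l"
  show "card {x\<in>{x. C x (b (Suc i)) = 0}. x < l} = card {x\<in>?P. x < l} + N (scal (Suc i) * l)"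
    unfolding c_def[symmetric] Nc[symmetric]
  proof (rule cc(4))
    show "\<not> (l \<notin> ?P \<and> ?F l \<le> - (gap i / 2))" using bad(1) unfolding bad_left_def by simp
    have "d * w \<le> - (gap i / 2) \<longleftrightarrow> w \<le> - (gap i / (2 * d))" for w using d by (simp add: field_simps)
    then show "\<not> (l \<notin> ?Q \<and> ?G l \<le> - (gap i / 2))" 
      using bad(2) unfolding bad_right_def d_def[symmetric] c_def[symmetric] mem_Collect_eq by (simp only: simp_thms)
  qed
qed

text \<open>Crossing one gap at a time loses at most one zero, hence the total \<open>i - 1\<close>,
  and none if both functions at that gap are above their thresholds. Finiteness is carried along
  because \<open>piece_count\<close> asks for it for the part already assembled.\<close>

lemma partial_count:
  assumes fin: "\<And>Y. finite {x. C x 1 = 0 \<and> x < Y}" and i: "1 \<le> i" "i \<le> m"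
  shows "(\<forall>Y. finite {x\<in>{x. C x (b i) = 0}. x < Y}) \<and>
    (\<forall>l. card {x\<in>{x. C x (b i) = 0}. x < l} \<le> (\<Sum>j=1..i. N (scal j * l)) \<and>
      (\<Sum>j=1..i. N (scal j * l)) \<le> card {x\<in>{x. C x (b i) = 0}. x < l} + (i - 1) \<and>
      ((\<forall>j\<in>{1..<i}. \<not> bad_left j l \<and> \<not> bad_right j l) \<longrightarrow>
        card {x\<in>{x. C x (b i) = 0}. x < l} = (\<Sum>j=1..i. N (scal j * l))))"
  using i
proof (induction i rule: dec_induct)
  case base
  have m1: "(1::nat) \<in> {1..m}" using m_ge_2 by auto
  have "C x (b 1) = 0 \<longleftrightarrow> C (scal 1 * x) 1 = 0" for x
    using C_piece[OF m1, of x] ab[OF m1] unfolding AC_first by auto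
  then show ?case using scaled_zeros[OF scal_pos[OF m1]] fin by simp
next
  case (step i)
  have i: "i \<in> {1..<m}" "i \<le> m" using step by auto
  note IH = step.IH[OF i(2)]
  note pc = piece_count[OF fin i(1), of l for l]
  have f: "\<And>Y. finite {x\<in>{x. C x (b i) = 0}. x < Y}" using IH by blast
  have S: "(\<Sum>j=1..Suc i. N (scal j * l)) = (\<Sum>j=1..i. N (scal j * l)) + N (scal (Suc i) * l)" for l by simp
  show ?case
  proof (intro conjI allI impI)
    fix l
    show "finite {x\<in>{x. C x (b (Suc i)) = 0}. x < l}" by (rule pc(1)[OF f])
    have I: "card {x\<in>{x. C x (b i) = 0}. x < l} \<le> (\<Sum>j=1..i. N (scal j * l))"
        "(\<Sum>j=1..i. N (scal j * l)) \<le> card {x\<in>{x. C x (b i) = 0}. x < l} + (i - 1)" using IH by blast+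
    show "card {x\<in>{x. C x (b (Suc i)) = 0}. x < l} \<le> (\<Sum>j=1..Suc i. N (scal j * l))"
      using pc(2)[OF f, of l] I(1) unfolding S by linarith
    show "(\<Sum>j=1..Suc i. N (scal j * l)) \<le> card {x\<in>{x. C x (b (Suc i)) = 0}. x < l} + (Suc i - 1)"
      using pc(3)[OF f, of l] I(2) i unfolding S by auto
    assume b: "\<forall>j\<in>{1..<Suc i}. \<not> bad_left j l \<and> \<not> bad_right j l"
    then have "\<not> bad_left i l" "\<not> bad_right i l" using i by auto
    moreover have "card {x\<in>{x. C x (b i) = 0}. x < l} = (\<Sum>j=1..i. N (scal j * l))" using IH b by auto
    ultimately show "card {x\<in>{x. C x (b (Suc i)) = 0}. x < l} = (\<Sum>j=1..Suc i. N (scal j * l))"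
      using pc(4)[OF f, of l] unfolding S by simp
  qed
qed

text \<open>The defect is at most \<open>m - 1\<close> and vanishes when no gap is bad, while a
  single bad gap makes the sum of indicators at least 1. The crude factor \<open>m\<close> turns
  this case distinction into an inequality that can be integrated.\<close>

lemma count_defect_le:
  assumes fin: "\<And>Y. finite {x. C x 1 = 0 \<and> x < Y}"
  shows "\<bar>real (N l) - (\<Sum>i=1..m. real (N (scal i * l)))\<bar>
    \<le> real m * (\<Sum>j\<in>{1..<m}. of_bool (bad_left j l) + of_bool (bad_right j l))"
proof -
  have m: "1 \<le> m" using m_ge_2 by simp
  define s where "s = (\<Sum>j\<in>{1..<m}. of_bool (bad_left j l) + of_bool (bad_right j l) :: real)"
  have eq: "card {x\<in>{x. C x (b m) = 0}. x < l} = N l" by (simp add: C_last N_def)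
  define S where "S = (\<Sum>i=1..m. N (scal i * l))"
  have c: "N l \<le> S" "S \<le> N l + (m - 1)" "(\<forall>j\<in>{1..<m}. \<not> bad_left j l \<and> \<not> bad_right j l) \<Longrightarrow> N l = S"
    using partial_count[OF fin m order_refl, THEN conjunct2, THEN spec, of l] unfolding eq S_def[symmetric] by blast+
  have s0: "0 \<le> s" unfolding s_def by (intro sum_nonneg) simp
  have "\<bar>real (N l) - real S\<bar> \<le> real m * s"
  proof (cases "\<forall>j\<in>{1..<m}. \<not> bad_left j l \<and> \<not> bad_right j l")
    case True
    then show ?thesis using c(3) s0 by simp
  next
    case False
    then obtain j where j: "j \<in> {1..<m}" "bad_left j l \<or> bad_right j l" by blast
    have "1 \<le> (of_bool (bad_left j l) + of_bool (bad_right j l) :: real)" using j(2) by auto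
    also have "\<dots> \<le> s" unfolding s_def using j(1) by (intro member_le_sum) auto
    finally have "real m * 1 \<le> real m * s" by (intro mult_left_mono) auto
    then show ?thesis using c(1,2) m by linarith
  qed
  then show ?thesis by (simp add: s_def S_def)
qed

lemma defect_integral:
  assumes fin: "\<And>Y. finite {x. C x 1 = 0 \<and> x < Y}" and T: "T > 0"
    and k: "\<And>i. i \<in> {1..m} \<Longrightarrow> scal i = exp (- (real (k i) * T))" and \<epsilon>: "\<epsilon> > 0"
  defines "f \<equiv> \<lambda>t. real (N (exp t))"
  shows "\<forall>\<^sub>F n in sequentially.
      (\<integral>\<^sup>+t. ennreal \<bar>f (real n * T + t) - (\<Sum>i=1..m. f (real n * T + t - real (k i) * T))\<bar>
        * indicator {0<..<T} t \<partial>lborel) \<le> ennreal \<epsilon>"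
proof -
  \<comment> \<open>\<open>ER\<close> is stated at the unscaled parameter: as
    \<open>scal (Suc j) * exp u = exp (u - k (Suc j) * T)\<close>, scaling of a piece becomes a
    delay by \<open>k (Suc j)\<close> windows.\<close>
  define EL ER where "EL j = {t. bad_left j (exp t)}"
    and "ER j = {t. C (exp t) 1 \<noteq> 0 \<and> W (Suc j) (exp t) / C (exp t) 1 \<le> - (gap j / (2 * (b (Suc j) - a (Suc j))))}" for j
  \<comment> \<open>One factor \<open>m\<close> comes from the pointwise bound and one from the
    number of gaps; each gap has two bad sets.\<close>
  define \<delta> where "\<delta> = \<epsilon> / (2 * real m * real m)"
  have m0: "real m > 0" using m_ge_2 by simp
  have \<delta>: "\<delta> > 0" using \<epsilon> m0 by (simp add: \<delta>_def)
  have finb: "finite {x. C x (b j) = 0 \<and> x < Y}" if "j \<in> {1..<m}" for j Y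
    using partial_count[OF fin, of j] that by simp
  have L: "EL j \<in> sets borel" "\<forall>\<^sub>F n in sequentially.
      (\<integral>\<^sup>+t. indicator (EL j) (real n * T + t - real 0 * T) * indicator {0<..<T} t \<partial>lborel) \<le> ennreal \<delta>"
    if j: "j \<in> {1..<m}" for j
  proof -
    have "j \<in> {1..m}" using j by auto
    then interpret L: herglotz_pair \<mu> "\<lambda>l. A l (b j)" "\<lambda>l. C l (b j)" "\<lambda>l x. indicator {0..b j} x *\<^sub>R A l x"
      by (rule herglotz_right)
    have "gap j / 2 > 0" using gap_pos[OF j] by simp
    note B = L.below_level_window_integral[OF finb[OF j] T this \<delta>]
    from B(1) B(2)[where j = 0]
    show "EL j \<in> sets borel" "\<forall>\<^sub>F n in sequentially.
      (\<integral>\<^sup>+t. indicator (EL j) (real n * T + t - real 0 * T) * indicator {0<..<T} t \<partial>lborel) \<le> ennreal \<delta>"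
      unfolding EL_def bad_left_def L.h_def .
  qed
  have Rt: "ER j \<in> sets borel" "\<forall>\<^sub>F n in sequentially.
      (\<integral>\<^sup>+t. indicator (ER j) (real n * T + t - real (k (Suc j)) * T) * indicator {0<..<T} t \<partial>lborel) \<le> ennreal \<delta>"
    if j: "j \<in> {1..<m}" for j
  proof -
    obtain y where "herglotz_pair \<mu> (W (Suc j)) (\<lambda>l. C l 1) y" using herglotz_W by blast
    then interpret G: herglotz_pair \<mu> "W (Suc j)" "\<lambda>l. C l 1" y .
    have "gap j / (2 * (b (Suc j) - a (Suc j))) > 0" using gap_pos[OF j] ab[of "Suc j"] j by auto
    note B = G.below_level_window_integral[OF fin T this \<delta>]
    from B(1) B(2)[where j = "k (Suc j)"]
    show "ER j \<in> sets borel" "\<forall>\<^sub>F n in sequentially.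
      (\<integral>\<^sup>+t. indicator (ER j) (real n * T + t - real (k (Suc j)) * T) * indicator {0<..<T} t \<partial>lborel) \<le> ennreal \<delta>"
      unfolding ER_def G.h_def .
  qed
  have ev: "\<forall>\<^sub>F n in sequentially. \<forall>j\<in>{1..<m}.
      (\<integral>\<^sup>+t. indicator (EL j) (real n * T + t - real 0 * T) * indicator {0<..<T} t \<partial>lborel) \<le> ennreal \<delta> \<and>
      (\<integral>\<^sup>+t. indicator (ER j) (real n * T + t - real (k (Suc j)) * T) * indicator {0<..<T} t \<partial>lborel) \<le> ennreal \<delta>"
    by (intro eventually_ball_finite ballI eventually_conj L(2) Rt(2)) auto
  have scale: "scal i * exp u = exp (u - real (k i) * T)" if "i \<in> {1..m}" for i u
    using k[OF that] by (simp add: exp_add[symmetric])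
  have bnd: "ennreal \<bar>f (real n * T + t) - (\<Sum>i=1..m. f (real n * T + t - real (k i) * T))\<bar> * indicator {0<..<T} t
      \<le> ennreal (real m) * (\<Sum>j\<in>{1..<m}. indicator (EL j) (real n * T + t - real 0 * T) * indicator {0<..<T} t
        + indicator (ER j) (real n * T + t - real (k (Suc j)) * T) * indicator {0<..<T} t)" for n t
  proof (cases "t \<in> {0<..<T}")
    case True
    define u where "u = real n * T + t"
    have r: "bad_right j (exp u) \<longleftrightarrow> u - real (k (Suc j)) * T \<in> ER j" if "j \<in> {1..<m}" for j
      using scale[of "Suc j" u] that unfolding bad_right_def ER_def by simp
    have "(\<Sum>i=1..m. f (u - real (k i) * T)) = (\<Sum>i=1..m. real (N (scal i * exp u)))"
      unfolding f_def by (intro sum.cong refl) (simp add: scale)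
    then have "\<bar>f u - (\<Sum>i=1..m. f (u - real (k i) * T))\<bar>
        \<le> real m * (\<Sum>j\<in>{1..<m}. of_bool (bad_left j (exp u)) + of_bool (bad_right j (exp u)))"
      using count_defect_le[OF fin, of "exp u"] by (simp add: f_def)
    also have "(\<Sum>j\<in>{1..<m}. of_bool (bad_left j (exp u)) + of_bool (bad_right j (exp u)))
        = (\<Sum>j\<in>{1..<m}. indicator (EL j) u + indicator (ER j) (u - real (k (Suc j)) * T) :: real)"
      by (intro sum.cong refl) (simp add: r EL_def indicator_def of_bool_def)
    finally have "ennreal \<bar>f u - (\<Sum>i=1..m. f (u - real (k i) * T))\<bar>
        \<le> ennreal (real m * (\<Sum>j\<in>{1..<m}. indicator (EL j) u + indicator (ER j) (u - real (k (Suc j)) * T)))"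
      by (rule ennreal_leI)
    also have "\<dots> = ennreal (real m) * (\<Sum>j\<in>{1..<m}. indicator (EL j) u + indicator (ER j) (u - real (k (Suc j)) * T))"
    proof -
      have "ennreal (\<Sum>j\<in>{1..<m}. indicator (EL j) u + indicator (ER j) (u - real (k (Suc j)) * T))
          = (\<Sum>j\<in>{1..<m}. ennreal (indicator (EL j) u + indicator (ER j) (u - real (k (Suc j)) * T)))"
        by (rule sum_ennreal[symmetric]) simp
      also have "\<dots> = (\<Sum>j\<in>{1..<m}. indicator (EL j) u + indicator (ER j) (u - real (k (Suc j)) * T))"
        by (intro sum.cong refl) (simp add: indicator_def)
      finally show ?thesis by (subst ennreal_mult) (auto intro: sum_nonneg)
    qed
    finally show ?thesis using True by (simp add: u_def)
  qed simp
  show ?thesis using ev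
  proof eventually_elim
    case (elim n)
    let ?X = "\<lambda>j t. indicator (EL j) (real n * T + t - real 0 * T) * indicator {0<..<T} t
        + indicator (ER j) (real n * T + t - real (k (Suc j)) * T) * indicator {0<..<T} t :: ennreal"
    have meas: "(\<lambda>t. indicator (EL j) (real n * T + t - real 0 * T) * indicator {0<..<T} t :: ennreal) \<in> borel_measurable lborel"
        "(\<lambda>t. indicator (ER j) (real n * T + t - real (k (Suc j)) * T) * indicator {0<..<T} t :: ennreal) \<in> borel_measurable lborel"
      if j: "j \<in> {1..<m}" for j
    proof -
      have [measurable]: "EL j \<in> sets borel" "ER j \<in> sets borel" using L(1) Rt(1) j by blast+
      show "(\<lambda>t. indicator (EL j) (real n * T + t - real 0 * T) * indicator {0<..<T} t :: ennreal) \<in> borel_measurable lborel"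
        "(\<lambda>t. indicator (ER j) (real n * T + t - real (k (Suc j)) * T) * indicator {0<..<T} t :: ennreal) \<in> borel_measurable lborel"
        by measurable
    qed
    have "(\<integral>\<^sup>+t. ennreal \<bar>f (real n * T + t) - (\<Sum>i=1..m. f (real n * T + t - real (k i) * T))\<bar> * indicator {0<..<T} t \<partial>lborel)
        \<le> (\<integral>\<^sup>+t. ennreal (real m) * (\<Sum>j\<in>{1..<m}. ?X j t) \<partial>lborel)"
      by (rule nn_integral_mono) (rule bnd)
    also have "\<dots> = ennreal (real m) * (\<Sum>j\<in>{1..<m}. \<integral>\<^sup>+t. ?X j t \<partial>lborel)"
      by (subst nn_integral_cmult, intro borel_measurable_sum borel_measurable_add meas, assumption, assumption,
          subst nn_integral_sum, intro borel_measurable_add meas, assumption, assumption, rule refl)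
    also have "\<dots> \<le> ennreal (real m) * (\<Sum>j\<in>{1..<m}. ennreal (2 * \<delta>))"
    proof (intro mult_left_mono sum_mono)
      fix j assume j: "j \<in> {1..<m}"
      have "(\<integral>\<^sup>+t. ?X j t \<partial>lborel) \<le> ennreal \<delta> + ennreal \<delta>"
        using elim j by (subst nn_integral_add[OF meas[OF j]]) (auto intro: add_mono)
      then show "(\<integral>\<^sup>+t. ?X j t \<partial>lborel) \<le> ennreal (2 * \<delta>)" using \<delta> by (simp flip: ennreal_plus)
    qed simp
    also have "\<dots> = ennreal (real m * (real (m - 1) * (2 * \<delta>)))"
      using \<delta> by (simp add: ennreal_mult' ennreal_of_nat_eq_real_of_nat)
    also have "\<dots> \<le> ennreal (real m * (real m * (2 * \<delta>)))"
      using \<delta> by (intro ennreal_leI mult_left_mono mult_right_mono) auto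
    also have "real m * (real m * (2 * \<delta>)) = \<epsilon>" using m0 by (simp add: \<delta>_def)
    finally show ?case .
  qed
qed

end

section \<open>From the eigenvalue asymptotics to the renewal equation\<close>

lemma periodic_shift:
  fixes s :: "real \<Rightarrow> 'a"
  assumes "\<And>t. s (t + T) = s t"
  shows "s (real n * T + t) = s t"
proof (induction n)
  case (Suc n)
  have "s (real (Suc n) * T + t) = s ((real n * T + t) + T)" by (simp add: algebra_simps)
  then show ?case using assms[of "real n * T + t"] Suc by simp
qed simp

lemma purely_singular_zero: "purely_singular_nondecreasing T (\<lambda>_. 0)"
proof -
  let ?\<nu> = "null_measure borel :: real measure"
  have "finite_measure ?\<nu>" by (rule finite_measureI) simp
  moreover have "mutually_singular lborel ?\<nu>"
    unfolding mutually_singular_def by (intro exI[of _ "{}"]) (simp add: null_sets_def)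
  ultimately show ?thesis unfolding purely_singular_nondecreasing_def
    by (intro conjI exI[of _ ?\<nu>]) (simp_all add: mono_on_def measure_def)
qed

context ladder_string
begin

lemma eigenvalue_count_eq: "eigenvalue_count \<mu> l = N l"
  unfolding eigenvalue_count_def N_def neumann_eigenvalue_iff ..

lemma N_mono:
  assumes "\<And>Y. finite {x. C x 1 = 0 \<and> x < Y}" "l \<le> l'"
  shows "N l \<le> N l'"
  unfolding N_def using assms by (intro card_mono) auto

text \<open>In logarithmic time, with \<open>p = exp (d * T)\<close>, the asymptotics say that
  \<open>f (n * T + t) / p ^ n\<close> tends to \<open>\<sigma> t\<close> uniformly on a period, and
  the equation for \<open>d\<close> says that the renewal weights sum to 1.\<close>

lemma spectral_function_singular:
  assumes arith: "arithmetic_self_similarity m a b \<rho> \<tau> k"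
    and d: "0 < d" "(\<Sum>i=1..m. \<tau> powr (real (k i) * d)) = 1"
    and T: "T = - ln \<tau>"
    and s: "continuous_on UNIV s" "\<And>t. s (t + T) = s t"
    and asymp: "eigenvalue_asymptotics \<mu> d s"
  shows "\<exists>\<sigma>. purely_singular_nondecreasing T \<sigma> \<and> (\<forall>t\<in>{0..T}. s t = exp (- d * t) * \<sigma> t)"
proof -
  have \<tau>: "0 < \<tau>" "\<tau> < 1" and sc: "\<And>i. i \<in> {1..m} \<Longrightarrow> scal i = \<tau> ^ k i"
    using arith unfolding arithmetic_self_similarity_def scal_def by auto
  have T0: "T > 0" using \<tau> T by simp
  have tau_exp: "\<tau> = exp (- T)" using \<tau> T by simp
  have sce: "scal i = exp (- (real (k i) * T))" if "i \<in> {1..m}" for i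
    unfolding sc[OF that] tau_exp by (simp add: exp_of_nat_mult[symmetric])
  \<comment> \<open>Each piece is strictly smaller than the whole string since its weight is below
    1. Hence every delay is positive and the recursion moves strictly back in time.\<close>
  have k1: "k i \<ge> 1" if i: "i \<in> {1..m}" for i
  proof -
    have "scal i \<le> \<rho> i * 1" unfolding scal_def using ab[OF i] rho_pos[OF i] by (intro mult_left_mono) auto
    then have "scal i \<noteq> 1" using rho_lt_1[OF i] by simp
    then show ?thesis using sc[OF i] by (cases "k i") auto
  qed
  obtain r where r: "(r \<longlongrightarrow> 0) at_top" "\<forall>\<^sub>F l in at_top. real (N l) = l powr d * (s (ln l) + r l)"
    using asymp unfolding eigenvalue_asymptotics_def eigenvalue_count_eq by blast
  obtain L0 where L0: "\<And>l. l \<ge> L0 \<Longrightarrow> real (N l) = l powr d * (s (ln l) + r l)"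
    using r(2) unfolding eventually_at_top_linorder by blast
  have lim: "filterlim (\<lambda>n. exp (real n * T + t)) at_top sequentially" for t
  proof -
    have "filterlim (\<lambda>n. real n * T) at_top sequentially"
      by (rule filterlim_at_top_mult_tendsto_pos[OF tendsto_const T0 filterlim_real_sequentially])
    then have "filterlim (\<lambda>n. t + real n * T) at_top sequentially" by (rule filterlim_tendsto_add_at_top[OF tendsto_const])
    then show ?thesis by (subst add.commute) (rule filterlim_compose[OF exp_at_top])
  qed
  have far: "\<forall>\<^sub>F n in sequentially. L \<le> exp (real n * T)" for L
    using lim[of 0] unfolding filterlim_at_top by simp
  show ?thesis
  proof (cases "\<forall>Y. finite {x. C x 1 = 0 \<and> x < Y}")
    case False
    then obtain Y where Y: "infinite {x. C x 1 = 0 \<and> x < Y}" by blast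
    txt \<open>The cardinality of an infinite set is zero, so in this case \<open>s\<close> vanishes.\<close>
    have zero: "s (ln l) = - r l" if l: "l \<ge> max 1 (max L0 Y)" for l
    proof -
      have "infinite {x. C x 1 = 0 \<and> x < l}"
        by (rule contrapos_nn[OF Y]) (erule rev_finite_subset, use l in auto)
      then have "real (N l) = 0" unfolding N_def by simp
      then show ?thesis using L0[of l] l by simp
    qed
    have "s t = 0" for t
    proof -
      have "\<forall>\<^sub>F n in sequentially. max 1 (max L0 Y) \<le> exp (real n * T + t)" using lim[of t] unfolding filterlim_at_top by blast
      then have "\<forall>\<^sub>F n in sequentially. - r (exp (real n * T + t)) = s t"
      proof eventually_elim
        case (elim n)
        from zero[OF elim] show ?case using periodic_shift[of s T n t] s(2) by simp
      qed
      moreover have "(\<lambda>n. - r (exp (real n * T + t))) \<longlonglongrightarrow> - 0"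
        by (intro tendsto_minus filterlim_compose[OF r(1) lim[of t]])
      ultimately have "(\<lambda>n::nat. s t) \<longlonglongrightarrow> - 0" by (rule Lim_transform_eventually[rotated])
      then show ?thesis using LIMSEQ_unique[OF _ tendsto_const] by fastforce
    qed
    then show ?thesis using purely_singular_zero by (intro exI[of _ "\<lambda>_. 0"]) simp
  next
    case True
    then have fin: "\<And>Y. finite {x. C x 1 = 0 \<and> x < Y}" by blast
    define f where "f t = real (N (exp t))" for t
    define \<sigma> where "\<sigma> t = exp (d * t) * s t" for t
    define p where "p = exp (d * T)"
    \<comment> \<open>Zeros that are not positive lie below every \<open>exp t\<close>; they add a
      constant to \<open>f\<close> and produce no jump.\<close>
    define \<Lambda> where "\<Lambda> = ln ` {x. C x 1 = 0 \<and> 0 < x}"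
    have p: "p > 1" using d(1) T0 by (simp add: p_def)
    have pn: "p ^ n = exp (d * (real n * T))" for n
      unfolding p_def by (simp add: exp_of_nat_mult[symmetric] algebra_simps)
    have fmono: "mono f" unfolding f_def by (intro monoI of_nat_mono N_mono fin) simp
    have main: "f (real n * T + t) / p ^ n = \<sigma> t + exp (d * t) * r (exp (real n * T + t))"
      if n: "L0 \<le> exp (real n * T)" and t: "0 \<le> t" for n t
    proof -
      have "exp (real n * T) \<le> exp (real n * T + t)" using t by simp
      then have "L0 \<le> exp (real n * T + t)" using n by linarith
      from L0[OF this] have "f (real n * T + t) = exp (d * (real n * T + t)) * (s t + r (exp (real n * T + t)))"
        using periodic_shift[of s T n t] s(2) by (simp add: f_def powr_def)
      moreover have "exp (d * (real n * T + t)) = p ^ n * exp (d * t)"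
        unfolding pn by (simp add: exp_add[symmetric] algebra_simps)
      ultimately have "f (real n * T + t) = p ^ n * (\<sigma> t + exp (d * t) * r (exp (real n * T + t)))"
        by (simp only: \<sigma>_def ring_distribs mult.assoc)
      then show ?thesis using p by simp
    qed
    have conv: "\<forall>\<^sub>F n in sequentially. \<forall>t\<in>{0..T}. \<bar>\<sigma> t - f (real n * T + t) / p ^ n\<bar> \<le> \<delta>" if \<delta>: "\<delta> > 0" for \<delta>
    proof -
      have "\<delta> / p > 0" using \<delta> p by simp
      then have "\<forall>\<^sub>F l in at_top. \<bar>r l\<bar> < \<delta> / p" using tendstoD[OF r(1)] by (simp add: dist_real_def)
      then obtain L1 where L1: "\<And>l. l \<ge> L1 \<Longrightarrow> \<bar>r l\<bar> < \<delta> / p" unfolding eventually_at_top_linorder by blast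
      show ?thesis using far[of L0] far[of L1]
      proof eventually_elim
        case (elim n)
        show ?case
        proof
          fix t assume t: "t \<in> {0..T}"
          have "exp (real n * T) \<le> exp (real n * T + t)" using t by simp
          then have "\<bar>r (exp (real n * T + t))\<bar> \<le> \<delta> / p" using L1[of "exp (real n * T + t)"] elim(2) by linarith
          moreover have "exp (d * t) \<le> p" using t d(1) by (simp add: p_def)
          ultimately have "exp (d * t) * \<bar>r (exp (real n * T + t))\<bar> \<le> p * (\<delta> / p)" using p by (intro mult_mono) auto
          also have "\<dots> = \<delta>" using p by simp
          finally have "\<bar>exp (d * t) * r (exp (real n * T + t))\<bar> \<le> \<delta>" by (simp add: abs_mult)
          then show "\<bar>\<sigma> t - f (real n * T + t) / p ^ n\<bar> \<le> \<delta>" using main[OF elim(1), of t] t by simp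
        qed
      qed
    qed
    \<comment> \<open>Inherited from \<open>f\<close> through the limit of the rescaled
      windows.\<close>
    have mono: "mono_on {0..T} \<sigma>"
    proof (rule mono_onI)
      fix u v assume uv: "u \<in> {0..T}" "v \<in> {0..T}" "u \<le> v"
      show "\<sigma> u \<le> \<sigma> v"
      proof (rule field_le_epsilon)
        fix \<epsilon> :: real assume "\<epsilon> > 0"
        then obtain n where n: "\<forall>t\<in>{0..T}. \<bar>\<sigma> t - f (real n * T + t) / p ^ n\<bar> \<le> \<epsilon> / 2"
          using conv[of "\<epsilon> / 2"] by (auto simp: eventually_sequentially)
        have "f (real n * T + u) / p ^ n \<le> f (real n * T + v) / p ^ n"
          using uv p by (intro divide_right_mono monoD[OF fmono]) auto
        moreover have "\<bar>\<sigma> u - f (real n * T + u) / p ^ n\<bar> \<le> \<epsilon> / 2" "\<bar>\<sigma> v - f (real n * T + v) / p ^ n\<bar> \<le> \<epsilon> / 2"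
          using n uv by auto
        ultimately show "\<sigma> u \<le> \<sigma> v + \<epsilon>" by linarith
      qed
    qed
    have cont: "continuous_on {0..T} \<sigma>"
      unfolding \<sigma>_def by (intro continuous_intros continuous_on_subset[OF s(1)]) auto
    have ln_less: "ln x < y \<longleftrightarrow> x < exp y" if "0 < x" for x y :: real
      using exp_less_cancel_iff[of "ln x" y] that by simp
    have Lam: "{l\<in>\<Lambda>. l < y} = ln ` {x. C x 1 = 0 \<and> 0 < x \<and> x < exp y}" for y
      by (auto simp: \<Lambda>_def ln_less)
    have finL: "finite {x. C x 1 = 0 \<and> 0 < x \<and> x < exp y}" for y by (rule finite_subset[OF _ fin[of "exp y"]]) auto
    obtain n1 where n1: "\<And>n t. n \<ge> n1 \<Longrightarrow> t \<in> {0..T} \<Longrightarrow> \<bar>\<sigma> t - f (real n * T + t) / p ^ n\<bar> \<le> 1"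
      using conv[OF zero_less_one] unfolding eventually_sequentially by blast
    \<comment> \<open>From \<open>n1\<close> on the convergence at \<open>t = 0\<close> bounds
      \<open>f (n * T) / p ^ n\<close> by \<open>\<bar>\<sigma> 0\<bar> + 1\<close>; for earlier
      \<open>n\<close> monotonicity bounds \<open>f (n * T)\<close> by
      \<open>f (n1 * T)\<close>.\<close>
    define K where "K = f (real n1 * T) + \<bar>\<sigma> 0\<bar> + 1"
    have f0: "0 \<le> f t" for t by (simp add: f_def)
    have K: "0 \<le> K" using f0[of "real n1 * T"] by (simp add: K_def)
    have fK: "f (real n * T) \<le> K * p ^ n" for n
    proof (cases "n \<ge> n1")
      case True
      have "f (real n * T) / p ^ n \<le> K" using n1[OF True, of 0] T0 f0[of "real n1 * T"] unfolding K_def by auto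
      then show ?thesis using p by (simp add: divide_le_eq)
    next
      case False
      have "f (real n * T) \<le> f (real n1 * T)" using False T0 by (intro monoD[OF fmono] mult_right_mono) auto
      also have "\<dots> \<le> K * 1" by (simp add: K_def)
      also have "\<dots> \<le> K * p ^ n" using p K by (intro mult_left_mono one_le_power) auto
      finally show ?thesis .
    qed
    have "purely_singular_nondecreasing T \<sigma>"
    proof (rule purely_singular_of_step_approximation[OF T0 mono cont])
      fix \<epsilon> :: real assume \<epsilon>: "\<epsilon> > 0"
      show "\<exists>Z g. finite Z \<and>
        (\<forall>u v. 0 < u \<longrightarrow> u < v \<longrightarrow> v < T \<longrightarrow> {u..v} \<inter> Z = {} \<longrightarrow> g u = g v) \<and>
        (\<integral>\<^sup>+t. ennreal \<bar>\<sigma> t - g t\<bar> * indicator {0<..<T} t \<partial>lborel) \<le> ennreal (\<epsilon> / (real (card Z) + 1))"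
      proof (rule renewal_step_approximation[OF T0 p K m_ge_2 k1 _ fmono _ _ _ _ conv \<epsilon>, where \<Lambda> = \<Lambda>])
        have "(1 / p) ^ k i = \<tau> powr (real (k i) * d)" for i
          unfolding tau_exp power_one_over pn by (simp add: powr_def exp_minus[symmetric] divide_inverse algebra_simps)
        then show "(\<Sum>i=1..m. (1 / p) ^ k i) = 1" using d(2) by simp
      next
        fix u v :: real assume uv: "u < v" "{u..v} \<inter> \<Lambda> = {}"
        have "x < exp u" if x: "C x 1 = 0" "x < exp v" for x
        proof (rule ccontr)
          assume "\<not> x < exp u"
          then have g: "exp u \<le> x" "0 < x" using exp_gt_zero[of u] by linarith+
          then have "u \<le> ln x" "ln x < v" using x(2) by (simp_all add: ln_ge_iff ln_less)
          moreover have "ln x \<in> \<Lambda>" using x g by (auto simp: \<Lambda>_def)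
          ultimately have "ln x \<in> {u..v} \<inter> \<Lambda>" unfolding Int_iff atLeastAtMost_iff by (intro conjI less_imp_le[of _ v])
          then show False unfolding uv(2) by blast
        qed
        moreover have "exp u < exp v" using uv by simp
        ultimately have "{x. C x 1 = 0 \<and> x < exp u} = {x. C x 1 = 0 \<and> x < exp v}" by (blast intro: less_trans)
        then show "f u = f v" by (simp add: f_def N_def)
      next
        fix n
        show "finite {l\<in>\<Lambda>. l < real n * T}" unfolding Lam by (rule finite_imageI[OF finL])
        have "card {l\<in>\<Lambda>. l < real n * T} \<le> card {x. C x 1 = 0 \<and> 0 < x \<and> x < exp (real n * T)}"
          unfolding Lam by (rule card_image_le[OF finL])
        also have "\<dots> \<le> N (exp (real n * T))" unfolding N_def by (rule card_mono[OF fin]) auto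
        finally have "real (card {l\<in>\<Lambda>. l < real n * T}) \<le> f (real n * T)" by (simp add: f_def)
        then show "real (card {l\<in>\<Lambda>. l < real n * T}) \<le> K * p ^ n" using fK[of n] by linarith
      next
        fix \<epsilon> :: real assume "\<epsilon> > 0"
        from defect_integral[OF fin T0 sce this]
        show "\<forall>\<^sub>F n in sequentially.
          (\<integral>\<^sup>+t. ennreal \<bar>f (real n * T + t) - (\<Sum>i=1..m. f (real n * T + t - real (k i) * T))\<bar>
            * indicator {0<..<T} t \<partial>lborel) \<le> ennreal \<epsilon>"
          unfolding f_def .
      qed
    qed
    moreover have "s t = exp (- d * t) * \<sigma> t" for t
      unfolding \<sigma>_def by (simp add: mult.assoc[symmetric] exp_add[symmetric])
    ultimately show ?thesis by blast
  qed
qed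

end

theorem theorem2:
  fixes m :: nat and a b \<rho> :: "nat \<Rightarrow> real" and e k :: "nat \<Rightarrow> nat"
    and C s :: "real \<Rightarrow> real" and \<mu> :: "real measure" and \<tau> D T :: real
  assumes ladder: "cantor_ladder m a b \<rho> e C"
    and mu: "distributional_derivative01 C \<mu>"
    and arithmetic: "arithmetic_self_similarity m a b \<rho> \<tau> k"
    and gaps: "\<forall>i\<in>{2..m}. a i - b (i - 1) > 0"
    and D: "0 < D" "D < 1/2" "(\<Sum>i=1..m. \<tau> powr (real (k i) * D)) = 1"
    and T: "T = - ln \<tau>"
    and s: "continuous_on UNIV s" "\<forall>t. s (t + T) = s t"
    and asymptotics: "eigenvalue_asymptotics \<mu> D s"
  shows "\<exists>\<sigma>. purely_singular_nondecreasing T \<sigma> \<and> (\<forall>t\<in>{0..T}. s t = exp (- D * t) * \<sigma> t)"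
proof -
  interpret L: gapped_ladder m a b \<rho> e
    by unfold_locales (use ladder gaps in \<open>auto simp: cantor_ladder_def\<close>)
  interpret string_measure \<mu> by (rule L.string_measure_of_ladder(1)[OF ladder mu])
  interpret ladder_string m a b \<rho> e \<mu>
    by (intro ladder_string.intro ladder_string_axioms.intro L.gapped_ladder_axioms string_measure_axioms
        L.string_measure_of_ladder(2)[OF ladder mu])
  show ?thesis
    by (rule spectral_function_singular[OF arithmetic D(1,3) T s(1) _ asymptotics]) (use s(2) in blast)
qed

end
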